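(* Let $\Omega\subset\mathbb R^2$ be a bounded smooth domain, $P\in\Omega$, $\Omega_\varepsilon=\Omega\setminus\overline{B(P,\varepsilon)}$, and assume $\nabla\mathcal R_\Omega(P)=0$. Let $\tau=\Lambda_1/\Lambda_2$, $\beta=\frac{\tau}{(1+\tau)^2}$, $C_\tau=\tau^{\frac1{1+\tau}}e^{-\frac{2\pi\mathcal R_\Omega(P)(\tau^2+\tau+1)}{(1+\tau)^2}}$, and suppose the matrix $\overline{\mathbf M}=\big[(\tau^4+\tau^2+1)\frac{\partial^2H_\Omega(P,P)}{\partial x_i\partial x_j}+(\tau^2-1)^2\frac{\partial^2H_\Omega(P,P)}{\partial y_i\partial x_j}\big]_{1\le i,j\le2}$ has two different eigenvalues $\mu_1\ne\mu_2$ with unit eigenvectors $\nu^{(1)},\nu^{(2)}$. Then for all sufficiently small $\varepsilon$, $\mathcal{KR}_{\Omega_\varepsilon}$ has exactly four type III critical points $(x_\varepsilon^{(m),\pm},y_\varepsilon^{(m),\pm})$, $m=1,2$, which are nondegenerate and satisfy $|x_\varepsilon^{(m),\pm}-P|=C_\tau\varepsilon^\beta+O(\varepsilon^{2\beta})$, $\frac{x_\varepsilon^{(m),\pm}-P}{|x_\varepsilon^{(m),\pm}-P|}=\pm\nu^{(m)}+o(1)$, $|y_\varepsilon^{(m),\pm}-P|=\frac{C_\tau}{\tau}\varepsilon^\beta+O(\varepsilon^{2\beta})$, $\frac{y_\varepsilon^{(m),\pm}-P}{|y_\varepsilon^{(m),\pm}-P|}=\mp\nu^{(m)}+o(1)$.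 Moreover, if $\Lambda_1=\Lambda_2$, only two of them are nontrivially different.
   Context: For a bounded smooth domain $D\subset\mathbb R^2$, $G_D=S-H_D$ is the Dirichlet Green function of $-\Delta$, $S(x,y)=-\frac1{2\pi}\ln|x-y|$, $H_D(x,y)$ harmonic in each variable, $\mathcal R_D(x)=H_D(x,x)$; $\frac{\partial^2H_\Omega(P,P)}{\partial x_i\partial x_j}$ is the second derivative of $H_\Omega(x,y)$ twice in $x$ at $x=y=P$, and $\frac{\partial^2H_\Omega(P,P)}{\partial y_i\partial x_j}$ the mixed derivative at $x=y=P$. Fix $\Lambda_1,\Lambda_2>0$ and $\mathcal{KR}_D(x,y)=\Lambda_1^2\mathcal R_D(x)+\Lambda_2^2\mathcal R_D(y)-2\Lambda_1\Lambda_2G_D(x,y)$. Type III critical points: critical points with $|x-P|<\delta$, $|y-P|<\delta$ for a fixed small $\delta>0$ and all sufficiently small $\varepsilon$. Nondegenerate: invertible $4\times4$ Hessian. Two critical points $(x_1,y_1)\neq(x_2,y_2)$ are nontrivially different if $(x_2,y_2)\ne(y_1,x_1)$. *)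

theory Defs
  imports "HOL-Analysis.Analysis" "HOL-Library.Landau_Symbols"
begin

type_synonym pt = "real^2"

definition partial :: "2 \<Rightarrow> (pt \<Rightarrow> real) \<Rightarrow> pt \<Rightarrow> real" where
  "partial i f x = deriv (\<lambda>t. f (x + t *\<^sub>R axis i 1)) 0"

fun iter_partial :: "2 list \<Rightarrow> (pt \<Rightarrow> real) \<Rightarrow> pt \<Rightarrow> real" where
  "iter_partial [] f = f"
| "iter_partial (i # is) f = partial i (iter_partial is f)"

definition C_inf_on :: "pt set \<Rightarrow> (pt \<Rightarrow> real) \<Rightarrow> bool" where
  "C_inf_on S f \<longleftrightarrow>
     (\<forall>is. continuous_on S (iter_partial is f) \<and>
        (\<forall>i. \<forall>x\<in>S. (\<lambda>t. iter_partial is f (x + t *\<^sub>R axis i 1)) differentiable (at 0)))"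

definition harmonic_on :: "pt set \<Rightarrow> (pt \<Rightarrow> real) \<Rightarrow> bool" where
  "harmonic_on S f \<longleftrightarrow> C_inf_on S f \<and>
     (\<forall>x\<in>S. partial 1 (partial 1 f) x + partial 2 (partial 2 f) x = 0)"

definition smooth_bounded_domain :: "pt set \<Rightarrow> bool" where
  "smooth_bounded_domain D \<longleftrightarrow> open D \<and> connected D \<and> bounded D \<and> D \<noteq> {} \<and>
     (\<forall>p\<in>frontier D. \<exists>U g. open U \<and> p \<in> U \<and> C_inf_on U g \<and>
         (\<forall>x\<in>U. \<exists>i. partial i g x \<noteq> 0) \<and> D \<inter> U = {x\<in>U. g x < 0})"

definition fund :: "pt \<Rightarrow> pt \<Rightarrow> real" where
  "fund x y = - (1 / (2 * pi)) * ln (dist x y)"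

text \<open>Regular part H_D(x,y): the harmonic function in x (continuous up to the boundary)
  with boundary values S(.,y); normalised to 0 outside the closure for uniqueness.\<close>
definition Hreg :: "pt set \<Rightarrow> pt \<Rightarrow> pt \<Rightarrow> real" where
  "Hreg D x y = (THE h. continuous_on (closure D) h \<and> harmonic_on D h \<and>
                     (\<forall>z\<in>frontier D. h z = fund z y) \<and> (\<forall>z. z \<notin> closure D \<longrightarrow> h z = 0)) x"

definition Green :: "pt set \<Rightarrow> pt \<Rightarrow> pt \<Rightarrow> real" where
  "Green D x y = fund x y - Hreg D x y"

definition Robin :: "pt set \<Rightarrow> pt \<Rightarrow> real" where
  "Robin D x = Hreg D x x"

definition KR :: "pt set \<Rightarrow> real \<Rightarrow> real \<Rightarrow> pt \<times> pt \<Rightarrow> real" where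
  "KR D L1 L2 z = L1\<^sup>2 * Robin D (fst z) + L2\<^sup>2 * Robin D (snd z) - 2 * L1 * L2 * Green D (fst z) (snd z)"

definition KR_crit :: "pt set \<Rightarrow> real \<Rightarrow> real \<Rightarrow> pt \<times> pt \<Rightarrow> bool" where
  "KR_crit D L1 L2 z \<longleftrightarrow> fst z \<in> D \<and> snd z \<in> D \<and> fst z \<noteq> snd z \<and>
     (KR D L1 L2 has_derivative (\<lambda>h. 0)) (at z)"

definition nondeg_crit :: "('a::euclidean_space \<Rightarrow> real) \<Rightarrow> 'a \<Rightarrow> bool" where
  "nondeg_crit F z \<longleftrightarrow> (F has_derivative (\<lambda>h. 0)) (at z) \<and>
     (\<exists>Gr Hs e. e > 0 \<and> (\<forall>w\<in>ball z e. (F has_derivative (\<lambda>h. Gr w \<bullet> h)) (at w)) \<and>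
        (Gr has_derivative Hs) (at z) \<and> bij Hs)"

definition Hxx :: "pt set \<Rightarrow> pt \<Rightarrow> 2 \<Rightarrow> 2 \<Rightarrow> real" where
  "Hxx D P i j = partial i (partial j (\<lambda>x. Hreg D x P)) P"

definition Hyx :: "pt set \<Rightarrow> pt \<Rightarrow> 2 \<Rightarrow> 2 \<Rightarrow> real" where
  "Hyx D P i j = partial i (\<lambda>y. partial j (\<lambda>x. Hreg D x y) P) P"

definition sgnb :: "bool \<Rightarrow> real" where
  "sgnb s = (if s then 1 else -1)"

end

theory Submission
 imports Defs "HOL-Complex_Analysis.Complex_Analysis" "HOL-Real_Asymp.Real_Asymp"
begin

text \<open>After moving $P$ to $0$ and identifying the plane with the complex numbers, the regular part for
$\<Omega>_e$ equals that of $\<Omega>$ plus the capacity term $g(x)g(y)/L_e$, $L_e about -ln e$, up to the regular part of the disc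
and errors of order $e$. A sequence argument forces $y/x$ to $-1/\<tau>$ and $|x|/e^\<beta>$ to the constant. Scaling by $e^\<beta>$
and replacing the two equations by one of them and the real and imaginary parts of
$\<Lambda>_1 xd_x + \<Lambda>_2 yd_y$ (the dilation and rotation fields, of orders $1/L_e$ and $e^{2\<beta>}$) gives a $C^1$-small perturbation of a
limit system with exactly four nondegenerate zeros, along the eigenvectors of the matrix.\<close>

section \<open>Harmonic functions in the plane\<close>

text \<open>Type III points are constrained only by |x-P| < \<delta>, so they could sit right next
  to the hole, where the image charges are not small. Two facts exclude this: a gradient estimate
  weighted by |x| that holds up to the circle |x| = e, and the nonnegativity of the quadratic form
  that the image terms contribute to l1 times the x-equation plus l2 times the y-equation. Together
  they give |x| >= const e^k with some k < 1. In the same weighted sum the singular fractions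
  x/(x-y) and y/(y-x) add up to 1; this cancellation fixes the exponent, through (l1+l2) \<beta> =
  l1 l2/(l1+l2), and uncovers the two weak equations. The bound \<beta> <= 1/4 keeps the remainder
  of the hole below e^(2\<beta>). The C^1 size of the perturbation is about 1/L_e, too weak for the
  error O(e^(2\<beta>)) in the moduli; but at the zeros of the limit system the logarithmic part
  vanishes, and the defect at these points is O(e^\<beta>). As the regular part is given by a
  definite description, existence, uniqueness and symmetry have to be proved first: Perron's method
  with an exterior disc condition is used, because it covers the domain and the perforated domain
  alike.\<close>

definition cgrad :: "(complex => real) => complex => complex" where
 "cgrad u z = Complex (frechet_derivative u (at z) 1) (- frechet_derivative u (at z) \<i>)"

text \<open>Harmonicity is encoded by a holomorphic gradient: \<open>cgrad u\<close> is u_x - i u_y,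
  whose Cauchy-Riemann equations are the Laplace equation and the equality of mixed derivatives.
  Second derivatives are never mentioned, and Cauchy's formulas are available at once.\<close>

definition harm :: "complex set => (complex => real) => bool" where
 "harm S u \<longleftrightarrow> (\<exists>g. g holomorphic_on S & (\<forall>z\<in>S. (u has_derivative (%h. Re (g z * h))) (at z)))"

lemma cgrad_eqI:
 assumes "(u has_derivative (%h. Re (c * h))) (at z)"
 shows "cgrad u z = c"
 unfolding cgrad_def frechet_derivative_at[OF assms, symmetric] by (simp add: complex_eq_iff)

lemma cgrad_cong:
 assumes "open S" "z \<in> S" "!!w. w \<in> S ==> u w = v w"
 shows "cgrad u z = cgrad v z"
proof -
 have "(u has_derivative D) (at z) \<longleftrightarrow> (v has_derivative D) (at z)" for D
 using assms has_derivative_transform_within_open[of u D z UNIV S v]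
 has_derivative_transform_within_open[of v D z UNIV S u] by metis
 then show ?thesis unfolding cgrad_def frechet_derivative_def by simp
qed

lemma harm_has_derivative:
 assumes "harm S u" "z \<in> S"
 shows "(u has_derivative (%h. Re (cgrad u z * h))) (at z)"
 using assms cgrad_eqI unfolding harm_def by metis

lemma harm_cgrad_holomorphic:
 assumes "harm S u"
 shows "cgrad u holomorphic_on S"
proof -
 obtain g where "g holomorphic_on S" "\<forall>z\<in>S. (u has_derivative (%h. Re (g z * h))) (at z)"
 using assms unfolding harm_def by blast
 moreover from this have "g z = cgrad u z" if "z \<in> S" for z using cgrad_eqI that by metis
 ultimately show ?thesis using holomorphic_transform by metis
qed

lemma harmI:
 assumes "g holomorphic_on S" "!!z. z \<in> S ==> (u has_derivative (%h. Re (g z * h))) (at z)"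
 shows "harm S u"
 using assms unfolding harm_def by blast

lemma harm_subset: "harm S u ==> T \<subseteq> S ==> harm T u"
 unfolding harm_def by (meson holomorphic_on_subset subsetD)

lemma harm_cong:
 assumes "harm S u" "open S" "!!z. z \<in> S ==> u z = v z"
 shows "harm S v"
proof (rule harmI)
 show "cgrad u holomorphic_on S" using assms harm_cgrad_holomorphic by blast
 show "(v has_derivative (%h. Re (cgrad u z * h))) (at z)" if "z \<in> S" for z
 using has_derivative_transform_within_open[OF harm_has_derivative[OF assms(1) that] assms(2) that]
 assms(3) by metis
qed

lemma harm_local:
 assumes "!!z. z \<in> S ==> \<exists>T. open T & z \<in> T & harm T u"
 shows "harm S u"
proof (rule harmI)
 show "cgrad u holomorphic_on S"
 unfolding holomorphic_on_def
 proof
 fix z assume "z \<in> S"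
 then obtain T where T: "open T" "z \<in> T" "harm T u" using assms by blast
 then have "cgrad u field_differentiable at z"
 using harm_cgrad_holomorphic[OF T(3)] holomorphic_on_imp_differentiable_at by blast
 then show "cgrad u field_differentiable at z within S"
 by (rule field_differentiable_at_within)
 qed
 show "(u has_derivative (%h. Re (cgrad u z * h))) (at z)" if "z \<in> S" for z
 using assms[OF that] harm_has_derivative by blast
qed

lemma harm_continuous_on: "harm S u ==> continuous_on S u"
 unfolding harm_def
 by (meson continuous_at_imp_continuous_on has_derivative_continuous)

lemma harm_const: "harm S (%z. c)"
 by (rule harmI[of "%_. 0"]) auto

lemma harm_add:
 assumes "harm S u" "harm S v"
 shows "harm S (%z. u z + v z)"
 by (rule harmI[of "%z. cgrad u z + cgrad v z"])
 (auto intro!: holomorphic_intros harm_cgrad_holomorphic assms derivative_eq_intros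
 harm_has_derivative[OF assms(1)] harm_has_derivative[OF assms(2)] simp: algebra_simps)

lemma harm_cmult:
 assumes "harm S u"
 shows "harm S (%z. c * u z)"
 by (rule harmI[of "%z. of_real c * cgrad u z"])
 (auto intro!: holomorphic_intros harm_cgrad_holomorphic assms derivative_eq_intros
 harm_has_derivative[OF assms] simp: algebra_simps)

lemma harm_minus: "harm S u ==> harm S (%z. - u z)"
 using harm_cmult[of S u "-1"] by simp

lemma harm_diff:
 assumes "harm S u" "harm S v"
 shows "harm S (%z. u z - v z)"
 using harm_add[OF assms(1) harm_minus[OF assms(2)]] by simp

lemma has_derivative_Re_holomorphic:
 assumes "(f has_field_derivative f') (at z)"
 shows "((%z. Re (f z)) has_derivative (%h. Re (f' * h))) (at z)"
proof -
 have "(f has_derivative (%h. f' * h)) (at z)"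
 using assms by (simp add: has_field_derivative_def)
 from bounded_linear.has_derivative[OF bounded_linear_Re this] show ?thesis .
qed

lemma harm_Re:
 assumes "f holomorphic_on S" "open S"
 shows "harm S (%z. Re (f z))"
 using assms by (intro harmI[of "deriv f"] holomorphic_deriv has_derivative_Re_holomorphic holomorphic_derivI)

lemma harm_Im:
 assumes "f holomorphic_on S" "open S"
 shows "harm S (%z. Im (f z))"
proof -
 have "(%z. - \<i> * f z) holomorphic_on S" using assms(1) by (intro holomorphic_intros)
 from harm_Re[OF this assms(2)] show ?thesis by simp
qed

text \<open>Locally this is the real part of a branch of log (z - c); differentiating the norm
  directly avoids the choice of a branch.\<close>

lemma has_derivative_ln_cmod:
 assumes "z ~= c"
 shows "((%z. ln (cmod (z - c))) has_derivative (%h. Re (inverse (z - c) * h))) (at z)"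
proof -
 have "(%h. inner h (sgn (z - c)) / cmod (z - c)) = (%h. Re (inverse (z - c) * h))"
 proof
 fix h
 obtain x y where w: "z - c = Complex x y" by (cases "z - c")
 obtain p q where h: "h = Complex p q" by (cases h)
 have "x^2 + y^2 ~= 0" using assms w
 by (metis Complex_eq_0 right_minus_eq sum_power2_eq_zero_iff)
 moreover have "inner h (sgn (z - c)) / cmod (z - c) = inner h (z - c) / (cmod (z - c))^2"
 by (simp add: sgn_div_norm power2_eq_square divide_inverse del: cmod_power2)
 ultimately show "inner h (sgn (z - c)) / cmod (z - c) = Re (inverse (z - c) * h)"
 unfolding w h by (simp add: inner_complex_def cmod_power2 add_divide_distrib mult.commute)
 qed
 moreover have "((%z. ln (cmod (z - c))) has_derivative (%h. inner h (sgn (z - c)) / cmod (z - c))) (at z)"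
 proof -
 have *: "((%z. z - c) has_derivative (%h. h)) (at z)" by (auto intro!: derivative_eq_intros)
 have "((%z. cmod (z - c)) has_derivative (%h. inner h (sgn (z - c)))) (at z)"
 using has_derivative_compose[of "%z. z - c" "%h. h" z UNIV norm "%h. inner h (sgn (z - c))"]
 has_derivative_norm[of "z - c"] * assms by simp
 from DERIV_ln[THEN DERIV_compose_FDERIV, OF _ this] assms show ?thesis by (simp add: divide_inverse)
 qed
 ultimately show ?thesis by simp
qed

lemma harm_ln_cmod:
 assumes "c \<notin> S"
 shows "harm S (%z. ln (cmod (z - c)))"
proof (rule harmI[of "%z. inverse (z - c)"])
 show "(%z. inverse (z - c)) holomorphic_on S" using assms by (auto intro!: holomorphic_intros)
qed (rule has_derivative_ln_cmod, use assms in blast)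

text \<open>A ball is convex, so the holomorphic gradient has a primitive; its real part differs
  from \<open>u\<close> by a constant, which is absorbed into \<open>f\<close>.\<close>

lemma harm_ball_Re:
 assumes "harm (ball c R) u"
 shows "\<exists>f. f holomorphic_on ball c R \<and>
 (\<forall>z\<in>ball c R. u z = Re (f z) & (f has_field_derivative cgrad u z) (at z))"
proof -
 obtain g where g: "!!x. x \<in> ball c R ==> (g has_field_derivative cgrad u x) (at x within ball c R)"
 using holomorphic_convex_primitive'[of "ball c R" "cgrad u"] harm_cgrad_holomorphic[OF assms] by auto
 then have g': "(g has_field_derivative cgrad u x) (at x)" if "x \<in> ball c R" for x
 using that by (metis at_within_open open_ball)
 define k where "k = u c - Re (g c)"
 have *: "u z = Re (g z) + k" if "z \<in> ball c R" for z
 proof -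
 have "(%z. u z - Re (g z)) z = (%z. u z - Re (g z)) c"
 proof (rule has_derivative_zero_unique[of "ball c R"])
 fix x assume "x \<in> ball c R"
 then have "((%z. u z - Re (g z)) has_derivative (%h. Re (cgrad u x * h) - Re (cgrad u x * h))) (at x)"
 by (intro has_derivative_diff harm_has_derivative[OF assms] has_derivative_Re_holomorphic g')
 then show "((%z. u z - Re (g z)) has_derivative (%h. 0)) (at x within ball c R)"
 by (simp add: has_derivative_at_withinI)
 qed (use that zero_le_dist[of c z] in \<open>auto simp del: zero_le_dist\<close>)
 then show ?thesis by (simp add: k_def)
 qed
 have "((%z. g z + of_real k) has_field_derivative cgrad u z) (at z)" if "z \<in> ball c R" for z
 using g'[OF that] by (auto intro!: derivative_eq_intros)
 moreover from this have "(%z. g z + of_real k) holomorphic_on ball c R"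
 unfolding holomorphic_on_open[OF open_ball] by blast
 ultimately show ?thesis using * by (intro exI[of _ "%z. g z + of_real k"]) auto
qed

section \<open>Circle means\<close>

text \<open>With \<open>circlepath\<close> parametrised over [0,1] the mean needs no factor 1/(2
  pi).\<close>

definition circ_mean :: "(complex => real) => complex => real => real" where
 "circ_mean u z r = integral {0..1} (%t. u (circlepath z r t))"

lemma cmod_circlepath: "cmod (circlepath z r t - z) = \<bar>r\<bar>"
proof -
 have "exp (2 * complex_of_real pi * \<i> * complex_of_real t) = exp (\<i> * complex_of_real (2 * pi * t))"
 by (simp add: mult_ac)
 then have "cmod (exp (2 * complex_of_real pi * \<i> * complex_of_real t)) = 1"
 by (simp only: norm_exp_i_times)
 then show ?thesis unfolding circlepath by (simp add: norm_mult)
qed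

lemma circlepath_in_sphere: "0 <= r ==> circlepath z r t \<in> sphere z r"
 using cmod_circlepath[of z r t] by (simp add: dist_norm norm_minus_commute)

lemma continuous_on_circlepath: "continuous_on A (circlepath z r)"
 unfolding circlepath by (intro continuous_intros)

lemma circ_continuous:
 fixes u :: "complex => 'a::topological_space"
 assumes "continuous_on (sphere z r) u" "0 <= r"
 shows "continuous_on A (%t. u (circlepath z r t))"
 by (rule continuous_on_compose2[OF assms(1) continuous_on_circlepath])
 (use circlepath_in_sphere assms in blast)

lemma circ_integrable:
 fixes u :: "complex => 'a::banach"
 assumes "continuous_on (sphere z r) u" "0 <= r"
 shows "(%t. u (circlepath z r t)) integrable_on {0..1}"
 by (intro integrable_continuous_real circ_continuous assms)

lemma sphere_circlepathE:
 assumes "w \<in> sphere z r" "0 <= r"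
 obtains t where "t \<in> {0..1}" "w = circlepath z r t"
proof -
 have "w \<in> path_image (circlepath z r)" using assms by simp
 then show thesis using that unfolding path_image_def by blast
qed

lemma circ_mean_cong:
 assumes "!!w. w \<in> sphere z r ==> u w = v w" "0 <= r"
 shows "circ_mean u z r = circ_mean v z r"
 unfolding circ_mean_def using assms circlepath_in_sphere by (intro integral_cong) auto

lemma circ_mean_const: "circ_mean (%_. c) z r = c"
 unfolding circ_mean_def by simp

lemma circ_mean_add:
 assumes "continuous_on (sphere z r) u" "continuous_on (sphere z r) v" "0 <= r"
 shows "circ_mean (%w. u w + v w) z r = circ_mean u z r + circ_mean v z r"
 unfolding circ_mean_def using assms by (intro integral_add circ_integrable)

lemma circ_mean_cmult: "circ_mean (%w. c * u w) z r = c * circ_mean u z r"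
 unfolding circ_mean_def by simp

lemma circ_mean_minus: "circ_mean (%w. - u w) z r = - circ_mean u z r"
 using circ_mean_cmult[of "-1"] by simp

lemma circ_mean_diff:
 assumes "continuous_on (sphere z r) u" "continuous_on (sphere z r) v" "0 <= r"
 shows "circ_mean (%w. u w - v w) z r = circ_mean u z r - circ_mean v z r"
 unfolding circ_mean_def using assms by (intro integral_diff circ_integrable)

lemma circ_mean_mono:
 assumes "continuous_on (sphere z r) u" "continuous_on (sphere z r) v" "0 <= r"
 "!!w. w \<in> sphere z r ==> u w <= v w"
 shows "circ_mean u z r <= circ_mean v z r"
 unfolding circ_mean_def using assms circlepath_in_sphere by (intro integral_le circ_integrable) auto

lemma circ_mean_nonneg_eq_0:
 assumes "continuous_on (sphere z r) u" "0 <= r" "!!w. w \<in> sphere z r ==> 0 <= u w"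
 "circ_mean u z r <= 0" "w \<in> sphere z r"
 shows "u w = 0"
proof -
 have "circ_mean u z r >= 0"
 using circ_mean_mono[OF _ assms(1,2), of "%_. 0"] assms(3) by (simp add: circ_mean_const)
 then have 0: "integral (cbox 0 1) (%t. u (circlepath z r t)) = 0"
 using assms(4) by (simp add: circ_mean_def)
 obtain t where t: "t \<in> {0..1}" "w = circlepath z r t" using sphere_circlepathE assms(2,5) by blast
 have "((%t. u (circlepath z r t)) has_integral 0) (cbox 0 1)"
 using 0 circ_integrable[OF assms(1,2)] by (metis box_real(2) integrable_integral)
 then have "u (circlepath z r t) = 0"
 using has_integral_0_cbox_imp_0[of 0 1 "%t. u (circlepath z r t)" t]
 circ_continuous[OF assms(1,2)] assms(2,3) circlepath_in_sphere t by auto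
 then show ?thesis using t by simp
qed

lemma has_contour_integral_circlepath_iff:
 "(f has_contour_integral I) (circlepath z r) \<longleftrightarrow>
 ((%t. 2 * of_real pi * \<i> * (f (circlepath z r t) * (circlepath z r t - z))) has_integral I) {0..1}"
proof -
 have "f (circlepath z r t) * vector_derivative (circlepath z r) (at t within {0..1}) =
 2 * of_real pi * \<i> * (f (circlepath z r t) * (circlepath z r t - z))" if "t \<in> {0..1}" for t
 using that by (simp add: vector_derivative_circlepath01) (simp add: circlepath)
 then show ?thesis unfolding has_contour_integral_def by (rule has_integral_cong)
qed

lemma has_integral_cmult_cancel:
 fixes k :: complex
 assumes "((%t. k * f t) has_integral k * I) S" "k ~= 0"
 shows "(f has_integral I) S"
 using has_integral_mult_right[OF assms(1), of "inverse k"] assms(2)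
 by (simp add: mult.assoc[symmetric])

lemma circle_integral_eq:
 assumes "(f has_contour_integral (2 * of_real pi * \<i> * I)) (circlepath z r)"
 shows "((%t. f (circlepath z r t) * (circlepath z r t - z)) has_integral I) {0..1}"
proof (rule has_integral_cmult_cancel)
 show "((%t. 2 * of_real pi * \<i> * (f (circlepath z r t) * (circlepath z r t - z))) has_integral
 2 * of_real pi * \<i> * I) {0..1}"
 using assms unfolding has_contour_integral_circlepath_iff .
 show "2 * of_real pi * \<i> ~= 0" by simp
qed

lemma harm_circ_mean:
 assumes "harm (ball c R) u" "0 < r" "r < R"
 shows "circ_mean u c r = u c"
proof -
 obtain f where f: "f holomorphic_on ball c R" "!!z. z \<in> ball c R ==> u z = Re (f z)"
 "!!z. z \<in> ball c R ==> (f has_field_derivative cgrad u z) (at z)"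
 using harm_ball_Re[OF assms(1)] by blast
 have "cball c r \<subseteq> ball c R" using assms(2,3) by auto
 from holomorphic_on_subset[OF f(1) this] assms(2)
 have "((%w. f w / (w - c)) has_contour_integral (2 * of_real pi * \<i> * f c)) (circlepath c r)"
 by (intro Cauchy_integral_circlepath_simple) simp_all
 from circle_integral_eq[OF this]
 have "((%t. f (circlepath c r t) / (circlepath c r t - c) * (circlepath c r t - c)) has_integral f c) {0..1}" .
 moreover have "circlepath c r t - c ~= 0" for t using cmod_circlepath[of c r t] assms(2) by auto
 ultimately have "((%t. f (circlepath c r t)) has_integral f c) {0..1}" by simp
 then have "((%t. Re (f (circlepath c r t))) has_integral Re (f c)) {0..1}"
 by (rule has_integral_Re)
 moreover have "circlepath c r t \<in> ball c R" for t
 using circlepath_in_sphere[of r c t] assms(2,3) by auto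
 moreover have "c \<in> ball c R" using assms(2,3) by simp
 ultimately have "((%t. u (circlepath c r t)) has_integral u c) {0..1}" by (simp only: f(2))
 then show ?thesis unfolding circ_mean_def by (rule integral_unique)
qed

text \<open>Write u = Re f. Cauchy's formula gives f'(c) as the mean of f/(p - c). Cauchy's theorem
  makes the mean of f (p - c) vanish; conjugated and divided by r^2 this says that the mean of cnj
  f/(p - c) vanishes. The sum of the two involves only 2u. Expressing the gradient by
  \<open>u\<close> itself is what allows gradient estimates and differentiation with respect to
  parameters.\<close>

lemma cgrad_circle_integral:
 assumes "harm (ball c R) u" "0 < r" "r < R"
 shows "((%t. of_real (2 * u (circlepath c r t)) * inverse (circlepath c r t - c)) has_integral cgrad u c) {0..1}"
proof -
 let ?p = "circlepath c r"
 obtain f where f: "f holomorphic_on ball c R" "!!z. z \<in> ball c R ==> u z = Re (f z)"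
 "!!z. z \<in> ball c R ==> (f has_field_derivative cgrad u z) (at z)"
 using harm_ball_Re[OF assms(1)] by blast
 have sub: "cball c r \<subseteq> ball c R" using assms(2,3) by auto
 have ne: "?p t - c ~= 0" for t using cmod_circlepath[of c r t] assms(2) by auto
 have inb: "?p t \<in> ball c R" for t using circlepath_in_sphere[of r c t] assms(2,3) by auto
 have cont: "continuous_on (cball c r) f"
 using f(1) sub holomorphic_on_imp_continuous_on continuous_on_subset by blast
 have "deriv f c = cgrad u c" using f(3)[of c] assms(2,3) by (intro DERIV_imp_deriv) simp
 then have "((%w. f w / (w - c)^2) has_contour_integral (2 * of_real pi * \<i> * cgrad u c)) (circlepath c r)"
 using Cauchy_has_contour_integral_higher_derivative_circlepath[of c r f c 1] cont
 holomorphic_on_subset[OF f(1) order_trans[OF ball_subset_cball sub]] assms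
 by (simp add: numeral_2_eq_2)
 from circle_integral_eq[OF this]
 have 1: "((%t. f (?p t) * inverse (?p t - c)) has_integral cgrad u c) {0..1}"
 using ne by (simp add: power2_eq_square divide_inverse mult.assoc)
 have "(f has_contour_integral 0) (circlepath c r)"
 proof (rule Cauchy_theorem_disc_simple[of _ c R])
 show "path_image (circlepath c r) \<subseteq> ball c R" using assms(2,3) sub by auto
 qed (use f(1) assms(2,3) in simp_all)
 then have "(f has_contour_integral 2 * of_real pi * \<i> * 0) (circlepath c r)" by simp
 from circle_integral_eq[OF this] have "((%t. f (?p t) * (?p t - c)) has_integral 0) {0..1}" .
 then have "((%t. cnj (f (?p t) * (?p t - c))) has_integral cnj 0) {0..1}"
 by (rule has_integral_linear[OF _ bounded_linear_cnj, unfolded o_def])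
 then have "((%t. cnj (f (?p t) * (?p t - c)) * (1 / of_real (r^2))) has_integral (cnj 0 * (1 / of_real (r^2)))) {0..1}"
 by (rule has_integral_mult_left)
 moreover have "cnj (f (?p t) * (?p t - c)) * (1 / of_real (r^2)) = cnj (f (?p t)) * inverse (?p t - c)" for t
 proof -
 have "(?p t - c) * cnj (?p t - c) = of_real (r^2)"
 using cmod_circlepath[of c r t] by (metis complex_norm_square power2_abs)
 then have "cnj (?p t - c) * (1 / of_real (r^2)) = inverse (?p t - c)"
 using ne[of t] assms by (simp add: field_simps)
 then show ?thesis by (simp only: complex_cnj_mult mult.assoc)
 qed
 ultimately have "((%t. cnj (f (?p t)) * inverse (?p t - c)) has_integral 0) {0..1}" by simp
 from has_integral_add[OF 1 this]
 have "((%t. (f (?p t) + cnj (f (?p t))) * inverse (?p t - c)) has_integral cgrad u c) {0..1}"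
 by (simp add: ring_distribs)
 moreover have "f (?p t) + cnj (f (?p t)) = of_real (2 * u (?p t))" for t
 using f(2)[OF inb] by (simp add: complex_add_cnj)
 ultimately show ?thesis by simp
qed

text \<open>The circle of radius R/2 is used, where the kernel 2/|p - c| equals 4/R.\<close>

lemma cgrad_bound:
 assumes "harm (ball c R) u" "0 < R" "!!z. z \<in> ball c R ==> \<bar>u z\<bar> <= M"
 shows "cmod (cgrad u c) <= 4 * M / R"
proof -
 have M: "0 <= M" using assms(3)[of c] assms(2) by auto
 have "norm (cgrad u c) <= 4 * M / R * measure lborel (cbox (0::real) 1)"
 proof (rule has_integral_bound)
 show "((%t. of_real (2 * u (circlepath c (R/2) t)) * inverse (circlepath c (R/2) t - c)) has_integral cgrad u c) (cbox 0 1)"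
 using cgrad_circle_integral[OF assms(1), of "R/2"] assms(2) by simp
 fix t :: real
 have "circlepath c (R/2) t \<in> ball c R"
 using circlepath_in_sphere[of "R/2" c t] assms(2) by auto
 then have "\<bar>u (circlepath c (R/2) t)\<bar> <= M" by (rule assms(3))
 moreover have "norm (of_real (2 * u (circlepath c (R/2) t)) * inverse (circlepath c (R/2) t - c))
 = 2 * \<bar>u (circlepath c (R/2) t)\<bar> * inverse (R/2)"
 using assms(2) by (simp only: norm_mult norm_inverse cmod_circlepath norm_of_real)
 ultimately show "norm (of_real (2 * u (circlepath c (R/2) t)) * inverse (circlepath c (R/2) t - c)) <= 4 * M / R"
 using assms(2) by (simp add: field_simps)
 qed (simp add: M assms(2) less_imp_le)
 then show ?thesis by simp
qed


section \<open>The Poisson integral\<close>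

text \<open>With w = p - c and s = z - c the Poisson kernel is Re ((w + s)/(w - s)), and (w + s)/(w
  - s) = 2w/(w - s) - 1. So the integral is the real part of twice a Cauchy transform minus a
  constant, which is holomorphic by construction.\<close>

lemma poisson_integral:
 fixes phi :: "complex => real"
 assumes "continuous_on (sphere c R) phi" "0 < R"
 shows "\<exists>F. F holomorphic_on ball c R & (\<forall>z\<in>ball c R.
 ((%t. phi (circlepath c R t) * ((R\<^sup>2 - (cmod (z - c))\<^sup>2) / (cmod (circlepath c R t - z))\<^sup>2))
 has_integral Re (F z)) {0..1})"
proof -
 let ?p = "circlepath c R"
 define g where "g z = contour_integral ?p (%w. of_real (phi w) / (w - z))" for z
 define F where "F z = g z / (of_real pi * \<i>) - integral {0..1} (%t. complex_of_real (phi (?p t)))" for z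
 have cont: "continuous_on (sphere c R) (%w. complex_of_real (phi w))"
 using assms(1) by (intro continuous_intros)
 have Re_mult: "Re (of_real a * x) = a * Re x" for a x by simp
 have ne: "?p t - z ~= 0" if "z \<in> ball c R" for z t
 using circlepath_in_sphere[of R c t] assms(2) that by auto
 have int: "((%w. of_real (phi w) / (w - z)^1) has_contour_integral g z) ?p" if "z \<in> ball c R" for z
 unfolding g_def using that assms cont
 by (auto intro!: has_contour_integral_integral contour_integrable_continuous_circlepath continuous_intros)
 have "(g has_field_derivative (of_nat 1 * contour_integral ?p (%u. of_real (phi u) / (u - z)^(Suc 1)))) (at z)"
 if "z \<in> ball c R" for z
 by (rule Cauchy_next_derivative_circlepath(2)[OF _ int _ that]) (use cont assms(2) in auto)
 then have "g holomorphic_on ball c R" unfolding holomorphic_on_open[OF open_ball] by blast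
 then have "F holomorphic_on ball c R" unfolding F_def by (intro holomorphic_intros) auto
 moreover have "((%t. phi (?p t) * ((R\<^sup>2 - (cmod (z - c))\<^sup>2) / (cmod (?p t - z))\<^sup>2))
 has_integral Re (F z)) {0..1}" if "z \<in> ball c R" for z
 proof -
 have "((%w. of_real (phi w) / (w - z)) has_contour_integral 2 * of_real pi * \<i> * (g z / (2 * of_real pi * \<i>))) ?p"
 using int[OF that] by simp
 from circle_integral_eq[OF this]
 have "((%t. of_real (phi (?p t)) / (?p t - z) * (?p t - c)) has_integral (g z / (2 * of_real pi * \<i>))) {0..1}" .
 from has_integral_mult_right[OF this, of 2]
 have 1: "((%t. 2 * (of_real (phi (?p t)) / (?p t - z) * (?p t - c))) has_integral g z / (of_real pi * \<i>)) {0..1}"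
 by simp
 have 2: "((%t. complex_of_real (phi (?p t))) has_integral integral {0..1} (%t. complex_of_real (phi (?p t)))) {0..1}"
 using circ_integrable[OF cont] assms(2) by (simp add: integrable_integral)
 have "Re (2 * (of_real (phi (?p t)) / (?p t - z) * (?p t - c)) - complex_of_real (phi (?p t)))
 = phi (?p t) * ((R\<^sup>2 - (cmod (z - c))\<^sup>2) / (cmod (?p t - z))\<^sup>2)" for t
 proof -
 define w where "w = ?p t - c"
 define s where "s = z - c"
 have ws: "w - s ~= 0" "?p t - z = w - s" using ne[OF that, of t] by (auto simp: w_def s_def)
 have "(cmod w)\<^sup>2 = R\<^sup>2" unfolding w_def cmod_circlepath by simp
 then have "Re ((w + s) * cnj (w - s)) = R\<^sup>2 - (cmod s)\<^sup>2"
 by (simp add: cmod_power2) (simp add: power2_eq_square algebra_simps)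
 then have "Re ((w + s) / (w - s)) = (R\<^sup>2 - (cmod s)\<^sup>2) / (cmod (w - s))\<^sup>2"
 by (subst complex_div_cnj) simp
 moreover have "2 * (of_real (phi (?p t)) / (w - s) * w) - complex_of_real (phi (?p t)) = of_real (phi (?p t)) * ((w + s) / (w - s))"
 using ws by (simp add: divide_simps) (simp add: algebra_simps)
 moreover have "Re (of_real (phi (?p t)) * ((w + s) / (w - s))) = phi (?p t) * Re ((w + s) / (w - s))"
 using Re_mult by (simp only:)
 ultimately show ?thesis unfolding ws(2) w_def[symmetric] s_def[symmetric] by (simp only:)
 qed
 with has_integral_Re[OF has_integral_diff[OF 1 2]] show ?thesis unfolding F_def by simp
 qed
 ultimately show ?thesis by blast
qed

lemma poisson_kernel_integral:
 assumes "z \<in> ball c R" "0 < R"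
 shows "((%t. (R\<^sup>2 - (cmod (z - c))\<^sup>2) / (cmod (circlepath c R t - z))\<^sup>2) has_integral 1) {0..1}"
proof -
 let ?p = "circlepath c R"
 have ne: "?p t - z ~= 0" for t
 using circlepath_in_sphere[of R c t] assms by auto
 have "((%w. 1 / (w - z)) has_contour_integral 2 * of_real pi * \<i> * 1) ?p"
 using Cauchy_integral_circlepath_simple[of "%_. 1" c R z] assms by (simp add: dist_norm norm_minus_commute)
 from circle_integral_eq[OF this]
 have 1: "((%t. 1 / (?p t - z) * (?p t - c)) has_integral 1) {0..1}" .
 have "((%t. 2 * (1 / (?p t - z) * (?p t - c)) - 1) has_integral 2 * 1 - 1) {0..1}"
 using has_integral_diff[OF has_integral_mult_right[OF 1, of 2] has_integral_const_real[of "1::complex" 0 1]] by simp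
 from has_integral_Re[OF this]
 have "((%t. Re (2 * (1 / (?p t - z) * (?p t - c)) - 1)) has_integral 1) {0..1}" by simp
 moreover have "Re (2 * (1 / (?p t - z) * (?p t - c)) - 1)
 = (R\<^sup>2 - (cmod (z - c))\<^sup>2) / (cmod (?p t - z))\<^sup>2" for t
 proof -
 define w where "w = ?p t - c"
 define s where "s = z - c"
 have ws: "w - s ~= 0" "?p t - z = w - s" using ne[of t] by (auto simp: w_def s_def)
 have "(cmod w)\<^sup>2 = R\<^sup>2" unfolding w_def cmod_circlepath by simp
 then have "Re ((w + s) * cnj (w - s)) = R\<^sup>2 - (cmod s)\<^sup>2"
 by (simp add: cmod_power2) (simp add: power2_eq_square algebra_simps)
 then have "Re ((w + s) / (w - s)) = (R\<^sup>2 - (cmod s)\<^sup>2) / (cmod (w - s))\<^sup>2"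
 by (subst complex_div_cnj) simp
 moreover have "2 * (1 / (w - s) * w) - 1 = (w + s) / (w - s)"
 using ws by (simp add: divide_simps)
 ultimately show ?thesis using ws unfolding w_def[symmetric] s_def[symmetric] by (simp only:)
 qed
 ultimately show ?thesis by simp
qed

text \<open>Only continuity at a boundary point \<open>z0\<close> needs work: the kernel has mass 1,
  and away from \<open>z0\<close> it is bounded by a multiple of R^2 - |z - c|^2, which tends to 0
  at the circle.\<close>

lemma poisson_disc:
 fixes phi :: "complex => real"
 assumes "continuous_on (sphere c R) phi" "0 < R"
 shows "\<exists>v. continuous_on (cball c R) v & harm (ball c R) v & (\<forall>z\<in>sphere c R. v z = phi z)"
proof -
 let ?p = "circlepath c R"
 let ?K = "%z t. (R\<^sup>2 - (cmod (z - c))\<^sup>2) / (cmod (?p t - z))\<^sup>2"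
 obtain F where F: "F holomorphic_on ball c R"
 "!!z. z \<in> ball c R ==> ((%t. phi (?p t) * ?K z t) has_integral Re (F z)) {0..1}"
 using poisson_integral[OF assms] by blast
 define v where "v z = (if z \<in> ball c R then Re (F z) else phi z)" for z
 have hv: "harm (ball c R) v"
 by (rule harm_cong[OF harm_Re[OF F(1) open_ball] open_ball]) (simp add: v_def)
 obtain M where M: "!!w. w \<in> sphere c R ==> \<bar>phi w\<bar> <= M"
 using compact_imp_bounded[OF compact_continuous_image[OF assms(1) compact_sphere]]
 unfolding bounded_iff by (metis imageI real_norm_def)
 have psph: "?p t \<in> sphere c R" for t using circlepath_in_sphere assms(2) by simp
 have "continuous (at z0 within cball c R) v" if "z0 \<in> cball c R" for z0
 proof (cases "z0 \<in> ball c R")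
 case True
 then have "continuous (at z0) v"
 using harm_continuous_on[OF hv] continuous_on_eq_continuous_at by blast
 then show ?thesis by (rule continuous_at_imp_continuous_at_within)
 next
 case False
 then have z0: "z0 \<in> sphere c R" using that by auto
 then have M0: "0 <= M" using M[OF z0] by linarith
 show ?thesis unfolding continuous_within_eps_delta
 proof (intro allI impI)
 fix eta :: real assume "eta > 0"
 then obtain d where d: "d > 0" "!!w. w \<in> sphere c R ==> dist w z0 < d ==> \<bar>phi w - phi z0\<bar> < eta / 2"
 using assms(1) z0 unfolding continuous_on_iff
 by (metis dist_real_def half_gt_zero)
 \<comment> \<open>Far from \<open>z0\<close> the data differ by at most 2M and |p - z| >= d/2, so
   that part of the integral costs at most \<open>C * m\<close> with \<open>m\<close> as defined
   below. Since m <= 2R dist z z0, the choice of \<open>rho\<close> pushes this below eta/2.\<close>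
 define C where "C = 2 * M * (4 / d\<^sup>2)"
 have C0: "0 <= C" using M0 by (simp add: C_def)
 define rho where "rho = min (d / 2) (eta / (2 * (2 * R * C + 1)))"
 have rho: "rho > 0" using d(1) \<open>eta > 0\<close> C0 assms(2)
 by (auto simp: rho_def intro!: divide_pos_pos add_nonneg_pos)
 have "\<bar>v z - phi z0\<bar> < eta" if z: "z \<in> cball c R" "dist z z0 < rho" for z
 proof (cases "z \<in> ball c R")
 case False
 then have "z \<in> sphere c R" using z by auto
 moreover have "dist z z0 < d" using z(2) d(1) by (simp add: rho_def)
 ultimately show ?thesis using d(2)[of z] False \<open>eta > 0\<close> by (simp add: v_def)
 next
 case True
 define m where "m = R\<^sup>2 - (cmod (z - c))\<^sup>2"
 have zc: "cmod (z - c) < R" using True by (simp add: dist_norm norm_minus_commute)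
 have m0: "m > 0" using zc by (simp add: m_def power_strict_mono)
 have "R <= cmod (z - c) + dist z z0"
 using z0 norm_triangle_ineq4[of "z - c" "z - z0"] by (simp add: dist_norm norm_minus_commute)
 then have "R - cmod (z - c) <= dist z z0" by simp
 then have "m <= dist z z0 * (2 * R)"
 using mult_mono[of "R - cmod (z - c)" "dist z z0" "R + cmod (z - c)" "2 * R"] zc assms(2)
 by (simp add: m_def square_diff_square_factored power2_eq_square mult.commute)
 also have "... <= rho * (2 * R)" using z assms(2) by simp
 finally have "C * m <= C * (rho * (2 * R))" using C0 by (rule mult_left_mono)
 also have "... = rho * (2 * R * C)" by simp
 also have "... < rho * (2 * R * C + 1)" using rho by simp
 also have "... <= eta / (2 * (2 * R * C + 1)) * (2 * R * C + 1)"
 using C0 assms(2) by (intro mult_right_mono) (auto simp: rho_def)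
 also have "... = eta / 2"
 proof -
 have "2 * R * C + 1 > 0" using C0 assms(2) by (intro add_nonneg_pos) auto
 then show ?thesis by (simp add: field_simps)
 qed
 finally have Cm: "C * m < eta / 2" .
 have pt: "\<bar>(phi (?p t) - phi z0) * ?K z t\<bar> <= eta / 2 * ?K z t + C * m" for t
 proof -
 define k where "k = ?K z t"
 have k0: "k >= 0" using m0 unfolding k_def m_def[symmetric] by simp
 have "\<bar>phi (?p t) - phi z0\<bar> * k <= eta / 2 * k + C * m"
 proof (cases "dist (?p t) z0 < d")
 case True
 then have "\<bar>phi (?p t) - phi z0\<bar> * k <= eta / 2 * k"
 using d(2)[OF psph True] k0 by (intro mult_right_mono) auto
 moreover have "0 <= C * m" using C0 m0 by simp
 ultimately show ?thesis by linarith
 next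
 case False
 have "dist (?p t) z0 <= dist (?p t) z + dist z z0" by (rule dist_triangle)
 moreover have "dist z z0 < d / 2" using z(2) by (simp add: rho_def)
 ultimately have "d / 2 <= cmod (?p t - z)" using False by (simp add: dist_norm)
 then have "(d / 2)\<^sup>2 <= (cmod (?p t - z))\<^sup>2" using d(1) by (intro power_mono) auto
 moreover have "0 < (d / 2)\<^sup>2" using d(1) by simp
 ultimately have "m / (cmod (?p t - z))\<^sup>2 <= m / (d / 2)\<^sup>2"
 using m0 by (intro divide_left_mono mult_pos_pos) linarith+
 then have "k <= 4 / d\<^sup>2 * m" unfolding k_def m_def[symmetric] by (simp add: power_divide mult.commute)
 moreover have "\<bar>phi (?p t) - phi z0\<bar> <= 2 * M" using M[OF psph, of t] M[OF z0] by linarith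
 ultimately have "\<bar>phi (?p t) - phi z0\<bar> * k <= 2 * M * (4 / d\<^sup>2 * m)"
 using M0 k0 by (intro mult_mono) auto
 moreover have "0 <= eta / 2 * k" using k0 \<open>eta > 0\<close> by simp
 ultimately show ?thesis by (simp add: C_def)
 qed
 then show ?thesis unfolding k_def[symmetric] using k0 by (simp add: abs_mult)
 qed
 have K1: "(?K z has_integral 1) {0..1}" using poisson_kernel_integral True assms(2) by blast
 have 1: "((%t. (phi (?p t) - phi z0) * ?K z t) has_integral Re (F z) - phi z0 * 1) {0..1}"
 unfolding left_diff_distrib
 by (rule has_integral_diff[OF F(2)[OF True] has_integral_mult_right[OF K1, of "phi z0"]])
 have 2: "((%t. eta / 2 * ?K z t + C * m) has_integral eta / 2 * 1 + C * m) {0..1}"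
 using has_integral_add[OF has_integral_mult_right[OF K1, of "eta / 2"] has_integral_const_real[of "C * m" 0 1]]
 by simp
 have "Re (F z) - phi z0 * 1 <= eta / 2 * 1 + C * m"
 by (rule has_integral_le[OF 1 2]) (rule order_trans[OF abs_ge_self pt])
 moreover have "- (Re (F z) - phi z0 * 1) <= eta / 2 * 1 + C * m"
 by (rule has_integral_le[OF has_integral_neg[OF 1] 2]) (rule order_trans[OF abs_ge_minus_self pt])
 ultimately show ?thesis using Cm True by (simp add: v_def)
 qed
 then show "\<exists>d>0. \<forall>x'\<in>cball c R. dist x' z0 < d --> dist (v x') (v z0) < eta"
 using rho False by (intro exI[of _ rho]) (auto simp: dist_real_def v_def)
 qed
 qed
 then have "continuous_on (cball c R) v" unfolding continuous_on_eq_continuous_within by blast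
 moreover have "\<forall>z\<in>sphere c R. v z = phi z" by (simp add: v_def)
 ultimately show ?thesis using hv by blast
qed

section \<open>Sub-mean-value property and the maximum principle\<close>

text \<open>Only small circles are tested, with a threshold depending on the point. This local form
  survives the gluing in Perron's method, and imposed on both u and -u it forces a continuous
  function to be harmonic.\<close>

definition subh :: "complex set => (complex => real) => bool" where
 "subh D v \<longleftrightarrow> (\<forall>x\<in>D. \<exists>r0>0. \<forall>r. 0 < r & r < r0 --> v x <= circ_mean v x r)"

lemma subh_subset: "subh D v ==> E \<subseteq> D ==> subh E v"
 unfolding subh_def by blast

lemma subhE_ball:
 assumes "subh D v" "open D" "x \<in> D"
 shows "\<exists>r0>0. ball x r0 \<subseteq> D & (\<forall>r. 0 < r & r < r0 --> v x <= circ_mean v x r)"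
proof -
 obtain r0 where r0: "r0 > 0" "\<forall>r. 0 < r & r < r0 --> v x <= circ_mean v x r"
 using assms(1,3) unfolding subh_def by blast
 obtain e where "e > 0" "ball x e \<subseteq> D" using assms(2,3) openE by blast
 then show ?thesis using r0 by (intro exI[of _ "min r0 e"]) auto
qed

lemma sphere_subset_ball: "0 < r ==> r < e ==> sphere x r \<subseteq> ball x e"
 by auto

lemma subh_harm:
 assumes "open D" "harm D u"
 shows "subh D u"
 unfolding subh_def
proof
 fix x assume "x \<in> D"
 then obtain e where "e > 0" "ball x e \<subseteq> D" using assms(1) openE by blast
 then show "\<exists>r0>0. \<forall>r. 0 < r & r < r0 --> u x <= circ_mean u x r"
 using harm_circ_mean[OF harm_subset[OF assms(2)]] by (intro exI[of _ e]) auto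
qed

lemma subh_add:
 assumes "open D" "continuous_on D u" "continuous_on D v" "subh D u" "subh D v"
 shows "subh D (%z. u z + v z)"
 unfolding subh_def
proof
 fix x assume x: "x \<in> D"
 obtain a where a: "a > 0" "ball x a \<subseteq> D" "\<forall>r. 0 < r & r < a --> u x <= circ_mean u x r"
 using subhE_ball[OF assms(4,1) x] by blast
 obtain b where b: "b > 0" "\<forall>r. 0 < r & r < b --> v x <= circ_mean v x r"
 using subhE_ball[OF assms(5,1) x] by blast
 have "u x + v x <= circ_mean (%z. u z + v z) x r" if "0 < r" "r < min a b" for r
 proof -
 have "sphere x r \<subseteq> D" using sphere_subset_ball[of r a x] that a(2) by auto
 then have "circ_mean (%z. u z + v z) x r = circ_mean u x r + circ_mean v x r"
 using assms(2,3) that by (intro circ_mean_add) (auto intro: continuous_on_subset)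
 then show ?thesis using a(3) b(2) that by (simp add: add_mono)
 qed
 then show "\<exists>r0>0. \<forall>r. 0 < r & r < r0 --> u x + v x <= circ_mean (%z. u z + v z) x r"
 using a(1) b(1) by (intro exI[of _ "min a b"]) auto
qed

lemma subh_max:
 assumes "open D" "continuous_on D u" "continuous_on D v" "subh D u" "subh D v"
 shows "subh D (%z. max (u z) (v z))"
 unfolding subh_def
proof
 fix x assume x: "x \<in> D"
 obtain a where a: "a > 0" "ball x a \<subseteq> D" "\<forall>r. 0 < r & r < a --> u x <= circ_mean u x r"
 using subhE_ball[OF assms(4,1) x] by blast
 obtain b where b: "b > 0" "\<forall>r. 0 < r & r < b --> v x <= circ_mean v x r"
 using subhE_ball[OF assms(5,1) x] by blast
 have "max (u x) (v x) <= circ_mean (%z. max (u z) (v z)) x r" if "0 < r" "r < min a b" for r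
 proof -
 have "sphere x r \<subseteq> D" using sphere_subset_ball[of r a x] that a(2) by auto
 then have c: "continuous_on (sphere x r) u" "continuous_on (sphere x r) v"
 using assms(2,3) by (auto intro: continuous_on_subset)
 have "circ_mean u x r <= circ_mean (%z. max (u z) (v z)) x r"
 "circ_mean v x r <= circ_mean (%z. max (u z) (v z)) x r"
 using that c by (auto intro!: circ_mean_mono continuous_on_max)
 moreover have "u x <= circ_mean u x r" "v x <= circ_mean v x r" using a(3) b(2) that by auto
 ultimately show ?thesis by linarith
 qed
 then show "\<exists>r0>0. \<forall>r. 0 < r & r < r0 --> max (u x) (v x) <= circ_mean (%z. max (u z) (v z)) x r"
 using a(1) b(1) by (intro exI[of _ "min a b"]) auto
qed

text \<open>Take a point of the maximum set with largest real part. If it lay in \<open>D\<close>, a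
  small circle around it would consist of maximum points as well, among them one further to the
  right. The extremal choice replaces the usual connectedness argument.\<close>

lemma max_principle:
 assumes "open D" "bounded D" "continuous_on (closure D) v" "subh D v"
 "!!z. z \<in> frontier D ==> v z <= M" "z \<in> closure D"
 shows "v z <= M"
proof (rule ccontr)
 assume "\<not> v z <= M"
 have comp: "compact (closure D)" using assms(2) by (simp add: compact_closure)
 have ne: "closure D ~= {}" using assms(6) by auto
 obtain m where m: "m \<in> closure D" "!!y. y \<in> closure D ==> v y <= v m"
 using continuous_attains_sup[OF comp ne assms(3)] by auto
 define K where "K = {x \<in> closure D. v x = v m}"
 have "closed K" unfolding K_def by (rule continuous_closed_preimage_constant[OF assms(3) closed_closure])
 moreover have "bounded K"
 by (rule bounded_subset[OF bounded_closure[OF assms(2)]]) (auto simp: K_def)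
 ultimately have "compact K" using compact_eq_bounded_closed by blast
 have "K ~= {}" using m(1) by (auto simp: K_def)
 then obtain x where x: "x \<in> K" "!!y. y \<in> K ==> Re y <= Re x"
 using continuous_attains_sup[OF \<open>compact K\<close> _ continuous_on_Re[OF continuous_on_id]] by auto
 have "v x > M" using x(1) m(2)[OF assms(6)] \<open>\<not> v z <= M\<close> by (simp add: K_def)
 then have "x \<in> D" using x(1) assms(5)[of x] unfolding K_def frontier_def by (force simp: interior_open[OF assms(1)])
 obtain a where a: "a > 0" "ball x a \<subseteq> D" "\<forall>r. 0 < r & r < a --> v x <= circ_mean v x r"
 using subhE_ball[OF assms(4,1) \<open>x \<in> D\<close>] by blast
 define r where "r = a / 2"
 have r: "0 < r" "r < a" using a(1) by (auto simp: r_def)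
 have sph: "sphere x r \<subseteq> D" using sphere_subset_ball[OF r] a(2) by blast
 then have sc: "sphere x r \<subseteq> closure D" using closure_subset by blast
 have cv: "continuous_on (sphere x r) v" using assms(3) sc by (rule continuous_on_subset)
 have xr: "x + of_real r \<in> sphere x r" using r by (simp add: dist_norm)
 have "v x - v (x + of_real r) = 0"
 proof (rule circ_mean_nonneg_eq_0[of x r "%w. v x - v w"])
 show "circ_mean (%w. v x - v w) x r <= 0"
 using circ_mean_diff[of x r "%_. v x" v] cv r a(3) by (simp add: circ_mean_const)
 show "0 <= v x - v w" if "w \<in> sphere x r" for w using m(2)[of w] x(1) that sc by (auto simp: K_def)
 qed (use cv r xr in \<open>auto intro!: continuous_intros\<close>)
 then have "x + of_real r \<in> K" using xr sc x(1) by (auto simp: K_def)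
 then show False using x(2)[of "x + of_real r"] r by simp
qed

lemma harm_max_principle:
 assumes "open D" "bounded D" "continuous_on (closure D) v" "harm D v"
 "!!z. z \<in> frontier D ==> \<bar>v z\<bar> <= M" "z \<in> closure D"
 shows "\<bar>v z\<bar> <= M"
proof -
 have "v z <= M"
 by (rule max_principle[OF assms(1-3) subh_harm[OF assms(1,4)] _ assms(6)]) (use assms(5) in force)
 moreover have "- v z <= M"
 by (rule max_principle[OF assms(1,2) continuous_on_minus[OF assms(3)] subh_harm[OF assms(1) harm_minus[OF assms(4)]] _ assms(6)])
 (use assms(5) in force)
 ultimately show ?thesis by linarith
qed

lemma subh_diff_harm:
 assumes "open D" "continuous_on D u" "subh D u" "harm D v"
 shows "subh D (%z. u z - v z)"
 using subh_add[OF assms(1,2) harm_continuous_on[OF harm_minus[OF assms(4)]] assms(3)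
 subh_harm[OF assms(1) harm_minus[OF assms(4)]]] by simp

lemma subh_le_harm:
 assumes "open D" "bounded D" "continuous_on (closure D) u" "subh D u"
 "continuous_on (closure D) v" "harm D v" "!!z. z \<in> frontier D ==> u z <= v z" "x \<in> closure D"
 shows "u x <= v x"
proof -
 have "u x - v x <= 0"
 proof (rule max_principle[OF assms(1,2)])
 show "continuous_on (closure D) (%x. u x - v x)" using assms(3,5) by (rule continuous_on_diff)
 have "continuous_on D u" using assms(3) closure_subset by (rule continuous_on_subset)
 then show "subh D (%x. u x - v x)" using assms(1,4,6) by (intro subh_diff_harm)
 show "u z - v z <= 0" if "z \<in> frontier D" for z using assms(7)[OF that] by simp
 qed (rule assms(8))
 then show ?thesis by simp
qed

text \<open>On a small disc the function is compared with the Poisson solution of the same boundary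
  values; the maximum principle for u and for -u makes the two agree.\<close>

lemma harm_if_mean:
 assumes "open S" "continuous_on S u" "subh S u" "subh S (%z. - u z)"
 shows "harm S u"
proof (rule harm_local)
 fix z assume "z \<in> S"
 then obtain R where R: "R > 0" "cball z R \<subseteq> S" using assms(1) open_contains_cball by blast
 have cu: "continuous_on (cball z R) u" using assms(2) R(2) by (rule continuous_on_subset)
 obtain v where v: "continuous_on (cball z R) v" "harm (ball z R) v" "\<forall>w\<in>sphere z R. v w = u w"
 using poisson_disc[OF continuous_on_subset[OF cu sphere_cball] R(1)] by blast
 have bS: "ball z R \<subseteq> S" using R by auto
 have clb: "closure (ball z R) = cball z R" "frontier (ball z R) = sphere z R"
 using R(1) by (auto simp: frontier_ball)
 have cl: "continuous_on (closure (ball z R)) v" "continuous_on (closure (ball z R)) u"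
 "continuous_on (closure (ball z R)) (%z. - u z)" "continuous_on (closure (ball z R)) (%z. - v z)"
 unfolding clb using v(1) cu by (auto intro: continuous_on_minus)
 have "v w = u w" if "w \<in> ball z R" for w
 proof -
 have w: "w \<in> closure (ball z R)" using that closure_subset by blast
 have "u w <= v w"
 by (rule subh_le_harm[OF open_ball bounded_ball cl(2) subh_subset[OF assms(3) bS] cl(1) v(2) _ w])
 (use v(3) clb in simp)
 moreover have "- u w <= - v w"
 by (rule subh_le_harm[OF open_ball bounded_ball cl(3) subh_subset[OF assms(4) bS] cl(4) harm_minus[OF v(2)] _ w])
 (use v(3) clb in simp)
 ultimately show ?thesis by simp
 qed
 then have "harm (ball z R) u" by (rule harm_cong[OF v(2) open_ball])
 then show "\<exists>T. open T & z \<in> T & harm T u" using R(1) by (intro exI[of _ "ball z R"]) auto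
qed

text \<open>Perron's lifting. At a point outside the open ball the value is unchanged while the mean
  over circles can only grow, so the sub-mean-value inequality is inherited even on the sphere where
  the two pieces meet.\<close>

lemma poisson_modification:
 assumes "open D" "continuous_on (closure D) v" "subh D v" "0 < R" "cball c R \<subseteq> D"
 shows "\<exists>w. continuous_on (closure D) w & subh D w & harm (ball c R) w \<and>
 (\<forall>x. x \<notin> ball c R --> w x = v x) & (\<forall>x\<in>closure D. v x <= w x)"
proof -
 have cD: "cball c R \<subseteq> closure D" using assms(5) closure_subset by blast
 have cv: "continuous_on (cball c R) v" using assms(2) cD by (rule continuous_on_subset)
 obtain p where p: "continuous_on (cball c R) p" "harm (ball c R) p" "\<forall>w\<in>sphere c R. p w = v w"
 using poisson_disc[OF continuous_on_subset[OF cv sphere_cball] assms(4)] by blast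
 define w where "w x = (if x \<in> cball c R then p x else v x)" for x
 have wv: "w x = v x" if "x \<notin> ball c R" for x
 using that p(3) by (cases "x \<in> sphere c R") (auto simp: w_def)
 have hw: "harm (ball c R) w" by (rule harm_cong[OF p(2)]) (auto simp: w_def)
 have "continuous_on (cball c R \<union> (closure D - ball c R)) (%x. if x \<in> cball c R then p x else v x)"
 using p assms(2) by (intro continuous_on_If) (auto intro: continuous_on_subset)
 moreover have "cball c R \<union> (closure D - ball c R) = closure D" using cD by auto
 ultimately have cw: "continuous_on (closure D) w" unfolding w_def by simp
 have bD: "ball c R \<subseteq> D" using assms(5) by auto
 have clb: "closure (ball c R) = cball c R" "frontier (ball c R) = sphere c R"
 using assms(4) by (auto simp: frontier_ball)
 have le: "v x <= w x" for x
 proof (cases "x \<in> ball c R")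
 case True
 have "v x <= p x"
 by (rule subh_le_harm[OF open_ball bounded_ball _ subh_subset[OF assms(3) bD] _ p(2), unfolded clb, OF cv p(1)])
 (use p(3) True in simp_all)
 then show ?thesis using True by (auto simp: w_def)
 qed (simp add: wv)
 have "subh D w" unfolding subh_def
 proof
 fix x assume x: "x \<in> D"
 show "\<exists>r0>0. \<forall>r. 0 < r & r < r0 --> w x <= circ_mean w x r"
 proof (cases "x \<in> ball c R")
 case True
 then show ?thesis using subh_harm[OF open_ball hw] unfolding subh_def by blast
 next
 case False
 obtain a where a: "a > 0" "ball x a \<subseteq> D" "\<forall>r. 0 < r & r < a --> v x <= circ_mean v x r"
 using subhE_ball[OF assms(3,1) x] by blast
 have "w x <= circ_mean w x r" if r: "0 < r" "r < a" for r
 proof -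
 have "sphere x r \<subseteq> closure D" using sphere_subset_ball[OF r] a(2) closure_subset by blast
 then have "continuous_on (sphere x r) v" "continuous_on (sphere x r) w"
 using assms(2) cw by (auto intro: continuous_on_subset)
 then have "circ_mean v x r <= circ_mean w x r" using r le by (intro circ_mean_mono) auto
 then show ?thesis using a(3) r wv[OF False] by force
 qed
 then show ?thesis using a(1) by blast
 qed
 qed
 then show ?thesis using cw hw wv le by (intro exI[of _ w]) auto
qed


section \<open>Perron's method\<close>

text \<open>The constant depends on \<open>M\<close> and \<open>R\<close> only: this is the
  equicontinuity behind Perron's argument.\<close>

lemma harm_lipschitz:
 assumes "harm (ball c R) u" "0 < R" "!!z. z \<in> ball c R ==> \<bar>u z\<bar> <= M"
 "x \<in> ball c (R/2)" "y \<in> ball c (R/2)"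
 shows "\<bar>u x - u y\<bar> <= 8 * M / R * cmod (x - y)"
proof -
 have g: "cmod (cgrad u z) <= 8 * M / R" if z: "z \<in> ball c (R/2)" for z
 proof -
 have sub: "ball z (R/2) \<subseteq> ball c R"
 proof
 fix w assume "w \<in> ball z (R/2)"
 then show "w \<in> ball c R" using z dist_triangle[of c w z] by simp
 qed
 have "cmod (cgrad u z) <= 4 * M / (R/2)"
 by (rule cgrad_bound[OF harm_subset[OF assms(1) sub]]) (use assms(2,3) sub in auto)
 then show ?thesis by simp
 qed
 have "norm (u x - u y) <= 8 * M / R * norm (x - y)"
 proof (rule differentiable_bound[of "ball c (R/2)" u "%z h. Re (cgrad u z * h)"])
 fix z assume z: "z \<in> ball c (R/2)"
 then have "z \<in> ball c R" using assms(2) by simp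
 then show "(u has_derivative (%h. Re (cgrad u z * h))) (at z within ball c (R/2))"
 by (rule has_derivative_at_withinI[OF harm_has_derivative[OF assms(1)]])
 show "onorm (%h. Re (cgrad u z * h)) <= 8 * M / R"
 proof (rule onorm_le)
 fix h
 have "\<bar>Re (cgrad u z * h)\<bar> <= cmod (cgrad u z) * cmod h"
 using abs_Re_le_cmod[of "cgrad u z * h"] by (simp add: norm_mult)
 also have "... <= 8 * M / R * cmod h" using g[OF z] by (rule mult_right_mono) simp
 finally show "norm (Re (cgrad u z * h)) <= 8 * M / R * norm h" by simp
 qed
 qed (use assms in auto)
 then show ?thesis by simp
qed

lemma directed_finite_bound:
 assumes "G ~= {}" "!!g1 g2. g1 \<in> G ==> g2 \<in> G ==> \<exists>g\<in>G. \<forall>x\<in>B. g1 x <= g x & g2 x <= (g x :: real)"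
 "finite I" "!!i. i \<in> I ==> h i \<in> G"
 shows "\<exists>g\<in>G. \<forall>i\<in>I. \<forall>x\<in>B. h i x <= g x"
 using assms(3,4)
proof (induction I)
 case empty
 then show ?case using assms(1) by auto
next
 case (insert j I)
 then obtain g where g: "g \<in> G" "\<forall>i\<in>I. \<forall>x\<in>B. h i x <= g x" by auto
 have "h j \<in> G" using insert.prems by simp
 obtain k where k: "k \<in> G" "\<forall>x\<in>B. g x <= k x & h j x <= k x"
 using assms(2)[OF g(1) \<open>h j \<in> G\<close>] by blast
 have "h i x <= k x" if "i \<in> insert j I" "x \<in> B" for i x
 using that g(2) k(2) order_trans[of "h i x" "g x" "k x"] by auto
 then show ?case using k(1) by blast
qed

text \<open>The family is uniformly Lipschitz near each point, so the supremum is continuous. On a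
  circle, compactness and directedness give a single member within eta of the supremum (a Dini
  argument), so the mean value identity passes to the supremum without extracting sequences.\<close>

lemma harm_directed_Sup:
 assumes "0 < R" "G ~= {}" "!!g. g \<in> G ==> harm (ball c R) g"
 "!!g x. g \<in> G ==> x \<in> ball c R ==> \<bar>g x\<bar> <= M"
 "!!g1 g2. g1 \<in> G ==> g2 \<in> G ==> \<exists>g\<in>G. \<forall>x\<in>ball c R. g1 x <= g x & g2 x <= g x"
 shows "harm (ball c R) (%x. SUP g\<in>G. g x)"
proof -
 let ?U = "%x. SUP g\<in>G. g x"
 let ?B = "ball c R"
 have bdd: "bdd_above ((%g. g x) ` G)" if "x \<in> ?B" for x
 using assms(4)[OF _ that] by (intro bdd_aboveI[of _ M]) (auto simp: abs_le_iff)
 have up: "g x <= ?U x" if "g \<in> G" "x \<in> ?B" for g x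
 using bdd[OF that(2)] that(1) by (rule cSUP_upper2) simp
 have Lip: "\<exists>L d. d > 0 & (\<forall>y\<in>ball x d. \<bar>?U y - ?U x\<bar> <= L * cmod (y - x))" if x: "x \<in> ?B" for x
 proof -
 define d where "d = R - dist c x"
 have d: "d > 0" using x by (simp add: d_def)
 have sub: "ball x d \<subseteq> ?B"
 proof
 fix w assume "w \<in> ball x d"
 then show "w \<in> ?B" using dist_triangle[of c w x] by (simp add: d_def)
 qed
 have l: "\<bar>g y - g y'\<bar> <= 8 * M / d * cmod (y - y')" if "g \<in> G" "y \<in> ball x (d/2)" "y' \<in> ball x (d/2)" for g y y'
 by (rule harm_lipschitz[OF harm_subset[OF assms(3)[OF that(1)] sub] d])
 (use that sub assms(4)[OF that(1)] in auto)
 have one: "?U y <= ?U y' + 8 * M / d * cmod (y - y')" if "y \<in> ball x (d/2)" "y' \<in> ball x (d/2)" for y y'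
 proof (rule cSUP_least[OF assms(2)])
 fix g assume g: "g \<in> G"
 have "y' \<in> ball x d" using that(2) d by simp
 then have "y' \<in> ?B" using sub by blast
 then show "g y <= ?U y' + 8 * M / d * cmod (y - y')"
 using l[OF g that] up[OF g, of y'] by linarith
 qed
 have "\<bar>?U y - ?U x\<bar> <= 8 * M / d * cmod (y - x)" if "y \<in> ball x (d/2)" for y
 using one[OF that, of x] one[OF _ that, of x] d by (simp add: norm_minus_commute abs_le_iff)
 then show ?thesis using d by (intro exI[of _ "8 * M / d"] exI[of _ "d/2"]) auto
 qed
 have "isCont ?U x" if x: "x \<in> ?B" for x
 proof -
 obtain L d where Ld: "d > 0" "!!y. y \<in> ball x d ==> \<bar>?U y - ?U x\<bar> <= L * cmod (y - x)"
 using Lip[OF x] by blast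
 have "((%y. ?U y - ?U x) \<longlongrightarrow> 0) (at x)"
 proof (rule Lim_null_comparison)
 have "eventually (%y. y \<in> ball x d) (at x)" using Ld(1) by (intro eventually_at_in_open') auto
 then show "eventually (%y. norm (?U y - ?U x) <= L * cmod (y - x)) (at x)"
 by eventually_elim (use Ld(2) in simp)
 show "((%y. L * cmod (y - x)) \<longlongrightarrow> 0) (at x)"
 by (rule tendsto_eq_intros refl)+ auto
 qed
 then show ?thesis unfolding isCont_def by (simp add: LIM_zero_iff)
 qed
 then have cU: "continuous_on ?B ?U" by (simp add: continuous_at_imp_continuous_on)
 have mean: "circ_mean ?U x r = ?U x" if x: "x \<in> ?B" and r: "0 < r" "r < R - dist c x" for x r
 proof -
 have sub: "ball x (R - dist c x) \<subseteq> ?B"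
 proof
 fix w assume "w \<in> ball x (R - dist c x)"
 then show "w \<in> ?B" using dist_triangle[of c w x] by simp
 qed
 have sph: "sphere x r \<subseteq> ?B" using sphere_subset_ball[OF r] sub by (rule order_trans)
 have cs: "continuous_on (sphere x r) ?U" using cU sph by (rule continuous_on_subset)
 have gm: "circ_mean g x r = g x" if "g \<in> G" for g
 by (rule harm_circ_mean[OF harm_subset[OF assms(3)[OF that] sub] r])
 have gc: "continuous_on ?B g" if "g \<in> G" for g
 using assms(3)[OF that] by (rule harm_continuous_on)
 have ge: "circ_mean g x r <= circ_mean ?U x r" if "g \<in> G" for g
 by (rule circ_mean_mono) (use cs gc[OF that] r sph up[OF that] in \<open>auto intro: continuous_on_subset\<close>)
 have 1: "?U x <= circ_mean ?U x r"
 by (rule cSUP_least[OF assms(2)]) (use ge gm in force)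
 have "circ_mean ?U x r <= ?U x + eta" if "eta > 0" for eta
 proof -
 have "\<exists>g\<in>G. g p > ?U p - eta" if "p \<in> sphere x r" for p
 using less_cSUP_iff[OF assms(2) bdd, of p "?U p - eta"] that sph \<open>eta > 0\<close> by auto
 then obtain h where h: "!!p. p \<in> sphere x r ==> h p \<in> G & h p p > ?U p - eta"
 by metis
 \<comment> \<open>The open set on which the member chosen for \<open>p\<close> stays within
   \<open>eta\<close> of the supremum. Finitely many of these sets cover the circle, and one member
   of the family dominates all the members chosen for them.\<close>
 define N where "N p = ?B \<inter> (%y. h p y - ?U y) -` {-eta<..}" for p
 have oN: "open (N p)" if "p \<in> sphere x r" for p
 unfolding N_def using h[OF that] gc cU
 by (intro continuous_open_preimage[OF _ open_ball open_greaterThan] continuous_on_diff) auto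
 have pN: "p \<in> N p" if "p \<in> sphere x r" for p
 using h[OF that] that sph by (auto simp: N_def)
 have "sphere x r \<subseteq> \<Union> (N ` sphere x r)" using pN by blast
 then obtain I where I: "I \<subseteq> sphere x r" "finite I" "sphere x r \<subseteq> \<Union> (N ` I)"
 using compactE_image[OF compact_sphere, of "sphere x r" N x r] oN by metis
 obtain k where k: "k \<in> G" "\<forall>i\<in>I. \<forall>y\<in>?B. h i y <= k y"
 using directed_finite_bound[OF assms(2,5) I(2), of h] h I(1) by blast
 have "?U w <= k w + eta" if w: "w \<in> sphere x r" for w
 proof -
 obtain i where "i \<in> I" "w \<in> N i" using I(3) w by blast
 then show ?thesis using k(2) by (force simp: N_def)
 qed
 then have "circ_mean ?U x r <= circ_mean (%w. k w + eta) x r"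
 using cs gc[OF k(1)] sph r by (intro circ_mean_mono) (auto intro!: continuous_intros intro: continuous_on_subset)
 also have "... = k x + eta"
 using circ_mean_add[of x r k "%_. eta"] gc[OF k(1)] sph r gm[OF k(1)]
 by (simp add: circ_mean_const continuous_on_subset)
 finally show ?thesis using up[OF k(1) x] by linarith
 qed
 then have "circ_mean ?U x r <= ?U x" by (rule field_le_epsilon)
 with 1 show ?thesis by simp
 qed
 show ?thesis
 proof (rule harm_if_mean[OF open_ball cU])
 show "subh ?B ?U" unfolding subh_def
 by (intro ballI exI[of _ "R - dist c x" for x]) (use mean in auto)
 show "subh ?B (%x. - ?U x)" unfolding subh_def circ_mean_minus
 by (intro ballI exI[of _ "R - dist c x" for x]) (use mean in auto)
 qed
qed

text \<open>Exterior disc condition in strict form: the closed disc meets the closure only at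
  \<open>p\<close>. Strictness is what makes the logarithmic barrier vanish at \<open>p\<close>
  alone.\<close>

definition touched :: "complex set => complex => bool" where
 "touched D p \<longleftrightarrow> (\<exists>c r. 0 < r & dist c p = r & (\<forall>z\<in>closure D - {p}. r < dist c z))"

definition regular_domain :: "complex set => bool" where
 "regular_domain D \<longleftrightarrow> open D & bounded D & (\<forall>p\<in>frontier D. touched D p)"

lemma barrier:
 assumes "touched D p" "p \<in> frontier D" "open D"
 shows "\<exists>b. continuous_on (closure D) b & harm D b & b p = 0 & (\<forall>z\<in>closure D. 0 <= b z) \<and>
 (\<forall>z\<in>closure D - {p}. 0 < b z)"
proof -
 obtain c r where cr: "0 < r" "dist c p = r" "!!z. z \<in> closure D - {p} ==> r < dist c z"
 using assms(1) unfolding touched_def by blast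
 have c: "c \<notin> closure D" using cr(1,2) cr(3)[of c] by (cases "c = p") auto
 define b where "b z = ln (cmod (z - c)) - ln r" for z
 have "continuous_on (closure D) b" unfolding b_def using c by (intro continuous_intros) auto
 moreover have "harm D b" unfolding b_def
 using c closure_subset by (intro harm_diff harm_ln_cmod harm_const) blast
 moreover have "b p = 0" using cr(2) by (simp add: b_def dist_norm norm_minus_commute)
 moreover have pos: "0 < b z" if "z \<in> closure D - {p}" for z
 proof -
 have "r < cmod (z - c)" using cr(3)[OF that] by (simp add: dist_norm norm_minus_commute)
 then have "ln r < ln (cmod (z - c))" using cr(1) by (intro ln_less_cancel_iff[THEN iffD2]) linarith+
 then show ?thesis by (simp add: b_def)
 qed
 moreover have "0 <= b z" if "z \<in> closure D" for z
 using pos[of z] that \<open>b p = 0\<close> by (cases "z = p") auto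
 ultimately show ?thesis by blast
qed

text \<open>Perron's method: \<open>F\<close> consists of the continuous subsolutions below the data
  and \<open>U\<close> is its upper envelope. Harmonicity comes from Poisson liftings, the boundary
  values from the barrier.\<close>

theorem dirichlet:
 assumes "regular_domain D" "continuous_on (frontier D) phi"
 shows "\<exists>u. continuous_on (closure D) u & harm D u & (\<forall>z\<in>frontier D. u z = phi z)"
proof -
 have D: "open D" "bounded D" "!!p. p \<in> frontier D ==> touched D p"
 using assms(1) by (auto simp: regular_domain_def)
 have compF: "compact (frontier D)" using D(2) by (rule compact_frontier_bounded)
 have "bounded (phi ` frontier D)"
 by (rule compact_imp_bounded[OF compact_continuous_image[OF assms(2) compF]])
 then obtain M where "\<forall>y\<in>phi ` frontier D. norm y <= M" "M > 0"
 unfolding bounded_pos by blast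
 then have M: "!!z. z \<in> frontier D ==> \<bar>phi z\<bar> <= M" "M > 0" by simp_all
 have FD: "frontier D \<subseteq> closure D" by (auto simp: frontier_def)
 have Dcl: "D \<subseteq> closure D" by (rule closure_subset)
 have cl_cases: "z \<in> D \<or> z \<in> frontier D" if "z \<in> closure D" for z
 using that unfolding frontier_def interior_open[OF D(1)] by blast
 define F where "F = {v. continuous_on (closure D) v & subh D v & (\<forall>z\<in>frontier D. v z <= phi z)}"
 define U where "U x = (SUP v\<in>F. v x)" for x
 have cD: "continuous_on D v" if "v \<in> F" for v
 proof -
 have "continuous_on (closure D) v" using that by (simp add: F_def)
 then show ?thesis using Dcl by (rule continuous_on_subset)
 qed
 have MF: "(%_. - M) \<in> F"
 proof -
 have "- M <= phi z" if "z \<in> frontier D" for z using M(1)[OF that] by linarith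
 then show ?thesis using subh_harm[OF D(1) harm_const] by (auto simp: F_def)
 qed
 have Fub: "v z <= M" if "v \<in> F" "z \<in> closure D" for v z
 proof (rule max_principle[OF D(1,2)])
 show "v y <= M" if "y \<in> frontier D" for y
 proof -
 have "v y <= phi y" using \<open>v \<in> F\<close> that by (simp add: F_def)
 then show ?thesis using M(1)[OF that] by linarith
 qed
 qed (use that in \<open>auto simp: F_def\<close>)
 have bddF: "bdd_above ((%v. v x) ` F)" if "x \<in> closure D" for x
 using Fub[OF _ that] by (intro bdd_aboveI[of _ M]) auto
 have Fmax: "(%z. max (v z) (w z)) \<in> F" if "v \<in> F" "w \<in> F" for v w
 using that subh_max[OF D(1) cD[OF that(1)] cD[OF that(2)]] by (auto simp: F_def intro!: continuous_on_max)
 have harmU: "harm D U"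
 proof (rule harm_local)
 fix c assume "c \<in> D"
 then obtain R where R: "0 < R" "cball c R \<subseteq> D" using D(1) open_contains_cball by blast
 have bD: "ball c R \<subseteq> D" using R by auto
 \<comment> \<open>Lifting max(v, -M) shows that every member of \<open>F\<close> is dominated by a
   member of \<open>G\<close>, so both families have the same supremum; in addition the members of
   \<open>G\<close> are harmonic and uniformly bounded in the ball, as
   \<open>harm_directed_Sup\<close> requires.\<close>
 define G where "G = {v \<in> F. harm (ball c R) v & (\<forall>x\<in>ball c R. - M <= v x)}"
 have ex: "\<exists>g\<in>G. \<forall>x\<in>closure D. v x <= g x" if v: "v \<in> F" for v
 proof -
 have m: "(%z. max (v z) (- M)) \<in> F" using Fmax[OF v MF] .
 obtain w where w: "continuous_on (closure D) w" "subh D w" "harm (ball c R) w"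
 "\<forall>x. x \<notin> ball c R --> w x = max (v x) (- M)" "\<forall>x\<in>closure D. max (v x) (- M) <= w x"
 using poisson_modification[of D "%z. max (v z) (- M)" R c] m D(1) R unfolding F_def by blast
 have "w z <= phi z" if "z \<in> frontier D" for z
 proof -
 have "z \<notin> D" using that unfolding frontier_def interior_open[OF D(1)] by simp
 then have "w z = max (v z) (- M)" using w(4) bD by blast
 then show ?thesis using m that by (simp add: F_def)
 qed
 then have "w \<in> F" using w by (simp add: F_def)
 moreover have "v x <= w x & - M <= w x" if "x \<in> closure D" for x using w(5) that by fastforce
 ultimately show ?thesis using w(3) bD Dcl by (intro bexI[of _ w]) (auto simp: G_def)
 qed
 have "G ~= {}" using ex[OF MF] by blast
 have GF: "g \<in> F" if "g \<in> G" for g using that by (simp add: G_def)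
 have "harm (ball c R) (%x. SUP g\<in>G. g x)"
 proof (rule harm_directed_Sup[OF R(1) \<open>G ~= {}\<close>])
 show "\<bar>g x\<bar> <= M" if "g \<in> G" "x \<in> ball c R" for g x
 using Fub[OF GF[OF that(1)], of x] that bD Dcl by (force simp: G_def abs_le_iff)
 show "\<exists>g\<in>G. \<forall>x\<in>ball c R. g1 x <= g x & g2 x <= g x" if g12: "g1 \<in> G" "g2 \<in> G" for g1 g2
 proof -
 obtain g where g: "g \<in> G" "\<forall>x\<in>closure D. max (g1 x) (g2 x) <= g x"
 using ex[OF Fmax[OF GF[OF g12(1)] GF[OF g12(2)]]] by blast
 then show ?thesis using bD Dcl by (intro bexI[OF _ g(1)]) fastforce
 qed
 qed (simp add: G_def)
 moreover have "(SUP g\<in>G. g x) = U x" if "x \<in> ball c R" for x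
 proof -
 have x: "x \<in> closure D" using that bD Dcl by blast
 have bddG: "bdd_above ((%v. v x) ` G)" by (rule bdd_above_mono[OF bddF[OF x]]) (use GF in blast)
 have "(SUP g\<in>G. g x) <= U x" unfolding U_def
 by (rule cSUP_subset_mono[OF \<open>G ~= {}\<close> bddF[OF x]]) (use GF in auto)
 moreover have "U x <= (SUP g\<in>G. g x)" unfolding U_def
 proof (rule cSUP_least)
 show "F ~= {}" using MF by blast
 fix v assume "v \<in> F"
 then obtain g where g: "g \<in> G" "\<forall>x\<in>closure D. v x <= g x" using ex by blast
 then show "v x <= (SUP g\<in>G. g x)" using x by (intro cSUP_upper2[OF bddG g(1)]) blast
 qed
 ultimately show ?thesis by simp
 qed
 ultimately have "harm (ball c R) U" by (rule harm_cong[OF _ open_ball])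
 then show "\<exists>T. open T & c \<in> T & harm T U" using R(1) by (intro exI[of _ "ball c R"]) auto
 qed
 define u where "u z = (if z \<in> D then U z else phi z)" for z
 have uharm: "harm D u" by (rule harm_cong[OF harmU D(1)]) (simp add: u_def)
 have ufr: "u z = phi z" if "z \<in> frontier D" for z
 using that unfolding u_def frontier_def interior_open[OF D(1)] by simp
 have "continuous (at p within closure D) u" if p: "p \<in> closure D" for p
 proof (cases "p \<in> D")
 case True
 then have "isCont u p" using harm_continuous_on[OF uharm] continuous_on_eq_continuous_at[OF D(1)] by blast
 then show ?thesis by (rule continuous_at_imp_continuous_at_within)
 next
 case False
 then have pF: "p \<in> frontier D" using cl_cases[OF p] by blast
 obtain b where b: "continuous_on (closure D) b" "harm D b" "b p = 0"
 "!!z. z \<in> closure D ==> 0 <= b z" "!!z. z \<in> closure D - {p} ==> 0 < b z"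
 using barrier[OF D(3)[OF pF] pF D(1)] by blast
 show ?thesis unfolding continuous_within_eps_delta
 proof (intro allI impI)
 fix eta' :: real assume "eta' > 0"
 define eta where "eta = eta' / 3"
 have eta: "eta > 0" using \<open>eta' > 0\<close> by (simp add: eta_def)
 obtain d where d: "d > 0" "!!z. z \<in> frontier D ==> dist z p < d ==> \<bar>phi z - phi p\<bar> < eta"
 using assms(2) pF eta unfolding continuous_on_iff by (metis dist_real_def)
 \<comment> \<open>Close to \<open>p\<close> the continuity of \<open>phi\<close> suffices. At
   distance at least \<open>d\<close> the barrier has a positive minimum \<open>b q\<close>, and the
   multiple 2M/(b q) of it exceeds any oscillation of \<open>phi\<close>.\<close>
 have "\<exists>K\<ge>0. \<forall>z\<in>frontier D. \<bar>phi z - phi p\<bar> <= eta + K * b z"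
 proof (cases "frontier D - ball p d = {}")
 case True
 then have "\<bar>phi z - phi p\<bar> <= eta + 0 * b z" if "z \<in> frontier D" for z
 using d(2)[OF that] that by (auto simp: dist_commute)
 then show ?thesis by (intro exI[of _ 0]) auto
 next
 case False
 have "compact (frontier D - ball p d)" using compF by (simp add: compact_diff)
 moreover have "continuous_on (frontier D - ball p d) b" using b(1) FD by (auto intro: continuous_on_subset)
 ultimately obtain q where q: "q \<in> frontier D - ball p d" "!!z. z \<in> frontier D - ball p d ==> b q <= b z"
 using continuous_attains_inf[OF _ False] by blast
 have bq: "b q > 0" using q(1) FD d(1) by (intro b(5)) auto
 have "\<bar>phi z - phi p\<bar> <= eta + (2 * M / b q) * b z" if z: "z \<in> frontier D" for z
 proof (cases "z \<in> ball p d")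
 case True
 then have "\<bar>phi z - phi p\<bar> < eta" using d(2)[OF z] by (simp add: dist_commute)
 moreover have "0 <= (2 * M / b q) * b z" using M(2) bq b(4) z FD by auto
 ultimately show ?thesis by linarith
 next
 case False
 then have "b q <= b z" using q(2) z by blast
 then have "2 * M <= (2 * M / b q) * b z" using M(2) bq by (simp add: field_simps)
 then show ?thesis using M(1)[OF z] M(1)[OF pF] eta by linarith
 qed
 then show ?thesis using M(2) bq by (intro exI[of _ "2 * M / b q"]) auto
 qed
 then obtain K where K: "K >= 0" "!!z. z \<in> frontier D ==> \<bar>phi z - phi p\<bar> <= eta + K * b z" by blast
 \<comment> \<open>The lower bound holds because phi p - eta - K b is itself a member of
   \<open>F\<close>; for the upper one, phi p + eta + K b majorises every member by
   comparison.\<close>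
 have low: "phi p - eta - K * b z <= U z" if "z \<in> closure D" for z
 unfolding U_def
 proof (rule cSUP_upper2[OF bddF[OF that]])
 have "phi p - eta - K * b y <= phi y" if "y \<in> frontier D" for y using K(2)[OF that] by linarith
 then show "(%z. phi p - eta - K * b z) \<in> F"
 using subh_harm[OF D(1) harm_diff[OF harm_const[of D "phi p - eta"] harm_cmult[OF b(2), of K]]] b(1)
 by (auto simp: F_def intro!: continuous_intros)
 qed simp
 have upp: "U z <= phi p + eta + K * b z" if z: "z \<in> closure D" for z
 unfolding U_def
 proof (rule cSUP_least)
 show "F ~= {}" using MF by blast
 fix v assume v: "v \<in> F"
 show "v z <= phi p + eta + K * b z"
 proof (rule subh_le_harm[OF D(1,2) _ _ _ _ _ z])
 show "v y <= phi p + eta + K * b y" if "y \<in> frontier D" for y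
 proof -
 have "v y <= phi y" using v that by (simp add: F_def)
 then show ?thesis using K(2)[OF that] by linarith
 qed
 show "harm D (%z. phi p + eta + K * b z)" by (intro harm_add harm_const harm_cmult b(2))
 qed (use v b(1) in \<open>auto simp: F_def intro!: continuous_intros\<close>)
 qed
 have "continuous_on (closure D) (%z. K * b z)" using b(1) by (intro continuous_intros)
 then obtain e where e: "e > 0" "!!z. z \<in> closure D ==> dist z p < e ==> \<bar>K * b z - K * b p\<bar> < eta"
 using p eta unfolding continuous_on_iff by (metis dist_real_def)
 have "\<bar>u z - u p\<bar> < eta'" if z: "z \<in> closure D" "dist z p < e" for z
 proof -
 have "K * b z < eta" using e(2)[OF z] b(3) by auto
 moreover have "\<bar>u z - phi p\<bar> <= eta + K * b z"
 using low[OF z(1)] upp[OF z(1)] K(2)[of z] cl_cases[OF z(1)] ufr[of z]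
 by (cases "z \<in> D") (auto simp: u_def)
 ultimately show ?thesis using ufr[OF pF] eta by (simp add: eta_def)
 qed
 then show "\<exists>d>0. \<forall>x'\<in>closure D. dist x' p < d --> dist (u x') (u p) < eta'"
 using e(1) by (intro exI[of _ e]) (auto simp: dist_real_def)
 qed
 qed
 then have "continuous_on (closure D) u" unfolding continuous_on_eq_continuous_within by blast
 then show ?thesis using uharm ufr by blast
qed


section \<open>Functions harmonic in each of two variables\<close>

lemma continuous_on_pair_compose:
 assumes "continuous_on (A \<times> B) (%(x, y). f x y)" "continuous_on U g" "continuous_on U h"
 "!!u. u \<in> U ==> g u \<in> A" "!!u. u \<in> U ==> h u \<in> B"
 shows "continuous_on U (%u. f (g u) (h u))"
 using continuous_on_compose2[OF assms(1) continuous_on_Pair[OF assms(2,3)]] assms(4,5) by auto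

lemma continuous_on_circ_mean_param:
 fixes f :: "'a::topological_space => complex => real"
 assumes "continuous_on (U \<times> sphere y r) (%(x, y). f x y)" "0 <= r"
 shows "continuous_on U (%x. circ_mean (f x) y r)"
proof -
 have "continuous_on (U \<times> cbox 0 1) (%(x, t). f x (circlepath y r t))"
 unfolding split_beta
 by (intro continuous_on_pair_compose[OF assms(1)] continuous_intros
 continuous_on_compose2[OF continuous_on_circlepath[of UNIV y r]] circlepath_in_sphere assms(2)) auto
 from integral_continuous_on_param[OF this] show ?thesis by (simp add: circ_mean_def)
qed

text \<open>Fubini moves the circle mean inside the integral, which gives the mean value property,
  and \<open>harm_if_mean\<close> turns it back into harmonicity. No differentiation under the
  integral sign occurs.\<close>

lemma harm_param_integral:
 fixes f :: "complex => complex => real" and gam :: "real => complex"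
 assumes "open T" "continuous_on (S \<times> T) (%(x, y). f x y)" "!!x. x \<in> S ==> harm T (f x)"
 "continuous_on {0..1} gam" "gam ` {0..1} \<subseteq> S" "continuous_on {0..1} kap"
 shows "harm T (%y. integral {0..1} (%t. f (gam t) y * kap t))"
proof -
 let ?F = "%y. integral {0..1} (%t. f (gam t) y * kap t)"
 have joint: "continuous_on (T \<times> {0..1}) (%(y, t). f (gam t) y * kap t)"
 proof -
 have 1: "continuous_on (T \<times> {0..1}) (%p. f (gam (snd p)) (fst p))"
 by (intro continuous_on_pair_compose[OF assms(2)] continuous_intros continuous_on_compose2[OF assms(4)])
 (use assms(5) in auto)
 have 2: "continuous_on (T \<times> {0..1}) (%p. kap (snd p))"
 by (intro continuous_on_compose2[OF assms(6)] continuous_intros) auto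
 show ?thesis unfolding split_beta by (rule continuous_on_mult[OF 1 2])
 qed
 have cF: "continuous_on T ?F"
 using integral_continuous_on_param[of T 0 1 "%y t. f (gam t) y * kap t"] joint by simp
 have mean: "circ_mean ?F y r = ?F y" if r: "0 < r" "r < R" and R: "ball y R \<subseteq> T" for y r R
 proof -
 have sph: "circlepath y r s \<in> T" for s
 using circlepath_in_sphere[of r y s] r R by auto
 have c2: "continuous_on (cbox (0, 0) (1, 1)) (%(s, t). f (gam t) (circlepath y r s) * kap t)"
 unfolding split_beta
 by (intro continuous_on_pair_compose[OF joint] continuous_intros
 continuous_on_compose2[OF continuous_on_circlepath[of UNIV y r]] sph) (auto simp: cbox_Pair_eq)
 have "circ_mean ?F y r = integral (cbox 0 1) (%s. integral (cbox 0 1) (%t. f (gam t) (circlepath y r s) * kap t))"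
 by (simp add: circ_mean_def)
 also have "... = integral (cbox 0 1) (%t. integral (cbox 0 1) (%s. f (gam t) (circlepath y r s) * kap t))"
 by (rule integral_swap_continuous[OF c2])
 also have "... = integral {0..1} (%t. circ_mean (f (gam t)) y r * kap t)"
 by (simp add: circ_mean_def)
 also have "... = ?F y"
 proof (rule integral_cong)
 fix t :: real assume "t \<in> {0..1}"
 then have "harm (ball y R) (f (gam t))" using assms(5) by (intro harm_subset[OF assms(3) R]) auto
 then show "circ_mean (f (gam t)) y r * kap t = f (gam t) y * kap t" using harm_circ_mean[OF _ r] by simp
 qed
 finally show ?thesis .
 qed
 have ex: "\<exists>R>0. ball y R \<subseteq> T" if "y \<in> T" for y using assms(1) that openE by blast
 show ?thesis
 proof (rule harm_if_mean[OF assms(1) cF])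
 show "subh T ?F" unfolding subh_def
 proof
 fix y assume "y \<in> T"
 then obtain R where "R > 0" "ball y R \<subseteq> T" using ex by blast
 then show "\<exists>r0>0. \<forall>r. 0 < r & r < r0 --> ?F y <= circ_mean ?F y r"
 using mean[of _ R y] by (intro exI[of _ R]) auto
 qed
 show "subh T (%y. - ?F y)" unfolding subh_def circ_mean_minus
 proof
 fix y assume "y \<in> T"
 then obtain R where "R > 0" "ball y R \<subseteq> T" using ex by blast
 then show "\<exists>r0>0. \<forall>r. 0 < r & r < r0 --> - ?F y <= - circ_mean ?F y r"
 using mean[of _ R y] by (intro exI[of _ R]) auto
 qed
 qed
qed

text \<open>Joint continuity is part of the notion, because circle integrals in one variable must
  depend continuously on the other and be interchangeable with means in it.\<close>

definition biharm :: "complex set => complex set => (complex => complex => real) => bool" where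
 "biharm S T f \<longleftrightarrow> open S & open T & continuous_on (S \<times> T) (%(x, y). f x y) \<and>
 (\<forall>y\<in>T. harm S (%x. f x y)) & (\<forall>x\<in>S. harm T (f x))"

lemma biharm_subset:
 "biharm S T f ==> open S' ==> open T' ==> S' \<subseteq> S ==> T' \<subseteq> T ==> biharm S' T' f"
 unfolding biharm_def
 by (meson Sigma_mono continuous_on_subset harm_subset subsetD)

lemma biharm_swap:
 assumes "biharm S T f"
 shows "biharm T S (%x y. f y x)"
proof -
 have c: "continuous_on (S \<times> T) (%(x, y). f x y)" using assms by (simp add: biharm_def)
 have "continuous_on (T \<times> S) (%(x, y). f y x)"
 unfolding split_beta by (intro continuous_on_pair_compose[OF c] continuous_intros) auto
 then show ?thesis using assms by (simp add: biharm_def)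
qed

lemma biharm_lin:
 assumes "biharm S T f" "biharm S T g"
 shows "biharm S T (%x y. a * f x y + b * g x y)"
 using assms unfolding biharm_def split_beta
 by (auto intro!: continuous_intros harm_add harm_cmult)

definition dx :: "(complex => complex => real) => complex => complex => complex" where
 "dx f x y = cgrad (%x. f x y) x"

definition dy :: "(complex => complex => real) => complex => complex => complex" where
 "dy f x y = cgrad (f x) y"

lemma circlepath_shift: "circlepath x r t = x + (circlepath 0 r t)"
 by (simp add: circlepath)

lemma dx_circle_integral:
 assumes "!!y. y \<in> T ==> harm S (%x. f x y)" "cball x r \<subseteq> S" "open S" "0 < r" "y \<in> T"
 shows "((%t. of_real (2 * f (x + circlepath 0 r t) y) * inverse (circlepath 0 r t)) has_integral dx f x y) {0..1}"
proof -
 \<comment> \<open>The gradient formula asks for an open ball strictly larger than the closed disc.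
   If \<open>e\<close> separates the disc from the complement of \<open>S\<close>, the radius r + e
   works: a point of that ball outside \<open>S\<close>, pulled back radially by the factor r/(r +
   e), would give a point of the disc at distance less than \<open>e\<close>.\<close>
 obtain R where R: "r < R" "ball x R \<subseteq> S"
 proof -
 have "\<exists>e>0. \<forall>a\<in>cball x r. \<forall>b\<in>- S. e <= dist a b"
 using separate_compact_closed[of "cball x r" "- S"] assms(2,3) by (auto simp: closed_Compl)
 then obtain e where e: "e > 0" "!!a b. a \<in> cball x r ==> b \<notin> S ==> e <= dist a b" by blast
 have "w \<in> S" if w: "w \<in> ball x (r + e)" for w
 proof (rule ccontr)
 assume wS: "w \<notin> S"
 define a where "a = x + of_real (r / (r + e)) * (w - x)"
 have "cmod (w - x) < r + e" using w by (simp add: dist_norm norm_minus_commute)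
 then have "r * cmod (w - x) <= r * (r + e)" using assms(4) by (intro mult_left_mono) auto
 then have "r / (r + e) * cmod (w - x) <= r" using assms(4) e(1) by (simp add: field_simps)
 moreover have "cmod (a - x) = r / (r + e) * cmod (w - x)"
 proof -
 have "a - x = of_real (r / (r + e)) * (w - x)" by (simp add: a_def)
 then have "cmod (a - x) = \<bar>r / (r + e)\<bar> * cmod (w - x)" by (simp only: norm_mult norm_of_real)
 then show ?thesis using assms(4) e(1) by simp
 qed
 ultimately have "a \<in> cball x r" by (simp add: dist_norm norm_minus_commute)
 then have "e <= dist a w" using e(2) wS by blast
 have "a - w = - (of_real (1 - r / (r + e)) * (w - x))" by (simp add: a_def algebra_simps)
 then have "cmod (a - w) = \<bar>1 - r / (r + e)\<bar> * cmod (w - x)" by (simp only: norm_minus_cancel norm_mult norm_of_real)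
 also have "... = e / (r + e) * cmod (w - x)" using assms(4) e(1) by (simp add: field_simps)
 also have "... < e"
 proof -
 have "e * cmod (w - x) < e * (r + e)" using \<open>cmod (w - x) < r + e\<close> e(1) by (intro mult_strict_left_mono) auto
 then show ?thesis using assms(4) e(1) by (simp add: field_simps)
 qed
 finally show False using \<open>e <= dist a w\<close> by (simp add: dist_norm)
 qed
 then have "ball x (r + e) \<subseteq> S" by blast
 then show thesis using that[of "r + e"] e(1) by simp
 qed
 have "harm (ball x R) (%x. f x y)" using assms(1)[OF assms(5)] R(2) by (rule harm_subset)
 from cgrad_circle_integral[OF this assms(4) R(1)] show ?thesis
 unfolding dx_def circlepath_shift[of x] by simp
qed

text \<open>The gradient in x is an integral of \<open>f\<close> over a circle around x of locally
  fixed radius. This yields joint continuity and harmonicity in y; harmonicity in x is that of the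
  parts of a holomorphic function. The class is thus closed under differentiation, which supplies
  all higher derivatives.\<close>

lemma biharm_dx:
 assumes "biharm S T f"
 shows "biharm S T (%x y. Re (dx f x y))" "biharm S T (%x y. Im (dx f x y))"
proof -
 have S: "open S" "open T" and fc: "continuous_on (S \<times> T) (%(x, y). f x y)"
 and hx: "!!y. y \<in> T ==> harm S (%x. f x y)" and hy: "!!x. x \<in> S ==> harm T (f x)"
 using assms by (auto simp: biharm_def)
 have hol: "(%x. dx f x y) holomorphic_on S" if "y \<in> T" for y
 unfolding dx_def by (rule harm_cgrad_holomorphic[OF hx[OF that]])
 have ne: "circlepath 0 r t ~= 0" if "0 < r" for r t
 using cmod_circlepath[of 0 r t] that by auto
 have ker: "continuous_on A (%t. inverse (circlepath 0 r t))" if "0 < r" for r A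
 using ne[OF that] by (intro continuous_on_inverse continuous_on_circlepath) auto
 have cont: "continuous_on (S \<times> T) (%p. dx f (fst p) (snd p))"
 proof (rule continuous_at_imp_continuous_on, rule ballI)
 fix p assume "p \<in> S \<times> T"
 then have p: "fst p \<in> S" "snd p \<in> T" by auto
 obtain r where r: "r > 0" "cball (fst p) (2 * r) \<subseteq> S"
 proof -
 obtain e where "e > 0" "cball (fst p) e \<subseteq> S" using S(1) p(1) open_contains_cball by blast
 then show thesis using that[of "e / 2"] by simp
 qed
 define V where "V = ball (fst p) r \<times> T"
 have sub: "x + circlepath 0 r t \<in> S" if "x \<in> ball (fst p) r" for x t
 proof -
 have "dist (fst p) (x + circlepath 0 r t) <= dist (fst p) x + dist x (x + circlepath 0 r t)" by (rule dist_triangle)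
 also have "dist x (x + circlepath 0 r t) = r" using cmod_circlepath[of 0 r t] r(1) by (simp add: dist_norm)
 finally show ?thesis using that r(2) by auto
 qed
 have 1: "continuous_on (V \<times> cbox 0 1) (%q. f (fst (fst q) + circlepath 0 r (snd q)) (snd (fst q)))"
 by (intro continuous_on_pair_compose[OF fc] continuous_intros sub
 continuous_on_compose2[OF continuous_on_circlepath[of UNIV 0 r]]) (auto simp: V_def)
 have 2: "continuous_on (V \<times> cbox 0 1) (%q. inverse (circlepath 0 r (snd q)))"
 by (intro continuous_on_compose2[OF ker[OF r(1), of UNIV]] continuous_intros) auto
 have "continuous_on (V \<times> cbox 0 1) (%(v, t). of_real (2 * f (fst v + circlepath 0 r t) (snd v)) * inverse (circlepath 0 r t))"
 unfolding split_beta by (intro continuous_on_mult continuous_on_of_real 1 2 continuous_on_const)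
 from integral_continuous_on_param[OF this]
 have "continuous_on V (%v. integral (cbox 0 1) (%t. of_real (2 * f (fst v + circlepath 0 r t) (snd v)) * inverse (circlepath 0 r t)))" .
 moreover have "integral (cbox 0 1) (%t. of_real (2 * f (fst v + circlepath 0 r t) (snd v)) * inverse (circlepath 0 r t)) = dx f (fst v) (snd v)"
 if v: "v \<in> V" for v
 proof -
 have "cball (fst v) r \<subseteq> S"
 proof
 fix w assume "w \<in> cball (fst v) r"
 then show "w \<in> S" using v r dist_triangle[of "fst p" w "fst v"] by (auto simp: V_def)
 qed
 moreover have "snd v \<in> T" using v by (auto simp: V_def)
 ultimately show ?thesis
 using dx_circle_integral[where f = f and S = S and T = T and x = "fst v" and y = "snd v" and r = r] hx S(1) r(1)
 by (simp add: integral_unique)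
 qed
 ultimately have "continuous_on V (%v. dx f (fst v) (snd v))" by (simp cong: continuous_on_cong)
 moreover have "open V" "p \<in> V" using S(2) p r(1) by (auto simp: V_def open_Times mem_Times_iff)
 ultimately show "isCont (%p. dx f (fst p) (snd p)) p" using continuous_on_eq_continuous_at by blast
 qed
 have harmy: "harm T (%y. Re (dx f x y)) & harm T (%y. Im (dx f x y))" if x: "x \<in> S" for x
 proof -
 obtain r where r: "r > 0" "cball x r \<subseteq> S" using S(1) x open_contains_cball by blast
 let ?gam = "%t. x + circlepath 0 r t"
 have gam: "continuous_on {0..1} ?gam" by (intro continuous_intros continuous_on_circlepath)
 have "?gam t \<in> cball x r" for t using cmod_circlepath[of 0 r t] r(1) by (simp add: dist_norm)
 then have sub: "?gam ` {0..1} \<subseteq> S" using r(2) by blast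
 have "((%t. f (?gam t) y * (2 * Re (inverse (circlepath 0 r t)))) has_integral Re (dx f x y)) {0..1}" if "y \<in> T" for y
 using has_integral_Re[OF dx_circle_integral[OF hx r(2) S(1) r(1) that]] by (simp add: mult_ac)
 then have eR: "integral {0..1} (%t. f (?gam t) y * (2 * Re (inverse (circlepath 0 r t)))) = Re (dx f x y)" if "y \<in> T" for y
 using that by (blast intro: integral_unique)
 have "((%t. f (?gam t) y * (2 * Im (inverse (circlepath 0 r t)))) has_integral Im (dx f x y)) {0..1}" if "y \<in> T" for y
 using has_integral_Im[OF dx_circle_integral[OF hx r(2) S(1) r(1) that]] by (simp add: mult_ac)
 then have eI: "integral {0..1} (%t. f (?gam t) y * (2 * Im (inverse (circlepath 0 r t)))) = Im (dx f x y)" if "y \<in> T" for y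
 using that by (blast intro: integral_unique)
 have "continuous_on {0..1} (%t. 2 * Re (inverse (circlepath 0 r t)))"
 by (intro continuous_intros ker r(1))
 from harm_param_integral[OF S(2) fc hy gam sub this]
 have "harm T (%y. integral {0..1} (%t. f (?gam t) y * (2 * Re (inverse (circlepath 0 r t)))))" .
 from harm_cong[OF this S(2) eR] have 1: "harm T (%y. Re (dx f x y))" .
 have "continuous_on {0..1} (%t. 2 * Im (inverse (circlepath 0 r t)))"
 by (intro continuous_intros ker r(1))
 from harm_param_integral[OF S(2) fc hy gam sub this]
 have "harm T (%y. integral {0..1} (%t. f (?gam t) y * (2 * Im (inverse (circlepath 0 r t)))))" .
 from harm_cong[OF this S(2) eI] 1 show ?thesis by blast
 qed
 show "biharm S T (%x y. Re (dx f x y))"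
 unfolding biharm_def split_beta
 using S harmy harm_Re[OF hol S(1)] continuous_on_Re[OF cont] by blast
 show "biharm S T (%x y. Im (dx f x y))"
 unfolding biharm_def split_beta
 using S harmy harm_Im[OF hol S(1)] continuous_on_Im[OF cont] by blast
qed

lemma biharm_dy:
 assumes "biharm S T f"
 shows "biharm S T (%x y. Re (dy f x y))" "biharm S T (%x y. Im (dy f x y))"
 using biharm_swap[OF biharm_dx(1)[OF biharm_swap[OF assms]]] biharm_swap[OF biharm_dx(2)[OF biharm_swap[OF assms]]]
 by (simp_all add: dx_def dy_def)

lemma biharm_continuous:
 assumes "biharm S T f"
 shows "continuous_on (S \<times> T) (%p. f (fst p) (snd p))"
 using assms by (simp add: biharm_def split_beta)

text \<open>One partial derivative together with a continuous second one gives the total derivative.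
  \<open>B\<close> only packages the second partial as a bounded linear map, so that its continuity
  can be stated.\<close>

lemma biharm_has_derivative:
 assumes "biharm S T f" "x \<in> S" "y \<in> T"
 shows "((%p. f (fst p) (snd p)) has_derivative (%h. Re (dx f x y * fst h) + Re (dy f x y * snd h))) (at (x, y))"
proof -
 have S: "open S" "open T" and hx: "!!y. y \<in> T ==> harm S (%x. f x y)" and hy: "!!x. x \<in> S ==> harm T (f x)"
 using assms by (auto simp: biharm_def)
 obtain e where e: "e > 0" "ball y e \<subseteq> T" using S(2) assms(3) openE by blast
 define B where "B c = Blinfun (%k. Re (c * k))" for c :: complex
 have blc: "bounded_linear (%k. Re (c * k))" for c :: complex
 by (intro bounded_linear_compose[OF bounded_linear_Re] bounded_linear_mult_right)
 have B: "blinfun_apply (B c) = (%k. Re (c * k))" for c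
 unfolding B_def by (rule bounded_linear_Blinfun_apply[OF blc])
 have "bounded_linear B"
 proof (rule bounded_linear_intro[of _ 1])
 show "norm (B c) <= norm c * 1" for c
 by (rule norm_blinfun_bound) (use abs_Re_le_cmod in \<open>force simp: B simp flip: norm_mult simp del: times_complex.sel\<close>)+
 qed (auto intro!: blinfun_eqI simp: B algebra_simps scaleR_blinfun.rep_eq plus_blinfun.rep_eq)
 have "continuous_on (S \<times> T) (%p. Complex (Re (dy f (fst p) (snd p))) (Im (dy f (fst p) (snd p))))"
 unfolding Complex_eq
 by (intro continuous_intros biharm_continuous biharm_dy[OF assms(1)])
 then have "continuous_on (S \<times> T) (%p. dy f (fst p) (snd p))" by simp
 then have "continuous_on (S \<times> T) (%p. B (dy f (fst p) (snd p)))"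
 by (rule bounded_linear.continuous_on[OF \<open>bounded_linear B\<close>])
 then have cB: "continuous_on (S \<times> ball y e) (%p. B (dy f (fst p) (snd p)))"
 by (rule continuous_on_subset) (use e in auto)
 have "((%(x, y). f x y) has_derivative (%(tx, ty). Re (dx f x y * tx) + blinfun_apply (B (dy f x y)) ty)) (at (x, y) within S \<times> ball y e)"
 proof (rule has_derivative_partialsI)
 show "((%x. f x y) has_derivative (%tx. Re (dx f x y * tx))) (at x within S)"
 unfolding dx_def by (rule has_derivative_at_withinI[OF harm_has_derivative[OF hx[OF assms(3)] assms(2)]])
 show "((%y. f x' y) has_derivative blinfun_apply (B (dy f x' y'))) (at y' within ball y e)"
 if "x' \<in> S" "y' \<in> ball y e" for x' y'
 unfolding B dy_def by (rule has_derivative_at_withinI[OF harm_has_derivative[OF hy]]) (use that e in auto)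
 show "continuous (at (x, y) within S \<times> ball y e) (%(x, y). B (dy f x y))"
 using cB assms(2) e(1) unfolding continuous_on_eq_continuous_within split_beta by auto
 qed (use e in auto)
 moreover have "at (x, y) within S \<times> ball y e = at (x, y)"
 by (rule at_within_open) (use S(1) assms(2) e in \<open>auto intro: open_Times\<close>)
 ultimately show ?thesis unfolding split_beta B by (simp only:)
qed


section \<open>The regular part of the Green function\<close>

text \<open>The factor 1/(2 pi) of \<open>fund\<close> is dropped, so this is 2 pi times the regular
  part. The chosen function is determined on the closure only.\<close>

definition hreg :: "complex set => complex => complex => real" where
 "hreg D x y = (SOME u. continuous_on (closure D) u & harm D u \<and>
 (\<forall>z\<in>frontier D. u z = - ln (cmod (z - y)))) x"

lemma abs_ln_diff_le:
 fixes a b r :: real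
 assumes "0 < r" "r <= a" "r <= b"
 shows "\<bar>ln a - ln b\<bar> <= \<bar>a - b\<bar> / r"
proof -
 have *: "ln s - ln t <= \<bar>s - t\<bar> / r" if "r <= s" "r <= t" for s t
 proof -
 have st: "0 < s" "0 < t" using that assms(1) by auto
 have "ln s - ln t <= (s - t) / t" by (rule ln_diff_le[OF st])
 also have "... <= \<bar>s - t\<bar> / r"
 by (rule frac_le) (use that assms(1) in auto)
 finally show ?thesis .
 qed
 show ?thesis using *[OF assms(2,3)] *[OF assms(3,2)] by (simp add: abs_le_iff abs_minus_commute)
qed

locale reg_domain =
 fixes D :: "complex set"
 assumes reg: "regular_domain D"
begin

lemma D_open: "open D" and D_bounded: "bounded D"
 using reg by (auto simp: regular_domain_def)

lemma D_sub_closure: "D \<subseteq> closure D"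
 by (rule closure_subset)

lemma closure_cases: "z \<in> closure D ==> z \<in> D \<or> z \<in> frontier D"
 unfolding frontier_def interior_open[OF D_open] by blast

lemma frontier_not_D: "z \<in> frontier D ==> z \<notin> D" "z \<in> frontier D ==> z \<in> closure D"
 unfolding frontier_def interior_open[OF D_open] by auto

lemma hreg_props:
 assumes "y \<in> D"
 shows "continuous_on (closure D) (%x. hreg D x y)" "harm D (%x. hreg D x y)"
 "!!z. z \<in> frontier D ==> hreg D z y = - ln (cmod (z - y))"
proof -
 have "continuous_on (frontier D) (%z. - ln (cmod (z - y)))"
 using frontier_not_D assms by (intro continuous_intros) auto
 from someI_ex[OF dirichlet[OF reg this]]
 have "continuous_on (closure D) (%x. hreg D x y) & harm D (%x. hreg D x y) \<and>
 (\<forall>z\<in>frontier D. hreg D z y = - ln (cmod (z - y)))"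
 unfolding hreg_def[abs_def] by simp
 then show "continuous_on (closure D) (%x. hreg D x y)" "harm D (%x. hreg D x y)"
 "!!z. z \<in> frontier D ==> hreg D z y = - ln (cmod (z - y))" by auto
qed

lemma harm_eq_on_closure:
 assumes "continuous_on (closure D) u" "harm D u" "continuous_on (closure D) v" "harm D v"
 "!!z. z \<in> frontier D ==> u z = v z" "x \<in> closure D"
 shows "u x = v x"
 using harm_max_principle[OF D_open D_bounded continuous_on_diff[OF assms(1,3)] harm_diff[OF assms(2,4)] _ assms(6), of 0]
 assms(5) by auto

lemma hreg_pole_diff:
 assumes "y \<in> D" "y' \<in> D" "!!z. z \<in> frontier D ==> \<bar>ln (cmod (z - y)) - ln (cmod (z - y'))\<bar> <= M" "x \<in> closure D"
 shows "\<bar>hreg D x y - hreg D x y'\<bar> <= M"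
proof (rule harm_max_principle[OF D_open D_bounded, where v = "%x. hreg D x y - hreg D x y'"])
 show "continuous_on (closure D) (%x. hreg D x y - hreg D x y')"
 by (intro continuous_on_diff hreg_props assms)
 show "harm D (%x. hreg D x y - hreg D x y')" by (intro harm_diff hreg_props assms)
 show "\<bar>hreg D z y - hreg D z y'\<bar> <= M" if "z \<in> frontier D" for z
 using assms(3)[OF that] hreg_props(3)[OF assms(1) that] hreg_props(3)[OF assms(2) that] by linarith
qed (rule assms(4))

text \<open>Moving the pole changes the boundary values uniformly little, and the maximum principle
  carries this to all x at once; what remains is continuity in x for one fixed pole.\<close>

lemma hreg_jointly_continuous: "continuous_on (closure D \<times> D) (%(x, y). hreg D x y)"
 unfolding split_beta continuous_on_iff
proof (intro ballI allI impI)
 fix p and eta :: real assume p: "p \<in> closure D \<times> D" and "eta > 0"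
 obtain x0 y0 where xy: "p = (x0, y0)" "x0 \<in> closure D" "y0 \<in> D" using p by auto
 obtain r where r: "r > 0" "ball y0 r \<subseteq> D" using D_open xy(3) openE by blast
 obtain d where d: "d > 0" "!!x. x \<in> closure D ==> dist x x0 < d ==> \<bar>hreg D x y0 - hreg D x0 y0\<bar> < eta / 2"
 using hreg_props(1)[OF xy(3)] xy(2) \<open>eta > 0\<close> unfolding continuous_on_iff
 by (metis dist_real_def half_gt_zero)
 define e where "e = min d (min (r / 2) (eta * r / 8))"
 have e: "e > 0" using d(1) r(1) \<open>eta > 0\<close> by (simp add: e_def)
 have bound: "\<bar>hreg D x y - hreg D x0 y0\<bar> < eta" if xyD: "x \<in> closure D" "y \<in> D" and ds: "dist x x0 < e" "dist y y0 < e" for x y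
 proof -
 have "\<bar>hreg D x y - hreg D x y0\<bar> <= eta / 4"
 proof (rule hreg_pole_diff[OF xyD(2) xy(3) _ xyD(1)])
 fix z assume "z \<in> frontier D"
 then have "z \<notin> ball y0 r" using frontier_not_D r(2) by blast
 then have zr: "r <= cmod (z - y0)" by (simp add: dist_norm norm_minus_commute)
 have yy: "cmod (y - y0) < r / 2" "cmod (y - y0) < eta * r / 8" using ds(2) by (simp_all add: e_def dist_norm)
 have tri: "\<bar>cmod (z - y) - cmod (z - y0)\<bar> <= cmod (y - y0)"
 using norm_triangle_ineq3[of "z - y" "z - y0"] by (simp add: norm_minus_commute)
 have "\<bar>ln (cmod (z - y)) - ln (cmod (z - y0))\<bar> <= \<bar>cmod (z - y) - cmod (z - y0)\<bar> / (r / 2)"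
 by (rule abs_ln_diff_le) (use zr tri yy r(1) in linarith)+
 also have "... <= (eta * r / 8) / (r / 2)"
 using tri yy r(1) by (intro divide_right_mono) linarith+
 also have "... = eta / 4" using r(1) by (simp add: field_simps)
 finally show "\<bar>ln (cmod (z - y)) - ln (cmod (z - y0))\<bar> <= eta / 4" .
 qed
 moreover have "\<bar>hreg D x y0 - hreg D x0 y0\<bar> < eta / 2" using d(2)[OF xyD(1)] ds(1) by (simp add: e_def)
 ultimately show ?thesis using \<open>eta > 0\<close> by linarith
 qed
 have "dist (hreg D (fst q) (snd q)) (hreg D (fst p) (snd p)) < eta"
 if q: "q \<in> closure D \<times> D" "dist q p < e" for q
 proof -
 have "dist (fst q) x0 < e" "dist (snd q) y0 < e"
 using dist_fst_le[of q p] dist_snd_le[of q p] q(2) xy(1) by auto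
 moreover have "fst q \<in> closure D" "snd q \<in> D" using q(1) by auto
 ultimately show ?thesis using bound xy(1) by (simp add: dist_real_def)
 qed
 then show "\<exists>d>0. \<forall>q\<in>closure D \<times> D. dist q p < d -->
 dist (hreg D (fst q) (snd q)) (hreg D (fst p) (snd p)) < eta"
 using e by blast
qed

text \<open>The circle mean over the pole is harmonic in x, and its boundary values are means of -ln
  |z - y|, which is harmonic in y because z lies outside \<open>D\<close>. Uniqueness identifies it
  with the value at the centre. This has to precede the symmetry, whose proof relies on it.\<close>

lemma hreg_harm_snd:
 assumes "x \<in> D"
 shows "harm D (%y. hreg D x y)"
proof -
 have cDD: "continuous_on (D \<times> D) (%(x, y). hreg D x y)"
 using hreg_jointly_continuous by (rule continuous_on_subset) (use D_sub_closure in auto)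
 have mean: "circ_mean (%y. hreg D x y) y r = hreg D x y"
 if R: "ball y R \<subseteq> D" and r: "0 < r" "r < R" for y r R
 proof -
 have yD: "y \<in> D" using R r by auto
 have cyl: "circlepath y r t \<in> D" for t using circlepath_in_sphere[of r y t] r R by auto
 have sph: "sphere y r \<subseteq> D" using sphere_subset_ball[OF r] R by (rule order_trans)
 define A where "A x = circ_mean (%y. hreg D x y) y r" for x
 have cA: "continuous_on (closure D) A" unfolding A_def
 proof (rule continuous_on_circ_mean_param)
 show "continuous_on (closure D \<times> sphere y r) (%(x, y). hreg D x y)"
 using hreg_jointly_continuous by (rule continuous_on_subset) (use sph in auto)
 qed (use r in auto)
 have sw: "continuous_on (D \<times> D) (%(y, x). hreg D x y)"
 unfolding split_beta by (intro continuous_on_pair_compose[OF cDD] continuous_intros) auto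
 have "harm D (%x. integral {0..1} (%t. hreg D x (circlepath y r t) * 1))"
 by (rule harm_param_integral[where f = "%y x. hreg D x y" and S = D and gam = "circlepath y r" and kap = "%_. 1"])
 (use D_open sw hreg_props cyl in \<open>auto intro: continuous_on_circlepath\<close>)
 then have hA: "harm D A" unfolding A_def circ_mean_def by simp
 have "A x = hreg D x y"
 proof (rule harm_eq_on_closure[OF cA hA hreg_props(1,2)[OF yD]])
 fix z assume z: "z \<in> frontier D"
 then have zD: "z \<notin> D" using frontier_not_D by blast
 have "A z = circ_mean (%y. - ln (cmod (y - z))) y r" unfolding A_def
 using sph r hreg_props(3)[OF _ z] by (intro circ_mean_cong) (auto simp: norm_minus_commute)
 also have "... = - ln (cmod (y - z))"
 by (rule harm_circ_mean[OF harm_minus[OF harm_ln_cmod] r]) (use R zD in blast)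
 finally show "A z = hreg D z y" using hreg_props(3)[OF yD z] by (simp add: norm_minus_commute)
 qed (use assms D_sub_closure in blast)
 then show ?thesis by (simp add: A_def)
 qed
 have cont: "continuous_on D (%y. hreg D x y)"
 by (intro continuous_on_pair_compose[OF cDD] continuous_intros) (use assms in auto)
 have ex: "\<exists>R>0. ball y R \<subseteq> D" if "y \<in> D" for y using D_open that openE by blast
 show ?thesis
 proof (rule harm_if_mean[OF D_open cont])
 show "subh D (hreg D x)" unfolding subh_def
 proof
 fix y assume "y \<in> D"
 then obtain R where "R > 0" "ball y R \<subseteq> D" using ex by blast
 then show "\<exists>r0>0. \<forall>r. 0 < r & r < r0 --> hreg D x y <= circ_mean (hreg D x) y r"
 using mean[of y R] by (intro exI[of _ R]) auto
 qed
 show "subh D (%y. - hreg D x y)" unfolding subh_def circ_mean_minus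
 proof
 fix y assume "y \<in> D"
 then obtain R where "R > 0" "ball y R \<subseteq> D" using ex by blast
 then show "\<exists>r0>0. \<forall>r. 0 < r & r < r0 --> - hreg D x y <= - circ_mean (hreg D x) y r"
 using mean[of y R] by (intro exI[of _ R]) auto
 qed
 qed
qed

text \<open>A closed disc around the pole is removed, so small that -ln rho exceeds the bound
  \<open>B\<close> of the regular part; on what remains the comparison principle applies.\<close>

lemma green_nonneg:
 assumes "y \<in> D" "x \<in> closure D" "x ~= y"
 shows "hreg D x y <= - ln (cmod (x - y))"
proof -
 have "compact (closure D)" using D_bounded by (simp add: compact_closure)
 then have "bounded ((%x. hreg D x y) ` closure D)"
 by (rule compact_imp_bounded[OF compact_continuous_image[OF hreg_props(1)[OF assms(1)]]])
 then obtain B where "\<forall>v\<in>(%x. hreg D x y) ` closure D. norm v <= B" unfolding bounded_iff by blast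
 then have B: "!!x. x \<in> closure D ==> \<bar>hreg D x y\<bar> <= B" by simp
 obtain r where r: "r > 0" "cball y r \<subseteq> D" using D_open assms(1) open_contains_cball by blast
 define rho where "rho = min (min r (exp (- B))) (cmod (x - y) / 2)"
 have rho: "rho > 0" using r(1) assms(3) by (simp add: rho_def)
 have "rho <= cmod (x - y) / 2" by (simp add: rho_def)
 moreover have "cmod (x - y) > 0" using assms(3) by simp
 ultimately have rl: "rho < cmod (x - y)" by linarith
 have lnr: "B <= - ln rho"
 proof -
 have "rho <= exp (- B)" by (simp add: rho_def)
 then have "ln rho <= ln (exp (- B))" using rho by (intro ln_le_cancel_iff[THEN iffD2]) auto
 then show ?thesis by simp
 qed
 define E where "E = D - cball y rho"
 have oE: "open E" unfolding E_def using D_open by (intro open_Diff) auto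
 have bE: "bounded E" using D_bounded unfolding E_def by (rule bounded_subset) auto
 have clE: "closure E \<subseteq> closure D" unfolding E_def by (rule closure_mono) auto
 have "E \<subseteq> - ball y rho" unfolding E_def by auto
 then have clE2: "closure E \<subseteq> - ball y rho" by (rule closure_minimal) auto
 have xE: "x \<in> closure E"
 proof -
 have "x \<in> (- cball y rho) \<inter> closure D" using assms(2) rl by (simp add: dist_norm norm_minus_commute)
 also have "... \<subseteq> closure (- cball y rho \<inter> D)" by (rule open_Int_closure_subset) auto
 finally show ?thesis unfolding E_def by (simp add: Diff_eq Int_commute)
 qed
 show ?thesis
 proof (rule subh_le_harm[OF oE bE, where v = "%x. - ln (cmod (x - y))"])
 show "continuous_on (closure E) (%x. hreg D x y)"
 using hreg_props(1)[OF assms(1)] clE by (rule continuous_on_subset)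
 show "subh E (%x. hreg D x y)"
 by (rule subh_harm[OF oE harm_subset[OF hreg_props(2)[OF assms(1)]]]) (simp add: E_def)
 show "continuous_on (closure E) (%x. - ln (cmod (x - y)))"
 using clE2 rho by (intro continuous_intros) auto
 show "harm E (%x. - ln (cmod (x - y)))"
 by (intro harm_minus harm_ln_cmod) (use rho in \<open>auto simp: E_def\<close>)
 fix z assume z: "z \<in> frontier E"
 then have zc: "z \<in> closure E" and zE: "z \<notin> E" unfolding frontier_def interior_open[OF oE] by auto
 have zD: "z \<in> closure D" using zc clE by blast
 show "hreg D z y <= - ln (cmod (z - y))"
 proof (cases "z \<in> frontier D")
 case True
 then show ?thesis using hreg_props(3)[OF assms(1)] by simp
 next
 case False
 then have "z \<in> D" using closure_cases[OF zD] by blast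
 then have "z \<in> cball y rho" using zE by (simp add: E_def)
 moreover have "z \<notin> ball y rho" using zc clE2 by blast
 ultimately have "cmod (z - y) = rho" by (simp add: dist_norm norm_minus_commute)
 then show ?thesis using lnr B[OF zD] by simp
 qed
 qed (rule xE)
qed

end

text \<open>Green's function of the exterior of the disc of radius \<open>r\<close> around the origin is nonnegative;
 \<open>(r / cmod y)\<^sup>2 * y\<close> is the point inverse to \<open>y\<close>.\<close>
lemma green_exterior_disc:
 fixes y z :: complex
 assumes "0 < r" "r <= cmod y" "r <= cmod z"
 shows "r * cmod (z - y) <= cmod y * cmod (z - of_real ((r / cmod y)\<^sup>2) * y)"
proof (rule power2_le_imp_le)
 obtain a b where y: "y = Complex a b" by (cases y)
 obtain p q where z: "z = Complex p q" by (cases z)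
 define Y where "Y = a\<^sup>2 + b\<^sup>2"
 define Z where "Z = p\<^sup>2 + q\<^sup>2"
 have Y: "(cmod y)\<^sup>2 = Y" and Z: "(cmod z)\<^sup>2 = Z" unfolding y z Y_def Z_def by (simp_all add: cmod_power2)
 have "cmod y > 0" using assms(1,2) by linarith
 then have Y0: "Y > 0" unfolding Y[symmetric] by simp
 have le: "r\<^sup>2 <= Y" "r\<^sup>2 <= Z" unfolding Y[symmetric] Z[symmetric] using assms by (auto intro!: power_mono)
 define s where "s = r\<^sup>2 / Y"
 have s: "s * Y = r\<^sup>2" using Y0 by (simp add: s_def)
 have sq: "(r / cmod y)\<^sup>2 = s" by (simp add: s_def power_divide Y)
 have "(cmod (z - of_real s * y))\<^sup>2 = Z - 2 * s * (p * a + q * b) + s * (s * Y)"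
 unfolding y z Z_def Y_def by (simp add: cmod_power2) (simp add: power2_eq_square algebra_simps)
 then have "Y * (cmod (z - of_real s * y))\<^sup>2 = Y * (Z - 2 * s * (p * a + q * b) + s * (s * Y))" by (simp only:)
 then have "Y * (cmod (z - of_real s * y))\<^sup>2 = Y * Z - 2 * (s * Y) * (p * a + q * b) + (s * Y) * (s * Y)"
 by (simp add: algebra_simps)
 then have 1: "Y * (cmod (z - of_real s * y))\<^sup>2 = Y * Z - 2 * r\<^sup>2 * (p * a + q * b) + r\<^sup>2 * r\<^sup>2" unfolding s .
 have 2: "(cmod (z - y))\<^sup>2 = Z - 2 * (p * a + q * b) + Y"
 unfolding y z Z_def Y_def by (simp add: cmod_power2) (simp add: power2_eq_square algebra_simps)
 \<comment> \<open>After squaring and multiplying out, the difference of the two sides is exactly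
   this product.\<close>
 have "0 <= (Z - r\<^sup>2) * (Y - r\<^sup>2)" using le by simp
 then show "(r * cmod (z - y))\<^sup>2 <= (cmod y * cmod (z - of_real ((r / cmod y)\<^sup>2) * y))\<^sup>2"
 unfolding sq power_mult_distrib Y 1 2 by (simp add: algebra_simps)
qed simp

section \<open>Boundary behaviour in the pole and symmetry of the regular part\<close>

context reg_domain
begin

text \<open>A squeeze. One bound is the positivity of the Green function. For the other,
  \<open>D\<close> lies outside the touching disc, whose explicit Green function with image point
  \<open>y'\<close> is a majorant. As y tends to p so does \<open>y'\<close>, and the extra term ln
  (|y - c|/r) tends to 0.\<close>

lemma hreg_boundary_limit:
 assumes "x \<in> D" "p \<in> frontier D"
 shows "((%y. hreg D x y) \<longlongrightarrow> - ln (cmod (x - p))) (at p within D)"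
proof -
 obtain c r where cr: "0 < r" "dist c p = r" "!!z. z \<in> closure D - {p} ==> r < dist c z"
 using reg assms(2) unfolding regular_domain_def touched_def by blast
 have le: "r <= cmod (z - c)" if "z \<in> closure D" for z
 using cr(2) cr(3)[of z] that by (cases "z = p") (auto simp: dist_norm norm_minus_commute)
 have xp: "x ~= p" using assms frontier_not_D by blast
 define y' where "y' y = c + of_real ((r / cmod (y - c))\<^sup>2) * (y - c)" for y
 have pc: "cmod (p - c) = r" using cr(2) by (simp add: dist_norm norm_minus_commute)
 have low: "- ln (cmod (x - y' y)) - ln (cmod (y - c) / r) <= hreg D x y" if y: "y \<in> D" for y
 proof -
 have yc: "r < cmod (y - c)"
 using cr(3)[of y] y D_sub_closure frontier_not_D(1)[OF assms(2)] by (auto simp: dist_norm norm_minus_commute)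
 have "cmod (y' y - c) = (r / cmod (y - c))\<^sup>2 * cmod (y - c)"
 unfolding y'_def add_diff_cancel_left' norm_mult norm_of_real by simp
 also have "... = r * (r / cmod (y - c))" using yc cr(1) by (simp add: power2_eq_square field_simps)
 also have "r / cmod (y - c) < 1" using yc cr(1) by (subst divide_less_eq_1_pos) linarith+
 then have "r * (r / cmod (y - c)) < r * 1" using cr(1) by (intro mult_strict_left_mono) auto
 finally have y'c: "y' y \<notin> closure D" using le[of "y' y"] by auto
 have "- hreg D x y <= ln (cmod (x - y' y)) + ln (cmod (y - c) / r)"
 proof (rule subh_le_harm[OF D_open D_bounded, where v = "%x. ln (cmod (x - y' y)) + ln (cmod (y - c) / r)"])
 show "continuous_on (closure D) (%x. - hreg D x y)" by (intro continuous_on_minus hreg_props y)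
 show "subh D (%x. - hreg D x y)" by (intro subh_harm harm_minus hreg_props D_open y)
 show "continuous_on (closure D) (%x. ln (cmod (x - y' y)) + ln (cmod (y - c) / r))"
 using y'c by (intro continuous_intros) auto
 show "harm D (%x. ln (cmod (x - y' y)) + ln (cmod (y - c) / r))"
 by (intro harm_add harm_const harm_ln_cmod) (use y'c D_sub_closure in auto)
 fix z assume z: "z \<in> frontier D"
 then have zc: "z \<in> closure D" "z ~= y" using frontier_not_D y by blast+
 have "r * cmod (z - y) <= cmod (y - c) * cmod (z - y' y)"
 using green_exterior_disc[OF cr(1), of "y - c" "z - c"] yc le[OF zc(1)] by (simp add: y'_def algebra_simps)
 then have "cmod (z - y) <= cmod (z - y' y) * (cmod (y - c) / r)"
 using cr(1) by (simp add: field_simps)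
 moreover have "cmod (z - y) > 0" "cmod (z - y' y) > 0" using zc y'c by auto
 moreover have "cmod (y - c) / r > 0" using yc cr(1) by (intro divide_pos_pos) linarith+
 ultimately have "ln (cmod (z - y)) <= ln (cmod (z - y' y) * (cmod (y - c) / r))"
 by (intro ln_le_cancel_iff[THEN iffD2] mult_pos_pos)
 also have "... = ln (cmod (z - y' y)) + ln (cmod (y - c) / r)"
 using \<open>cmod (z - y' y) > 0\<close> \<open>cmod (y - c) / r > 0\<close> by (rule ln_mult_pos)
 finally show "- hreg D z y <= ln (cmod (z - y' y)) + ln (cmod (y - c) / r)"
 using hreg_props(3)[OF y z] by simp
 qed (use assms(1) D_sub_closure in blast)
 then show ?thesis by linarith
 qed
 have y'p: "y' p = p" using cr(1) by (simp add: y'_def pc)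
 have c1: "isCont (%y. - ln (cmod (x - y' y)) - ln (cmod (y - c) / r)) p"
 unfolding y'_def using cr(1) pc xp y'p by (intro continuous_intros) (auto simp: y'_def)
 have "((%y. - ln (cmod (x - y' y)) - ln (cmod (y - c) / r)) \<longlongrightarrow> - ln (cmod (x - p))) (at p within D)"
 using continuous_at_imp_continuous_at_within[OF c1, of D] cr(1) pc by (simp add: continuous_within y'p)
 moreover have c2: "isCont (%y. - ln (cmod (x - y))) p"
 using xp by (intro continuous_intros) auto
 have "((%y. - ln (cmod (x - y))) \<longlongrightarrow> - ln (cmod (x - p))) (at p within D)"
 using continuous_at_imp_continuous_at_within[OF c2, of D] by (simp add: continuous_within)
 moreover have "eventually (%y. - ln (cmod (x - y' y)) - ln (cmod (y - c) / r) <= hreg D x y) (at p within D)"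
 using low by (auto simp: eventually_at_filter)
 moreover have "eventually (%y. hreg D x y <= - ln (cmod (x - y))) (at p within D)"
 proof -
 have "eventually (%y. y \<in> ball p (cmod (x - p))) (at p within D)"
 using xp unfolding eventually_at by (intro exI[of _ "cmod (x - p)"]) (auto simp: dist_commute)
 moreover have "eventually (%y. y \<in> D) (at p within D)" by (simp add: eventually_at_filter)
 ultimately show ?thesis
 proof eventually_elim
 case (elim y)
 then have "x ~= y" by (auto simp: dist_norm norm_minus_commute)
 then show ?case using green_nonneg[of y x] elim assms(1) D_sub_closure by blast
 qed
 qed
 ultimately show ?thesis by (intro tendsto_sandwich[of _ "%y. hreg D x y"])
qed

text \<open>As a function of the pole, the regular part is harmonic and, by the boundary limit,
  extends continuously with values -ln |x - y| on the frontier. These are also the boundary data of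
  the function with the roles exchanged, so uniqueness applies.\<close>

theorem hreg_sym:
 assumes "x \<in> D" "y \<in> D"
 shows "hreg D x y = hreg D y x"
proof -
 define k where "k y = (if y \<in> D then hreg D x y else - ln (cmod (x - y)))" for y
 have kh: "harm D k" by (rule harm_cong[OF hreg_harm_snd[OF assms(1)] D_open]) (simp add: k_def)
 have "continuous (at p within closure D) k" if p: "p \<in> closure D" for p
 proof (cases "p \<in> D")
 case True
 then have "isCont k p" using harm_continuous_on[OF kh] continuous_on_eq_continuous_at[OF D_open] by blast
 then show ?thesis by (rule continuous_at_imp_continuous_at_within)
 next
 case False
 then have pF: "p \<in> frontier D" using closure_cases[OF p] by blast
 have "x ~= p" using False assms(1) by blast
 then have c2: "isCont (%y. - ln (cmod (x - y))) p" by (intro continuous_intros) auto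
 have "(hreg D x \<longlongrightarrow> k p) (at p within D)"
 using hreg_boundary_limit[OF assms(1) pF] False by (simp add: k_def)
 moreover have "eventually (%y. hreg D x y = k y) (at p within D)"
 by (auto simp: k_def eventually_at_filter)
 ultimately have t1: "(k \<longlongrightarrow> k p) (at p within D)" by (rule Lim_transform_eventually)
 have "((%y. - ln (cmod (x - y))) \<longlongrightarrow> k p) (at p within frontier D)"
 using continuous_at_imp_continuous_at_within[OF c2, of "frontier D"] False by (simp add: continuous_within k_def)
 moreover have "eventually (%y. - ln (cmod (x - y)) = k y) (at p within frontier D)"
 using frontier_not_D by (auto simp: k_def eventually_at_filter)
 ultimately have t2: "(k \<longlongrightarrow> k p) (at p within frontier D)" by (rule Lim_transform_eventually)
 have "closure D = D \<union> frontier D" using closure_cases D_sub_closure frontier_not_D by blast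
 then show ?thesis using t1 t2 by (simp add: continuous_within Lim_Un)
 qed
 then have kc: "continuous_on (closure D) k" unfolding continuous_on_eq_continuous_within by blast
 have "k y = hreg D y x"
 by (rule harm_eq_on_closure[OF kc kh hreg_props(1,2)[OF assms(1)]])
 (use hreg_props(3)[OF assms(1)] frontier_not_D assms(2) D_sub_closure in \<open>auto simp: k_def norm_minus_commute\<close>)
 then show ?thesis using assms(2) by (simp add: k_def)
qed

lemma hreg_biharm: "biharm D D (hreg D)"
 unfolding biharm_def using D_open hreg_props(2) hreg_harm_snd
 continuous_on_subset[OF hreg_jointly_continuous] D_sub_closure by (simp add: Sigma_mono)

end


section \<open>Transfer between the complex plane and \<open>real^2\<close>\<close>

definition em :: "pt => complex => pt" where
 "em P z = P + Re z *\<^sub>R axis 1 1 + Im z *\<^sub>R axis 2 1"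

definition pm :: "pt => pt => complex" where
 "pm P x = Complex ((x - P) $ 1) ((x - P) $ 2)"

lemma axis_2_component: "axis (1::2) (1::real) $ 1 = 1" "axis (1::2) (1::real) $ 2 = 0"
 "axis (2::2) (1::real) $ 1 = 0" "axis (2::2) (1::real) $ 2 = 1"
 by (simp_all add: axis_def)

lemma em_nth: "em P z $ 1 = P $ 1 + Re z" "em P z $ 2 = P $ 2 + Im z"
 by (simp_all add: em_def axis_2_component)

lemma pm_em [simp]: "pm P (em P z) = z"
 by (simp add: pm_def em_nth complex_eq_iff)

lemma em_pm [simp]: "em P (pm P x) = x"
 by (simp add: vec_eq_iff forall_2 em_nth) (simp add: pm_def)

lemma em_inj [simp]: "em P z = em P w \<longleftrightarrow> z = w"
 by (metis pm_em)

lemma norm_real2: "norm (x :: pt) = sqrt ((x $ 1)\<^sup>2 + (x $ 2)\<^sup>2)"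
 by (simp add: norm_vec_def L2_set_def sum_2)

lemma dist_em [simp]: "dist (em P z) (em P w) = cmod (z - w)"
 by (simp add: dist_norm norm_real2 em_nth complex_norm[symmetric]) (simp add: cmod_def)

lemma em_0 [simp]: "em P 0 = P" by (simp add: em_def)

lemma em_add_1: "em P (z + of_real t) = em P z + t *\<^sub>R axis 1 1"
 by (simp add: vec_eq_iff forall_2 em_nth axis_2_component)

lemma em_add_i: "em P (z + of_real t * \<i>) = em P z + t *\<^sub>R axis 2 1"
 by (simp add: vec_eq_iff forall_2 em_nth axis_2_component)

lemma continuous_on_em: "continuous_on A (em P)"
 unfolding em_def by (intro continuous_intros)

lemma continuous_on_pm: "continuous_on A (pm P)"
 unfolding pm_def Complex_eq by (intro continuous_intros)

lemma em_vimage_open: "open S ==> open (em P -` S)"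
 by (simp add: open_vimage continuous_on_em)

lemma em_vimage_closure: "closure (em P -` S) = em P -` closure S"
proof -
 have "z \<in> closure (em P -` S) \<longleftrightarrow> em P z \<in> closure S" for z
 unfolding closure_approachable
 by (auto simp: Bex_def) (metis dist_em dist_norm em_pm)+
 then show ?thesis by auto
qed

lemma em_vimage_frontier: "frontier (em P -` S) = em P -` frontier S"
 unfolding frontier_closures vimage_Compl[symmetric] em_vimage_closure by auto

lemma em_vimage_bounded:
 assumes "bounded S"
 shows "bounded (em P -` S)"
proof -
 obtain B where B: "!!x. x \<in> S ==> dist P x <= B" using assms bounded_any_center[of S P] by blast
 have "cmod z <= B" if "z \<in> em P -` S" for z
 proof -
 have "em P z \<in> S" using that by simp
 from B[OF this] show ?thesis using dist_em[of P 0 z] by simp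
 qed
 then show ?thesis unfolding bounded_iff by blast
qed

lemma em_vimage_cball: "em P -` (cball P r) = cball 0 r" "em P -` (ball P r) = ball 0 r"
 using dist_em[of P 0] by auto

definition has_dir_deriv :: "(complex => real) => complex => complex => real => bool" where
 "has_dir_deriv f v z d \<longleftrightarrow> ((%t. f (z + of_real t * v)) has_real_derivative d) (at 0)"

lemma has_dir_deriv_shift:
 assumes "has_dir_deriv f v (z + of_real s * v) d"
 shows "((%t. f (z + of_real t * v)) has_real_derivative d) (at s)"
 using assms DERIV_shift[of "%t. f (z + of_real t * v)" d 0 s] unfolding has_dir_deriv_def
 by (simp add: algebra_simps)

lemma has_dir_deriv_harm:
 assumes "harm S u" "z \<in> S"
 shows "has_dir_deriv u v z (Re (cgrad u z * v))"
proof -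
 have "((%t. z + of_real t * v) has_derivative (%t. of_real t * v)) (at 0)"
 by (auto intro!: derivative_eq_intros)
 from has_derivative_compose[OF this, of u "%h. Re (cgrad u z * h)"] harm_has_derivative[OF assms]
 have "((%t. u (z + of_real t * v)) has_derivative (%t. Re (cgrad u z * (of_real t * v)))) (at 0)" by simp
 moreover have "(%t. Re (cgrad u z * (of_real t * v))) = (%t. Re (cgrad u z * v) * t)"
 by (auto simp: algebra_simps)
 ultimately show ?thesis unfolding has_dir_deriv_def has_field_derivative_def by simp
qed

lemma partial_em:
 "(%t. f (em P z + t *\<^sub>R axis 1 1)) = (%t. (f \<circ> em P) (z + of_real t * 1))"
 "(%t. f (em P z + t *\<^sub>R axis 2 1)) = (%t. (f \<circ> em P) (z + of_real t * \<i>))"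
 by (simp_all add: em_add_1 em_add_i)

definition cdir :: "2 => complex" where "cdir i = (if i = 1 then 1 else \<i>)"

lemma partial_em_cdir:
 "(%t. f (em P z + t *\<^sub>R axis i 1)) = (%t. (f \<circ> em P) (z + of_real t * cdir i))"
 using exhaust_2[of i] partial_em[of f P z] by (auto simp: cdir_def)

lemma partial_em_harm:
 assumes "harm S (f \<circ> em P)" "z \<in> S"
 shows "partial i f (em P z) = Re (cgrad (f \<circ> em P) z * cdir i)"
 unfolding partial_def partial_em_cdir
 using has_dir_deriv_harm[OF assms, of "cdir i"] unfolding has_dir_deriv_def by (rule DERIV_imp_deriv)

lemma C_inf_has_dir_deriv:
 assumes "C_inf_on U g" "z \<in> em P -` U"
 shows "has_dir_deriv (iter_partial is g \<circ> em P) (cdir i) z (iter_partial (i # is) g (em P z))"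
proof -
 have "(%t. iter_partial is g (em P z + t *\<^sub>R axis i 1)) differentiable (at 0)"
 using assms by (auto simp: C_inf_on_def)
 then have "((%t. iter_partial is g (em P z + t *\<^sub>R axis i 1)) has_real_derivative
 deriv (%t. iter_partial is g (em P z + t *\<^sub>R axis i 1)) 0) (at 0)"
 by (metis DERIV_deriv_iff_real_differentiable)
 then show ?thesis unfolding partial_em_cdir has_dir_deriv_def by (simp add: partial_def partial_em_cdir)
qed

lemma harm_iter_partial:
 assumes "open S" "harm (em P -` S) (f \<circ> em P)"
 shows "harm (em P -` S) (iter_partial is f \<circ> em P)"
proof (induction "is")
 case Nil
 then show ?case using assms(2) by (simp add: o_def)
next
 case (Cons i "is")
 have "(%z. cgrad (iter_partial is f \<circ> em P) z * cdir i) holomorphic_on (em P -` S)"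
 by (intro holomorphic_intros harm_cgrad_holomorphic Cons)
 from harm_Re[OF this em_vimage_open[OF assms(1)]] show ?case
 by (rule harm_cong[OF _ em_vimage_open[OF assms(1)]]) (simp add: partial_em_harm[OF Cons])
qed

text \<open>Each partial derivative is the real part of \<open>cgrad\<close> times 1 or i, hence
  again the real part of a holomorphic function. So all iterates exist, and with G the complex
  gradient the Laplacian is Re (G' (1 + i^2)) = 0.\<close>

lemma harm_imp_harmonic_on:
 assumes "open S" "harm (em P -` S) (f \<circ> em P)"
 shows "harmonic_on S f"
proof -
 let ?D = "em P -` S"
 have oD: "open ?D" by (rule em_vimage_open[OF assms(1)])
 note h = harm_iter_partial[OF assms]
 have "C_inf_on S f" unfolding C_inf_on_def
 proof (intro allI conjI ballI)
 fix "is"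
 have "continuous_on S (%x. (iter_partial is f \<circ> em P) (pm P x))"
 by (rule continuous_on_compose2[OF harm_continuous_on[OF h] continuous_on_pm]) auto
 then show "continuous_on S (iter_partial is f)" by simp
 fix i x assume "x \<in> S"
 then have "pm P x \<in> ?D" by simp
 from has_dir_deriv_harm[OF h this, of "is" "cdir i"]
 show "(%t. iter_partial is f (x + t *\<^sub>R axis i 1)) differentiable (at 0)"
 using partial_em_cdir[of "iter_partial is f" P "pm P x" i]
 unfolding has_dir_deriv_def real_differentiable_def by auto
 qed
 moreover have "partial 1 (partial 1 f) x + partial 2 (partial 2 f) x = 0" if "x \<in> S" for x
 proof -
 define z where "z = pm P x"
 have z: "z \<in> ?D" "x = em P z" using that by (simp_all add: z_def)
 have hol: "cgrad (f \<circ> em P) holomorphic_on ?D" by (rule harm_cgrad_holomorphic[OF assms(2)])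
 have "partial i (partial i f) x = Re (deriv (cgrad (f \<circ> em P)) z * cdir i * cdir i)" for i
 proof -
 have "partial i (partial i f) x = Re (cgrad (partial i f \<circ> em P) z * cdir i)"
 unfolding z(2) using partial_em_harm[OF h[of "[i]"] z(1)] by simp
 also have "cgrad (partial i f \<circ> em P) z = cgrad (%z. Re (cgrad (f \<circ> em P) z * cdir i)) z"
 by (rule cgrad_cong[OF oD z(1)]) (simp add: partial_em_harm[OF assms(2)])
 also have "... = deriv (cgrad (f \<circ> em P)) z * cdir i"
 by (rule cgrad_eqI[OF has_derivative_Re_holomorphic])
 (use holomorphic_derivI[OF hol oD z(1)] in \<open>auto intro!: derivative_eq_intros\<close>)
 finally show ?thesis .
 qed
 then show ?thesis by (simp add: cdir_def)
 qed
 ultimately show ?thesis unfolding harmonic_on_def by blast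
qed

lemma second_derivative_local_max:
 fixes phi :: "real => real"
 assumes "e > 0" "!!t. \<bar>t\<bar> < e ==> (phi has_real_derivative phi' t) (at t)"
 "(phi' has_real_derivative c) (at 0)" "!!t. \<bar>t\<bar> < e ==> phi t <= phi 0"
 shows "c <= 0"
proof (rule ccontr)
 assume "\<not> c <= 0"
 have z: "phi' 0 = 0"
 by (rule DERIV_local_max[of phi _ 0 e]) (use assms in auto)
 obtain d where d: "d > 0" "!!h. 0 < h ==> h < d ==> phi' 0 < phi' (0 + h)"
 using DERIV_pos_inc_right[OF assms(3)] \<open>\<not> c <= 0\<close> by auto
 define h where "h = min d e / 2"
 have h: "0 < h" "h < d" "h < e" using d(1) assms(1) by (auto simp: h_def)
 obtain s where s: "0 < s" "s < h" "phi h - phi 0 = (h - 0) * phi' s"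
 using MVT2[OF h(1), of phi phi'] assms(2) h by (smt (verit))
 have "phi' s > 0" using d(2)[of s] s h z by simp
 then have "phi h - phi 0 > 0" using s(3) h(1) by simp
 then show False using assms(4)[of h] h by simp
qed

text \<open>The competitors in the definition of \<open>Hreg\<close> are known only through
  one-variable derivatives along the axes, so \<open>max_principle\<close> is not applicable to
  them. The classical argument is: after adding eta |x|^2, both second derivatives at an interior
  maximum would be nonpositive, yet they sum to 4 eta.\<close>

lemma laplace_max_principle:
 assumes "open D" "bounded D" "continuous_on (closure D) w"
 "!!z i. z \<in> D ==> has_dir_deriv w (cdir i) z (w1 i z)"
 "!!z i. z \<in> D ==> has_dir_deriv (w1 i) (cdir i) z (w2 i z)"
 "!!z. z \<in> D ==> w2 1 z + w2 2 z = 0"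
 "!!z. z \<in> frontier D ==> w z <= 0" "z \<in> closure D"
 shows "w z <= 0"
proof (rule ccontr)
 assume "\<not> w z <= 0"
 have comp: "compact (closure D)" using assms(2) by (simp add: compact_closure)
 then obtain B where B: "B > 0" "!!x. x \<in> closure D ==> cmod x <= B"
 using compact_imp_bounded bounded_pos by metis
 \<comment> \<open>Since |x| <= B on the closure, the added term is at most half of
   \<open>w z\<close>, too little to move the maximum to the frontier.\<close>
 define eta where "eta = w z / (2 * B\<^sup>2)"
 have eta: "eta > 0" using \<open>\<not> w z <= 0\<close> B(1) by (simp add: eta_def)
 define W where "W x = w x + eta * (cmod x)\<^sup>2" for x
 have cW: "continuous_on (closure D) W" unfolding W_def using assms(3) by (intro continuous_intros)
 obtain m where m: "m \<in> closure D" "!!y. y \<in> closure D ==> W y <= W m"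
 using continuous_attains_sup[OF comp _ cW] assms(8) by (metis empty_iff)
 have "m \<in> D"
 proof (rule ccontr)
 assume "m \<notin> D"
 then have "m \<in> frontier D" using m(1) unfolding frontier_def interior_open[OF assms(1)] by blast
 then have "W m <= eta * (cmod m)\<^sup>2" using assms(7) by (simp add: W_def)
 also have "... <= eta * B\<^sup>2" using eta B(2)[OF m(1)] by (intro mult_left_mono power_mono) auto
 also have "... = w z / 2" using B(1) by (simp add: eta_def)
 also have "... < w z" using \<open>\<not> w z <= 0\<close> by simp
 also have "... <= W z" using eta by (simp add: W_def)
 finally show False using m(2)[OF assms(8)] by simp
 qed
 obtain e where e: "e > 0" "ball m e \<subseteq> D" using assms(1) \<open>m \<in> D\<close> openE by blast
 have nc: "cmod (cdir i) = 1" for i by (simp add: cdir_def)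
 have le: "w2 i m + 2 * eta <= 0" for i
 proof (rule second_derivative_local_max[OF e(1)])
 let ?p = "%t. m + of_real t * cdir i"
 have inD: "?p t \<in> D" if "\<bar>t\<bar> < e" for t using that e(2) nc by (auto simp: dist_norm norm_mult)
 have sq: "(cmod (?p t))\<^sup>2 = (cmod m)\<^sup>2 + 2 * t * Re (cnj m * cdir i) + t\<^sup>2" for t
 by (simp add: cmod_power2 cdir_def) (simp add: power2_eq_square algebra_simps)
 show "((%t. W (?p t)) has_real_derivative w1 i (?p t) + eta * (2 * Re (cnj m * cdir i) + 2 * t)) (at t)" if "\<bar>t\<bar> < e" for t
 unfolding W_def sq using has_dir_deriv_shift[OF assms(4)[OF inD[OF that]]]
 by (auto intro!: derivative_eq_intros)
 show "((%t. w1 i (?p t) + eta * (2 * Re (cnj m * cdir i) + 2 * t)) has_real_derivative w2 i m + 2 * eta) (at 0)"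
 using assms(5)[OF \<open>m \<in> D\<close>, of i] unfolding has_dir_deriv_def
 by (auto intro!: derivative_eq_intros)
 show "W (?p t) <= W (?p 0)" if "\<bar>t\<bar> < e" for t
 using m(2)[of "?p t"] inD[OF that] closure_subset[of D] by auto
 qed
 from le[of 1] le[of 2] assms(6)[OF \<open>m \<in> D\<close>] eta show False by simp
qed

lemma has_dir_deriv_diff:
 "has_dir_deriv f v z a ==> has_dir_deriv g v z b ==> has_dir_deriv (%z. f z - g z) v z (a - b)"
 unfolding has_dir_deriv_def by (rule DERIV_diff)

lemma harmonic_on_unique_le:
 assumes "open S" "bounded S" "continuous_on (closure S) f" "harmonic_on S f"
 "continuous_on (closure S) g" "harmonic_on S g" "!!x. x \<in> frontier S ==> f x <= g x" "x \<in> closure S"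
 shows "f x <= g x"
proof -
 let ?D = "em 0 -` S"
 define w1 where "w1 i z = partial i f (em 0 z) - partial i g (em 0 z)" for i z
 define w2 where "w2 i z = partial i (partial i f) (em 0 z) - partial i (partial i g) (em 0 z)" for i z
 have C: "C_inf_on S f" "C_inf_on S g" using assms(4,6) by (auto simp: harmonic_on_def)
 have "f (em 0 (pm 0 x)) - g (em 0 (pm 0 x)) <= 0"
 proof (rule laplace_max_principle[of ?D "%z. f (em 0 z) - g (em 0 z)" w1 w2 "pm 0 x"])
 have "continuous_on (closure ?D) (%z. f (em 0 z))" "continuous_on (closure ?D) (%z. g (em 0 z))"
 by (rule continuous_on_compose2[OF assms(3) continuous_on_em] continuous_on_compose2[OF assms(5) continuous_on_em];
 auto simp: em_vimage_closure)+
 then show "continuous_on (closure ?D) (%z. f (em 0 z) - g (em 0 z))" by (rule continuous_on_diff)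
 fix z i assume z: "z \<in> ?D"
 show "has_dir_deriv (%z. f (em 0 z) - g (em 0 z)) (cdir i) z (w1 i z)"
 using has_dir_deriv_diff[OF C_inf_has_dir_deriv[OF C(1) z, of "[]" i] C_inf_has_dir_deriv[OF C(2) z, of "[]" i]]
 by (simp add: o_def w1_def)
 show "has_dir_deriv (w1 i) (cdir i) z (w2 i z)"
 using has_dir_deriv_diff[OF C_inf_has_dir_deriv[OF C(1) z, of "[i]" i] C_inf_has_dir_deriv[OF C(2) z, of "[i]" i]]
 by (simp add: o_def w1_def[abs_def] w2_def)
 have "partial 1 (partial 1 f) (em 0 z) + partial 2 (partial 2 f) (em 0 z) = 0"
 "partial 1 (partial 1 g) (em 0 z) + partial 2 (partial 2 g) (em 0 z) = 0"
 using assms(4,6) z by (auto simp: harmonic_on_def)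
 then show "w2 1 z + w2 2 z = 0" unfolding w2_def by linarith
 qed (use assms em_vimage_open em_vimage_bounded in \<open>auto simp: em_vimage_frontier em_vimage_closure\<close>)
 then show ?thesis by simp
qed

text \<open>Perron's solution, extended by 0 as the definite description demands, satisfies the
  description; comparison in both directions on the closure shows that no other function
  does.\<close>

lemma Hreg_eq_hreg:
 assumes "open S" "regular_domain (em P -` S)" "y \<in> em P -` S" "x \<in> closure (em P -` S)"
 shows "Hreg S (em P x) (em P y) = hreg (em P -` S) x y / (2 * pi)"
proof -
 let ?D = "em P -` S"
 interpret reg_domain ?D by unfold_locales (rule assms(2))
 define k where "k q = (if q \<in> closure S then hreg ?D (pm P q) y / (2 * pi) else 0)" for q
 have ka: "continuous_on (closure S) k"
 proof -
 have "continuous_on (closure S) (%q. hreg ?D (pm P q) y / (2 * pi))"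
 by (intro continuous_intros continuous_on_compose2[OF hreg_props(1)[OF assms(3)] continuous_on_pm])
 (auto simp: em_vimage_closure)
 then show ?thesis by (rule continuous_on_eq) (simp add: k_def)
 qed
 have kb: "harmonic_on S k"
 proof (rule harm_imp_harmonic_on[OF assms(1)])
 have "harm ?D (%z. 1 / (2 * pi) * hreg ?D z y)" by (intro harm_cmult hreg_props assms(3))
 then show "harm ?D (k \<circ> em P)"
 by (rule harm_cong[OF _ D_open]) (use closure_subset[of S] in \<open>auto simp: k_def\<close>)
 qed
 have kc: "k z = fund z (em P y)" if "z \<in> frontier S" for z
 proof -
 have "pm P z \<in> frontier ?D" using that by (simp add: em_vimage_frontier)
 moreover have "z \<in> closure S" using that by (simp add: frontier_def)
 ultimately show ?thesis using hreg_props(3)[OF assms(3)] dist_em[of P "pm P z" y] by (simp add: k_def fund_def)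
 qed
 have bS: "bounded S"
 proof -
 obtain B where B: "\<forall>z\<in>?D. norm z <= B" using D_bounded unfolding bounded_iff by blast
 have "dist P x <= B" if "x \<in> S" for x
 using B[rule_format, of "pm P x"] that dist_em[of P 0 "pm P x"] by simp
 then show ?thesis unfolding bounded_def by blast
 qed
 have "(THE h. continuous_on (closure S) h & harmonic_on S h \<and>
 (\<forall>z\<in>frontier S. h z = fund z (em P y)) & (\<forall>z. z \<notin> closure S --> h z = 0)) = k"
 proof (rule the_equality)
 show "continuous_on (closure S) k & harmonic_on S k & (\<forall>z\<in>frontier S. k z = fund z (em P y)) \<and>
 (\<forall>z. z \<notin> closure S --> k z = 0)"
 using ka kb kc by (simp add: k_def)
 fix h assume h: "continuous_on (closure S) h & harmonic_on S h \<and>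
 (\<forall>z\<in>frontier S. h z = fund z (em P y)) & (\<forall>z. z \<notin> closure S --> h z = 0)"
 show "h = k"
 proof
 fix q
 show "h q = k q"
 proof (cases "q \<in> closure S")
 case True
 have "h q <= k q"
 by (rule harmonic_on_unique_le[OF assms(1) bS _ _ ka kb _ True]) (use h kc in auto)
 moreover have "k q <= h q"
 by (rule harmonic_on_unique_le[OF assms(1) bS ka kb _ _ _ True]) (use h kc in auto)
 ultimately show ?thesis by simp
 qed (use h in \<open>simp add: k_def\<close>)
 qed
 qed
 then show ?thesis using assms(4) unfolding Hreg_def by (simp add: k_def em_vimage_closure)
qed

section \<open>Exterior discs\<close>

lemma touched_mono: "touched D p ==> E \<subseteq> D ==> touched E p"
 unfolding touched_def using closure_mono by blast

text \<open>The hole itself would touch along its whole circle, so at a point with |p| = eps the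
  disc of half the radius centred at p/2 is taken, which meets the closure at p alone.\<close>

lemma regular_domain_minus_disc:
 assumes "regular_domain D" "0 < eps"
 shows "regular_domain (D - cball 0 eps)"
proof -
 let ?E = "D - cball 0 eps"
 have D: "open D" "bounded D" "!!p. p \<in> frontier D ==> touched D p"
 using assms(1) by (auto simp: regular_domain_def)
 have oE: "open ?E" using D(1) by (intro open_Diff) auto
 have bE: "bounded ?E" using D(2) by (rule bounded_subset) auto
 have cl: "closure ?E \<subseteq> closure D" by (rule closure_mono) auto
 have cl2: "closure ?E \<subseteq> - ball 0 eps" by (rule closure_minimal) auto
 have "touched ?E p" if p: "p \<in> frontier ?E" for p
 proof (cases "p \<in> frontier D")
 case True
 then show ?thesis using touched_mono[OF D(3)] by blast
 next
 case False
 have pc: "p \<in> closure ?E" "p \<notin> ?E" using p unfolding frontier_def interior_open[OF oE] by auto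
 then have "p \<in> D" using False cl unfolding frontier_def interior_open[OF D(1)] by blast
 then have pe: "cmod p = eps" using pc cl2 by force
 have "eps / 2 < dist (p / 2) z" if z: "z \<in> closure ?E - {p}" for z
 proof -
 have ze: "eps <= cmod z" using z cl2 by force
 have "(cmod (p / 2 - z))\<^sup>2 = (cmod z)\<^sup>2 / 2 + (cmod (z - p))\<^sup>2 / 2 - (cmod p)\<^sup>2 / 4"
 by (simp add: cmod_power2) (simp add: power2_eq_square field_simps)
 moreover have "eps\<^sup>2 <= (cmod z)\<^sup>2" using ze assms(2) by (intro power_mono) auto
 moreover have "(cmod (z - p))\<^sup>2 > 0" using z by simp
 moreover have "(eps / 2)\<^sup>2 = eps\<^sup>2 / 4" by (simp add: power_divide)
 ultimately have "(eps / 2)\<^sup>2 < (cmod (p / 2 - z))\<^sup>2" unfolding pe by linarith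
 then have "eps / 2 < cmod (p / 2 - z)" by (rule power_less_imp_less_base) simp
 then show ?thesis by (simp add: dist_norm)
 qed
 moreover have "dist (p / 2) p = eps / 2"
 proof -
 have "p / 2 - p = - (p / 2)" by simp
 then show ?thesis using pe by (simp add: dist_norm norm_divide)
 qed
 ultimately show ?thesis unfolding touched_def using assms(2) by (intro exI[of _ "p / 2"] exI[of _ "eps / 2"]) auto
 qed
 then show ?thesis using oE bE by (simp add: regular_domain_def)
qed

lemma dir_deriv_mvt:
 assumes "!!s. \<bar>s\<bar> <= \<bar>t\<bar> ==> has_dir_deriv f v (z + of_real s * v) (f' (z + of_real s * v))"
 shows "\<exists>s. \<bar>s\<bar> <= \<bar>t\<bar> & f (z + of_real t * v) - f z = t * f' (z + of_real s * v)"
proof -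
 have d: "((%t. f (z + of_real t * v)) has_real_derivative f' (z + of_real s * v)) (at s)" if "\<bar>s\<bar> <= \<bar>t\<bar>" for s
 by (rule has_dir_deriv_shift[OF assms[OF that]])
 consider "t = 0" | "t > 0" | "t < 0" by linarith
 then show ?thesis
 proof cases
 case 1
 then show ?thesis by (intro exI[of _ 0]) simp
 next
 case 2
 then obtain s where "0 < s" "s < t" "f (z + of_real t * v) - f (z + of_real 0 * v) = (t - 0) * f' (z + of_real s * v)"
 using MVT2[of 0 t "%t. f (z + of_real t * v)" "%s. f' (z + of_real s * v)"] d by auto
 then show ?thesis by (intro exI[of _ s]) auto
 next
 case 3
 then obtain s where "t < s" "s < 0" "f (z + of_real 0 * v) - f (z + of_real t * v) = (0 - t) * f' (z + of_real s * v)"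
 using MVT2[of t 0 "%t. f (z + of_real t * v)" "%s. f' (z + of_real s * v)"] d by auto
 then show ?thesis by (intro exI[of _ s]) auto
 qed
qed

text \<open>\<open>C_inf_on\<close> offers axis-parallel derivatives only, so every point is reached
  from \<open>p\<close> by a horizontal and then a vertical segment, with the mean value theorem on
  each. With h = x - p the first costs K |h|^2 and the second 2K |h|^2. A one-sided quadratic bound
  is all that an exterior disc requires.\<close>

lemma smooth_taylor:
 assumes "C_inf_on U g" "open U" "p \<in> em P -` U"
 shows "\<exists>K r. K >= 0 & r > 0 & cball p r \<subseteq> em P -` U & (\<forall>x\<in>cball p r.
 g (em P p) + partial 1 g (em P p) * Re (x - p) + partial 2 g (em P p) * Im (x - p) - K * (cmod (x - p))\<^sup>2 <= g (em P x))"
proof -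
 let ?V = "em P -` U"
 obtain r where r: "r > 0" "cball p r \<subseteq> ?V"
 using em_vimage_open[OF assms(2)] assms(3) open_contains_cball by blast
 have dd: "has_dir_deriv (iter_partial is g \<circ> em P) (cdir i) z (iter_partial (i # is) g (em P z))" if "z \<in> cball p r" for "is" i z
 by (rule C_inf_has_dir_deriv[OF assms(1)]) (use that r in blast)
 have "\<exists>B. \<forall>z\<in>cball p r. \<bar>iter_partial [i, j] g (em P z)\<bar> <= B" for i j
 proof -
 have "continuous_on U (iter_partial [i, j] g)" using assms(1) unfolding C_inf_on_def by blast
 then have "continuous_on (cball p r) (%z. iter_partial [i, j] g (em P z))"
 by (rule continuous_on_compose2[OF _ continuous_on_em]) (use r in auto)
 from compact_imp_bounded[OF compact_continuous_image[OF this compact_cball]] show ?thesis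
 unfolding bounded_iff by auto
 qed
 then obtain B where B: "!!i j z. z \<in> cball p r ==> \<bar>iter_partial [i, j] g (em P z)\<bar> <= B i j" by metis
 define K where "K = \<bar>B 1 1\<bar> + \<bar>B 1 2\<bar> + \<bar>B 2 1\<bar> + \<bar>B 2 2\<bar>"
 have K: "\<bar>iter_partial [i, j] g (em P z)\<bar> <= K" if "z \<in> cball p r" for i j z
 using B[OF that, of i j] exhaust_2[of i] exhaust_2[of j] by (auto simp: K_def)
 have K0: "K >= 0" by (simp add: K_def)
 have inb: "p + of_real a + of_real b * \<i> \<in> cball p r" if "\<bar>a\<bar> <= \<bar>Re h\<bar>" "\<bar>b\<bar> <= \<bar>Im h\<bar>" "cmod h <= r" for a b h
 proof -
 have "a\<^sup>2 + b\<^sup>2 <= (Re h)\<^sup>2 + (Im h)\<^sup>2" using that by (intro add_mono) (auto simp: abs_le_square_iff)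
 then have "cmod (Complex a b) <= cmod h" by (simp add: cmod_def)
 moreover have "dist p (p + of_real a + of_real b * \<i>) = cmod (Complex a b)"
 by (simp add: dist_norm cmod_def)
 ultimately show ?thesis using that(3) by simp
 qed
 have first: "\<bar>partial i g (em P (p + of_real a + of_real b * \<i>)) - partial i g (em P p)\<bar> <= K * (\<bar>a\<bar> + \<bar>b\<bar>)"
 if ab: "\<bar>a\<bar> <= \<bar>Re h\<bar>" "\<bar>b\<bar> <= \<bar>Im h\<bar>" "cmod h <= r" for a b h i
 proof -
 let ?f = "iter_partial [i] g \<circ> em P"
 have "has_dir_deriv ?f (cdir 1) (p + of_real s * cdir 1) (iter_partial [1, i] g (em P (p + of_real s * cdir 1)))"
 if "\<bar>s\<bar> <= \<bar>a\<bar>" for s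
 by (rule dd) (use inb[of s h 0] that ab in \<open>simp add: cdir_def\<close>)
 from dir_deriv_mvt[where f' = "%z. iter_partial [1, i] g (em P z)", OF this]
 obtain s where s: "\<bar>s\<bar> <= \<bar>a\<bar>" "?f (p + of_real a * cdir 1) - ?f (p) = a * iter_partial [1, i] g (em P (p + of_real s * cdir 1))"
 by blast
 have "has_dir_deriv ?f (cdir 2) (p + of_real a + of_real s * cdir 2) (iter_partial [2, i] g (em P (p + of_real a + of_real s * cdir 2)))"
 if "\<bar>s\<bar> <= \<bar>b\<bar>" for s
 by (rule dd) (use inb[of a h s] that ab in \<open>simp add: cdir_def\<close>)
 from dir_deriv_mvt[where f' = "%z. iter_partial [2, i] g (em P z)", OF this]
 obtain s' where s': "\<bar>s'\<bar> <= \<bar>b\<bar>" "?f (p + of_real a + of_real b * cdir 2) - ?f (p + of_real a) = b * iter_partial [2, i] g (em P (p + of_real a + of_real s' * cdir 2))"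
 by blast
 have "\<bar>?f (p + of_real a * cdir 1) - ?f p\<bar> <= \<bar>a\<bar> * K"
 unfolding s(2) abs_mult using inb[of s h 0] ab s(1) by (intro mult_left_mono K) (auto simp: cdir_def)
 moreover have "\<bar>?f (p + of_real a + of_real b * cdir 2) - ?f (p + of_real a)\<bar> <= \<bar>b\<bar> * K"
 unfolding s'(2) abs_mult using inb[of a h s'] ab s'(1) by (intro mult_left_mono K) (auto simp: cdir_def)
 ultimately show ?thesis by (simp add: cdir_def algebra_simps)
 qed
 have "g (em P p) + partial 1 g (em P p) * Re (x - p) + partial 2 g (em P p) * Im (x - p) - 3 * K * (cmod (x - p))\<^sup>2 <= g (em P x)"
 if x: "x \<in> cball p r" for x
 proof -
 define h where "h = x - p"
 define a where "a = Re h"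
 define b where "b = Im h"
 have hr: "cmod h <= r" using x by (simp add: h_def dist_norm norm_minus_commute)
 have xh: "x = p + of_real a + of_real b * \<i>" by (simp add: complex_eq_iff a_def b_def h_def)
 let ?f = "iter_partial [] g \<circ> em P"
 have "has_dir_deriv ?f (cdir 1) (p + of_real s * cdir 1) (iter_partial [1] g (em P (p + of_real s * cdir 1)))"
 if "\<bar>s\<bar> <= \<bar>a\<bar>" for s
 by (rule dd) (use inb[of s h 0] that hr in \<open>simp add: cdir_def a_def b_def\<close>)
 from dir_deriv_mvt[where f' = "%z. iter_partial [1] g (em P z)", OF this]
 obtain s where s: "\<bar>s\<bar> <= \<bar>a\<bar>" "?f (p + of_real a * cdir 1) - ?f (p) = a * iter_partial [1] g (em P (p + of_real s * cdir 1))"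
 by blast
 have "has_dir_deriv ?f (cdir 2) (p + of_real a + of_real s * cdir 2) (iter_partial [2] g (em P (p + of_real a + of_real s * cdir 2)))"
 if "\<bar>s\<bar> <= \<bar>b\<bar>" for s
 by (rule dd) (use inb[of a h s] that hr in \<open>simp add: cdir_def a_def b_def\<close>)
 from dir_deriv_mvt[where f' = "%z. iter_partial [2] g (em P z)", OF this]
 obtain s' where s': "\<bar>s'\<bar> <= \<bar>b\<bar>" "?f (p + of_real a + of_real b * cdir 2) - ?f (p + of_real a) = b * iter_partial [2] g (em P (p + of_real a + of_real s' * cdir 2))"
 by blast
 have ha: "\<bar>a\<bar> <= cmod h" "\<bar>b\<bar> <= cmod h" using abs_Re_le_cmod abs_Im_le_cmod by (auto simp: a_def b_def)
 have 1: "\<bar>a * (partial 1 g (em P (p + of_real s)) - partial 1 g (em P p))\<bar> <= cmod h * (K * cmod h)"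
 proof -
 have "\<bar>partial 1 g (em P (p + of_real s)) - partial 1 g (em P p)\<bar> <= K * \<bar>s\<bar>"
 using first[of s h 0 1] s(1) hr by (simp add: a_def)
 also have "... <= K * cmod h" using s(1) ha K0 by (intro mult_left_mono) auto
 finally show ?thesis unfolding abs_mult using ha by (intro mult_mono) auto
 qed
 have 2: "\<bar>b * (partial 2 g (em P (p + of_real a + of_real s' * \<i>)) - partial 2 g (em P p))\<bar> <= cmod h * (K * (2 * cmod h))"
 proof -
 have "\<bar>partial 2 g (em P (p + of_real a + of_real s' * \<i>)) - partial 2 g (em P p)\<bar> <= K * (\<bar>a\<bar> + \<bar>s'\<bar>)"
 using first[of a h s' 2] s'(1) hr by (simp add: a_def b_def)
 also have "... <= K * (2 * cmod h)" using s'(1) ha K0 by (intro mult_left_mono) auto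
 finally show ?thesis unfolding abs_mult using ha by (intro mult_mono) auto
 qed
 have "g (em P x) - g (em P p) = a * partial 1 g (em P (p + of_real s)) + b * partial 2 g (em P (p + of_real a + of_real s' * \<i>))"
 using s(2) s'(2) unfolding xh by (simp add: cdir_def)
 then have e: "g (em P x) - g (em P p) = a * partial 1 g (em P p) + b * partial 2 g (em P p)
 + a * (partial 1 g (em P (p + of_real s)) - partial 1 g (em P p))
 + b * (partial 2 g (em P (p + of_real a + of_real s' * \<i>)) - partial 2 g (em P p))"
 by (simp add: algebra_simps)
 have "cmod h * (K * cmod h) + cmod h * (K * (2 * cmod h)) = 3 * K * (cmod h)\<^sup>2" by (simp add: power2_eq_square)
 with 1 2 e have "g (em P x) - g (em P p) >= a * partial 1 g (em P p) + b * partial 2 g (em P p) - 3 * K * (cmod h)\<^sup>2"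
 by linarith
 then show ?thesis unfolding a_def b_def h_def by (simp add: mult.commute)
 qed
 then show ?thesis using K0 r by (intro exI[of _ "3 * K"] exI[of _ r]) auto
qed

text \<open>The disc is centred at distance rho from p in the direction u of the gradient n of the
  defining function. For h = z - p in the closed disc |h|^2 <= 2 rho Re (cnj u h), so once 2 K rho <
  |n| the linear Taylor term beats the quadratic one, and g > 0 near z keeps z off the
  closure.\<close>

theorem smooth_imp_regular:
 assumes "smooth_bounded_domain S"
 shows "regular_domain (em P -` S)"
proof -
 let ?D = "em P -` S"
 have S: "open S" "bounded S" using assms by (auto simp: smooth_bounded_domain_def)
 have oD: "open ?D" by (rule em_vimage_open[OF S(1)])
 have "touched ?D p" if p: "p \<in> frontier ?D" for p
 proof -
 have pF: "em P p \<in> frontier S" using p by (simp add: em_vimage_frontier)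
 then obtain U g where U: "open U" "em P p \<in> U" "C_inf_on U g" "\<forall>x\<in>U. \<exists>i. partial i g x ~= 0"
 "S \<inter> U = {x\<in>U. g x < 0}"
 using assms unfolding smooth_bounded_domain_def by blast
 have "em P p \<notin> S" using pF unfolding frontier_def interior_open[OF S(1)] by blast
 then have g0: "g (em P p) >= 0" using U(2,5) by force
 let ?V = "em P -` U"
 obtain K r where K: "K >= 0" "r > 0" "cball p r \<subseteq> ?V"
 "!!x. x \<in> cball p r ==> g (em P p) + partial 1 g (em P p) * Re (x - p) + partial 2 g (em P p) * Im (x - p)
 - K * (cmod (x - p))\<^sup>2 <= g (em P x)"
 using smooth_taylor[OF U(3,1), of p P] U(2) by auto
 define n where "n = Complex (partial 1 g (em P p)) (partial 2 g (em P p))"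
 have n0: "cmod n > 0"
 proof -
 obtain i where "partial i g (em P p) ~= 0" using U(2,4) by blast
 then show ?thesis using exhaust_2[of i] by (auto simp: n_def complex_eq_iff)
 qed
 \<comment> \<open>The entry r/3 keeps the disc inside the ball of the Taylor bound; the other one
   yields 2 K rho < |n|.\<close>
 define rho where "rho = min (r / 3) (cmod n / (4 * (K + 1)))"
 have rho: "rho > 0" "2 * rho < r" using K n0 by (auto simp: rho_def)
 have "rho <= cmod n / (4 * (K + 1))" by (simp add: rho_def)
 then have "4 * (K + 1) * rho <= cmod n" using K(1) by (simp add: field_simps)
 moreover have "4 * (K + 1) * rho = 2 * (K * rho) + (2 * (K * rho) + 4 * rho)" by (simp add: algebra_simps)
 moreover have "K * rho >= 0" using K(1) rho by simp
 ultimately have Kr: "2 * K * rho < cmod n" using rho by linarith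
 define u where "u = n / of_real (cmod n)"
 have u1: "cmod u = 1" using n0 by (simp add: u_def norm_divide)
 define c where "c = p + of_real rho * u"
 have gc: "continuous_on ?V (%z. g (em P z))"
 proof -
 have "continuous_on U (iter_partial [] g)" using U(3) unfolding C_inf_on_def by blast
 then show ?thesis by (intro continuous_on_compose2[OF _ continuous_on_em, of U g]) auto
 qed
 have "rho < dist c z" if z: "z \<in> closure ?D - {p}" for z
 proof (rule ccontr)
 assume "\<not> rho < dist c z"
 define h where "h = z - p"
 have le: "cmod (h - of_real rho * u) <= rho" using \<open>\<not> rho < dist c z\<close>
 by (simp add: h_def c_def dist_norm norm_minus_commute algebra_simps)
 have h0: "h ~= 0" using z by (simp add: h_def)
 have "cmod h <= cmod (h - of_real rho * u) + cmod (of_real rho * u)"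
 using norm_triangle_ineq[of "h - of_real rho * u" "of_real rho * u"] by simp
 also have "... <= 2 * rho" using le rho u1 by (simp add: norm_mult)
 finally have hr: "cmod h < r" using rho by linarith
 have "(cmod (h - of_real rho * u))\<^sup>2 <= rho\<^sup>2" using le by (intro power_mono) auto
 moreover have "(cmod (h - of_real rho * u))\<^sup>2 = (cmod h)\<^sup>2 - 2 * rho * Re (cnj u * h) + rho\<^sup>2 * (cmod u)\<^sup>2"
 by (simp add: cmod_power2) (simp add: power2_eq_square algebra_simps)
 ultimately have h2: "(cmod h)\<^sup>2 <= 2 * rho * Re (cnj u * h)" using u1 by simp
 moreover have "(cmod h)\<^sup>2 > 0" using h0 by simp
 ultimately have "2 * rho * Re (cnj u * h) > 0" by linarith
 then have pos: "Re (cnj u * h) > 0" using rho(1) by (simp add: zero_less_mult_iff)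
 have "partial 1 g (em P p) * Re h + partial 2 g (em P p) * Im h = cmod n * Re (cnj u * h)"
 proof -
 have "Re n = cmod n * Re u" "Im n = cmod n * Im u" using n0 by (simp_all add: u_def)
 then have "partial 1 g (em P p) = cmod n * Re u" "partial 2 g (em P p) = cmod n * Im u"
 by (simp_all add: n_def)
 then show ?thesis by (simp add: algebra_simps)
 qed
 moreover have "z \<in> cball p r" using hr by (simp add: h_def dist_norm norm_minus_commute)
 ultimately have "cmod n * Re (cnj u * h) - K * (cmod h)\<^sup>2 <= g (em P z)"
 using K(4)[of z] g0 unfolding h_def[symmetric] by linarith
 moreover have "K * (cmod h)\<^sup>2 <= K * (2 * rho * Re (cnj u * h))" using h2 K(1) by (rule mult_left_mono)
 moreover have "K * (2 * rho * Re (cnj u * h)) < cmod n * Re (cnj u * h)"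
 using mult_strict_right_mono[OF Kr pos] by (simp add: mult_ac)
 ultimately have gz: "g (em P z) > 0" by linarith
 have zV: "z \<in> ?V" using \<open>z \<in> cball p r\<close> K(3) by blast
 define N where "N = ?V \<inter> (%z. g (em P z)) -` {0<..}"
 have oN: "open N" unfolding N_def
 by (rule continuous_open_preimage[OF gc em_vimage_open[OF U(1)] open_greaterThan])
 have "z \<in> N" using gz zV by (simp add: N_def)
 then have "N \<inter> closure ?D ~= {}" using z by blast
 then have "N \<inter> ?D ~= {}" unfolding open_Int_closure_eq_empty[OF oN] .
 then obtain y where "y \<in> N" "em P y \<in> S" by auto
 then have "em P y \<in> S \<inter> U" "g (em P y) > 0" by (auto simp: N_def)
 then show False unfolding U(5) by simp
 qed
 moreover have "dist c p = rho" using rho u1 by (simp add: c_def dist_norm norm_mult)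
 ultimately show ?thesis unfolding touched_def using rho(1) by blast
 qed
 then show ?thesis using oD em_vimage_bounded[OF S(2)] by (simp add: regular_domain_def)
qed


section \<open>Stability of nondegenerate zeros\<close>

text \<open>Size O(r) in the C^1 norm on \<open>V\<close> as the parameter tends to 0. The
  nonnegativity of \<open>r\<close> is carried along so that bounds can be multiplied and weakened
  freely.\<close>

definition c1_bound :: "'a::real_normed_vector set => (real => 'a => 'b::real_normed_vector) => (real => real) => bool" where
 "c1_bound V f r \<longleftrightarrow> (\<exists>C\<ge>0. \<forall>\<^sub>F eps in at_right 0. 0 <= r eps & (\<forall>p\<in>V. \<exists>f'. (f eps has_derivative f') (at p) \<and>
 norm (f eps p) <= C * r eps & (\<forall>v. norm (f' v) <= C * r eps * norm v)))"

lemma c1_bound_weaken: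
 assumes "c1_bound V f r" "0 <= M" "\<forall>\<^sub>F eps in at_right 0. r eps <= M * s eps & 0 <= s eps"
 shows "c1_bound V f s"
proof -
 obtain C where C: "C >= 0" "\<forall>\<^sub>F eps in at_right 0. 0 <= r eps & (\<forall>p\<in>V. \<exists>f'. (f eps has_derivative f') (at p) \<and>
 norm (f eps p) <= C * r eps & (\<forall>v. norm (f' v) <= C * r eps * norm v))"
 using assms(1) unfolding c1_bound_def by blast
 have "\<forall>\<^sub>F eps in at_right 0. 0 <= s eps & (\<forall>p\<in>V. \<exists>f'. (f eps has_derivative f') (at p) \<and>
 norm (f eps p) <= (C * M) * s eps & (\<forall>v. norm (f' v) <= (C * M) * s eps * norm v))"
 using C(2) assms(3)
 proof eventually_elim
 case (elim eps)
 have le: "C * r eps <= (C * M) * s eps"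
 using mult_left_mono[of "r eps" "M * s eps" C] elim C(1) by (simp add: mult.assoc)
 show ?case
 proof (intro conjI ballI)
 fix p assume "p \<in> V"
 then obtain f' where f': "(f eps has_derivative f') (at p)" "norm (f eps p) <= C * r eps"
 "!!v. norm (f' v) <= C * r eps * norm v" using elim by blast
 have "norm (f' v) <= (C * M) * s eps * norm v" for v
 using f'(3)[of v] mult_right_mono[OF le, of "norm v"] by simp
 then show "\<exists>f'. (f eps has_derivative f') (at p) & norm (f eps p) <= (C * M) * s eps \<and>
 (\<forall>v. norm (f' v) <= (C * M) * s eps * norm v)" using f'(1,2) le by (intro exI[of _ f']) auto
 qed (use elim in simp)
 qed
 then show ?thesis unfolding c1_bound_def using C(1) assms(2) by (intro exI[of _ "C * M"]) auto
qed

lemma c1_bound_add: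
 assumes "c1_bound V f r" "c1_bound V g r"
 shows "c1_bound V (%eps p. f eps p + g eps p) r"
proof -
 obtain C where C: "C >= 0" "\<forall>\<^sub>F eps in at_right 0. 0 <= r eps & (\<forall>p\<in>V. \<exists>f'. (f eps has_derivative f') (at p) \<and>
 norm (f eps p) <= C * r eps & (\<forall>v. norm (f' v) <= C * r eps * norm v))"
 using assms(1) unfolding c1_bound_def by blast
 obtain B where B: "B >= 0" "\<forall>\<^sub>F eps in at_right 0. 0 <= r eps & (\<forall>p\<in>V. \<exists>f'. (g eps has_derivative f') (at p) \<and>
 norm (g eps p) <= B * r eps & (\<forall>v. norm (f' v) <= B * r eps * norm v))"
 using assms(2) unfolding c1_bound_def by blast
 have "\<forall>\<^sub>F eps in at_right 0. 0 <= r eps & (\<forall>p\<in>V. \<exists>f'. ((%p. f eps p + g eps p) has_derivative f') (at p) \<and>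
 norm (f eps p + g eps p) <= (C + B) * r eps & (\<forall>v. norm (f' v) <= (C + B) * r eps * norm v))"
 using C(2) B(2)
 proof eventually_elim
 case (elim eps)
 show ?case
 proof (intro conjI ballI)
 fix p assume p: "p \<in> V"
 obtain f' where f': "(f eps has_derivative f') (at p)" "norm (f eps p) <= C * r eps"
 "!!v. norm (f' v) <= C * r eps * norm v" using elim p by blast
 obtain g' where g': "(g eps has_derivative g') (at p)" "norm (g eps p) <= B * r eps"
 "!!v. norm (g' v) <= B * r eps * norm v" using elim p by blast
 have "norm (f' v + g' v) <= (C + B) * r eps * norm v" for v
 using norm_triangle_ineq[of "f' v" "g' v"] f'(3)[of v] g'(3)[of v] by (simp add: algebra_simps)
 moreover have "norm (f eps p + g eps p) <= (C + B) * r eps"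
 using norm_triangle_ineq[of "f eps p" "g eps p"] f'(2) g'(2) by (simp add: algebra_simps)
 ultimately show "\<exists>f'. ((%p. f eps p + g eps p) has_derivative f') (at p) \<and>
 norm (f eps p + g eps p) <= (C + B) * r eps & (\<forall>v. norm (f' v) <= (C + B) * r eps * norm v)"
 using has_derivative_add[OF f'(1) g'(1)] by blast
 qed (use elim in simp)
 qed
 then show ?thesis unfolding c1_bound_def using C(1) B(1) by (intro exI[of _ "C + B"]) auto
qed

lemma c1_bound_mult:
 fixes f g :: "real => 'a::real_normed_vector => 'b::real_normed_algebra"
 assumes "c1_bound V f r" "c1_bound V g s"
 shows "c1_bound V (%eps p. f eps p * g eps p) (%eps. r eps * s eps)"
proof -
 obtain C where C: "C >= 0" "\<forall>\<^sub>F eps in at_right 0. 0 <= r eps & (\<forall>p\<in>V. \<exists>f'. (f eps has_derivative f') (at p) \<and>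
 norm (f eps p) <= C * r eps & (\<forall>v. norm (f' v) <= C * r eps * norm v))"
 using assms(1) unfolding c1_bound_def by blast
 obtain B where B: "B >= 0" "\<forall>\<^sub>F eps in at_right 0. 0 <= s eps & (\<forall>p\<in>V. \<exists>f'. (g eps has_derivative f') (at p) \<and>
 norm (g eps p) <= B * s eps & (\<forall>v. norm (f' v) <= B * s eps * norm v))"
 using assms(2) unfolding c1_bound_def by blast
 have "\<forall>\<^sub>F eps in at_right 0. 0 <= r eps * s eps & (\<forall>p\<in>V. \<exists>f'. ((%p. f eps p * g eps p) has_derivative f') (at p) \<and>
 norm (f eps p * g eps p) <= (2 * C * B) * (r eps * s eps) & (\<forall>v. norm (f' v) <= (2 * C * B) * (r eps * s eps) * norm v))"
 using C(2) B(2)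
 proof eventually_elim
 case (elim eps)
 have rs: "0 <= C * r eps" "0 <= B * s eps" using elim C(1) B(1) by auto
 show ?case
 proof (intro conjI ballI)
 fix p assume p: "p \<in> V"
 obtain f' where f': "(f eps has_derivative f') (at p)" "norm (f eps p) <= C * r eps"
 "!!v. norm (f' v) <= C * r eps * norm v" using elim p by blast
 obtain g' where g': "(g eps has_derivative g') (at p)" "norm (g eps p) <= B * s eps"
 "!!v. norm (g' v) <= B * s eps * norm v" using elim p by blast
 have "norm (f eps p * g' v + f' v * g eps p) <= (2 * C * B) * (r eps * s eps) * norm v" for v
 proof -
 have "norm (f eps p * g' v + f' v * g eps p) <= norm (f eps p) * norm (g' v) + norm (f' v) * norm (g eps p)"
 by (intro order_trans[OF norm_triangle_ineq] add_mono norm_mult_ineq)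
 also have "... <= (C * r eps) * (B * s eps * norm v) + (C * r eps * norm v) * (B * s eps)"
 using f'(2) g'(2) f'(3)[of v] g'(3)[of v] rs by (intro add_mono mult_mono) auto
 finally show ?thesis by (simp add: algebra_simps)
 qed
 moreover have "norm (f eps p * g eps p) <= (2 * C * B) * (r eps * s eps)"
 proof -
 have "norm (f eps p * g eps p) <= (C * r eps) * (B * s eps)"
 using f'(2) g'(2) rs by (intro order_trans[OF norm_mult_ineq] mult_mono) auto
 also have "... <= 2 * ((C * r eps) * (B * s eps))" using mult_nonneg_nonneg[OF rs] by linarith
 finally show ?thesis by (simp add: algebra_simps)
 qed
 ultimately show "\<exists>f'. ((%p. f eps p * g eps p) has_derivative f') (at p) \<and>
 norm (f eps p * g eps p) <= (2 * C * B) * (r eps * s eps) & (\<forall>v. norm (f' v) <= (2 * C * B) * (r eps * s eps) * norm v)"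
 using has_derivative_mult[OF f'(1) g'(1)] by blast
 qed (use elim in simp)
 qed
 then show ?thesis unfolding c1_bound_def using C(1) B(1) by (intro exI[of _ "2 * C * B"]) auto
qed

lemma c1_bound_linear:
 assumes "c1_bound V f r" "bounded_linear B"
 shows "c1_bound V (%eps p. B (f eps p)) r"
proof -
 obtain C where C: "C >= 0" "\<forall>\<^sub>F eps in at_right 0. 0 <= r eps & (\<forall>p\<in>V. \<exists>f'. (f eps has_derivative f') (at p) \<and>
 norm (f eps p) <= C * r eps & (\<forall>v. norm (f' v) <= C * r eps * norm v))"
 using assms(1) unfolding c1_bound_def by blast
 obtain N where N: "N > 0" "!!x. norm (B x) <= norm x * N"
 using bounded_linear.pos_bounded[OF assms(2)] by blast
 have "\<forall>\<^sub>F eps in at_right 0. 0 <= r eps & (\<forall>p\<in>V. \<exists>f'. ((%p. B (f eps p)) has_derivative f') (at p) \<and>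
 norm (B (f eps p)) <= (C * N) * r eps & (\<forall>v. norm (f' v) <= (C * N) * r eps * norm v))"
 using C(2)
 proof eventually_elim
 case (elim eps)
 show ?case
 proof (intro conjI ballI)
 fix p assume p: "p \<in> V"
 obtain f' where f': "(f eps has_derivative f') (at p)" "norm (f eps p) <= C * r eps"
 "!!v. norm (f' v) <= C * r eps * norm v" using elim p by blast
 have "norm (B (f' v)) <= (C * N) * r eps * norm v" for v
 using order_trans[OF N(2)[of "f' v"] mult_right_mono[OF f'(3)[of v], of N]] N(1) by (simp add: algebra_simps)
 moreover have "norm (B (f eps p)) <= (C * N) * r eps"
 using order_trans[OF N(2)[of "f eps p"] mult_right_mono[OF f'(2), of N]] N(1) by (simp add: algebra_simps)
 ultimately show "\<exists>f'. ((%p. B (f eps p)) has_derivative f') (at p) \<and>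
 norm (B (f eps p)) <= (C * N) * r eps & (\<forall>v. norm (f' v) <= (C * N) * r eps * norm v)"
 using bounded_linear.has_derivative[OF assms(2) f'(1)] by blast
 qed (use elim in simp)
 qed
 then show ?thesis unfolding c1_bound_def using C(1) N(1) by (intro exI[of _ "C * N"]) auto
qed

lemma c1_bound_scale:
 assumes "c1_bound V f r"
 shows "c1_bound V (%eps p. c eps *\<^sub>R f eps p) (%eps. \<bar>c eps\<bar> * r eps)"
proof -
 obtain C where C: "C >= 0" "\<forall>\<^sub>F eps in at_right 0. 0 <= r eps & (\<forall>p\<in>V. \<exists>f'. (f eps has_derivative f') (at p) \<and>
 norm (f eps p) <= C * r eps & (\<forall>v. norm (f' v) <= C * r eps * norm v))"
 using assms(1) unfolding c1_bound_def by blast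
 have "\<forall>\<^sub>F eps in at_right 0. 0 <= \<bar>c eps\<bar> * r eps & (\<forall>p\<in>V. \<exists>f'. ((%p. c eps *\<^sub>R f eps p) has_derivative f') (at p) \<and>
 norm (c eps *\<^sub>R f eps p) <= C * (\<bar>c eps\<bar> * r eps) & (\<forall>v. norm (f' v) <= C * (\<bar>c eps\<bar> * r eps) * norm v))"
 using C(2)
 proof eventually_elim
 case (elim eps)
 show ?case
 proof (intro conjI ballI)
 fix p assume p: "p \<in> V"
 obtain f' where f': "(f eps has_derivative f') (at p)" "norm (f eps p) <= C * r eps"
 "!!v. norm (f' v) <= C * r eps * norm v" using elim p by blast
 have "norm (c eps *\<^sub>R f' v) <= C * (\<bar>c eps\<bar> * r eps) * norm v" for v
 using mult_left_mono[OF f'(3)[of v], of "\<bar>c eps\<bar>"] by (simp add: algebra_simps)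
 moreover have "norm (c eps *\<^sub>R f eps p) <= C * (\<bar>c eps\<bar> * r eps)"
 using mult_left_mono[OF f'(2), of "\<bar>c eps\<bar>"] by (simp add: algebra_simps)
 ultimately show "\<exists>f'. ((%p. c eps *\<^sub>R f eps p) has_derivative f') (at p) \<and>
 norm (c eps *\<^sub>R f eps p) <= C * (\<bar>c eps\<bar> * r eps) & (\<forall>v. norm (f' v) <= C * (\<bar>c eps\<bar> * r eps) * norm v)"
 using has_derivative_scaleR_right[OF f'(1)] by blast
 qed (use elim in simp)
 qed
 then show ?thesis unfolding c1_bound_def using C(1) by (intro exI[of _ C]) auto
qed

lemma c1_bound_diff:
 assumes "c1_bound V f r" "c1_bound V g r"
 shows "c1_bound V (%eps p. f eps p - g eps p) r"
 using c1_bound_add[OF assms(1) c1_bound_linear[OF assms(2) bounded_linear_minus[OF bounded_linear_ident]]] by simp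

lemma c1_bound_Pair:
 assumes "c1_bound V f r" "c1_bound V g r"
 shows "c1_bound V (%eps p. (f eps p, g eps p)) r"
 using c1_bound_add[OF
 c1_bound_linear[OF assms(1) bounded_linear_Pair[OF bounded_linear_ident bounded_linear_zero]]
 c1_bound_linear[OF assms(2) bounded_linear_Pair[OF bounded_linear_zero bounded_linear_ident]]] by simp

lemma c1_bound_fixed:
 assumes "!!p. p \<in> V ==> (f has_derivative f' p) (at p)" "!!p. p \<in> V ==> norm (f p) <= C"
 "!!p v. p \<in> V ==> norm (f' p v) <= C * norm v" "0 <= C"
 shows "c1_bound V (%_. f) (%_. 1)"
proof -
 have "\<exists>f'. (f has_derivative f') (at p) & norm (f p) <= C * 1 & (\<forall>v. norm (f' v) <= C * 1 * norm v)" if "p \<in> V" for p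
 using assms(1-3)[OF that] by (intro exI[of _ "f' p"]) simp
 then show ?thesis unfolding c1_bound_def using assms(4) by (intro exI[of _ C]) simp
qed

lemma derivative_lipschitz:
 fixes G :: "'a::euclidean_space => 'b::real_normed_vector"
 assumes "convex S" "!!z. z \<in> S ==> (G has_derivative G' z) (at z)"
 "!!z v. z \<in> S ==> norm (G' z v) <= B * norm v" "x \<in> S" "y \<in> S"
 shows "norm (G x - G y) <= B * norm (x - y)"
proof (rule differentiable_bound[OF assms(1) _ _ assms(4,5)])
 show "(G has_derivative G' z) (at z within S)" if "z \<in> S" for z
 by (rule has_derivative_at_withinI[OF assms(2)[OF that]])
 show "onorm (G' z) <= B" if "z \<in> S" for z
 by (rule onorm_le) (rule assms(3)[OF that])
qed

text \<open>Simplified Newton iteration with the derivative A frozen at \<open>z0\<close>. If m is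
  the lower bound of A, the perturbed map minus A is Lipschitz with constant m/2 near
  \<open>z0\<close>: m/4 from the variation of \<open>D0\<close> and m/4 from the perturbation. This
  makes the iteration a contraction and also yields uniqueness and injectivity of the derivative.
  The distance to \<open>z0\<close> is measured by the perturbation at \<open>z0\<close> alone,
  which later beats the general rate \<open>r\<close>.\<close>

lemma zero_stability_local:
 fixes F0 :: "'a::euclidean_space => 'a" and Del :: "real => 'a => 'a"
 assumes "open V" "z0 \<in> V" "!!z. z \<in> V ==> (F0 has_derivative D0 z) (at z)" "F0 z0 = 0"
 "!!eta. eta > 0 ==> \<exists>rho>0. \<forall>z\<in>ball z0 rho. \<forall>v. norm (D0 z v - D0 z0 v) <= eta * norm v"
 "!!v. D0 z0 v = 0 ==> v = 0"
 "c1_bound V Del r" "(r \<longlongrightarrow> 0) (at_right 0)"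
 shows "\<exists>rho0>0. \<exists>M. \<forall>rho. 0 < rho & rho <= rho0 --> (\<forall>\<^sub>F eps in at_right 0. \<exists>z\<in>cball z0 rho.
 F0 z + Del eps z = 0 & (\<forall>w\<in>cball z0 rho. F0 w + Del eps w = 0 --> w = z) \<and>
 norm (z - z0) <= M * norm (Del eps z0) \<and>
 (\<forall>D v. ((%z. F0 z + Del eps z) has_derivative D) (at z) --> D v = 0 --> v = 0))"
proof -
 define A where "A = D0 z0"
 have blA: "bounded_linear A" unfolding A_def by (rule has_derivative_bounded_linear[OF assms(3)[OF assms(2)]])
 then have linA: "linear A" by (rule bounded_linear.linear)
 have injA: "inj A" unfolding linear_injective_0[OF linA] using assms(6) by (simp add: A_def)
 obtain m where m: "m > 0" "!!v. m * norm v <= norm (A v)"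
 using linear_inj_bounded_below_pos[OF linA injA] by blast
 obtain B where B: "linear B" "!!x. B (A x) = x" "!!x. A (B x) = x"
 using linear_injective_isomorphism[OF linA injA] by blast
 have Bn: "norm (B w) <= norm w / m" for w using m(2)[of "B w"] m(1) by (simp add: B(3) field_simps)
 obtain rho1 where r1: "rho1 > 0" "!!z v. z \<in> ball z0 rho1 ==> norm (D0 z v - A v) <= m / 4 * norm v"
 using assms(5)[of "m / 4"] m(1) unfolding A_def by auto
 obtain rho2 where r2: "rho2 > 0" "ball z0 rho2 \<subseteq> V" using assms(1,2) openE by blast
 define rho0 where "rho0 = min rho1 rho2 / 2"
 have r0: "rho0 > 0" using r1(1) r2(1) by (simp add: rho0_def)
 obtain C where C: "C >= 0" "\<forall>\<^sub>F eps in at_right 0. 0 <= r eps & (\<forall>p\<in>V. \<exists>f'. (Del eps has_derivative f') (at p) \<and>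
 norm (Del eps p) <= C * r eps & (\<forall>v. norm (f' v) <= C * r eps * norm v))"
 using assms(7) unfolding c1_bound_def by blast
 have Cr: "((%eps. C * r eps) \<longlongrightarrow> 0) (at_right 0)" using tendsto_mult_right_zero[OF assms(8)] .
 have main: "\<forall>\<^sub>F eps in at_right 0. \<exists>z\<in>cball z0 rho.
 F0 z + Del eps z = 0 & (\<forall>w\<in>cball z0 rho. F0 w + Del eps w = 0 --> w = z) \<and>
 norm (z - z0) <= 2 / m * norm (Del eps z0) \<and>
 (\<forall>D v. ((%z. F0 z + Del eps z) has_derivative D) (at z) --> D v = 0 --> v = 0)"
 if rho: "0 < rho" "rho <= rho0" for rho
 proof -
 have "\<forall>\<^sub>F eps in at_right 0. C * r eps < min (m / 4) (m * rho / 2)"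
 using order_tendstoD(2)[OF Cr, of "min (m / 4) (m * rho / 2)"] m(1) rho(1) by simp
 with C(2) show ?thesis
 proof eventually_elim
 case (elim eps)
 let ?F = "%z. F0 z + Del eps z"
 have sub: "z \<in> ball z0 rho1 & z \<in> V" if "z \<in> cball z0 rho" for z
 using that rho r0 r2(2) unfolding rho0_def by auto
 have "\<forall>p\<in>V. \<exists>f'. (Del eps has_derivative f') (at p) & norm (Del eps p) <= C * r eps & (\<forall>v. norm (f' v) <= C * r eps * norm v)"
 using elim by blast
 from bchoice[OF this] obtain D1 where D1: "!!p. p \<in> V ==> (Del eps has_derivative D1 p) (at p)"
 "!!p. p \<in> V ==> norm (Del eps p) <= C * r eps" "!!p v. p \<in> V ==> norm (D1 p v) <= C * r eps * norm v"
 by blast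
 have Fd: "(?F has_derivative (%v. D0 z v + D1 z v)) (at z)" if "z \<in> V" for z
 by (rule has_derivative_add[OF assms(3)[OF that] D1(1)[OF that]])
 have dev: "norm (D0 z v + D1 z v - A v) <= m / 2 * norm v" if "z \<in> cball z0 rho" for z v
 proof -
 have "norm (D0 z v + D1 z v - A v) <= norm (D0 z v - A v) + norm (D1 z v)"
 using norm_triangle_ineq[of "D0 z v - A v" "D1 z v"] by (simp add: algebra_simps)
 also have "... <= m / 4 * norm v + C * r eps * norm v"
 using sub[OF that] by (intro add_mono r1(2) D1(3)) auto
 also have "... <= m / 4 * norm v + m / 4 * norm v"
 using elim by (intro add_left_mono mult_right_mono) auto
 finally show ?thesis by simp
 qed
 have lip: "norm ((?F x - A x) - (?F y - A y)) <= m / 2 * norm (x - y)"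
 if "x \<in> cball z0 rho" "y \<in> cball z0 rho" for x y
 proof (rule derivative_lipschitz[OF convex_cball _ dev that])
 show "((%z. ?F z - A z) has_derivative (%v. D0 z v + D1 z v - A v)) (at z)" if "z \<in> cball z0 rho" for z
 by (rule has_derivative_diff[OF Fd bounded_linear_imp_has_derivative[OF blA]]) (use sub[OF that] in blast)
 qed
 have low: "m / 2 * norm (x - y) <= norm (?F x - ?F y)" if "x \<in> cball z0 rho" "y \<in> cball z0 rho" for x y
 proof -
 have "A x - A y = (?F x - ?F y) - ((?F x - A x) - (?F y - A y))" by simp
 then have "norm (A (x - y)) <= norm (?F x - ?F y) + norm ((?F x - A x) - (?F y - A y))"
 unfolding linear_diff[OF linA] by (metis norm_triangle_ineq4)
 then show ?thesis using m(2)[of "x - y"] lip[OF that] by simp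
 qed
 define T where "T z = z - B (?F z)" for z
 have TB: "T x - T y = - B ((?F x - A x) - (?F y - A y))" for x y
 unfolding T_def linear_diff[OF B(1)] B(2) by simp
 have TL: "dist (T x) (T y) <= 1/2 * dist x y" if "x \<in> cball z0 rho" "y \<in> cball z0 rho" for x y
 proof -
 have "norm (T x - T y) <= norm ((?F x - A x) - (?F y - A y)) / m" unfolding TB norm_minus_cancel by (rule Bn)
 also have "... <= (m / 2 * norm (x - y)) / m" using lip[OF that] m(1) by (intro divide_right_mono) auto
 finally show ?thesis using m(1) by (simp add: dist_norm)
 qed
 have z0: "z0 \<in> cball z0 rho" using rho by simp
 have "norm (T z0 - z0) <= norm (Del eps z0) / m" unfolding T_def assms(4) using Bn[of "Del eps z0"] by simp
 also have "... <= rho / 2" using D1(2)[OF assms(2)] elim m(1) by (simp add: field_simps)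
 finally have T0: "dist z0 (T z0) <= rho / 2" by (simp add: dist_norm norm_minus_commute)
 have Tin: "T ` cball z0 rho \<subseteq> cball z0 rho"
 proof
 fix w assume "w \<in> T ` cball z0 rho"
 then obtain z where z: "z \<in> cball z0 rho" "w = T z" by blast
 have "dist z0 (T z) <= dist z0 (T z0) + dist (T z0) (T z)" by (rule dist_triangle)
 also have "... <= rho / 2 + 1/2 * dist z0 z" by (intro add_mono T0 TL z0 z(1))
 also have "... <= rho" using z(1) by simp
 finally show "w \<in> cball z0 rho" using z(2) by simp
 qed
 have "\<exists>!x\<in>cball z0 rho. T x = x"
 by (rule Banach_fix[OF _ _ _ _ Tin TL]) (use z0 in \<open>auto simp: compact_imp_complete\<close>)
 then obtain z where z: "z \<in> cball z0 rho" "T z = z" by blast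
 have Fz: "?F z = 0"
 proof -
 have "A (B (?F z)) = A 0" using z(2) by (simp add: T_def)
 then show ?thesis using B(3) linear_0[OF linA] by simp
 qed
 show ?case
 proof (intro bexI[OF _ z(1)] conjI ballI impI allI)
 show "?F z = 0" by (rule Fz)
 show "w = z" if "w \<in> cball z0 rho" "?F w = 0" for w
 proof -
 have "m / 2 * norm (w - z) <= 0" using low[OF that(1) z(1)] that(2) Fz by simp
 then show ?thesis using m(1) by (simp add: mult_le_0_iff)
 qed
 show "norm (z - z0) <= 2 / m * norm (Del eps z0)"
 using low[OF z(1) z0] Fz assms(4) m(1) by (simp add: field_simps)
 fix D v assume D: "(?F has_derivative D) (at z)" "D v = 0"
 have "D = (%v. D0 z v + D1 z v)" using has_derivative_unique[OF D(1) Fd] sub[OF z(1)] by blast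
 then have "norm (A v) <= m / 2 * norm v" using dev[OF z(1), of v] D(2) by simp
 then have "m / 2 * norm v <= 0" using m(2)[of v] by simp
 then show "v = 0" using m(1) by (simp add: mult_le_0_iff)
 qed
 qed
 qed
 show ?thesis using r0 main by (intro exI[of _ rho0] conjI exI[of _ "2 / m"]) auto
qed

text \<open>Outside small balls around \<open>Z\<close> the limit map is bounded below on a compact
  set, so a small perturbation creates no further zeros there; inside the balls the local result
  applies.\<close>

theorem zero_stability:
 fixes F0 :: "'a::euclidean_space => 'a" and Del :: "real => 'a => 'a"
 assumes "open V" "compact K" "K \<subseteq> V" "finite Z" "Z \<subseteq> interior K"
 "!!z. z \<in> K ==> F0 z = 0 \<longleftrightarrow> z \<in> Z"
 "!!z. z \<in> V ==> (F0 has_derivative D0 z) (at z)"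
 "!!z0 eta. z0 \<in> Z ==> eta > 0 ==> \<exists>rho>0. \<forall>z\<in>ball z0 rho. \<forall>v. norm (D0 z v - D0 z0 v) <= eta * norm v"
 "!!z0 v. z0 \<in> Z ==> D0 z0 v = 0 ==> v = 0"
 "c1_bound V Del r" "(r \<longlongrightarrow> 0) (at_right 0)"
 shows "\<exists>sol M. \<forall>\<^sub>F eps in at_right 0. {z \<in> K. F0 z + Del eps z = 0} = (%z0. sol z0 eps) ` Z \<and>
 inj_on (%z0. sol z0 eps) Z & (\<forall>z0\<in>Z. norm (sol z0 eps - z0) <= M * norm (Del eps z0) \<and>
 (\<forall>D v. ((%z. F0 z + Del eps z) has_derivative D) (at (sol z0 eps)) --> D v = 0 --> v = 0))"
proof -
 let ?P = "%M rho eps z0 z. z \<in> cball z0 rho & F0 z + Del eps z = 0 & (\<forall>w\<in>cball z0 rho. F0 w + Del eps w = 0 --> w = z) \<and>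
 norm (z - z0) <= M * norm (Del eps z0) \<and>
 (\<forall>D v. ((%z. F0 z + Del eps z) has_derivative D) (at z) --> D v = 0 --> v = 0)"
 have ZK: "Z \<subseteq> K" using assms(5) interior_subset by blast
 define Q where "Q z0 rho0 M \<longleftrightarrow> rho0 > 0 & (\<forall>rho. 0 < rho & rho <= rho0 -->
 (\<forall>\<^sub>F eps in at_right 0. \<exists>z. ?P M rho eps z0 z))" for z0 rho0 M
 have "\<exists>rho0 M. Q z0 rho0 M" if z0: "z0 \<in> Z" for z0
 proof -
 have "z0 \<in> V" "F0 z0 = 0" using z0 ZK assms(3,6) by blast+
 from zero_stability_local[OF assms(1) this(1) assms(7) this(2) assms(8)[OF z0] assms(9)[OF z0] assms(10,11)]
 show ?thesis unfolding Q_def Bex_def by blast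
 qed
 then obtain rho0 M0 where Q: "!!z0. z0 \<in> Z ==> Q z0 (rho0 z0) (M0 z0)" by metis
 have loc: "!!z0. z0 \<in> Z ==> rho0 z0 > 0"
 "!!z0 rho. z0 \<in> Z ==> 0 < rho ==> rho <= rho0 z0 ==> \<forall>\<^sub>F eps in at_right 0. \<exists>z. ?P (M0 z0) rho eps z0 z"
 using Q unfolding Q_def by blast+
 have "\<exists>d>0. \<forall>z0\<in>Z. d <= rho0 z0" using assms(4) loc(1)
 proof (induction Z)
 case (insert a Z)
 then obtain d where "d > 0" "\<forall>z0\<in>Z. d <= rho0 z0" by auto
 then show ?case using insert.prems[of a] by (intro exI[of _ "min d (rho0 a)"]) auto
 qed (auto intro: exI[of _ 1])
 then obtain d1 where d1: "d1 > 0" "!!z0. z0 \<in> Z ==> d1 <= rho0 z0" by blast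
 obtain d2 where d2: "d2 > 0" "!!x y. x \<in> Z ==> y \<in> Z ==> x ~= y ==> d2 <= dist x y"
 proof -
 define W where "W = (%(x, y). dist x y) ` {p \<in> Z \<times> Z. fst p ~= snd p}"
 have fW: "finite W" unfolding W_def using assms(4) by simp
 show thesis
 proof (rule that[of "Min (insert 1 W)"])
 show "Min (insert 1 W) > 0" using fW by (subst Min_gr_iff) (auto simp: W_def)
 fix x y assume "x \<in> Z" "y \<in> Z" "x ~= y"
 then have "dist x y \<in> W" unfolding W_def by force
 then show "Min (insert 1 W) <= dist x y" using fW by simp
 qed
 qed
 have "\<exists>d>0. \<forall>z0\<in>Z. cball z0 d \<subseteq> K" using assms(4,5)
 proof (induction Z)
 case (insert a Z)
 then obtain d where d: "d > 0" "\<forall>z0\<in>Z. cball z0 d \<subseteq> K" by auto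
 have "a \<in> interior K" using insert.prems by blast
 then obtain e where "e > 0" "cball a e \<subseteq> K" unfolding mem_interior_cball by blast
 then show ?case using d by (intro exI[of _ "min d e"]) (auto simp: subset_iff)
 qed (auto intro: exI[of _ 1])
 then obtain d3 where d3: "d3 > 0" "!!z0. z0 \<in> Z ==> cball z0 d3 \<subseteq> K" by blast
 \<comment> \<open>\<open>d1\<close> makes the local result valid, \<open>d2 / 3\<close> keeps the
   balls around different zeros disjoint, and \<open>d3\<close> keeps them inside
   \<open>K\<close>.\<close>
 define rho where "rho = min (min d1 (d2 / 3)) d3"
 have rho: "rho > 0" "!!z0. z0 \<in> Z ==> rho <= rho0 z0" "!!z0. z0 \<in> Z ==> cball z0 rho \<subseteq> K" "3 * rho <= d2"
 using d1 d2(1) d3 by (force simp: rho_def)+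
 define M where "M = (\<Sum>z0\<in>Z. \<bar>M0 z0\<bar>)"
 have MM: "M0 z0 <= M" if "z0 \<in> Z" for z0
 using member_le_sum[of z0 Z "%z. \<bar>M0 z\<bar>"] that assms(4) by (simp add: M_def)
 have ev: "\<forall>\<^sub>F eps in at_right 0. \<forall>z0\<in>Z. \<exists>z. ?P (M0 z0) rho eps z0 z"
 using assms(4) loc(2) rho(1,2) by (intro eventually_ball_finite) auto
 define N where "N = K - (\<Union>z0\<in>Z. ball z0 rho)"
 have cN: "compact N" unfolding N_def using assms(2) by (intro compact_diff) auto
 obtain C where C: "C >= 0" "\<forall>\<^sub>F eps in at_right 0. 0 <= r eps & (\<forall>p\<in>V. \<exists>f'. (Del eps has_derivative f') (at p) \<and>
 norm (Del eps p) <= C * r eps & (\<forall>v. norm (f' v) <= C * r eps * norm v))"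
 using assms(10) unfolding c1_bound_def by blast
 have "\<exists>\<mu>>0. \<forall>z\<in>N. \<mu> <= norm (F0 z)"
 proof (cases "N = {}")
 case False
 have "continuous_on N (%z. norm (F0 z))"
 proof (intro continuous_on_norm continuous_at_imp_continuous_on ballI)
 fix z assume "z \<in> N"
 then have "z \<in> V" using assms(3) by (auto simp: N_def)
 then show "isCont F0 z" using has_derivative_continuous[OF assms(7)] by blast
 qed
 then obtain q where q: "q \<in> N" "!!z. z \<in> N ==> norm (F0 q) <= norm (F0 z)"
 using continuous_attains_inf[OF cN False] by blast
 have "q \<in> K" using q(1) by (simp add: N_def)
 moreover have "q \<notin> Z"
 proof
 assume "q \<in> Z"
 then have "q \<in> (\<Union>z0\<in>Z. ball z0 rho)" using rho(1) by (intro UN_I[of q]) auto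
 then show False using q(1) by (simp add: N_def)
 qed
 ultimately have "F0 q ~= 0" using assms(6) by blast
 then show ?thesis using q(2) by (intro exI[of _ "norm (F0 q)"]) auto
 qed (auto intro: exI[of _ 1])
 then obtain \<mu> where mu: "\<mu> > 0" "!!z. z \<in> N ==> \<mu> <= norm (F0 z)" by blast
 have "((%eps. C * r eps) \<longlongrightarrow> 0) (at_right 0)" using tendsto_mult_right_zero[OF assms(11)] .
 then have ev2: "\<forall>\<^sub>F eps in at_right 0. C * r eps < \<mu>" by (rule order_tendstoD(2)) (rule mu(1))
 define sol where "sol z0 eps = (SOME z. ?P (M0 z0) rho eps z0 z)" for z0 eps
 have "\<forall>\<^sub>F eps in at_right 0. {z \<in> K. F0 z + Del eps z = 0} = (%z0. sol z0 eps) ` Z \<and>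
 inj_on (%z0. sol z0 eps) Z & (\<forall>z0\<in>Z. norm (sol z0 eps - z0) <= M * norm (Del eps z0) \<and>
 (\<forall>D v. ((%z. F0 z + Del eps z) has_derivative D) (at (sol z0 eps)) --> D v = 0 --> v = 0))"
 using ev ev2 C(2)
 proof eventually_elim
 case (elim eps)
 have s: "?P (M0 z0) rho eps z0 (sol z0 eps)" if "z0 \<in> Z" for z0
 unfolding sol_def by (rule someI_ex[OF bspec[OF elim(1) that]])
 have "z \<in> (%z0. sol z0 eps) ` Z" if z: "z \<in> K" "F0 z + Del eps z = 0" for z
 proof -
 have "z \<notin> N"
 proof
 assume "z \<in> N"
 then have "\<mu> <= norm (F0 z)" by (rule mu(2))
 moreover have "norm (F0 z) = norm (Del eps z)" using z(2) by (metis add_eq_0_iff norm_minus_cancel)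
 moreover have "z \<in> V" using z(1) assms(3) by blast
 then have "norm (Del eps z) <= C * r eps" using elim(3) by blast
 ultimately show False using elim(2) by simp
 qed
 then have "z \<in> (\<Union>z0\<in>Z. ball z0 rho)" using z(1) by (simp add: N_def)
 then obtain z0 where z0: "z0 \<in> Z" "z \<in> ball z0 rho" by (rule UN_E)
 have "\<forall>w\<in>cball z0 rho. F0 w + Del eps w = 0 --> w = sol z0 eps" using s[OF z0(1)] by (elim conjE)
 moreover have "z \<in> cball z0 rho" using z0(2) by simp
 ultimately have "z = sol z0 eps" using z(2) by blast
 then show ?thesis using z0(1) by blast
 qed
 then have 1: "{z \<in> K. F0 z + Del eps z = 0} \<subseteq> (%z0. sol z0 eps) ` Z" by blast
 have "sol z0 eps \<in> K" if "z0 \<in> Z" for z0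
 using s[OF that] by (elim conjE) (rule subsetD[OF rho(3)[OF that]])
 moreover have "F0 (sol z0 eps) + Del eps (sol z0 eps) = 0" if "z0 \<in> Z" for z0
 using s[OF that] by (elim conjE)
 ultimately have 2: "(%z0. sol z0 eps) ` Z \<subseteq> {z \<in> K. F0 z + Del eps z = 0}" by blast
 have 3: "inj_on (%z0. sol z0 eps) Z"
 proof (rule inj_onI, rule ccontr)
 fix a b assume ab: "a \<in> Z" "b \<in> Z" "sol a eps = sol b eps" "a ~= b"
 have "dist a b <= dist a (sol a eps) + dist b (sol a eps)" by (rule dist_triangle2)
 also have "... <= rho + rho"
 proof (rule add_mono)
 have "sol a eps \<in> cball a rho" using s[OF ab(1)] by (elim conjE)
 then show "dist a (sol a eps) <= rho" by simp
 have "sol b eps \<in> cball b rho" using s[OF ab(2)] by (elim conjE)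
 then show "dist b (sol a eps) <= rho" using ab(3) by simp
 qed
 finally show False using d2(2)[OF ab(1,2,4)] rho(1,4) by linarith
 qed
 have 4: "norm (sol z0 eps - z0) <= M * norm (Del eps z0)" if "z0 \<in> Z" for z0
 proof -
 have "norm (sol z0 eps - z0) <= M0 z0 * norm (Del eps z0)" using s[OF that] by (elim conjE)
 then show ?thesis using mult_right_mono[OF MM[OF that], of "norm (Del eps z0)"] by simp
 qed
 have 5: "\<forall>D v. ((%z. F0 z + Del eps z) has_derivative D) (at (sol z0 eps)) --> D v = 0 --> v = 0" if "z0 \<in> Z" for z0
 using s[OF that] by (elim conjE)
 show ?case
 by (intro conjI ballI) (rule subset_antisym[OF 1 2] 3 4 5 | assumption)+
 qed
 then show ?thesis by blast
qed


section \<open>The regular part in a domain with a small hole\<close>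

text \<open>\<open>C1\<close> and \<open>M\<close> bound the gradient in x and the regular part
  itself on a bidisc around the origin. The later constants are built from these and
  \<open>r1\<close>, hence do not depend on the radius of the hole.\<close>

locale hole = reg_domain +
 fixes r1 C1 M :: real
 assumes r1: "0 < r1" "cball 0 (4 * r1) \<subseteq> D" and C1: "0 <= C1"
 and dx_le: "!!x y. cmod x <= 2 * r1 ==> cmod y <= 2 * r1 ==> cmod (dx (hreg D) x y) <= C1"
 and h_le: "!!x y. cmod x <= 2 * r1 ==> cmod y <= 2 * r1 ==> \<bar>hreg D x y\<bar> <= M"
begin

abbreviation "H \<equiv> hreg D"
abbreviation "He e \<equiv> hreg (D - cball 0 e)"

definition R0 :: real where "R0 = H 0 0"
text \<open>2 pi times the Green function of \<open>D\<close> with pole at the origin. It vanishes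
  on the frontier, and on the circle |x| = e it equals \<open>Lf e\<close> up to O(e).\<close>

definition g :: "complex => real" where "g x = - ln (cmod x) - H x 0"
definition Lf :: "real => real" where "Lf e = - ln e - R0"
text \<open>This is x times the complex gradient in x of ln |x - e^2/cnj y| - ln |x|: the field of
  the image of y in the circle of radius e, together with the compensating charge at 0.\<close>

definition A :: "real => complex => complex => complex" where
 "A e x y = of_real (e\<^sup>2) / (x * cnj y - of_real (e\<^sup>2))"
text \<open>What is left of the regular part of the perforated domain once the capacity term and
  both image charges are taken into account.\<close>

definition kt :: "real => complex => complex => real" where
 "kt e x y = H x y + g x * (g y / Lf e) - He e x y - (ln (cmod (x - of_real (e\<^sup>2) / cnj y)) - ln (cmod (x - 0)))"
text \<open>4e < r1 leaves room for the annulus e < |z| < 4e inside \<open>D\<close>; the last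
  inequality is what gives g <= 2 Lf outside the hole.\<close>

definition good :: "real => bool" where
 "good e \<longleftrightarrow> 0 < e & 4 * e < r1 & 1 <= Lf e & M + 2 * R0 <= - ln e"

lemma in_D: "cmod x <= 4 * r1 ==> x \<in> D"
 using r1(2) by (auto simp: subset_iff)

lemma zero_in_D: "0 \<in> D" using in_D[of 0] r1 by simp

lemma eventually_good: "\<forall>\<^sub>F e in at_right 0. good e"
proof -
 have "filterlim (%e::real. - ln e) at_top (at_right 0)"
 using ln_at_0 by (simp add: filterlim_uminus_at_bot)
 then have "\<forall>\<^sub>F e::real in at_right 0. max (1 + R0) (M + 2 * R0) <= - ln e"
 unfolding filterlim_at_top by blast
 moreover have "\<forall>\<^sub>F e::real in at_right 0. e < r1 / 4"
 using r1(1) by (intro eventually_at_right_less[THEN eventually_mono] order_tendstoD(2)[OF tendsto_ident_at]) auto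
 moreover have "\<forall>\<^sub>F e::real in at_right 0. 0 < e" by (rule eventually_at_right_less)
 ultimately show ?thesis by eventually_elim (auto simp: good_def Lf_def)
qed

lemma hreg_lipschitz:
 assumes "cmod x <= 2 * r1" "cmod x' <= 2 * r1" "cmod y <= 2 * r1"
 shows "\<bar>H x y - H x' y\<bar> <= C1 * cmod (x - x')"
proof -
 have yD: "y \<in> D" using assms(3) r1 by (intro in_D) auto
 have "norm (H x y - H x' y) <= C1 * norm (x - x')"
 proof (rule differentiable_bound[of "cball 0 (2 * r1)" "%x. H x y" "%x h. Re (dx H x y * h)"])
 fix z :: complex assume "z \<in> cball 0 (2 * r1)"
 then have z: "cmod z <= 2 * r1" by simp
 then have "z \<in> D" using r1 by (intro in_D) auto
 then show "((%x. H x y) has_derivative (%h. Re (dx H z y * h))) (at z within cball 0 (2 * r1))"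
 unfolding dx_def by (rule has_derivative_at_withinI[OF harm_has_derivative[OF hreg_props(2)[OF yD]]])
 show "onorm (%h. Re (dx H z y * h)) <= C1"
 proof (rule onorm_bound[OF C1])
 fix h
 have "\<bar>Re (dx H z y * h)\<bar> <= cmod (dx H z y) * cmod h"
 using abs_Re_le_cmod[of "dx H z y * h"] by (simp only: norm_mult)
 also have "... <= C1 * cmod h" using dx_le[OF z assms(3)] by (rule mult_right_mono) simp
 finally show "norm (Re (dx H z y * h)) <= C1 * norm h" by simp
 qed
 qed (use assms in auto)
 then show ?thesis by simp
qed

lemma g_bounds:
 assumes "good e" "e < cmod y" "cmod y < r1"
 shows "0 <= g y" "g y <= 2 * Lf e" "0 <= g y / Lf e" "g y / Lf e <= 2"
proof -
 have y: "y \<in> closure D" "y ~= 0" using in_D[of y] assms D_sub_closure by (auto simp: good_def)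
 show 0: "0 <= g y" using green_nonneg[OF zero_in_D y] by (simp add: g_def)
 have "ln e <= ln (cmod y)" using assms by (intro ln_le_cancel_iff[THEN iffD2]) (auto simp: good_def)
 have "\<bar>H y 0\<bar> <= M" using assms r1 by (intro h_le) auto
 then have 1: "g y <= 2 * Lf e"
 proof -
 have "M + 2 * R0 <= - ln e" using assms(1) by (simp add: good_def)
 moreover have "- H y 0 <= M" using \<open>\<bar>H y 0\<bar> <= M\<close> by linarith
 ultimately show ?thesis using \<open>ln e <= ln (cmod y)\<close> unfolding g_def Lf_def by argo
 qed
 then show "g y <= 2 * Lf e" .
 have "1 <= Lf e" using assms(1) by (simp add: good_def)
 then show "0 <= g y / Lf e" "g y / Lf e <= 2" using 0 1 by (simp_all add: divide_le_eq)
qed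

lemma g_harm: "harm (D - {0}) g"
 unfolding g_def
 by (intro harm_diff harm_minus harm_ln_cmod[of 0, unfolded diff_zero] harm_subset[OF hreg_props(2)[OF zero_in_D]]) auto

lemma pole_small:
 assumes "good e" "e < cmod y"
 shows "cmod (of_real (e\<^sup>2) / cnj y) < e"
proof -
 have "e * e < e * cmod y" using assms by (intro mult_strict_left_mono) (auto simp: good_def)
 moreover have "cmod (of_real (e\<^sup>2) / cnj y) = e * e / cmod y"
 by (simp only: norm_divide norm_of_real complex_mod_cnj) (simp add: power2_eq_square)
 moreover have "0 < cmod y" using assms by (auto simp: good_def)
 ultimately show ?thesis by (simp add: divide_less_eq)
qed

section \<open>Remainder estimates for a fixed radius of the hole, uniform up to its
  boundary\<close>

context
 fixes e :: real
 assumes ge: "good e"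
begin

interpretation E: reg_domain "D - cball 0 e"
 using regular_domain_minus_disc[OF reg] ge by unfold_locales (auto simp: good_def)

lemma in_E: "e < cmod x ==> cmod x < 4 * r1 ==> x \<in> D - cball 0 e"
 using in_D[of x] by auto

lemma kt_harm:
 assumes "e < cmod y" "cmod y < r1"
 shows "harm (D - cball 0 e) (%x. kt e x y)"
proof -
 have yD: "y \<in> D" "y \<in> D - cball 0 e" using in_E[of y] assms r1 by auto
 have w: "of_real (e\<^sup>2) / cnj y \<notin> D - cball 0 e" using pole_small[OF ge assms(1)] by auto
 have "harm (D - cball 0 e) (%x. (g y / Lf e) * g x)"
 by (intro harm_cmult harm_subset[OF g_harm]) (use ge in \<open>auto simp: good_def\<close>)
 then have gh: "harm (D - cball 0 e) (%x. g x * (g y / Lf e))" by (simp add: mult.commute)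
 have "(0::complex) \<notin> D - cball 0 e" using ge by (auto simp: good_def)
 then show ?thesis unfolding kt_def
 by (intro harm_diff harm_add gh harm_ln_cmod w E.hreg_props(2)[OF yD(2)] harm_subset[OF hreg_props(2)[OF yD(1)]]) auto
qed

lemma closure_E: "z \<in> closure (D - cball 0 e) ==> e <= cmod z & z \<in> closure D"
proof -
 assume z: "z \<in> closure (D - cball 0 e)"
 have "closure (D - cball 0 e) \<subseteq> - ball 0 e" by (rule closure_minimal) auto
 moreover have "closure (D - cball 0 e) \<subseteq> closure D" by (rule closure_mono) auto
 ultimately show ?thesis using z by (auto simp: subset_iff)
qed

lemma kt_continuous:
 assumes "e < cmod y" "cmod y < r1"
 shows "continuous_on (closure (D - cball 0 e)) (%x. kt e x y)"
proof -
 have yD: "y \<in> D" "y \<in> D - cball 0 e" using in_E[of y] assms r1 by auto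
 have e0: "0 < e" using ge by (simp add: good_def)
 have sub: "closure (D - cball 0 e) \<subseteq> closure D" using closure_E by blast
 have w: "of_real (e\<^sup>2) / cnj y ~= z" "z ~= 0" if "z \<in> closure (D - cball 0 e)" for z
 using pole_small[OF ge assms(1)] closure_E[OF that] e0 by auto
 show ?thesis unfolding kt_def g_def
 by (intro continuous_intros E.hreg_props(1)[OF yD(2)] continuous_on_subset[OF hreg_props(1)[OF yD(1)] sub]
 continuous_on_subset[OF hreg_props(1)[OF zero_in_D] sub]) (use w in \<open>auto\<close>)
qed

text \<open>By the maximum principle only boundary points matter. On the outer frontier
  \<open>g\<close> vanishes and a difference of two logarithms with poles at distance less than e
  survives. On |z| = e inversion gives |z - w| = e |z - y| / |y|, so all logarithms cancel and
  Lipschitz differences of the regular part remain.\<close>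

lemma kt_bound:
 assumes "e < cmod y" "cmod y < r1" "x \<in> closure (D - cball 0 e)"
 shows "\<bar>kt e x y\<bar> <= (3 * C1 + 1 / r1) * e"
proof (rule harm_max_principle[OF E.D_open E.D_bounded kt_continuous[OF assms(1,2)] kt_harm[OF assms(1,2)] _ assms(3)])
 fix z assume z: "z \<in> frontier (D - cball 0 e)"
 have e0: "0 < e" "4 * e < r1" "1 <= Lf e" using ge by (simp_all add: good_def)
 have yD: "y \<in> D" "y \<in> D - cball 0 e" using in_E[of y] assms r1 by auto
 have zc: "e <= cmod z" "z \<in> closure D" "z \<notin> D - cball 0 e"
 using E.frontier_not_D[OF z] closure_E[of z] by auto
 have Hez: "He e z y = - ln (cmod (z - y))" by (rule E.hreg_props(3)[OF yD(2) z])
 define w where "w = of_real (e\<^sup>2) / cnj y"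
 have we: "cmod w < e" unfolding w_def by (rule pole_small[OF ge assms(1)])
 show "\<bar>kt e z y\<bar> <= (3 * C1 + 1 / r1) * e"
 proof (cases "z \<in> frontier D")
 case True
 then have "z \<notin> D" using frontier_not_D by blast
 then have z4: "4 * r1 < cmod z" using in_D[of z] by linarith
 have "g z = 0" using hreg_props(3)[OF zero_in_D True] by (simp add: g_def)
 then have "kt e z y = - (ln (cmod (z - w)) - ln (cmod z))"
 using hreg_props(3)[OF yD(1) True] Hez unfolding kt_def w_def by simp
 moreover have "\<bar>ln (cmod (z - w)) - ln (cmod z)\<bar> <= \<bar>cmod (z - w) - cmod z\<bar> / r1"
 using norm_triangle_ineq2[of z w] z4 we e0 r1 by (intro abs_ln_diff_le) linarith+
 moreover have "\<bar>cmod (z - w) - cmod z\<bar> <= cmod w"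
 using norm_triangle_ineq3[of "z - w" z] by simp
 then have "\<bar>cmod (z - w) - cmod z\<bar> / r1 <= e / r1" using we r1(1) by (intro divide_right_mono) linarith+
 ultimately have "\<bar>kt e z y\<bar> <= e / r1" by linarith
 also have "... <= (3 * C1 + 1 / r1) * e" using C1 e0 by (simp add: algebra_simps)
 finally show ?thesis .
 next
 case False
 then have "z \<in> D" using closure_cases[OF zc(2)] by blast
 then have ze: "cmod z = e" using zc by auto
 have y0: "y ~= 0" "z ~= 0" "z ~= y" using assms(1) e0 ze by auto
 have "of_real (e\<^sup>2) = z * cnj z" using complex_norm_square[of z] ze by simp
 then have "z - w = z * cnj (y - z) / cnj y" unfolding w_def using y0 by (simp add: field_simps)
 then have "cmod (z - w) = e * cmod (z - y) / cmod y"
 by (simp only: norm_divide norm_mult complex_mod_cnj ze norm_minus_commute[of y z])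
 then have ln1: "ln (cmod (z - w)) - ln (cmod z) = ln (cmod (z - y)) - ln (cmod y)"
 using e0 y0 ze by (simp add: ln_div ln_mult)
 define c where "c = g y / Lf e"
 have cL: "Lf e * c = g y" using ge by (simp add: c_def good_def)
 have "ln (cmod y) = - g y - H 0 y" using hreg_sym[OF yD(1) zero_in_D] by (simp add: g_def)
 moreover have "g z = Lf e + (R0 - H z 0)" by (simp add: g_def Lf_def ze)
 moreover have "kt e z y = H z y + g z * c + ln (cmod y)"
 using ln1 Hez unfolding kt_def w_def c_def by simp
 ultimately have kte: "kt e z y = (H z y - H 0 y) + (R0 - H z 0) * c"
 using cL by (simp add: distrib_right)
 have "\<bar>H z y - H 0 y\<bar> <= C1 * e"
 using hreg_lipschitz[of z 0 y] ze e0 r1 assms by simp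
 moreover have "\<bar>R0 - H z 0\<bar> * \<bar>g y / Lf e\<bar> <= (C1 * e) * 2"
 using hreg_lipschitz[of z 0 0] ze e0 r1 g_bounds(3,4)[OF ge assms(1,2)]
 by (intro mult_mono) (auto simp: R0_def abs_minus_commute C1)
 moreover have "\<bar>kt e z y\<bar> <= \<bar>H z y - H 0 y\<bar> + \<bar>R0 - H z 0\<bar> * \<bar>g y / Lf e\<bar>"
 unfolding kte c_def abs_mult[symmetric] by (rule abs_triangle_ineq)
 ultimately have "\<bar>kt e z y\<bar> <= 3 * C1 * e" by linarith
 also have "... <= (3 * C1 + 1 / r1) * e" using r1 e0 by (simp add: algebra_simps)
 finally show ?thesis .
 qed
qed

text \<open>It coincides with \<open>kt\<close> on the circle |x| = e, but is harmonic in all of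
  \<open>D\<close> and of size O(|x|). Subtracting it produces zero boundary values on the
  hole.\<close>

definition bt :: "complex => complex => real" where
 "bt y x = (H x y - H 0 y) + (R0 - H x 0) * (g y / Lf e)"

lemma bt_bounds:
 assumes "e < cmod y" "cmod y < r1" "cmod x < 2 * r1"
 shows "\<bar>bt y x\<bar> <= 3 * C1 * cmod x" "cmod (cgrad (bt y) x) <= 3 * C1" "harm D (bt y)"
proof -
 have yD: "y \<in> D" "x \<in> D" using in_D assms r1 by auto
 have "harm D (%x. (H x y - H 0 y) + (g y / Lf e) * (R0 - H x 0))"
 by (intro harm_add harm_diff harm_cmult harm_const hreg_props(2) yD zero_in_D)
 then show "harm D (bt y)" unfolding bt_def by (simp add: mult.commute)
 have "\<bar>H x y - H 0 y\<bar> <= C1 * cmod x"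
 using hreg_lipschitz[of x 0 y] r1 assms by simp
 moreover have "\<bar>R0 - H x 0\<bar> * \<bar>g y / Lf e\<bar> <= (C1 * cmod x) * 2"
 using hreg_lipschitz[of x 0 0] r1 assms g_bounds(3,4)[OF ge assms(1,2)]
 by (intro mult_mono) (auto simp: R0_def abs_minus_commute C1)
 moreover have "\<bar>bt y x\<bar> <= \<bar>H x y - H 0 y\<bar> + \<bar>R0 - H x 0\<bar> * \<bar>g y / Lf e\<bar>"
 unfolding bt_def abs_mult[symmetric] by (rule abs_triangle_ineq)
 ultimately show "\<bar>bt y x\<bar> <= 3 * C1 * cmod x" by linarith
 have "(bt y has_derivative (%h. Re ((dx H x y - of_real (g y / Lf e) * dx H x 0) * h))) (at x)"
 proof -
 have 1: "((%x. H x y) has_derivative (%h. Re (dx H x y * h))) (at x)"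
 unfolding dx_def by (rule harm_has_derivative[OF hreg_props(2)[OF yD(1)] yD(2)])
 have 2: "((%x. H x 0) has_derivative (%h. Re (dx H x 0 * h))) (at x)"
 unfolding dx_def by (rule harm_has_derivative[OF hreg_props(2)[OF zero_in_D] yD(2)])
 define c where "c = g y / Lf e"
 show ?thesis unfolding bt_def c_def[symmetric]
 by (rule has_derivative_eq_rhs[OF has_derivative_add[OF has_derivative_diff[OF 1 has_derivative_const]
 has_derivative_mult_left[OF has_derivative_diff[OF has_derivative_const 2]]]])
 (simp add: fun_eq_iff algebra_simps)
 qed
 then have "cgrad (bt y) x = dx H x y - of_real (g y / Lf e) * dx H x 0" by (rule cgrad_eqI)
 moreover have "cmod (of_real (g y / Lf e) * dx H x 0) <= 2 * C1"
 unfolding norm_mult norm_of_real using g_bounds(3,4)[OF ge assms(1,2)] dx_le[of x 0] assms r1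
 by (intro mult_mono) auto
 ultimately show "cmod (cgrad (bt y) x) <= 3 * C1"
 using norm_triangle_ineq4[of "dx H x y" "of_real (g y / Lf e) * dx H x 0"] dx_le[of x y] assms r1 by simp
qed

text \<open>For |x| >= 2e the interior estimate on the ball of radius |x|/2 suffices. Closer to the
  hole it fails; there v = kt - bt vanishes on |z| = e, a logarithmic barrier in the annulus e < |z|
  < 4e gives |v| <= C' (|z| - e), and the interior estimate for v stays bounded. The constant 246 C1
  comes from this second case, 2 (8 * 15 + 3) C1.\<close>

lemma kt_grad:
 assumes "e < cmod y" "cmod y < r1" "e < cmod x" "cmod x < r1"
 shows "cmod x * cmod (cgrad (%x. kt e x y) x) <= (246 * C1 + 80 / r1) * e"
proof (cases "2 * e <= cmod x")
 case True
 have e0: "0 < e" using ge by (simp add: good_def)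
 have sub: "ball x (cmod x / 2) \<subseteq> D - cball 0 e"
 proof
 fix z assume "z \<in> ball x (cmod x / 2)"
 then have "cmod (x - z) < cmod x / 2" by (simp add: dist_norm)
 then have "cmod x / 2 < cmod z" "cmod z < 2 * cmod x"
 using norm_triangle_ineq2[of x "x - z"] norm_triangle_ineq2[of z x] e0 True by (auto simp: norm_minus_commute)
 then show "z \<in> D - cball 0 e" using True assms(4) r1 by (intro in_E) auto
 qed
 have "cmod (cgrad (%x. kt e x y) x) <= 4 * ((3 * C1 + 1 / r1) * e) / (cmod x / 2)"
 proof (rule cgrad_bound)
 show "harm (ball x (cmod x / 2)) (%x. kt e x y)" by (rule harm_subset[OF kt_harm[OF assms(1,2)] sub])
 show "\<bar>kt e z y\<bar> <= (3 * C1 + 1 / r1) * e" if "z \<in> ball x (cmod x / 2)" for z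
 using that sub closure_subset by (intro kt_bound[OF assms(1,2)]) blast
 qed (use assms e0 in auto)
 then have "cmod x * cmod (cgrad (%x. kt e x y) x) <= cmod x * (4 * ((3 * C1 + 1 / r1) * e) / (cmod x / 2))"
 by (rule mult_left_mono) simp
 also have "... = 8 * ((3 * C1 + 1 / r1) * e)"
 using assms(3) e0 by (subst times_divide_eq_right) auto
 also have "... = (24 * C1 + 8 / r1) * e" by (simp add: algebra_simps)
 also have "... <= (246 * C1 + 80 / r1) * e" using C1 r1 e0 by (intro mult_right_mono add_mono) (auto simp: divide_right_mono)
 finally show ?thesis .
next
 case False
 have e0: "0 < e" "4 * e < r1" using ge by (simp_all add: good_def)
 define v where "v z = kt e z y - bt y z" for z
 define C' where "C' = 15 * C1 + 1 / r1"
 have C'0: "0 <= C'" using C1 r1 by (simp add: C'_def)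
 define An where "An = ball 0 (4 * e) - cball (0::complex) e"
 have oA: "open An" "bounded An" unfolding An_def by (auto intro: open_Diff bounded_subset[of "ball 0 (4 * e)"])
 have An_iff: "z \<in> An \<longleftrightarrow> e < cmod z & cmod z < 4 * e" for z by (auto simp: An_def)
 have clA: "e <= cmod z & cmod z <= 4 * e" if "z \<in> closure An" for z
 proof -
 have "closure An \<subseteq> cball 0 (4 * e) - ball 0 e" unfolding An_def by (rule closure_minimal) auto
 then show ?thesis using that by auto
 qed
 have AD: "An \<subseteq> D - cball 0 e" using in_E e0 r1 by (auto simp: An_iff)
 have clAD: "closure An \<subseteq> closure (D - cball 0 e)" "closure An \<subseteq> D"
 proof -
 show "closure An \<subseteq> closure (D - cball 0 e)" by (rule closure_mono[OF AD])
 show "closure An \<subseteq> D"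
 proof
 fix z assume "z \<in> closure An"
 then have "cmod z <= 4 * r1" using clA[of z] e0 by linarith
 then show "z \<in> D" by (rule in_D)
 qed
 qed
 have vh: "harm An v" unfolding v_def
 using AD by (intro harm_diff harm_subset[OF kt_harm[OF assms(1,2)]] harm_subset[OF bt_bounds(3)[OF assms(1,2), of 0]])
 (use r1 in auto)
 have vc: "continuous_on (closure An) v" unfolding v_def
 by (intro continuous_on_diff continuous_on_subset[OF kt_continuous[OF assms(1,2)] clAD(1)]
 continuous_on_subset[OF harm_continuous_on[OF bt_bounds(3)[OF assms(1,2), of 0]] clAD(2)]) (use r1 in auto)
 have veq0: "v z = 0" if z: "cmod z = e" for z
 proof -
 have yD: "y \<in> D" "y \<in> D - cball 0 e" using in_E[of y] assms r1 by auto
 have zD: "z \<in> D" using z e0 r1 by (intro in_D) auto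
 have "z \<in> frontier (D - cball 0 e)"
 proof -
 have "z \<in> D \<inter> closure (- cball 0 e)"
 proof -
 have "z \<in> - ball 0 e" using z by simp
 also have "- ball 0 e = closure (- cball (0::complex) e)" using e0 by (simp add: closure_complement interior_cball)
 finally show ?thesis using zD by simp
 qed
 then have "z \<in> closure (D \<inter> - cball 0 e)" using open_Int_closure_subset[OF D_open] by blast
 then have "z \<in> closure (D - cball 0 e)" by (simp only: Diff_eq)
 moreover have "z \<notin> D - cball 0 e" using z by simp
 ultimately show ?thesis unfolding frontier_def interior_open[OF E.D_open] by blast
 qed
 from E.hreg_props(3)[OF yD(2) this] have Hez: "He e z y = - ln (cmod (z - y))" .
 define w where "w = of_real (e\<^sup>2) / cnj y"
 have y0: "y ~= 0" "z ~= 0" "z ~= y" using assms(1) e0 z by auto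
 have "of_real (e\<^sup>2) = z * cnj z" using complex_norm_square[of z] z by simp
 then have "z - w = z * cnj (y - z) / cnj y" unfolding w_def using y0 by (simp add: field_simps)
 then have "cmod (z - w) = e * cmod (z - y) / cmod y"
 by (simp only: norm_divide norm_mult complex_mod_cnj z norm_minus_commute[of y z])
 then have ln1: "ln (cmod (z - w)) - ln (cmod z) = ln (cmod (z - y)) - ln (cmod y)"
 using e0 y0 z by (simp add: ln_div ln_mult)
 define c where "c = g y / Lf e"
 have cL: "Lf e * c = g y" using ge by (simp add: c_def good_def)
 have "ln (cmod y) = - g y - H 0 y" using hreg_sym[OF yD(1) zero_in_D] by (simp add: g_def)
 moreover have "g z = Lf e + (R0 - H z 0)" by (simp add: g_def Lf_def z)
 moreover have "kt e z y = H z y + g z * c + ln (cmod y)"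
 using ln1 Hez unfolding kt_def w_def c_def by simp
 ultimately show ?thesis using cL unfolding v_def bt_def c_def[symmetric] by (simp add: distrib_right)
 qed
 have vb: "\<bar>v z\<bar> <= C' * e" if z: "z \<in> closure An" for z
 proof -
 have "\<bar>kt e z y\<bar> <= (3 * C1 + 1 / r1) * e" using kt_bound[OF assms(1,2)] clAD(1) z by blast
 moreover have "\<bar>bt y z\<bar> <= 3 * C1 * cmod z" using bt_bounds(1)[OF assms(1,2)] clA[OF z] e0 by simp
 moreover have "3 * C1 * cmod z <= 3 * C1 * (4 * e)" using clA[OF z] C1 by (intro mult_left_mono) auto
 ultimately show ?thesis unfolding v_def C'_def by (simp add: algebra_simps)
 qed
 \<comment> \<open>Makes the barrier C' e (ln |z| - ln e) dominate |v| <= C' e on the outer circle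
   |z| = 4e.\<close>
 have "ln (4::real) >= 1"
 proof -
 have "exp 1 <= (4::real)" using e_less_272 by simp
 then show ?thesis by (simp add: ln_ge_iff)
 qed
 have vbar: "\<bar>v z\<bar> <= C' * (cmod z - e)" if z: "z \<in> An" for z
 proof -
 have barrier: "\<bar>v z\<bar> <= C' * e * (ln (cmod (z - 0)) - ln e)"
 proof -
 define B where "B z = C' * e * (ln (cmod (z - 0)) - ln e)" for z :: complex
 have Bh: "harm An B" unfolding B_def by (intro harm_cmult harm_diff harm_const harm_ln_cmod) (use e0 in \<open>auto simp: An_iff\<close>)
 have "z ~= 0" if "z \<in> closure An" for z using clA[OF that] e0 by auto
 then have Bc: "continuous_on (closure An) B" unfolding B_def by (intro continuous_intros) auto
 have fr: "\<bar>v z\<bar> <= B z" if z: "z \<in> frontier An" for z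
 proof -
 have zc: "z \<in> closure An" "z \<notin> An" using z unfolding frontier_def interior_open[OF oA(1)] by auto
 then consider "cmod z = e" | "cmod z = 4 * e" using clA[OF zc(1)] by (fastforce simp: An_iff)
 then show ?thesis
 proof cases
 case 1
 then show ?thesis using veq0 by (simp add: B_def)
 next
 case 2
 have "C' * e * 1 <= C' * e * ln 4" using \<open>ln 4 >= 1\<close> C'0 e0 by (intro mult_left_mono) auto
 moreover have "B z = C' * e * ln 4" using 2 e0 by (simp add: B_def ln_mult)
 ultimately show ?thesis using vb[OF zc(1)] by simp
 qed
 qed
 have zc: "z \<in> closure An" using z closure_subset by blast
 have "v z <= B z"
 by (rule subh_le_harm[OF oA vc subh_harm[OF oA(1) vh] Bc Bh _ zc]) (use fr in force)
 moreover have "- v z <= B z"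
 by (rule subh_le_harm[OF oA continuous_on_minus[OF vc] subh_harm[OF oA(1) harm_minus[OF vh]] Bc Bh _ zc]) (use fr in force)
 ultimately show ?thesis by (simp add: B_def abs_le_iff)
 qed
 have ez: "e < cmod z" using z by (simp add: An_iff)
 then have "ln (cmod z) - ln e <= (cmod z - e) / e" using e0 by (intro ln_diff_le) linarith+
 then have "C' * e * (ln (cmod z) - ln e) <= C' * e * ((cmod z - e) / e)" using C'0 e0 by (intro mult_left_mono) auto
 then show ?thesis using barrier e0 by simp
 qed
 \<comment> \<open>The ball of radius |x| - e just reaches the circle of the hole; on it |z| - e <=
   2d, so \<open>d\<close> cancels in the gradient estimate.\<close>
 define d where "d = cmod x - e"
 have d: "0 < d" "d < e" using assms(3) False by (auto simp: d_def)
 have inA: "z \<in> An & cmod z - e <= 2 * d" if "z \<in> ball x d" for z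
 proof -
 have "cmod (x - z) < d" using that by (simp add: dist_norm)
 then have "cmod x - d < cmod z" "cmod z < cmod x + d"
 using norm_triangle_ineq2[of x "x - z"] norm_triangle_ineq2[of z x] by (auto simp: norm_minus_commute)
 then show ?thesis using d by (auto simp: An_iff d_def)
 qed
 have "cmod (cgrad v x) <= 4 * (C' * (2 * d)) / d"
 proof (rule cgrad_bound[OF _ d(1)])
 show "harm (ball x d) v" by (rule harm_subset[OF vh]) (use inA in blast)
 show "\<bar>v z\<bar> <= C' * (2 * d)" if "z \<in> ball x d" for z
 proof -
 have "\<bar>v z\<bar> <= C' * (cmod z - e)" using vbar inA[OF that] by blast
 also have "... <= C' * (2 * d)" using inA[OF that] C'0 by (intro mult_left_mono) auto
 finally show ?thesis .
 qed
 qed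
 then have gv: "cmod (cgrad v x) <= 8 * C'" using d by simp
 have xA: "x \<in> An" using assms(3) False e0 by (simp add: An_iff)
 have "cgrad (%x. kt e x y) x = cgrad v x + cgrad (bt y) x"
 proof (rule cgrad_eqI)
 have "((%z. v z + bt y z) has_derivative (%h. Re (cgrad v x * h) + Re (cgrad (bt y) x * h))) (at x)"
 by (intro has_derivative_add harm_has_derivative[OF vh xA] harm_has_derivative[OF bt_bounds(3)[OF assms(1,2), of 0]])
 (use r1 xA clAD(2) closure_subset in auto)
 then show "((%x. kt e x y) has_derivative (%h. Re ((cgrad v x + cgrad (bt y) x) * h))) (at x)"
 by (simp add: v_def algebra_simps)
 qed
 moreover have "cmod (cgrad (bt y) x) <= 3 * C1" using bt_bounds(2)[OF assms(1,2)] assms(4) r1 by simp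
 ultimately have "cmod (cgrad (%x. kt e x y) x) <= 8 * C' + 3 * C1"
 using gv norm_triangle_ineq[of "cgrad v x" "cgrad (bt y) x"] by simp
 then have "cmod x * cmod (cgrad (%x. kt e x y) x) <= (2 * e) * (8 * C' + 3 * C1)"
 using False e0 by (intro mult_mono) auto
 also have "... = (246 * C1 + 16 / r1) * e" by (simp add: C'_def algebra_simps)
 also have "... <= (246 * C1 + 80 / r1) * e" using r1 e0 by (intro mult_right_mono add_left_mono) (auto simp: divide_right_mono)
 finally show ?thesis .
qed

lemma dx_He_eq:
 assumes "e < cmod y" "cmod y < r1" "e < cmod x" "cmod x < r1"
 shows "x * dx (He e) x y + of_real (g y / Lf e) + A e x y =
 x * dx H x y - x * dx H x 0 * of_real (g y / Lf e) - x * cgrad (%x. kt e x y) x"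
proof -
 have e0: "0 < e" using ge by (simp add: good_def)
 have xD: "x \<in> D" "x \<in> D - cball 0 e" and yD: "y \<in> D" using in_E[of x] in_E[of y] assms r1 by auto
 define w where "w = of_real (e\<^sup>2) / cnj y"
 have we: "cmod w < e" unfolding w_def by (rule pole_small[OF ge assms(1)])
 have ne: "x ~= 0" "x ~= w" "y ~= 0" using assms e0 we by auto
 define c where "c = g y / Lf e"
 have d1: "((%x. H x y) has_derivative (%h. Re (dx H x y * h))) (at x)"
 unfolding dx_def by (rule harm_has_derivative[OF hreg_props(2)[OF yD] xD(1)])
 have d2: "((%x. H x 0) has_derivative (%h. Re (dx H x 0 * h))) (at x)"
 unfolding dx_def by (rule harm_has_derivative[OF hreg_props(2)[OF zero_in_D] xD(1)])
 note l0 = has_derivative_ln_cmod[OF ne(1)] and lw = has_derivative_ln_cmod[OF ne(2)]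
 note dk = harm_has_derivative[OF kt_harm[OF assms(1,2)] xD(2)]
 have "((%x. H x y + (- ln (cmod (x - 0)) - H x 0) * c - kt e x y - (ln (cmod (x - w)) - ln (cmod (x - 0))))
 has_derivative (%h. Re ((dx H x y + (- inverse (x - 0) - dx H x 0) * of_real c - cgrad (%x. kt e x y) x
 - (inverse (x - w) - inverse (x - 0))) * h))) (at x)"
 by (rule has_derivative_eq_rhs[OF has_derivative_diff[OF has_derivative_diff[OF has_derivative_add[OF d1
 has_derivative_mult_left[OF has_derivative_diff[OF has_derivative_minus[OF l0] d2]]] dk] has_derivative_diff[OF lw l0]]])
 (simp add: fun_eq_iff algebra_simps)
 moreover have "(%x. H x y + (- ln (cmod (x - 0)) - H x 0) * c - kt e x y - (ln (cmod (x - w)) - ln (cmod (x - 0))))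
 = (%x. He e x y)"
 by (simp add: kt_def g_def w_def c_def)
 ultimately have "dx (He e) x y = dx H x y + (- inverse (x - 0) - dx H x 0) * of_real c
 - cgrad (%x. kt e x y) x - (inverse (x - w) - inverse (x - 0))"
 unfolding dx_def[of "He e"] by (intro cgrad_eqI) (simp only:)
 moreover have "x * (inverse (x - w) - inverse x) = A e x y"
 proof -
 have "x * (inverse (x - w) - inverse x) = w / (x - w)" using ne by (simp add: field_simps)
 also have "... = of_real (e\<^sup>2) / (x * cnj y - of_real (e\<^sup>2))"
 proof -
 have "w * cnj y = of_real (e\<^sup>2)" using ne by (simp add: w_def)
 moreover have "w / (x - w) = (w * cnj y) / ((x - w) * cnj y)" using ne by simp
 ultimately show ?thesis by (simp only: left_diff_distrib)
 qed
 finally show ?thesis by (simp add: A_def)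
 qed
 moreover have "x * inverse x = 1" using ne(1) by simp
 moreover have "x * (P + (- inverse (x - 0) - Q) * c' - R - (inverse (x - w) - inverse (x - 0)))
 = x * P + (- (x * inverse x) - x * Q) * c' - x * R - x * (inverse (x - w) - inverse x)" for P Q R c' :: complex
 by (simp add: algebra_simps)
 ultimately have "x * dx (He e) x y = x * dx H x y + (- 1 - x * dx H x 0) * of_real c
 - x * cgrad (%x. kt e x y) x - A e x y" by (simp only:)
 then show ?thesis unfolding c_def[symmetric] by (simp add: algebra_simps)
qed

text \<open>Multiplication by x makes the expansion scale invariant: the capacity and image terms
  are kept exactly, and the error is O(|x|) uniformly down to the circle of radius e.\<close>

lemma dx_He_expansion:
 assumes "e < cmod y" "cmod y < r1" "e < cmod x" "cmod x < r1"
 shows "cmod (x * dx (He e) x y + of_real (g y / Lf e) + A e x y) <= (249 * C1 + 80 / r1) * cmod x"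
proof -
 have "cmod (x * dx H x y) <= cmod x * C1"
 unfolding norm_mult using dx_le[of x y] assms r1 by (intro mult_left_mono) auto
 moreover have "cmod (x * dx H x 0 * of_real (g y / Lf e)) <= cmod x * C1 * 2"
 unfolding norm_mult norm_of_real
 using dx_le[of x 0] assms r1 g_bounds(3,4)[OF ge assms(1,2)] C1 by (intro mult_mono) auto
 moreover have "cmod (x * cgrad (%x. kt e x y) x) <= (246 * C1 + 80 / r1) * cmod x"
 proof -
 have "(246 * C1 + 80 / r1) * e <= (246 * C1 + 80 / r1) * cmod x"
 using assms(3) C1 r1 by (intro mult_left_mono) auto
 then show ?thesis using kt_grad[OF assms] by (simp add: norm_mult)
 qed
 moreover have tri: "cmod (a - b - c) <= cmod a + cmod b + cmod c" for a b c :: complex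
 using norm_triangle_ineq4[of "a - b" c] norm_triangle_ineq4[of a b] by simp
 moreover have "(249 * C1 + 80 / r1) * cmod x = cmod x * C1 + cmod x * C1 * 2 + (246 * C1 + 80 / r1) * cmod x"
 by (simp add: algebra_simps)
 ultimately show ?thesis unfolding dx_He_eq[OF assms]
 using tri[of "x * dx H x y" "x * dx H x 0 * of_real (g y / Lf e)" "x * cgrad (%x. kt e x y) x"] by linarith
qed

end

end

lemma (in reg_domain) hole_exists:
 assumes "0 \<in> D"
 shows "\<exists>r1 C1 M. hole D r1 C1 M"
proof -
 obtain r where r: "r > 0" "cball 0 r \<subseteq> D" using D_open assms open_contains_cball by blast
 let ?K = "cball (0::complex) (r / 2) \<times> cball (0::complex) (r / 2)"
 have K: "compact ?K" "?K \<subseteq> D \<times> D" using r by (auto intro: compact_Times simp: subset_iff)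
 have "continuous_on (D \<times> D) (%p. Complex (Re (dx (hreg D) (fst p) (snd p))) (Im (dx (hreg D) (fst p) (snd p))))"
 unfolding Complex_eq by (intro continuous_intros biharm_continuous biharm_dx[OF hreg_biharm])
 then have "continuous_on ?K (%p. dx (hreg D) (fst p) (snd p))"
 using K(2) by (simp add: continuous_on_subset)
 from compact_imp_bounded[OF compact_continuous_image[OF this K(1)]]
 obtain C where C: "\<forall>v\<in>(%p. dx (hreg D) (fst p) (snd p)) ` ?K. norm v <= C" unfolding bounded_iff by blast
 have "continuous_on ?K (%p. hreg D (fst p) (snd p))"
 by (rule continuous_on_subset[OF biharm_continuous[OF hreg_biharm] K(2)])
 from compact_imp_bounded[OF compact_continuous_image[OF this K(1)]]
 obtain M where M: "\<forall>v\<in>(%p. hreg D (fst p) (snd p)) ` ?K. norm v <= M" unfolding bounded_iff by blast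
 have "hole D (r / 4) \<bar>C\<bar> M"
 proof
 show "0 < r / 4" "cball 0 (4 * (r / 4)) \<subseteq> D" "0 <= \<bar>C\<bar>" using r by auto
 fix x y :: complex assume xy: "cmod x <= 2 * (r / 4)" "cmod y <= 2 * (r / 4)"
 then have "(x, y) \<in> ?K" by simp
 then have "norm (dx (hreg D) (fst (x, y)) (snd (x, y))) <= C" "norm (hreg D (fst (x, y)) (snd (x, y))) <= M"
 using C M by blast+
 then show "cmod (dx (hreg D) x y) <= \<bar>C\<bar>" "\<bar>hreg D x y\<bar> <= M" by auto
 qed
 then show ?thesis by blast
qed


section \<open>A priori localisation of critical points\<close>

locale kr = hole +
 fixes l1 l2 :: real
 assumes l1: "0 < l1" and l2: "0 < l2"
begin

text \<open>The limit of \<open>qq\<close> at critical points: l1 times the x-equation plus l2 times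
  the y-equation leaves (l1 + l2) q = l1 l2, because x/(x - y) + y/(y - x) = 1. If |x| and |y| are
  of order e^b, then q is close to (l1 + l2) b, whence the exponent \<beta>.\<close>

definition q0 :: real where "q0 = l1 * l2 / (l1 + l2)"
definition \<beta> :: real where "\<beta> = q0 / (l1 + l2)"
text \<open>Solves l1 g(x) + l2 g(y) = q0 Lf up to o(1) for |x| = C e^\<beta> and |y| = (l2/l1) |x|;
  this is the logarithm of C.\<close>

definition lnC :: real where "lnC = (q0 * R0 - (l1 + l2) * R0 + l2 * ln (l1 / l2)) / (l1 + l2)"
definition CE :: real where "CE = 249 * C1 + 80 / r1"
text \<open>x times the complex gradient in x of the Kirchhoff-Routh function, up to a positive
  constant, with \<open>l\<close> the weight at x and \<open>m\<close> that at y. Its real part is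
  the derivative under dilations of x, its imaginary part minus that under rotations.\<close>

definition ee :: "real => real => real => complex => complex => complex" where
 "ee l m e x y = x * (of_real l * dx (He e) x x + of_real m * (dx (He e) x y + 1 / (x - y)))"
definition qq :: "real => complex => complex => real" where
 "qq e x y = (l1 * g x + l2 * g y) / Lf e"

lemma q0_pos: "0 < q0" and beta_pos: "0 < \<beta>"
 using l1 l2 by (auto simp: q0_def \<beta>_def)

lemma CE_nonneg: "0 <= CE"
 using C1 r1 by (simp add: CE_def)

lemma ee_expansion:
 assumes "good e" "e < cmod x" "cmod x < r1" "e < cmod y" "cmod y < r1" "x ~= y" "0 < l" "0 < m"
 shows "cmod (ee l m e x y + of_real ((l * g x + m * g y) / Lf e) - of_real m * (x / (x - y))
 + of_real l * A e x x + of_real m * A e x y) <= (l + m) * CE * cmod x"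
proof -
 let ?r = "%z. x * dx (He e) x z + of_real (g z / Lf e) + A e x z"
 have "ee l m e x y + of_real ((l * g x + m * g y) / Lf e) - of_real m * (x / (x - y))
 + of_real l * A e x x + of_real m * A e x y = of_real l * ?r x + of_real m * ?r y"
 by (simp add: ee_def algebra_simps add_divide_distrib)
 also have "cmod ... <= l * (CE * cmod x) + m * (CE * cmod x)"
 proof (rule order_trans[OF norm_triangle_ineq add_mono])
 show "cmod (of_real l * ?r x) <= l * (CE * cmod x)"
 unfolding norm_mult norm_of_real using dx_He_expansion[OF assms(1,2,3,2,3)] assms(7)
 by (simp add: CE_def mult_left_mono)
 show "cmod (of_real m * ?r y) <= m * (CE * cmod x)"
 unfolding norm_mult norm_of_real using dx_He_expansion[OF assms(1,4,5,2,3)] assms(8)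
 by (simp add: CE_def mult_left_mono)
 qed
 finally show ?thesis by (simp add: algebra_simps)
qed

lemma A_diag: "A e x x = of_real (e\<^sup>2 / ((cmod x)\<^sup>2 - e\<^sup>2))"
 unfolding A_def complex_norm_square[symmetric] by simp

text \<open>A Cauchy-Schwarz inequality: |x cnj y - e^2|^2 - (|x|^2 - e^2)(|y|^2 - e^2) = e^2 |x -
  y|^2, hence |A(x,y)|^2 <= A(x,x) A(y,y), and the quadratic form in (l1, l2) is nonnegative. It
  controls the image terms by sign in the region where their size is out of control.\<close>

lemma A_sum_nonneg:
 assumes "0 < e" "e < cmod x" "e < cmod y"
 shows "0 <= l1\<^sup>2 * Re (A e x x) + l2\<^sup>2 * Re (A e y y) + l1 * l2 * (Re (A e x y) + Re (A e y x))"
proof -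
 define a where "a = (cmod x)\<^sup>2 - e\<^sup>2"
 define b where "b = (cmod y)\<^sup>2 - e\<^sup>2"
 have ab: "0 < a" "0 < b" unfolding a_def b_def using assms by (auto intro!: power_strict_mono)
 have sq: "a * b <= (cmod (x * cnj y - of_real (e\<^sup>2)))\<^sup>2"
 proof -
 have "(cmod (x * cnj y - of_real (e\<^sup>2)))\<^sup>2 - a * b = e\<^sup>2 * (cmod (x - y))\<^sup>2"
 unfolding a_def b_def by (simp add: cmod_power2) (simp add: power2_eq_square algebra_simps)
 then show ?thesis by (smt (verit) mult_nonneg_nonneg zero_le_power2)
 qed
 have cn: "cmod (A e x y) <= sqrt (e\<^sup>2 / a) * sqrt (e\<^sup>2 / b)"
 proof -
 have "sqrt (a * b) <= cmod (x * cnj y - of_real (e\<^sup>2))" using sq by (simp add: real_le_lsqrt)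
 moreover have "0 < sqrt (a * b)" using ab by simp
 ultimately have "e\<^sup>2 / cmod (x * cnj y - of_real (e\<^sup>2)) <= e\<^sup>2 / sqrt (a * b)"
 by (intro divide_left_mono mult_pos_pos) auto
 moreover have "cmod (A e x y) = e\<^sup>2 / cmod (x * cnj y - of_real (e\<^sup>2))"
 unfolding A_def norm_divide norm_of_real by simp
 moreover have "sqrt (e\<^sup>2 / a) * sqrt (e\<^sup>2 / b) = e\<^sup>2 / sqrt (a * b)"
 using assms(1) by (simp add: real_sqrt_divide real_sqrt_mult power2_eq_square)
 ultimately show ?thesis by simp
 qed
 have "A e y x = cnj (A e x y)" by (simp add: A_def mult.commute)
 then have "Re (A e y x) = Re (A e x y)" by simp
 moreover have "- cmod (A e x y) <= Re (A e x y)" using abs_Re_le_cmod[of "A e x y"] by linarith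
 ultimately have "- (sqrt (e\<^sup>2 / a) * sqrt (e\<^sup>2 / b)) <= Re (A e x y)" "Re (A e y x) = Re (A e x y)" using cn by linarith+
 then have "l1 * l2 * (- 2 * (sqrt (e\<^sup>2 / a) * sqrt (e\<^sup>2 / b))) <= l1 * l2 * (Re (A e x y) + Re (A e y x))"
 using l1 l2 by (intro mult_left_mono) auto
 moreover have "l1\<^sup>2 * Re (A e x x) = (l1 * sqrt (e\<^sup>2 / a))\<^sup>2" "l2\<^sup>2 * Re (A e y y) = (l2 * sqrt (e\<^sup>2 / b))\<^sup>2"
 unfolding A_diag a_def[symmetric] b_def[symmetric] power_mult_distrib using ab by simp_all
 moreover have "0 <= (l1 * sqrt (e\<^sup>2 / a) - l2 * sqrt (e\<^sup>2 / b))\<^sup>2" by simp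
 ultimately show ?thesis by (simp add: power2_eq_square algebra_simps)
qed

definition is_crit :: "real => complex => complex => bool" where
 "is_crit e x y \<longleftrightarrow> x ~= y & ee l1 l2 e x y = 0 & ee l2 l1 e y x = 0"

text \<open>A slack with three uses, one for each entry: (q0 + sig) / min l1 l2 < 1, then qq >=
  q0/2, and finally x/(x - y) within half of \<open>X0\<close> and of 1 - \<open>X0\<close>. The
  radius \<delta>0 is chosen so that the O(|x|) errors stay below it.\<close>

definition sig :: real where
 "sig = min ((min l1 l2 - q0) / 2) (min (q0 / 4) (l2 * min l1 l2 / (l1 + l2) / 8))"
definition KK :: real where "KK = (l1 + l2) * CE"
definition \<delta>0 :: real where "\<delta>0 = min r1 (sig / (KK + 1))"
definition kap :: real where "kap = (q0 + sig) / min l1 l2"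

lemma q0_less: "q0 < l1" "q0 < l2" using l1 l2 by (auto simp: q0_def field_simps)

lemma sigma_pos: "0 < sig"
 using q0_less q0_pos l1 l2 by (auto simp: sig_def)

lemma sigma_le: "sig <= (min l1 l2 - q0) / 2" "sig <= q0 / 4" "sig <= l2 * min l1 l2 / (l1 + l2) / 8"
 unfolding sig_def by (rule min.cobounded1, (rule min.coboundedI2, rule min.cobounded1), (rule min.coboundedI2, rule min.cobounded2))

lemma KK_nonneg: "0 <= KK" using CE_nonneg l1 l2 by (simp add: KK_def)

lemma delta0: "0 < \<delta>0" "\<delta>0 <= r1" "KK * \<delta>0 <= sig"
proof -
 show "0 < \<delta>0" using r1 sigma_pos KK_nonneg by (simp add: \<delta>0_def)
 show "\<delta>0 <= r1" by (simp add: \<delta>0_def)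
 have "\<delta>0 <= sig / (KK + 1)" by (simp add: \<delta>0_def)
 then have "(KK + 1) * \<delta>0 <= sig" using KK_nonneg by (simp add: field_simps)
 then show "KK * \<delta>0 <= sig" using \<open>0 < \<delta>0\<close> by (simp add: algebra_simps)
qed

lemma kappa: "0 < kap" "kap < 1"
proof -
 have m: "0 < min l1 l2" "q0 < min l1 l2" using l1 l2 q0_less by auto
 show "0 < kap" using m sigma_pos q0_pos by (simp add: kap_def)
 have "q0 + sig < min l1 l2"
 proof -
 define mm where "mm = min l1 l2"
 have "sig <= (mm - q0) / 2" "q0 < mm" using m sigma_le(1) by (simp_all add: mm_def)
 then show ?thesis unfolding mm_def[symmetric] by argo
 qed
 then show "kap < 1" unfolding kap_def using m(1) by (subst divide_less_eq_1_pos) auto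
qed

text \<open>In the weighted sum of the two equations the image terms are dropped by their sign,
  which bounds q by q0 + sig. As both values of \<open>g\<close> are nonnegative, each is at most
  kap times Lf with kap < 1. So |x| and |y| are at least a constant times e^kap, far from the hole
  on its own scale.\<close>

lemma crit_lower_bound:
 assumes "good e" "e < cmod x" "cmod x < \<delta>0" "e < cmod y" "cmod y < \<delta>0" "is_crit e x y"
 shows "kap * ln e - (M + \<bar>R0\<bar>) <= ln (cmod x)" "kap * ln e - (M + \<bar>R0\<bar>) <= ln (cmod y)"
proof -
 have r: "cmod x < r1" "cmod y < r1" using assms delta0 by linarith+
 have e0: "0 < e" using assms(1) by (simp add: good_def)
 have L: "1 <= Lf e" using assms(1) by (simp add: good_def)
 define q where "q = qq e x y"
 define X where "X = x / (x - y)"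
 have xy: "x ~= y" "ee l1 l2 e x y = 0" "ee l2 l1 e y x = 0" using assms(6) by (auto simp: is_crit_def)
 have Y: "y / (y - x) = 1 - X" using xy(1) by (simp add: X_def field_simps)
 have q2: "(l2 * g y + l1 * g x) / Lf e = q" "(l1 * g x + l2 * g y) / Lf e = q" by (simp_all add: q_def qq_def add.commute)
 define R1 where "R1 = of_real q - of_real l2 * X + of_real l1 * A e x x + of_real l2 * A e x y"
 define R2 where "R2 = of_real q - of_real l1 * (1 - X) + of_real l2 * A e y y + of_real l1 * A e y x"
 have "cmod R1 <= KK * cmod x"
 using ee_expansion[OF assms(1,2) r(1) assms(4) r(2) xy(1) l1 l2] unfolding xy(2) X_def[symmetric] q2
 by (simp add: R1_def KK_def)
 also have "... <= KK * \<delta>0" using assms(3) KK_nonneg by (intro mult_left_mono) auto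
 finally have b1: "cmod R1 <= sig" using delta0 by linarith
 have "cmod R2 <= KK * cmod y"
 using ee_expansion[OF assms(1,4) r(2) assms(2) r(1) xy(1)[symmetric] l2 l1] unfolding xy(3) Y q2
 by (simp add: R2_def KK_def add.commute)
 also have "... <= KK * \<delta>0" using assms(5) KK_nonneg by (intro mult_left_mono) auto
 finally have b2: "cmod R2 <= sig" using delta0 by linarith
 have "l1 * Re R1 + l2 * Re R2 = (l1 + l2) * q - l1 * l2
 + (l1\<^sup>2 * Re (A e x x) + l2\<^sup>2 * Re (A e y y) + l1 * l2 * (Re (A e x y) + Re (A e y x)))"
 unfolding R1_def R2_def by (simp add: power2_eq_square algebra_simps)
 moreover have "l1 * Re R1 + l2 * Re R2 <= l1 * sig + l2 * sig"
 using b1 b2 abs_Re_le_cmod[of R1] abs_Re_le_cmod[of R2] l1 l2 by (intro add_mono mult_left_mono) auto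
 moreover have "(l1 + l2) * q0 = l1 * l2" using l1 l2 by (simp add: q0_def)
 moreover have "(l1 + l2) * (q0 + sig) = (l1 + l2) * q0 + l1 * sig + l2 * sig" by (simp add: algebra_simps)
 ultimately have "(l1 + l2) * q <= (l1 + l2) * (q0 + sig)"
 using A_sum_nonneg[OF e0 assms(2,4)] by linarith
 then have q: "q <= q0 + sig" using l1 l2 by (simp add: mult_le_cancel_left)
 have gx: "0 <= g x" "0 <= g y" using g_bounds(1)[OF assms(1)] assms r by blast+
 have qL: "q * Lf e = l1 * g x + l2 * g y" using L by (simp add: q_def qq_def)
 have m: "0 < min l1 l2" using l1 l2 by simp
 have "min l1 l2 * z <= q * Lf e" if "z = g x \<or> z = g y" for z
 proof -
 have "min l1 l2 * g x <= l1 * g x" "min l1 l2 * g y <= l2 * g y" using gx by (auto intro!: mult_right_mono)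
 moreover have "0 <= l1 * g x" "0 <= l2 * g y" using gx l1 l2 by auto
 ultimately show ?thesis using qL that by auto
 qed
 moreover have "q * Lf e <= (q0 + sig) * Lf e" using q L by (intro mult_right_mono) auto
 ultimately have "z <= kap * Lf e" if "z = g x \<or> z = g y" for z
 using that m unfolding kap_def by (fastforce simp: field_simps)
 then have gz: "g x <= kap * Lf e" "g y <= kap * Lf e" by blast+
 have "kap * Lf e <= - (kap * ln e) + \<bar>R0\<bar>"
 proof -
 have "- (kap * R0) <= kap * \<bar>R0\<bar>" using kappa by (metis abs_ge_minus_self mult_left_mono mult_minus_right less_imp_le)
 also have "... <= 1 * \<bar>R0\<bar>" using kappa by (intro mult_right_mono) auto
 finally show ?thesis by (simp add: Lf_def algebra_simps)
 qed
 moreover have "\<bar>H x 0\<bar> <= M" "\<bar>H y 0\<bar> <= M" using r r1 by (auto intro!: h_le)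
 ultimately show "kap * ln e - (M + \<bar>R0\<bar>) <= ln (cmod x)" "kap * ln e - (M + \<bar>R0\<bar>) <= ln (cmod y)"
 using gz unfolding g_def by linarith+
qed

text \<open>The bound for the image terms that results from |x|, |y| >= const e^kap, with t = -ln e;
  it is exponentially small in t.\<close>

definition \<alpha> :: "real => real" where
 "\<alpha> t = 1 / (exp (2 * (1 - kap) * t - 2 * (M + \<bar>R0\<bar>)) - 1)"

lemma A_small:
 assumes "0 < e" "kap * ln e - (M + \<bar>R0\<bar>) <= ln (cmod x)" "kap * ln e - (M + \<bar>R0\<bar>) <= ln (cmod y)"
 "0 < cmod x" "0 < cmod y" "1 < exp (2 * (1 - kap) * (- ln e) - 2 * (M + \<bar>R0\<bar>))"
 shows "cmod (A e x y) <= \<alpha> (- ln e)"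
proof -
 define E where "E = exp (2 * (1 - kap) * (- ln e) - 2 * (M + \<bar>R0\<bar>))"
 have E1: "1 < E" using assms(6) by (simp add: E_def)
 have "e\<^sup>2 * E = exp (2 * ln e) * E" using assms(1) exp_double[of "ln e"] by simp
 also have "... = exp ((kap * ln e - (M + \<bar>R0\<bar>)) + (kap * ln e - (M + \<bar>R0\<bar>)))"
 unfolding E_def exp_add[symmetric] by (simp add: algebra_simps)
 also have "... <= exp (ln (cmod x) + ln (cmod y))"
 unfolding exp_le_cancel_iff using assms(2,3) by (rule add_mono)
 also have "... = cmod x * cmod y" using assms(4,5) by (simp add: exp_add)
 finally have xy: "e\<^sup>2 * E <= cmod x * cmod y" .
 have "cmod x * cmod y - e\<^sup>2 <= cmod (x * cnj y - of_real (e\<^sup>2))"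
 using norm_triangle_ineq2[of "x * cnj y" "of_real (e\<^sup>2)"] by (simp add: norm_mult norm_power)
 then have den: "e\<^sup>2 * (E - 1) <= cmod (x * cnj y - of_real (e\<^sup>2))" using xy by (simp add: algebra_simps)
 have pos: "0 < e\<^sup>2 * (E - 1)" using assms(1) E1 by simp
 have "cmod (A e x y) = e\<^sup>2 / cmod (x * cnj y - of_real (e\<^sup>2))"
 unfolding A_def norm_divide norm_of_real by simp
 also have "... <= e\<^sup>2 / (e\<^sup>2 * (E - 1))"
 by (rule divide_left_mono[OF den _ mult_pos_pos[OF less_le_trans[OF pos den] pos]]) simp
 also have "... = 1 / (E - 1)" using assms(1) by simp
 finally show ?thesis by (simp add: \<alpha>_def E_def)
qed

lemma alpha_limits: "(\<alpha> \<longlongrightarrow> 0) at_top" "((%t. t * \<alpha> t) \<longlongrightarrow> 0) at_top"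
 "filterlim (%t. exp (2 * (1 - kap) * t - 2 * (M + \<bar>R0\<bar>))) at_top at_top"
proof -
 define a where "a = 2 * (1 - kap)"
 define b where "b = 2 * (M + \<bar>R0\<bar>)"
 have a: "a > 0" using kappa by (simp add: a_def)
 show "(\<alpha> \<longlongrightarrow> 0) at_top" unfolding \<alpha>_def[abs_def] a_def[symmetric] b_def[symmetric] using a by real_asymp
 show "((%t. t * \<alpha> t) \<longlongrightarrow> 0) at_top" unfolding \<alpha>_def[abs_def] a_def[symmetric] b_def[symmetric] using a by real_asymp
 show "filterlim (%t. exp (2 * (1 - kap) * t - 2 * (M + \<bar>R0\<bar>))) at_top at_top"
 unfolding a_def[symmetric] b_def[symmetric] using a by real_asymp
qed

definition X0 :: real where "X0 = l1 / (l1 + l2)"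
definition errf :: "real => complex => complex => real" where
 "errf e x y = KK * max (cmod x) (cmod y) + (l1 + l2) * \<alpha> (- ln e)"

text \<open>With X = x/(x - y) and 1 - X = y/(y - x) the equations read l2 X = q + error and l1 (1 -
  X) = q + error. The combination with weights l1 and l2 eliminates X and determines q; then X
  follows from the first equation.\<close>

lemma crit_estimates:
 assumes "good e" "e < cmod x" "cmod x < \<delta>0" "e < cmod y" "cmod y < \<delta>0" "is_crit e x y"
 "1 < exp (2 * (1 - kap) * (- ln e) - 2 * (M + \<bar>R0\<bar>))"
 shows "\<bar>qq e x y - q0\<bar> <= errf e x y" "cmod (x / (x - y) - of_real X0) <= 2 * errf e x y / l2"
proof -
 have r: "cmod x < r1" "cmod y < r1" using assms delta0 by linarith+
 have e0: "0 < e" using assms(1) by (simp add: good_def)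
 define q where "q = qq e x y"
 define X where "X = x / (x - y)"
 define err where "err = errf e x y"
 have xy: "x ~= y" "ee l1 l2 e x y = 0" "ee l2 l1 e y x = 0" using assms(6) by (auto simp: is_crit_def)
 have Y: "y / (y - x) = 1 - X" using xy(1) by (simp add: X_def field_simps)
 have q2: "(l2 * g y + l1 * g x) / Lf e = q" "(l1 * g x + l2 * g y) / Lf e = q" by (simp_all add: q_def qq_def add.commute)
 note lb = crit_lower_bound[OF assms(1-6)]
 have pos: "0 < cmod x" "0 < cmod y" using assms(2,4) e0 by linarith+
 have A1: "cmod (A e x x) <= \<alpha> (- ln e)" "cmod (A e x y) <= \<alpha> (- ln e)"
 "cmod (A e y y) <= \<alpha> (- ln e)" "cmod (A e y x) <= \<alpha> (- ln e)"
 using A_small[OF e0 lb(1) lb(1) pos(1) pos(1) assms(7)] A_small[OF e0 lb(1) lb(2) pos(1) pos(2) assms(7)]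
 A_small[OF e0 lb(2) lb(2) pos(2) pos(2) assms(7)] A_small[OF e0 lb(2) lb(1) pos(2) pos(1) assms(7)] by auto
 have tri: "cmod (a - b) <= err" if ab: "cmod (b - a + of_real l * u + of_real m * v) <= KK * cmod z"
 "cmod u <= \<alpha> (- ln e)" "cmod v <= \<alpha> (- ln e)" "0 < l" "0 < m" "l + m = l1 + l2" "z = x \<or> z = y" for a b u v z l m
 proof -
 have "a - b = of_real l * u + of_real m * v - (b - a + of_real l * u + of_real m * v)" by simp
 then have "cmod (a - b) <= cmod (of_real l * u + of_real m * v) + cmod (b - a + of_real l * u + of_real m * v)"
 by (metis norm_triangle_ineq4)
 also have "... <= (l * \<alpha> (- ln e) + m * \<alpha> (- ln e)) + KK * cmod z"
 proof (rule add_mono[OF _ ab(1)])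
 have "cmod (of_real l * u + of_real m * v) <= l * cmod u + m * cmod v"
 using norm_triangle_ineq[of "of_real l * u" "of_real m * v"] ab(4,5) by (simp add: norm_mult)
 also have "... <= l * \<alpha> (- ln e) + m * \<alpha> (- ln e)" using ab by (intro add_mono mult_left_mono) auto
 finally show "cmod (of_real l * u + of_real m * v) <= l * \<alpha> (- ln e) + m * \<alpha> (- ln e)" .
 qed
 also have "... <= (l1 + l2) * \<alpha> (- ln e) + KK * max (cmod x) (cmod y)"
 using ab(6,7) KK_nonneg by (intro add_mono mult_left_mono) (auto simp flip: ab(6) simp: distrib_right)
 finally show ?thesis by (simp add: err_def errf_def)
 qed
 have 1: "cmod (of_real l2 * X - of_real q) <= err"
 proof (rule tri[OF _ A1(1,2) l1 l2])
 show "cmod (of_real q - of_real l2 * X + of_real l1 * A e x x + of_real l2 * A e x y) <= KK * cmod x"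
 using ee_expansion[OF assms(1,2) r(1) assms(4) r(2) xy(1) l1 l2] unfolding xy(2) X_def[symmetric] q2
 by (simp add: KK_def)
 qed auto
 have 2: "cmod (of_real l1 * (1 - X) - of_real q) <= err"
 proof (rule tri[OF _ A1(3,4) l2 l1])
 show "cmod (of_real q - of_real l1 * (1 - X) + of_real l2 * A e y y + of_real l1 * A e y x) <= KK * cmod y"
 using ee_expansion[OF assms(1,4) r(2) assms(2) r(1) xy(1)[symmetric] l2 l1] unfolding xy(3) Y q2
 by (simp add: KK_def add.commute)
 qed auto
 have "of_real ((l1 + l2) * (q0 - q)) = of_real l1 * (of_real l2 * X - of_real q) + of_real l2 * (of_real l1 * (1 - X) - of_real q)"
 proof -
 have "(l1 + l2) * (q0 - q) = l1 * l2 - (l1 + l2) * q" using l1 l2 by (simp add: q0_def right_diff_distrib)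
 then show ?thesis by (simp add: algebra_simps)
 qed
 then have "cmod (of_real ((l1 + l2) * (q0 - q))) <= l1 * err + l2 * err"
 using 1 2 l1 l2 by (simp only:) (intro order_trans[OF norm_triangle_ineq add_mono]; simp add: norm_mult mult_left_mono)
 then have "(l1 + l2) * \<bar>q0 - q\<bar> <= (l1 + l2) * err"
 unfolding norm_of_real abs_mult using l1 l2 by (simp add: distrib_right)
 then have qe: "\<bar>q0 - q\<bar> <= err" using l1 l2 by (simp add: mult_le_cancel_left)
 then show "\<bar>qq e x y - q0\<bar> <= errf e x y" by (simp add: q_def err_def abs_minus_commute)
 have "of_real l2 * (X - of_real X0) = (of_real l2 * X - of_real q) - of_real (q0 - q)"
 using l1 l2 by (simp add: X0_def q0_def algebra_simps)
 then have "cmod (of_real l2 * (X - of_real X0)) <= cmod (of_real l2 * X - of_real q) + cmod (of_real (q0 - q))"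
 using norm_triangle_ineq4[of "of_real l2 * X - of_real q" "of_real (q0 - q)"] by (simp only:)
 also have "... <= err + err" using 1 qe by (intro add_mono) (simp_all only: norm_of_real)
 also have "cmod (of_real l2 * (X - of_real X0)) = l2 * cmod (X - of_real X0)" using l2 by (simp add: norm_mult)
 finally have "l2 * cmod (X - of_real X0) <= err + err" .
 then show "cmod (x / (x - y) - of_real X0) <= 2 * errf e x y / l2"
 using l2 by (simp add: X_def err_def field_simps)
qed

lemma X0_bounds: "0 < X0" "0 < 1 - X0" "X0 < 1" "1 - X0 = l2 / (l1 + l2)"
 using l1 l2 by (auto simp: X0_def field_simps)

text \<open>Neither X nor 1 - X is small, so x (1 - X) = - y X makes |x| and |y| comparable. This
  allows bounding the larger of the two by means of \<open>qq\<close>.\<close>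

lemma crit_comparable:
 assumes "good e" "e < cmod x" "cmod x < \<delta>0" "e < cmod y" "cmod y < \<delta>0" "is_crit e x y"
 "1 < exp (2 * (1 - kap) * (- ln e) - 2 * (M + \<bar>R0\<bar>))" "(l1 + l2) * \<alpha> (- ln e) <= sig"
 defines "k \<equiv> X0 * (1 - X0) / 3"
 shows "k * max (cmod x) (cmod y) <= cmod x" "k * max (cmod x) (cmod y) <= cmod y" "q0 / 2 <= qq e x y"
proof -
 define X where "X = x / (x - y)"
 have xy: "x ~= y" using assms(6) by (simp add: is_crit_def)
 have e0: "0 < e" using assms(1) by (simp add: good_def)
 have "KK * max (cmod x) (cmod y) <= KK * \<delta>0" using assms(3,5) KK_nonneg by (intro mult_left_mono) auto
 then have err: "errf e x y <= 2 * sig" using assms(8) delta0 by (simp add: errf_def)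
 show "q0 / 2 <= qq e x y" using sigma_le(2) crit_estimates(1)[OF assms(1-7)] err by linarith
 have "4 * sig / l2 <= 4 * (l2 * min l1 l2 / (l1 + l2) / 8) / l2"
 using sigma_le(3) l2 by (intro divide_right_mono mult_left_mono) auto
 also have "... = min l1 l2 / (l1 + l2) / 2"
 proof -
 have "4 * (a * b / c / 8) / a = b / c / 2" if "0 < a" for a b c :: real using that by simp
 from this[OF l2] show ?thesis .
 qed
 finally have f1: "4 * sig / l2 <= min l1 l2 / (l1 + l2) / 2" .
 have f2: "cmod (X - of_real X0) <= 4 * sig / l2"
 proof -
 have "2 * errf e x y / l2 <= 4 * sig / l2" using err l2 by (intro divide_right_mono) auto
 then show ?thesis using crit_estimates(2)[OF assms(1-7)] unfolding X_def by (rule order_trans[rotated])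
 qed
 have f3: "min l1 l2 / (l1 + l2) <= X0" "min l1 l2 / (l1 + l2) <= 1 - X0"
 unfolding X0_bounds(4) unfolding X0_def using l1 l2 by (auto intro!: divide_right_mono)
 have d1: "cmod (X - of_real X0) <= X0 / 2"
 by (rule order_trans[OF f2 order_trans[OF f1 divide_right_mono[OF f3(1)]]]) simp
 have d2: "cmod (X - of_real X0) <= (1 - X0) / 2"
 by (rule order_trans[OF f2 order_trans[OF f1 divide_right_mono[OF f3(2)]]]) simp
 note d = d1 d2
 have near: "v / 2 <= cmod U & cmod U <= 3 / 2" if "cmod (U - of_real v) <= v / 2" "0 < v" "v < 1" for U v
 proof -
 have b: "\<bar>cmod U - v\<bar> <= v / 2" using norm_triangle_ineq3[of U "of_real v"] that by simp
 show ?thesis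
 proof
 show "v / 2 <= cmod U" using b by arith
 show "cmod U <= 3 / 2" using b that(3) by arith
 qed
 qed
 have Xl: "X0 / 2 <= cmod X" "cmod X <= 3 / 2" using near[OF d(1)] X0_bounds(1,3) by simp_all
 have "(1 - X) - of_real (1 - X0) = - (X - of_real X0)" by simp
 then have "cmod ((1 - X) - of_real (1 - X0)) <= (1 - X0) / 2" using d(2) by (simp only: norm_minus_cancel)
 from near[OF this] have Yl: "(1 - X0) / 2 <= cmod (1 - X)" "cmod (1 - X) <= 3 / 2"
 using X0_bounds(1,2) by simp_all
 have eqs: "x * (1 - X) = - (y * X)" using xy by (simp add: X_def field_simps)
 then have eq: "cmod x * cmod (1 - X) = cmod y * cmod X" by (metis norm_minus_cancel norm_mult)
 have k3: "k <= X0 / 3" "k <= (1 - X0) / 3" "0 < k" "k <= 1"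
 proof -
 have gen: "v * w / 3 <= v / 3 & v * w / 3 <= w / 3 & 0 < v * w / 3 & v * w / 3 <= 1"
 if "0 < v" "v < 1" "0 < w" "w < 1" for v w :: real
 proof -
 have a: "v * w <= v" "v * w <= w" using that mult_left_le[of w v] mult_left_le_one_le[of w v] by auto
 have b: "0 < v * w" using that by simp
 show ?thesis by (intro conjI) (use a b that in linarith)+
 qed
 show "k <= X0 / 3" "k <= (1 - X0) / 3" "0 < k" "k <= 1"
 unfolding k_def using gen[of X0 "1 - X0"] X0_bounds(1-3) by auto
 qed
 have "cmod y * (X0 / 2) <= cmod y * cmod X" using Xl by (intro mult_left_mono) auto
 also have "... <= cmod x * (3 / 2)" unfolding eq[symmetric] using Yl by (intro mult_left_mono) auto
 finally have 1: "(X0 / 3) * cmod y <= cmod x" by (simp add: mult.commute)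
 have "cmod x * ((1 - X0) / 2) <= cmod x * cmod (1 - X)" using Yl by (intro mult_left_mono) auto
 also have "... <= cmod y * (3 / 2)" unfolding eq using Xl by (intro mult_left_mono) auto
 finally have 2: "((1 - X0) / 3) * cmod x <= cmod y" by (simp add: mult.commute)
 have "k * cmod y <= cmod x" using 1 mult_right_mono[OF k3(1), of "cmod y"] by simp
 moreover have "k * cmod x <= cmod y" using 2 mult_right_mono[OF k3(2), of "cmod x"] by simp
 moreover have "k * cmod x <= cmod x" "k * cmod y <= cmod y" using k3(4) by (simp_all add: mult_left_le_one_le k3(3) less_imp_le)
 ultimately show "k * max (cmod x) (cmod y) <= cmod x" "k * max (cmod x) (cmod y) <= cmod y"
 by (auto simp: max_def)
qed

text \<open>Two passes. First qq >= q0/2 and comparability force |x|, |y| <= const e^(\<beta>/2).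
  The errors in q then decay faster than 1/Lf, so (q - q0) Lf tends to 0, which is exactly the
  accuracy needed to read off ln |x| - \<beta> ln e.\<close>

theorem crit_limit:
 fixes e :: "nat => real" and x y :: "nat => complex"
 assumes "e \<longlonglongrightarrow> 0" "!!n. good (e n)" "!!n. e n < cmod (x n)" "!!n. cmod (x n) < \<delta>0"
 "!!n. e n < cmod (y n)" "!!n. cmod (y n) < \<delta>0" "!!n. is_crit (e n) (x n) (y n)"
 shows "(%n. y n / x n) \<longlonglongrightarrow> of_real (- l2 / l1)" "(%n. cmod (x n) / e n powr \<beta>) \<longlonglongrightarrow> exp lnC"
proof -
 define t where "t n = - ln (e n)" for n
 define s where "s n = max (cmod (x n)) (cmod (y n))" for n
 have e0: "0 < e n" for n using assms(2)[of n] by (simp add: good_def)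
 have pos: "0 < cmod (x n)" "0 < cmod (y n)" for n using assms(3,5)[of n] e0[of n] by linarith+
 have e1: "e n ~= 0" for n using e0[of n] by simp
 have "filterlim e (at_right 0) sequentially"
 unfolding filterlim_at using assms(1) e0 e1 by (auto intro!: always_eventually simp: order.strict_implies_not_eq)
 then have tt: "filterlim t at_top sequentially" unfolding t_def
 using filterlim_compose[OF ln_at_0] by (simp add: filterlim_uminus_at_bot)
 have a1: "(%n. \<alpha> (t n)) \<longlonglongrightarrow> 0" by (rule filterlim_compose[OF alpha_limits(1) tt])
 have a2: "(%n. t n * \<alpha> (t n)) \<longlonglongrightarrow> 0" by (rule filterlim_compose[OF alpha_limits(2) tt])
 have ev1: "\<forall>\<^sub>F n in sequentially. 1 < exp (2 * (1 - kap) * (- ln (e n)) - 2 * (M + \<bar>R0\<bar>))"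
 using filterlim_compose[OF alpha_limits(3) tt] unfolding filterlim_at_top_dense t_def by blast
 have "(%n. (l1 + l2) * \<alpha> (t n)) \<longlonglongrightarrow> 0" using tendsto_mult_right_zero[OF a1] .
 then have "\<forall>\<^sub>F n in sequentially. (l1 + l2) * \<alpha> (t n) < sig" by (rule order_tendstoD(2)) (rule sigma_pos)
 then have ev2: "\<forall>\<^sub>F n in sequentially. (l1 + l2) * \<alpha> (- ln (e n)) <= sig"
 by eventually_elim (simp add: t_def)
 define k where "k = X0 * (1 - X0) / 3"
 have k0: "0 < k" using X0_bounds(1,2) by (simp only: k_def mult_pos_pos divide_pos_pos zero_less_numeral)
 define cst where "cst = M - ln k + \<beta> * R0 / 2"
 have ls: "\<forall>\<^sub>F n in sequentially. ln (s n) <= cst - \<beta> / 2 * t n"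
 using ev1 ev2
 proof eventually_elim
 case (elim n)
 note c = crit_comparable[OF assms(2-7) elim]
 have s0: "0 < s n" unfolding s_def by (rule less_le_trans[OF pos(1) max.cobounded1])
 have r: "cmod (x n) < r1" "cmod (y n) < r1" using assms(4,6)[of n] delta0 by linarith+
 have ks: "ln k + ln (s n) <= ln (cmod (x n))" "ln k + ln (s n) <= ln (cmod (y n))"
 using c(1,2) pos[of n] s0 k0 unfolding k_def[symmetric] s_def[symmetric]
 by (auto simp: ln_mult_pos[symmetric])
 have H: "\<bar>H (x n) 0\<bar> <= M" "\<bar>H (y n) 0\<bar> <= M" using r r1 by (auto intro!: h_le)
 have L1: "1 <= Lf (e n)" using assms(2)[of n] by (simp add: good_def)
 have "q0 / 2 * Lf (e n) <= qq (e n) (x n) (y n) * Lf (e n)" using c(3) L1 by (intro mult_right_mono) auto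
 also have "... = l1 * g (x n) + l2 * g (y n)" using L1 by (simp add: qq_def)
 also have "... <= l1 * (M - ln k - ln (s n)) + l2 * (M - ln k - ln (s n))"
 using l1 l2 ks H by (intro add_mono mult_left_mono) (auto simp: g_def)
 also have "... = (l1 + l2) * (M - ln k - ln (s n))" by (rule distrib_right[symmetric])
 finally have "q0 / 2 * Lf (e n) <= (l1 + l2) * (M - ln k - ln (s n))" .
 moreover have "(l1 + l2) * \<beta> = q0" using l1 l2 by (simp add: \<beta>_def)
 then have "(l1 + l2) * (\<beta> / 2 * Lf (e n)) = q0 / 2 * Lf (e n)" by (metis mult.assoc times_divide_eq_right)
 ultimately have "(l1 + l2) * (\<beta> / 2 * Lf (e n)) <= (l1 + l2) * (M - ln k - ln (s n))" by (simp only:)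
 then have "\<beta> / 2 * Lf (e n) <= M - ln k - ln (s n)" using l1 l2 by (simp add: mult_le_cancel_left)
 then show ?case by (simp add: cst_def Lf_def t_def field_simps)
 qed
 have sb: "\<forall>\<^sub>F n in sequentially. s n <= exp (cst - \<beta> / 2 * t n)"
 using ls
 proof eventually_elim
 case (elim n)
 have "0 < s n" unfolding s_def by (rule less_le_trans[OF pos(1) max.cobounded1])
 then have "s n = exp (ln (s n))" by simp
 also have "... <= exp (cst - \<beta> / 2 * t n)" using elim by simp
 finally show ?case .
 qed
 have b2: "0 < \<beta> / 2" using beta_pos by simp
 have "((%u. exp (cst - \<beta> / 2 * u)) \<longlongrightarrow> 0) at_top" "((%u. u * exp (cst - \<beta> / 2 * u)) \<longlongrightarrow> 0) at_top"
 using beta_pos by real_asymp+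
 then have se: "(%n. exp (cst - \<beta> / 2 * t n)) \<longlonglongrightarrow> 0" "(%n. t n * exp (cst - \<beta> / 2 * t n)) \<longlonglongrightarrow> 0"
 using filterlim_compose[OF _ tt] by blast+
 have s0: "0 <= s n" for n by (simp add: s_def le_max_iff_disj)
 have s1: "s \<longlonglongrightarrow> 0"
 by (rule tendsto_sandwich[OF _ sb tendsto_const se(1)]) (simp add: s0)
 have tpos: "\<forall>\<^sub>F n in sequentially. 0 <= t n" using tt unfolding filterlim_at_top by blast
 have s2: "(%n. t n * s n) \<longlonglongrightarrow> 0"
 proof (rule tendsto_sandwich[OF _ _ tendsto_const se(2)])
 show "\<forall>\<^sub>F n in sequentially. 0 <= t n * s n" using tpos by eventually_elim (simp add: s0)
 show "\<forall>\<^sub>F n in sequentially. t n * s n <= t n * exp (cst - \<beta> / 2 * t n)"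
 using tpos sb by eventually_elim (rule mult_left_mono)
 qed
 define er where "er n = errf (e n) (x n) (y n)" for n
 have er_eq: "er n = KK * s n + (l1 + l2) * \<alpha> (t n)" for n by (simp add: er_def errf_def s_def t_def)
 have er1: "er \<longlonglongrightarrow> 0" unfolding er_eq[abs_def] using tendsto_add[OF tendsto_mult_right_zero[OF s1] tendsto_mult_right_zero[OF a1]] by simp
 have ter: "(%n. KK * (t n * s n) + (l1 + l2) * (t n * \<alpha> (t n))) \<longlonglongrightarrow> 0"
 using tendsto_add[OF tendsto_mult_right_zero[OF s2] tendsto_mult_right_zero[OF a2]] by simp
 have Ler: "(%n. Lf (e n) * er n) \<longlonglongrightarrow> 0"
 proof -
 have "Lf (e n) * er n = (KK * (t n * s n) + (l1 + l2) * (t n * \<alpha> (t n))) - R0 * er n" for n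
 by (simp add: Lf_def er_eq t_def algebra_simps)
 then show ?thesis using tendsto_diff[OF ter tendsto_mult_right_zero[OF er1, of R0]] by simp
 qed
 have "(%n. x n / (x n - y n) - of_real X0) \<longlonglongrightarrow> 0"
 proof (rule Lim_null_comparison)
 show "\<forall>\<^sub>F n in sequentially. norm (x n / (x n - y n) - of_real X0) <= 2 * er n / l2"
 using ev1 by eventually_elim (auto simp: er_def intro!: crit_estimates assms)
 show "(%n. 2 * er n / l2) \<longlonglongrightarrow> 0" using tendsto_mult_right_zero[OF er1, of "2 / l2"] by simp
 qed
 then have Xlim: "(%n. x n / (x n - y n)) \<longlonglongrightarrow> of_real X0" by (simp add: LIM_zero_iff)
 have "(%n. 1 - inverse (x n / (x n - y n))) \<longlonglongrightarrow> 1 - inverse (of_real X0)"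
 using X0_bounds by (intro tendsto_intros Xlim) auto
 moreover have "1 - inverse (x n / (x n - y n)) = y n / x n" for n
 proof -
 have "x n ~= y n" "x n ~= 0" using assms(7)[of n] pos[of n] by (auto simp: is_crit_def)
 then show ?thesis by (simp add: field_simps)
 qed
 moreover have "1 - inverse (complex_of_real X0) = of_real (- l2 / l1)"
 using l1 l2 by (simp add: X0_def field_simps flip: of_real_add of_real_inverse of_real_diff)
 ultimately show yx: "(%n. y n / x n) \<longlonglongrightarrow> of_real (- l2 / l1)" by simp
 have nlim: "cmod (of_real (- l2 / l1)) = l2 / l1" unfolding norm_of_real using l1 l2 by simp
 have "(%n. cmod (y n / x n)) \<longlonglongrightarrow> l2 / l1" using tendsto_norm[OF yx] unfolding nlim .
 then have lnyx: "(%n. ln (cmod (y n / x n))) \<longlonglongrightarrow> ln (l2 / l1)" using l1 l2 by (intro tendsto_ln) auto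
 have Hlim: "(%n. H (z n) 0) \<longlonglongrightarrow> R0" if z: "!!n. cmod (z n) <= s n" "!!n. cmod (z n) < \<delta>0" for z
 proof -
 have "(%n. H (z n) 0 - R0) \<longlonglongrightarrow> 0"
 proof (rule Lim_null_comparison[OF always_eventually tendsto_mult_right_zero[OF s1, of C1]], rule allI)
 fix n
 have "cmod (z n) < r1" using z(2)[of n] delta0 by linarith
 then have "\<bar>H (z n) 0 - H 0 0\<bar> <= C1 * cmod (z n)" using hreg_lipschitz[of "z n" 0 0] r1 by simp
 also have "... <= C1 * s n" using z(1) C1 by (rule mult_left_mono)
 finally show "norm (H (z n) 0 - R0) <= C1 * s n" by (simp add: R0_def)
 qed
 then show ?thesis by (simp add: LIM_zero_iff)
 qed
 have Hx: "(%n. H (x n) 0) \<longlonglongrightarrow> R0" "(%n. H (y n) 0) \<longlonglongrightarrow> R0"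
 using assms(4,6) by (auto intro!: Hlim simp: s_def)
 have "(%n. (qq (e n) (x n) (y n) - q0) * Lf (e n)) \<longlonglongrightarrow> 0"
 proof (rule Lim_null_comparison[OF _ Ler])
 show "\<forall>\<^sub>F n in sequentially. norm ((qq (e n) (x n) (y n) - q0) * Lf (e n)) <= Lf (e n) * er n"
 using ev1
 proof eventually_elim
 case (elim n)
 have "1 <= Lf (e n)" using assms(2)[of n] by (simp add: good_def)
 moreover have "\<bar>qq (e n) (x n) (y n) - q0\<bar> <= er n"
 unfolding er_def by (rule crit_estimates(1)[OF assms(2-7) elim])
 ultimately show ?case by (simp add: abs_mult mult.commute mult_left_mono)
 qed
 qed
 \<comment> \<open>The combination is arranged to equal (l1 + l2)(ln |x| + \<beta> t) identically:
   the ratio |y|/|x|, whose limit is known, trades ln |y| for ln |x|.\<close>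
 from tendsto_diff[OF tendsto_diff[OF tendsto_diff[OF tendsto_const[of "q0 * R0"] this] tendsto_mult_left[OF lnyx, of l2]]
 tendsto_add[OF tendsto_mult_left[OF Hx(1), of l1] tendsto_mult_left[OF Hx(2), of l2]]]
 have "(%n. q0 * R0 - (qq (e n) (x n) (y n) - q0) * Lf (e n) - l2 * ln (cmod (y n / x n)) - (l1 * H (x n) 0 + l2 * H (y n) 0))
 \<longlonglongrightarrow> q0 * R0 - 0 - l2 * ln (l2 / l1) - (l1 * R0 + l2 * R0)" .
 moreover have "q0 * R0 - (qq (e n) (x n) (y n) - q0) * Lf (e n) - l2 * ln (cmod (y n / x n)) - (l1 * H (x n) 0 + l2 * H (y n) 0)
 = (l1 + l2) * (ln (cmod (x n)) + \<beta> * t n)" for n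
 proof -
 have "1 <= Lf (e n)" using assms(2)[of n] by (simp add: good_def)
 then have "qq (e n) (x n) (y n) * Lf (e n) = l1 * g (x n) + l2 * g (y n)" by (simp add: qq_def)
 moreover have "ln (cmod (y n / x n)) = ln (cmod (y n)) - ln (cmod (x n))"
 using pos[of n] by (simp add: norm_divide ln_div)
 then have "l2 * ln (cmod (y n / x n)) = l2 * ln (cmod (y n)) - l2 * ln (cmod (x n))"
 by (simp only: right_diff_distrib)
 moreover have "(l1 + l2) * \<beta> = q0" using l1 l2 by (simp add: \<beta>_def)
 then have "(l1 + l2) * (\<beta> * t n) = q0 * t n" by (metis mult.assoc)
 ultimately show ?thesis by (simp add: g_def Lf_def t_def algebra_simps)
 qed
 ultimately have "(%n. (l1 + l2) * (ln (cmod (x n)) + \<beta> * t n)) \<longlonglongrightarrow> q0 * R0 - 0 - l2 * ln (l2 / l1) - (l1 * R0 + l2 * R0)" by simp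
 from tendsto_divide[OF this tendsto_const[of "l1 + l2"]]
 have "(%n. ln (cmod (x n)) + \<beta> * t n) \<longlonglongrightarrow> (q0 * R0 - 0 - l2 * ln (l2 / l1) - (l1 * R0 + l2 * R0)) / (l1 + l2)"
 using l1 l2 by simp
 moreover have "(q0 * R0 - 0 - l2 * ln (l2 / l1) - (l1 * R0 + l2 * R0)) / (l1 + l2) = lnC"
 using l1 l2 by (simp add: lnC_def ln_div algebra_simps)
 ultimately have "(%n. exp (ln (cmod (x n)) + \<beta> * t n)) \<longlonglongrightarrow> exp lnC" by (simp add: tendsto_exp)
 moreover have "exp (ln (cmod (x n)) + \<beta> * t n) = cmod (x n) / e n powr \<beta>" for n
 using pos[of n] e0[of n] by (simp add: powr_def t_def exp_diff)
 ultimately show "(%n. cmod (x n) / e n powr \<beta>) \<longlonglongrightarrow> exp lnC" by simp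
qed

end


section \<open>Scaled remainders\<close>

lemma biharm_dx_continuous:
 assumes "biharm S T f"
 shows "continuous_on (S \<times> T) (%p. dx f (fst p) (snd p))" "continuous_on (S \<times> T) (%p. dy f (fst p) (snd p))"
proof -
 have "continuous_on (S \<times> T) (%p. Complex (Re (dx f (fst p) (snd p))) (Im (dx f (fst p) (snd p))))"
 unfolding Complex_eq by (intro continuous_intros biharm_continuous biharm_dx[OF assms])
 then show "continuous_on (S \<times> T) (%p. dx f (fst p) (snd p))" by simp
 have "continuous_on (S \<times> T) (%p. Complex (Re (dy f (fst p) (snd p))) (Im (dy f (fst p) (snd p))))"
 unfolding Complex_eq by (intro continuous_intros biharm_continuous biharm_dy[OF assms])
 then show "continuous_on (S \<times> T) (%p. dy f (fst p) (snd p))" by simp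
qed

definition bD :: "(complex => complex => real) => complex \<times> complex => complex \<times> complex => real" where
 "bD f z v = Re (dx f (fst z) (snd z) * fst v) + Re (dy f (fst z) (snd z) * snd v)"

lemma biharm_bD:
 assumes "biharm S T f" "z \<in> S \<times> T"
 shows "((%p. f (fst p) (snd p)) has_derivative bD f z) (at z)"
 using biharm_has_derivative[OF assms(1), of "fst z" "snd z"] assms(2) unfolding bD_def by auto

lemma Re_mult_le: "\<bar>Re (a * b)\<bar> <= cmod a * cmod b"
 using abs_Re_le_cmod[of "a * b"] by (simp only: norm_mult)

lemma bD_bound:
 assumes "cmod (dx f (fst z) (snd z)) <= B" "cmod (dy f (fst z) (snd z)) <= C"
 shows "\<bar>bD f z v\<bar> <= (B + C) * norm v"
proof -
 have n: "cmod (fst v) <= norm v" "cmod (snd v) <= norm v"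
 using norm_fst_le[of "fst v" "snd v"] norm_snd_le[of "snd v" "fst v"] by simp_all
 have "\<bar>bD f z v\<bar> <= \<bar>Re (dx f (fst z) (snd z) * fst v)\<bar> + \<bar>Re (dy f (fst z) (snd z) * snd v)\<bar>"
 unfolding bD_def by (rule abs_triangle_ineq)
 also have "... <= B * norm v + C * norm v"
 using assms n by (intro add_mono order_trans[OF Re_mult_le] mult_mono) (auto intro: order_trans[OF norm_ge_zero])
 finally show ?thesis by (simp add: distrib_right)
qed

lemma biharm_lipschitz_at:
 assumes "biharm S T f" "p \<in> S \<times> T"
 shows "\<exists>B r. 0 <= B & 0 < r & cball p r \<subseteq> S \<times> T \<and>
 (\<forall>z\<in>cball p r. \<bar>f (fst z) (snd z) - f (fst p) (snd p)\<bar> <= B * norm (z - p))"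
proof -
 have "open (S \<times> T)" using assms(1) by (auto simp: biharm_def intro: open_Times)
 then obtain r where r: "r > 0" "cball p r \<subseteq> S \<times> T" using assms(2) open_contains_cball by blast
 have bd: "\<exists>B\<ge>0. \<forall>z\<in>cball p r. cmod (h z) <= B" if "continuous_on (S \<times> T) h" for h
 proof -
 have "bounded (h ` cball p r)"
 by (rule compact_imp_bounded[OF compact_continuous_image[OF continuous_on_subset[OF that r(2)] compact_cball]])
 then obtain B where "\<forall>v\<in>h ` cball p r. norm v <= B" "B > 0" unfolding bounded_pos by blast
 then show ?thesis by (intro exI[of _ B]) auto
 qed
 obtain B where B: "B >= 0" "\<forall>z\<in>cball p r. cmod (dx f (fst z) (snd z)) <= B"
 using bd[OF biharm_dx_continuous(1)[OF assms(1)]] by blast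
 obtain C where C: "C >= 0" "\<forall>z\<in>cball p r. cmod (dy f (fst z) (snd z)) <= C"
 using bd[OF biharm_dx_continuous(2)[OF assms(1)]] by blast
 have "norm (f (fst z) (snd z) - f (fst p) (snd p)) <= (B + C) * norm (z - p)" if "z \<in> cball p r" for z
 proof (rule derivative_lipschitz[of "cball p r" "%p. f (fst p) (snd p)" "bD f"])
 show "((%p. f (fst p) (snd p)) has_derivative bD f w) (at w)" if "w \<in> cball p r" for w
 by (rule biharm_bD[OF assms(1)]) (use that r in blast)
 show "norm (bD f w v) <= (B + C) * norm v" if "w \<in> cball p r" for w v
 unfolding real_norm_def by (rule bD_bound) (use that B C in auto)
 qed (use that r in auto)
 then show ?thesis using B(1) C(1) r by (intro exI[of _ "B + C"] exI[of _ r]) auto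
qed

text \<open>The real and imaginary parts of both gradients are separately harmonic again, so each of
  the four is Lipschitz near \<open>p\<close>.\<close>

lemma biharm_C11:
 assumes "biharm S T f" "p \<in> S \<times> T"
 shows "\<exists>B r. 0 <= B & 0 < r & cball p r \<subseteq> S \<times> T \<and>
 (\<forall>z\<in>cball p r. \<forall>v. \<bar>bD f z v - bD f p v\<bar> <= B * norm (z - p) * norm v)"
proof -
 obtain B1 r1 where 1: "0 <= B1" "0 < r1" "cball p r1 \<subseteq> S \<times> T"
 "\<forall>z\<in>cball p r1. \<bar>Re (dx f (fst z) (snd z)) - Re (dx f (fst p) (snd p))\<bar> <= B1 * norm (z - p)"
 using biharm_lipschitz_at[OF biharm_dx(1)[OF assms(1)] assms(2)] by blast
 obtain B2 r2 where 2: "0 <= B2" "0 < r2"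
 "\<forall>z\<in>cball p r2. \<bar>Im (dx f (fst z) (snd z)) - Im (dx f (fst p) (snd p))\<bar> <= B2 * norm (z - p)"
 using biharm_lipschitz_at[OF biharm_dx(2)[OF assms(1)] assms(2)] by blast
 obtain B3 r3 where 3: "0 <= B3" "0 < r3"
 "\<forall>z\<in>cball p r3. \<bar>Re (dy f (fst z) (snd z)) - Re (dy f (fst p) (snd p))\<bar> <= B3 * norm (z - p)"
 using biharm_lipschitz_at[OF biharm_dy(1)[OF assms(1)] assms(2)] by blast
 obtain B4 r4 where 4: "0 <= B4" "0 < r4"
 "\<forall>z\<in>cball p r4. \<bar>Im (dy f (fst z) (snd z)) - Im (dy f (fst p) (snd p))\<bar> <= B4 * norm (z - p)"
 using biharm_lipschitz_at[OF biharm_dy(2)[OF assms(1)] assms(2)] by blast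
 define r where "r = min (min r1 r2) (min r3 r4)"
 define B where "B = B1 + B2 + B3 + B4"
 have le: "\<bar>bD f z v - bD f p v\<bar> <= B * norm (z - p) * norm v" if z: "z \<in> cball p r" for z v
 proof -
 define a where "a = dx f (fst z) (snd z) - dx f (fst p) (snd p)"
 define b where "b = dy f (fst z) (snd z) - dy f (fst p) (snd p)"
 have "cmod a <= B1 * norm (z - p) + B2 * norm (z - p)"
 using 1(4) 2(3) z cmod_le[of a] by (force simp: a_def r_def)
 moreover have "cmod b <= B3 * norm (z - p) + B4 * norm (z - p)"
 using 3(3) 4(3) z cmod_le[of b] by (force simp: b_def r_def)
 ultimately have ab: "cmod a + cmod b <= B * norm (z - p)" by (simp add: B_def distrib_right)
 have n: "cmod (fst v) <= norm v" "cmod (snd v) <= norm v"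
 using norm_fst_le[of "fst v" "snd v"] norm_snd_le[of "snd v" "fst v"] by simp_all
 have "bD f z v - bD f p v = Re (a * fst v) + Re (b * snd v)" by (simp add: bD_def a_def b_def algebra_simps)
 then have "\<bar>bD f z v - bD f p v\<bar> <= cmod a * cmod (fst v) + cmod b * cmod (snd v)"
 using Re_mult_le[of a "fst v"] Re_mult_le[of b "snd v"] by linarith
 also have "... <= cmod a * norm v + cmod b * norm v" using n by (intro add_mono mult_left_mono) auto
 also have "... = (cmod a + cmod b) * norm v" by (simp add: distrib_right)
 also have "... <= B * norm (z - p) * norm v" using ab by (intro mult_right_mono) auto
 finally show ?thesis .
 qed
 have "cball p r \<subseteq> cball p r1" by (auto simp: r_def)
 then have "cball p r \<subseteq> S \<times> T" using 1(3) by (rule order_trans)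
 moreover have "0 <= B" "0 < r" using 1(1,2) 2(1,2) 3(1,2) 4(1,2) by (simp_all add: B_def r_def)
 ultimately show ?thesis using le by blast
qed

text \<open>The Lipschitz bound on the derivative at 0 makes the first-order Taylor remainder
  quadratic and its derivative linear, so after division by the scale both are of the order of the
  scale.\<close>

lemma scale_C11:
 fixes F :: "'a::euclidean_space => 'b::real_normed_vector" and m :: "'c::real_normed_vector => 'a"
 assumes "F 0 = 0" "0 < r" "!!z. z \<in> ball 0 r ==> (F has_derivative F' z) (at z)"
 "!!z v. z \<in> ball 0 r ==> norm (F' z v - F' 0 v) <= B * norm z * norm v" "0 <= B"
 "bounded_linear m" "bounded V" "\<forall>\<^sub>F eps in at_right 0. 0 < a eps" "(a \<longlongrightarrow> 0) (at_right 0)"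
 shows "c1_bound V (%eps p. (1 / a eps) *\<^sub>R F (a eps *\<^sub>R m p) - F' 0 (m p)) a"
proof -
 obtain N where N: "N > 0" "!!x. norm (m x) <= norm x * N" using bounded_linear.pos_bounded[OF assms(6)] by blast
 obtain R where R: "R > 0" "!!p. p \<in> V ==> norm p <= R" using assms(7) unfolding bounded_pos by blast
 have bl: "bounded_linear (F' 0)" using has_derivative_bounded_linear[OF assms(3)] assms(2) by simp
 define G where "G z = F z - F' 0 z" for z
 have Gd: "(G has_derivative (%v. F' z v - F' 0 v)) (at z)" if "z \<in> ball 0 r" for z
 unfolding G_def by (rule has_derivative_diff[OF assms(3)[OF that] bounded_linear_imp_has_derivative[OF bl]])
 have G0: "G 0 = 0" using assms(1) linear_0[OF bounded_linear.linear[OF bl]] by (simp add: G_def)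
 have Gn: "norm (G z) <= B * norm z * norm z" if z: "z \<in> ball 0 r" for z
 proof -
 have sub: "cball 0 (norm z) \<subseteq> ball (0::'a) r" using z by auto
 have "norm (G z - G 0) <= (B * norm z) * norm (z - 0)"
 proof (rule derivative_lipschitz[of "cball 0 (norm z)" G])
 show "(G has_derivative (%v. F' w v - F' 0 v)) (at w)" if "w \<in> cball 0 (norm z)" for w
 by (rule Gd) (use that sub in blast)
 show "norm (F' w v - F' 0 v) <= B * norm z * norm v" if "w \<in> cball 0 (norm z)" for w v
 proof -
 have "w \<in> ball 0 r" using that sub by blast
 then have "norm (F' w v - F' 0 v) <= B * norm w * norm v" by (rule assms(4))
 also have "... <= B * norm z * norm v" using that assms(5) by (intro mult_right_mono mult_left_mono) auto
 finally show ?thesis .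
 qed
 qed auto
 then show ?thesis using G0 by simp
 qed
 define Q where "Q = R * N"
 have Q: "Q > 0" "!!p. p \<in> V ==> norm (m p) <= Q"
 using N(1) R order_trans[OF N(2) mult_right_mono[of _ R N]] by (auto simp: Q_def)
 have "\<forall>\<^sub>F eps in at_right 0. a eps < r / (Q + 1)"
 using order_tendstoD(2)[OF assms(9), of "r / (Q + 1)"] assms(2) Q(1) by simp
 with assms(8) have "\<forall>\<^sub>F eps in at_right 0. 0 <= a eps & (\<forall>p\<in>V. \<exists>f'. ((%p. (1 / a eps) *\<^sub>R F (a eps *\<^sub>R m p) - F' 0 (m p)) has_derivative f') (at p) \<and>
 norm ((1 / a eps) *\<^sub>R F (a eps *\<^sub>R m p) - F' 0 (m p)) <= (B * Q * (Q + N)) * a eps \<and>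
 (\<forall>v. norm (f' v) <= (B * Q * (Q + N)) * a eps * norm v))"
 proof eventually_elim
 case (elim eps)
 show ?case
 proof (intro conjI ballI)
 fix p assume p: "p \<in> V"
 define z where "z = a eps *\<^sub>R m p"
 have nz: "norm z <= a eps * Q" using Q(2)[OF p] elim(1) by (simp add: z_def mult_left_mono)
 have "a eps * (Q + 1) < r" using elim(2) Q(1) by (simp add: field_simps)
 moreover have "a eps * Q <= a eps * (Q + 1)" using elim(1) by (intro mult_left_mono) auto
 ultimately have zr: "z \<in> ball 0 r" using nz by simp
 have eq: "(%p. (1 / a eps) *\<^sub>R F (a eps *\<^sub>R m p) - F' 0 (m p)) = (%p. (1 / a eps) *\<^sub>R G (a eps *\<^sub>R m p))"
 using elim(1) by (simp add: G_def scaleR_diff_right linear_cmul[OF bounded_linear.linear[OF bl]] fun_eq_iff)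
 have "((%p. a eps *\<^sub>R m p) has_derivative (%v. a eps *\<^sub>R m v)) (at p)"
 by (rule has_derivative_scaleR_right[OF bounded_linear_imp_has_derivative[OF assms(6)]])
 from has_derivative_compose[OF this Gd[OF zr, unfolded z_def]]
 have d: "((%p. (1 / a eps) *\<^sub>R G (a eps *\<^sub>R m p)) has_derivative (%v. (1 / a eps) *\<^sub>R (F' z (a eps *\<^sub>R m v) - F' 0 (a eps *\<^sub>R m v)))) (at p)"
 unfolding z_def by (rule has_derivative_scaleR_right)
 have BQ: "0 <= B * Q" using assms(5) Q(1) by simp
 have "norm ((1 / a eps) *\<^sub>R G z) <= (1 / a eps) * (B * (a eps * Q) * (a eps * Q))"
 proof -
 have "0 <= B * (a eps * Q)" using elim(1) assms(5) Q(1) by simp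
 from order_trans[OF Gn[OF zr] mult_mono[OF mult_left_mono[OF nz assms(5)] nz this norm_ge_zero]]
 have b: "norm (G z) <= B * (a eps * Q) * (a eps * Q)" .
 have e1: "norm ((1 / a eps) *\<^sub>R G z) = (1 / a eps) * norm (G z)" using elim(1) by simp
 show ?thesis unfolding e1 by (rule mult_left_mono[OF b]) (use elim(1) in simp)
 qed
 also have "... = B * Q * Q * a eps" using elim(1) by simp
 also have "... <= (B * Q * (Q + N)) * a eps" using elim(1) BQ N(1) by (intro mult_right_mono mult_left_mono) auto
 finally have n: "norm ((1 / a eps) *\<^sub>R G z) <= (B * Q * (Q + N)) * a eps" .
 have "norm ((1 / a eps) *\<^sub>R (F' z (a eps *\<^sub>R m v) - F' 0 (a eps *\<^sub>R m v))) <= (B * Q * (Q + N)) * a eps * norm v" for v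
 proof -
 have "norm (F' z (a eps *\<^sub>R m v) - F' 0 (a eps *\<^sub>R m v)) <= B * norm z * norm (a eps *\<^sub>R m v)" by (rule assms(4)[OF zr])
 also have "... <= B * (a eps * Q) * (a eps * (norm v * N))"
 using nz N(2)[of v] elim(1) assms(5) Q(1) by (intro mult_mono mult_left_mono) (auto intro!: mult_left_mono)
 finally have b: "norm (F' z (a eps *\<^sub>R m v) - F' 0 (a eps *\<^sub>R m v)) <= B * (a eps * Q) * (a eps * (norm v * N))" .
 have "norm ((1 / a eps) *\<^sub>R (F' z (a eps *\<^sub>R m v) - F' 0 (a eps *\<^sub>R m v)))
 = (1 / a eps) * norm (F' z (a eps *\<^sub>R m v) - F' 0 (a eps *\<^sub>R m v))" using elim(1) by simp
 also have "... <= (1 / a eps) * (B * (a eps * Q) * (a eps * (norm v * N)))"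
 by (rule mult_left_mono[OF b]) (use elim(1) in simp)
 also have "... = (B * Q * N) * a eps * norm v" using elim(1) by simp
 also have "... <= (B * Q * (Q + N)) * a eps * norm v" using elim(1) BQ Q(1) by (intro mult_right_mono mult_left_mono) auto
 finally show ?thesis .
 qed
 then show "\<exists>f'. ((%p. (1 / a eps) *\<^sub>R F (a eps *\<^sub>R m p) - F' 0 (m p)) has_derivative f') (at p) \<and>
 norm ((1 / a eps) *\<^sub>R F (a eps *\<^sub>R m p) - F' 0 (m p)) <= (B * Q * (Q + N)) * a eps \<and>
 (\<forall>v. norm (f' v) <= (B * Q * (Q + N)) * a eps * norm v)"
 using d n fun_cong[OF eq, of p] unfolding eq z_def by (intro exI conjI allI) auto
 qed (use elim in simp)
 qed
 then show ?thesis unfolding c1_bound_def using assms(5) Q(1) N(1) by (intro exI[of _ "B * Q * (Q + N)"]) auto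
qed

text \<open>The gradient estimate is applied twice: once for dx f on a smaller bidisc, once to its
  real and imaginary parts in each of the two variables. These four contributions of 16 B/rho^2 make
  the factor 64.\<close>

lemma biharm_derivative_bounds:
 assumes "biharm S T f" "0 < rho"
 "!!x' y'. cmod (x' - x) < 2 * rho ==> cmod (y' - y) < 2 * rho ==> x' \<in> S & y' \<in> T & \<bar>f x' y'\<bar> <= B"
 shows "cmod (dx f x y) <= 4 * B / rho"
 "\<exists>D. ((%p. dx f (fst p) (snd p)) has_derivative D) (at (x, y)) & (\<forall>v. norm (D v) <= 64 * B / rho\<^sup>2 * norm v)"
proof -
 have tri: "cmod (z - w) < 2 * rho" if "cmod (z - u) < rho" "cmod (u - w) < rho" for z u w :: complex
 using that norm_triangle_ineq[of "z - u" "u - w"] by simp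
 have dxb: "cmod (dx f x' y') <= 4 * B / rho" if "cmod (x' - x) < rho" "cmod (y' - y) < rho" for x' y'
 unfolding dx_def
 proof (rule cgrad_bound[OF _ assms(2)])
 have y': "y' \<in> T" using assms(3)[of x y'] that assms(2) by simp
 have "ball x' rho \<subseteq> S"
 proof
 fix z assume "z \<in> ball x' rho"
 then have "cmod (z - x) < 2 * rho" using tri[of z x' x] that by (simp add: dist_norm norm_minus_commute)
 then show "z \<in> S" using assms(3)[of z y'] that assms(2) by simp
 qed
 then show "harm (ball x' rho) (%x. f x y')" using assms(1) y' by (auto simp: biharm_def intro: harm_subset)
 show "\<bar>f z y'\<bar> <= B" if "z \<in> ball x' rho" for z
 proof -
 have "cmod (z - x) < 2 * rho" using tri[of z x' x] that \<open>cmod (x' - x) < rho\<close> by (simp add: dist_norm norm_minus_commute)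
 then show ?thesis using assms(3)[of z y'] \<open>cmod (y' - y) < rho\<close> assms(2) by simp
 qed
 qed
 then show "cmod (dx f x y) <= 4 * B / rho" using assms(2) by simp
 have xy: "x \<in> S" "y \<in> T" using assms(3)[of x y] assms(2) by auto
 have ballS: "ball x rho \<subseteq> S" "ball y rho \<subseteq> T"
 using assms(3)[of _ y] assms(3)[of x] assms(2) by (auto simp: dist_norm norm_minus_commute)
 have one: "cmod (dx h x y) <= 16 * B / rho\<^sup>2 & cmod (dy h x y) <= 16 * B / rho\<^sup>2"
 if h: "biharm S T h" "!!x' y'. \<bar>h x' y'\<bar> <= cmod (dx f x' y')" for h
 proof
 have "cmod (dx h x y) <= 4 * (4 * B / rho) / rho" unfolding dx_def
 proof (rule cgrad_bound[OF _ assms(2)])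
 show "harm (ball x rho) (%x. h x y)" using h(1) xy ballS by (auto simp: biharm_def intro: harm_subset)
 show "\<bar>h z y\<bar> <= 4 * B / rho" if "z \<in> ball x rho" for z
 using order_trans[OF h(2) dxb[of z y]] that assms(2) by (simp add: dist_norm norm_minus_commute)
 qed
 then show "cmod (dx h x y) <= 16 * B / rho\<^sup>2" by (simp add: power2_eq_square)
 have "cmod (dy h x y) <= 4 * (4 * B / rho) / rho" unfolding dy_def
 proof (rule cgrad_bound[OF _ assms(2)])
 show "harm (ball y rho) (h x)" using h(1) xy ballS by (auto simp: biharm_def intro: harm_subset)
 show "\<bar>h x z\<bar> <= 4 * B / rho" if "z \<in> ball y rho" for z
 using order_trans[OF h(2) dxb[of x z]] that assms(2) by (simp add: dist_norm norm_minus_commute)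
 qed
 then show "cmod (dy h x y) <= 16 * B / rho\<^sup>2" by (simp add: power2_eq_square)
 qed
 let ?R = "%x y. Re (dx f x y)" and ?I = "%x y. Im (dx f x y)"
 have "((%p. of_real (?R (fst p) (snd p)) + \<i> * of_real (?I (fst p) (snd p))) has_derivative
 (%v. of_real (bD ?R (x, y) v) + \<i> * of_real (bD ?I (x, y) v))) (at (x, y))"
 using xy by (intro has_derivative_add has_derivative_mult_right has_derivative_of_real
 biharm_bD[OF biharm_dx(1)[OF assms(1)]] biharm_bD[OF biharm_dx(2)[OF assms(1)]]) auto
 then have d: "((%p. dx f (fst p) (snd p)) has_derivative
 (%v. of_real (bD ?R (x, y) v) + \<i> * of_real (bD ?I (x, y) v))) (at (x, y))"
 by (simp flip: complex_eq)
 have "norm (complex_of_real (bD ?R (x, y) v) + \<i> * of_real (bD ?I (x, y) v)) <= 64 * B / rho\<^sup>2 * norm v" for v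
 proof -
 have "\<bar>bD ?R (x, y) v\<bar> <= (16 * B / rho\<^sup>2 + 16 * B / rho\<^sup>2) * norm v"
 using one[OF biharm_dx(1)[OF assms(1)] abs_Re_le_cmod] by (intro bD_bound) auto
 moreover have "\<bar>bD ?I (x, y) v\<bar> <= (16 * B / rho\<^sup>2 + 16 * B / rho\<^sup>2) * norm v"
 using one[OF biharm_dx(2)[OF assms(1)] abs_Im_le_cmod] by (intro bD_bound) auto
 moreover have "norm (complex_of_real s + \<i> * of_real u) <= \<bar>s\<bar> + \<bar>u\<bar>" for s u
 using norm_triangle_ineq[of "complex_of_real s" "\<i> * of_real u"] by (simp add: norm_mult)
 ultimately have "norm (complex_of_real (bD ?R (x, y) v) + \<i> * of_real (bD ?I (x, y) v))
 <= (16 * B / rho\<^sup>2 + 16 * B / rho\<^sup>2) * norm v + (16 * B / rho\<^sup>2 + 16 * B / rho\<^sup>2) * norm v"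
 by (meson add_mono order_trans)
 also have "... = 64 * B / rho\<^sup>2 * norm v" by (simp add: algebra_simps)
 finally show ?thesis .
 qed
 with d show "\<exists>D. ((%p. dx f (fst p) (snd p)) has_derivative D) (at (x, y)) & (\<forall>v. norm (D v) <= 64 * B / rho\<^sup>2 * norm v)"
 by blast
qed


section \<open>The rescaled critical point equations\<close>

text \<open>In rescaled variables: the region away from the singular sets x = 0, y = 0, x = y and
  from infinity, on which the perturbation is estimated.\<close>

definition annuli :: "real => (complex \<times> complex) set" where
 "annuli c = {p. c < cmod (fst p) & cmod (fst p) < 1 / c & c < cmod (snd p) & cmod (snd p) < 1 / c
 & c < cmod (fst p - snd p)}"

lemma annuli_open: "open (annuli c)"
 unfolding annuli_def by (intro open_Collect_conj open_Collect_less continuous_intros)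

lemma annuli_bounded:
 "bounded (annuli c)"
proof -
 have "norm p <= 2 / c" if "p \<in> annuli c" for p
 using norm_Pair_le[of "fst p" "snd p"] that by (simp add: annuli_def)
 then show ?thesis unfolding bounded_iff by blast
qed

text \<open>The assumption says that P is critical for the Robin function; because of it the
  gradient at the small scale starts with its linear term.\<close>

locale kr0 = kr +
 assumes dx0: "dx (hreg D) 0 0 = 0"
begin

definition sc :: "real => real" where "sc e = e powr \<beta>"

lemma beta_le: "\<beta> <= 1 / 4"
proof -
 have "4 * (l1 * l2) <= (l1 + l2) * (l1 + l2)"
 using zero_le_power2[of "l1 - l2"] by (simp add: power2_eq_square algebra_simps)
 then show ?thesis using l1 l2 by (simp add: \<beta>_def q0_def divide_le_eq)
qed

lemma sc_pos: "0 < e ==> 0 < sc e" by (simp add: sc_def)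

lemma ln_sc: "0 < e ==> ln (sc e) = \<beta> * ln e" by (simp add: sc_def ln_powr)

lemma sc_tendsto: "(sc \<longlongrightarrow> 0) (at_right 0)"
 unfolding sc_def using beta_pos by real_asymp

lemma Lf_limits: "((%e. 1 / Lf e) \<longlongrightarrow> 0) (at_right 0)" "((%e. Lf e * sc e) \<longlongrightarrow> 0) (at_right 0)"
 unfolding Lf_def sc_def using beta_pos by real_asymp+

lemma hole_over_sc: "((%e. e / sc e) \<longlongrightarrow> 0) (at_right 0)"
proof -
 have "\<beta> < 1" using beta_le by simp
 then show ?thesis unfolding sc_def using beta_pos by real_asymp
qed

text \<open>On the annuli the remainder \<open>kk\<close> is at most a constant times e + e^2/sc^2,
  hence O(sc^3). This is one power better than the size sc^2 at which it would enter the limit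
  system.\<close>

lemma sc_cubed:
 assumes "0 < e" "e <= 1"
 shows "e <= sc e ^ 3" "e\<^sup>2 <= sc e ^ 5"
proof -
 have p: "sc e ^ n = e powr (\<beta> * real n)" for n
 using assms(1) by (simp add: sc_def powr_powr flip: powr_realpow)
 have "e = e powr 1" using assms(1) by simp
 also have "... <= e powr (\<beta> * real 3)" using assms beta_le by (intro powr_mono') auto
 finally show "e <= sc e ^ 3" by (simp only: p)
 have "e\<^sup>2 = e powr (real 2)" using assms(1) by (simp only: powr_realpow)
 also have "... <= e powr (\<beta> * real 5)" using assms beta_le by (intro powr_mono') auto
 finally show "e\<^sup>2 <= sc e ^ 5" by (simp only: p)
qed

text \<open>Unlike \<open>kt\<close>, it leaves the image logarithms in the remainder: at distances
  of order e^\<beta> they are negligible. In return it is harmonic in both variables, so interior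
  estimates control its derivatives in x and in y.\<close>

definition kk :: "real => complex => complex => real" where
 "kk e x y = H x y + g x * (g y / Lf e) - He e x y"

lemma biharm_mult_sep:
 assumes "open S" "harm S u" "harm S v"
 shows "biharm S S (%x y. u x * (v y / c))"
proof -
 have "continuous_on (S \<times> S) (%p. u (fst p) * (v (snd p) / c))" if "c ~= 0"
 using that by (intro continuous_intros continuous_on_compose2[OF harm_continuous_on[OF assms(2)]]
 continuous_on_compose2[OF harm_continuous_on[OF assms(3)]]) auto
 moreover have "harm S (%x. u x * (v y / c))" for y
 using harm_cmult[OF assms(2), of "v y / c"] by (simp add: mult.commute)
 moreover have "harm S (%y. u x * (v y / c))" for x
 using harm_cmult[OF assms(3), of "u x / c"] by simp
 ultimately show ?thesis using assms(1) unfolding biharm_def split_beta by (cases "c = 0") auto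
qed

lemma kk_biharm:
 assumes "good e"
 shows "biharm (D - cball 0 e) (D - cball 0 e) (kk e)"
proof -
 interpret E: reg_domain "D - cball 0 e"
 using regular_domain_minus_disc[OF reg] assms by unfold_locales (auto simp: good_def)
 have gh: "harm (D - cball 0 e) g" by (rule harm_subset[OF g_harm]) (use assms in \<open>auto simp: good_def\<close>)
 have "biharm (D - cball 0 e) (D - cball 0 e) (%x y. 1 * H x y + 1 * (g x * (g y / Lf e)))"
 by (rule biharm_lin[OF biharm_subset[OF hreg_biharm E.D_open E.D_open] biharm_mult_sep[OF E.D_open gh gh]]) auto
 from biharm_lin[OF this E.hreg_biharm, of 1 "-1"] show ?thesis by (simp add: kk_def[abs_def])
qed

lemma kk_bound:
 assumes "good e" "e < cmod y" "cmod y < r1" "2 * e <= cmod x" "cmod x < r1"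
 shows "\<bar>kk e x y\<bar> <= (3 * C1 + 1 / r1) * e + 2 * e\<^sup>2 / (cmod x * cmod y)"
proof -
 have e0: "0 < e" using assms(1) by (simp add: good_def)
 define w where "w = of_real (e\<^sup>2) / cnj y"
 have w: "cmod w < e" unfolding w_def by (rule pole_small[OF assms(1,2)])
 have wn: "cmod w = e\<^sup>2 / cmod y" unfolding w_def norm_divide norm_of_real by simp
 have x0: "0 < cmod x" using assms(4) e0 by linarith
 have "cmod x - cmod w <= cmod (x - w)" by (rule norm_triangle_ineq2)
 then have "\<bar>ln (cmod (x - w)) - ln (cmod x)\<bar> <= \<bar>cmod (x - w) - cmod x\<bar> / (cmod x / 2)"
 using w assms(4) x0 by (intro abs_ln_diff_le) linarith+
 also have "... <= cmod w / (cmod x / 2)"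
 using norm_triangle_ineq3[of "x - w" x] x0 by (intro divide_right_mono) auto
 also have "... = 2 * e\<^sup>2 / (cmod x * cmod y)" unfolding wn by (simp add: mult.commute)
 finally have l: "\<bar>ln (cmod (x - w)) - ln (cmod x)\<bar> <= 2 * e\<^sup>2 / (cmod x * cmod y)" .
 have "x \<in> D - cball 0 e" using in_E[of e x] assms e0 r1 by auto
 then have "x \<in> closure (D - cball 0 e)" by (rule subsetD[OF closure_subset])
 from kt_bound[OF assms(1-3) this] have k: "\<bar>kt e x y\<bar> <= (3 * C1 + 1 / r1) * e" .
 have "kk e x y = kt e x y + (ln (cmod (x - w)) - ln (cmod x))"
 by (simp add: kk_def kt_def w_def)
 then show ?thesis using k l by linarith
qed

lemma dx_He_kk:
 assumes "good e" "x \<in> D - cball 0 e" "y \<in> D - cball 0 e"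
 shows "dx (He e) x y = dx H x y + (- inverse x - dx H x 0) * of_real (g y / Lf e) - dx (kk e) x y"
proof -
 define c where "c = g y / Lf e"
 have e0: "0 < e" using assms(1) by (simp add: good_def)
 have xD: "x \<in> D" "y \<in> D" and ne: "x ~= 0" using assms e0 by auto
 have d1: "((%x. H x y) has_derivative (%h. Re (dx H x y * h))) (at x)"
 unfolding dx_def by (rule harm_has_derivative[OF hreg_props(2)[OF xD(2)] xD(1)])
 have d2: "((%x. H x 0) has_derivative (%h. Re (dx H x 0 * h))) (at x)"
 unfolding dx_def by (rule harm_has_derivative[OF hreg_props(2)[OF zero_in_D] xD(1)])
 have "harm (D - cball 0 e) (%x. kk e x y)" using kk_biharm[OF assms(1)] assms(3) by (simp add: biharm_def)
 from harm_has_derivative[OF this assms(2)] have dk: "((%x. kk e x y) has_derivative (%h. Re (dx (kk e) x y * h))) (at x)"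
 by (simp only: dx_def)
 have "((%x. H x y + (- ln (cmod (x - 0)) - H x 0) * c - kk e x y)
 has_derivative (%h. Re ((dx H x y + (- inverse (x - 0) - dx H x 0) * of_real c - dx (kk e) x y) * h))) (at x)"
 by (rule has_derivative_eq_rhs[OF has_derivative_diff[OF has_derivative_add[OF d1
 has_derivative_mult_left[OF has_derivative_diff[OF has_derivative_minus[OF has_derivative_ln_cmod[OF ne]] d2]]] dk]])
 (simp add: fun_eq_iff algebra_simps)
 moreover have "(%x. H x y + (- ln (cmod (x - 0)) - H x 0) * c - kk e x y) = (%x. He e x y)"
 by (simp add: kk_def g_def c_def)
 ultimately show ?thesis unfolding dx_def[of "He e"] c_def[symmetric] by (intro cgrad_eqI) simp
qed

lemma ee_kk:
 assumes "good e" "x \<in> D - cball 0 e" "y \<in> D - cball 0 e"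
 shows "ee l m e x y = of_real m * (x / (x - y)) - of_real ((l * g x + m * g y) / Lf e)
 + (of_real l * (x * dx H x x) + of_real m * (x * dx H x y) - of_real ((l * g x + m * g y) / Lf e) * (x * dx H x 0)
 - (of_real l * (x * dx (kk e) x x) + of_real m * (x * dx (kk e) x y)))"
proof -
 define u where "u = g x / Lf e"
 define v where "v = g y / Lf e"
 have q: "(l * g x + m * g y) / Lf e = l * u + m * v" by (simp add: u_def v_def add_divide_distrib)
 have "x ~= 0" using assms(1,2) by (auto simp: good_def)
 then have xi: "x * inverse x = 1" by simp
 have *: "x * (of_real l * (P + (- inverse x - Q) * of_real u - K) + of_real m * (P' + (- inverse x - Q) * of_real v - K' + R))
 = of_real m * (x * R) - (x * inverse x) * of_real (l * u + m * v) + (of_real l * (x * P) + of_real m * (x * P')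
 - of_real (l * u + m * v) * (x * Q) - (of_real l * (x * K) + of_real m * (x * K')))" for P P' Q K K' R :: complex
 by (simp add: algebra_simps)
 show ?thesis unfolding ee_def dx_He_kk[OF assms(1,2,2)] dx_He_kk[OF assms] u_def[symmetric] v_def[symmetric] *
 unfolding q xi by simp
qed

text \<open>\<open>u\<close> and \<open>w\<close> stand for the coordinate projections or for 0, so
  that one definition serves both equations, the diagonal terms and the pole at the origin. Division
  by sc turns a gradient that vanishes at (0,0) into a quantity of order 1.\<close>

definition DN :: "(complex \<times> complex => complex) => (complex \<times> complex => complex) => real => complex \<times> complex => complex" where
 "DN u w e p = (1 / sc e) *\<^sub>R dx H (sc e *\<^sub>R u p) (sc e *\<^sub>R w p)"
definition DK :: "(complex \<times> complex => complex) => (complex \<times> complex => complex) => real => complex \<times> complex => complex" where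
 "DK u w e p = (1 / sc e) *\<^sub>R dx (kk e) (sc e *\<^sub>R u p) (sc e *\<^sub>R w p)"
text \<open>The differential of \<open>dx H\<close> at (0,0), which is the limit of
  \<open>DN\<close>; it contains the pure and the mixed second derivatives.\<close>

definition ll :: "complex \<times> complex => complex" where
 "ll v = of_real (bD (%x y. Re (dx H x y)) (0, 0) v) + \<i> * of_real (bD (%x y. Im (dx H x y)) (0, 0) v)"
definition Tg :: "real => real => (complex \<times> complex => complex) => (complex \<times> complex => complex) => real => complex \<times> complex => complex" where
 "Tg l m u w e p = u p * (of_real l * DN u u e p + of_real m * DN u w e p - of_real q0 * DN u (%_. 0) e p
 - (of_real l * DK u u e p + of_real m * DK u w e p))"
definition Bg :: "real => real => (complex \<times> complex => complex) => (complex \<times> complex => complex) => complex \<times> complex => complex" where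
 "Bg l m u w p = u p * (of_real l * ll (u p, u p) + of_real m * ll (u p, w p) - of_real q0 * ll (u p, 0))"
definition Wg :: "(complex \<times> complex => complex) => real => complex \<times> complex => complex" where
 "Wg u e p = u p * DN u (%_. 0) e p"
definition hh :: "real => complex \<times> complex => real" where
 "hh e p = l1 * (H (sc e *\<^sub>R fst p) 0 - R0) + l2 * (H (sc e *\<^sub>R snd p) 0 - R0)"
definition c0 :: real where "c0 = q0 * R0 - (l1 + l2) * R0"
text \<open>The deviation of \<open>qq\<close> from \<open>q0\<close> magnified by Lf, at the
  rescaled point \<open>p\<close>; it stays bounded on the annuli.\<close>

definition \<theta> :: "real => complex \<times> complex => real" where
 "\<theta> e p = c0 - l1 * ln (cmod (fst p)) - l2 * ln (cmod (snd p)) - hh e p"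

text \<open>Each gradient contributes one factor sc and the prefactor x another, whereas x/(x - y)
  is scale invariant; so the whole regular contribution carries sc^2.\<close>

lemma ee_scaled:
 assumes "good e" "sc e *\<^sub>R u p \<in> D - cball 0 e" "sc e *\<^sub>R w p \<in> D - cball 0 e"
 "(l * g (sc e *\<^sub>R u p) + m * g (sc e *\<^sub>R w p)) / Lf e = q0 + \<theta> e p / Lf e"
 shows "ee l m e (sc e *\<^sub>R u p) (sc e *\<^sub>R w p) = of_real m * (u p / (u p - w p)) - of_real (q0 + \<theta> e p / Lf e)
 + of_real ((sc e)\<^sup>2) * (Tg l m u w e p - of_real (\<theta> e p / Lf e) * Wg u e p)"
proof -
 define a where "a = complex_of_real (sc e)"
 have "0 < e" using assms(1) by (simp add: good_def)
 then have a0: "a ~= 0" using sc_pos[of e] by (simp add: a_def)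
 have s: "sc e *\<^sub>R z = a * z" for z :: complex by (simp add: a_def scaleR_conv_of_real)
 have r: "a * u p / (a * u p - a * w p) = u p / (u p - w p)"
 using a0 by (simp add: right_diff_distrib[symmetric])
 have n: "dx H (a * u p) (a * u p) = a * DN u u e p" "dx H (a * u p) (a * w p) = a * DN u w e p"
 "dx H (a * u p) 0 = a * DN u (%_. 0) e p"
 "dx (kk e) (a * u p) (a * u p) = a * DK u u e p" "dx (kk e) (a * u p) (a * w p) = a * DK u w e p"
 using a0 by (simp_all add: DN_def DK_def s) (simp_all add: a_def scaleR_conv_of_real)
 define t where "t = complex_of_real (\<theta> e p / Lf e)"
 have *: "of_real l * (a * U * (a * P)) + of_real m * (a * U * (a * Q)) - (of_real q0 + t) * (a * U * (a * R))
 - (of_real l * (a * U * (a * K)) + of_real m * (a * U * (a * K')))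
 = a\<^sup>2 * (U * (of_real l * P + of_real m * Q - of_real q0 * R - (of_real l * K + of_real m * K')) - t * (U * R))"
 for U P Q R K K' by (simp add: power2_eq_square algebra_simps)
 show ?thesis unfolding ee_kk[OF assms(1-3)] assms(4) unfolding Tg_def Wg_def s r n
 unfolding of_real_add t_def[symmetric] of_real_power a_def[symmetric] * by (simp add: a_def)
qed

lemma q_scaled:
 assumes "good e" "fst p ~= 0" "snd p ~= 0"
 shows "(l1 * g (sc e *\<^sub>R fst p) + l2 * g (sc e *\<^sub>R snd p)) / Lf e = q0 + \<theta> e p / Lf e"
proof -
 have e0: "0 < e" "1 <= Lf e" using assms(1) by (simp_all add: good_def)
 have a: "0 < sc e" "ln (sc e) = \<beta> * ln e" using sc_pos ln_sc e0 by auto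
 have gs: "g (sc e *\<^sub>R z) = - \<beta> * ln e - ln (cmod z) - H (sc e *\<^sub>R z) 0" if "z ~= 0" for z
 using that a by (simp add: g_def ln_mult)
 have "(l1 + l2) * \<beta> = q0" using l1 l2 by (simp add: \<beta>_def)
 then have "q0 * ln e = l1 * (\<beta> * ln e) + l2 * (\<beta> * ln e)" by (metis distrib_right mult.assoc)
 then have "l1 * g (sc e *\<^sub>R fst p) + l2 * g (sc e *\<^sub>R snd p) = q0 * Lf e + \<theta> e p"
 unfolding gs[OF assms(2)] gs[OF assms(3)] \<theta>_def hh_def c0_def Lf_def by (simp add: algebra_simps)
 then show ?thesis using e0 by (simp add: field_simps)
qed

lemma ll_linear: "bounded_linear ll"
proof -
 have b: "bounded_linear (bD f z)" for f z
 unfolding bD_def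
 by (intro bounded_linear_add bounded_linear_compose[OF bounded_linear_Re]
 bounded_linear_compose[OF bounded_linear_mult_right] bounded_linear_fst bounded_linear_snd)
 show ?thesis unfolding ll_def
 by (intro bounded_linear_add bounded_linear_compose[OF bounded_linear_of_real]
 bounded_linear_compose[OF bounded_linear_mult_right] b)
qed

lemma eventually_pos: "\<forall>\<^sub>F e in at_right 0. 0 < sc e"
 using eventually_at_right_less[of "0::real"] by eventually_elim (rule sc_pos)

lemma DN_remainder:
 assumes "bounded V" "bounded_linear u" "bounded_linear w"
 shows "c1_bound V (%e p. DN u w e p - ll (u p, w p)) sc"
proof -
 let ?R = "%x y. Re (dx H x y)" and ?I = "%x y. Im (dx H x y)"
 have bR: "biharm D D ?R" and bI: "biharm D D ?I" by (intro biharm_dx hreg_biharm)+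
 have z: "(0, 0) \<in> D \<times> D" using zero_in_D by simp
 obtain B1 s1 where 1: "0 <= B1" "0 < s1" "cball (0, 0) s1 \<subseteq> D \<times> D"
 "\<forall>z\<in>cball (0, 0) s1. \<forall>v. \<bar>bD ?R z v - bD ?R (0, 0) v\<bar> <= B1 * norm (z - (0, 0)) * norm v"
 using biharm_C11[OF bR z] by blast
 obtain B2 s2 where 2: "0 <= B2" "0 < s2"
 "\<forall>z\<in>cball (0, 0) s2. \<forall>v. \<bar>bD ?I z v - bD ?I (0, 0) v\<bar> <= B2 * norm (z - (0, 0)) * norm v"
 using biharm_C11[OF bI z] by blast
 define F' where "F' z v = complex_of_real (bD ?R z v) + \<i> * of_real (bD ?I z v)" for z v
 have F0: "F' 0 = ll" by (simp add: F'_def ll_def fun_eq_iff zero_prod_def)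
 have d: "((%p. dx H (fst p) (snd p)) has_derivative F' z) (at z)" if "z \<in> D \<times> D" for z
 proof -
 have "((%p. of_real (?R (fst p) (snd p)) + \<i> * of_real (?I (fst p) (snd p))) has_derivative F' z) (at z)"
 unfolding F'_def by (intro has_derivative_add has_derivative_mult_right has_derivative_of_real
 biharm_bD[OF bR that] biharm_bD[OF bI that])
 then show ?thesis by (simp flip: complex_eq)
 qed
 have lip: "norm (F' z v - F' 0 v) <= (B1 + B2) * norm z * norm v" if z: "z \<in> ball 0 (min s1 s2)" for z v
 proof -
 have zz: "z \<in> cball (0, 0) s1" "z \<in> cball (0, 0) s2" using z by (auto simp flip: zero_prod_def)
 have "F' z v - F' 0 v = of_real (bD ?R z v - bD ?R (0, 0) v) + \<i> * of_real (bD ?I z v - bD ?I (0, 0) v)"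
 by (simp add: F'_def zero_prod_def algebra_simps)
 then have "norm (F' z v - F' 0 v) <= \<bar>bD ?R z v - bD ?R (0, 0) v\<bar> + \<bar>bD ?I z v - bD ?I (0, 0) v\<bar>"
 using norm_triangle_ineq[of "complex_of_real (bD ?R z v - bD ?R (0, 0) v)" "\<i> * of_real (bD ?I z v - bD ?I (0, 0) v)"]
 by (simp only: norm_mult norm_of_real norm_ii mult_1)
 also have "... <= B1 * norm z * norm v + B2 * norm z * norm v"
 using 1(4)[rule_format, OF zz(1), of v] 2(3)[rule_format, OF zz(2), of v]
 by (intro add_mono) (simp_all flip: zero_prod_def)
 finally show ?thesis by (simp add: algebra_simps)
 qed
 have "c1_bound V (%e p. (1 / sc e) *\<^sub>R (%z. dx H (fst z) (snd z)) (sc e *\<^sub>R (u p, w p)) - F' 0 (u p, w p)) sc"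
 proof (rule scale_C11[OF _ _ _ lip])
 show "dx H (fst 0) (snd 0) = 0" by (simp add: dx0)
 show "((%z. dx H (fst z) (snd z)) has_derivative F' z) (at z)" if "z \<in> ball 0 (min s1 s2)" for z
 proof (rule d)
 have "z \<in> cball (0, 0) s1" using that by (auto simp flip: zero_prod_def)
 then show "z \<in> D \<times> D" using 1(3) by blast
 qed
 show "bounded_linear (%p. (u p, w p))" by (rule bounded_linear_Pair[OF assms(2,3)])
 qed (simp_all add: 1(1,2) 2(1,2) assms(1) sc_tendsto eventually_pos)
 then show ?thesis by (simp add: F0 DN_def)
qed

text \<open>The gradient of H(., 0) vanishes at the origin, so the linear part of the scaled
  difference is 0 and a further factor sc is gained.\<close>

lemma H_remainder:
 assumes "bounded V" "bounded_linear u"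
 shows "c1_bound V (%e p. H (sc e *\<^sub>R u p) 0 - R0) (%e. (sc e)\<^sup>2)"
proof -
 have z: "(0, 0) \<in> D \<times> D" using zero_in_D by simp
 obtain B s where 1: "0 <= B" "0 < s" "cball (0, 0) s \<subseteq> D \<times> D"
 "\<forall>z\<in>cball (0, 0) s. \<forall>v. \<bar>bD H z v - bD H (0, 0) v\<bar> <= B * norm (z - (0, 0)) * norm v"
 using biharm_C11[OF hreg_biharm z] by blast
 have "c1_bound V (%e p. (1 / sc e) *\<^sub>R (%z. H (fst z) (snd z) - R0) (sc e *\<^sub>R (u p, 0)) - bD H 0 (u p, 0)) sc"
 proof (rule scale_C11[OF _ 1(2)])
 show "H (fst 0) (snd 0) - R0 = 0" by (simp add: R0_def)
 show "((%z. H (fst z) (snd z) - R0) has_derivative bD H z) (at z)" if "z \<in> ball 0 s" for z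
 proof -
 have "z \<in> cball (0, 0) s" using that by (auto simp flip: zero_prod_def)
 then have "z \<in> D \<times> D" using 1(3) by blast
 from has_derivative_diff[OF biharm_bD[OF hreg_biharm this] has_derivative_const] show ?thesis by simp
 qed
 show "norm (bD H z v - bD H 0 v) <= B * norm z * norm v" if "z \<in> ball 0 s" for z v
 proof -
 have "z \<in> cball (0, 0) s" using that by (auto simp flip: zero_prod_def)
 from 1(4)[rule_format, OF this, of v] show ?thesis by (simp flip: zero_prod_def)
 qed
 show "bounded_linear (%p. (u p, 0::complex))" by (rule bounded_linear_Pair[OF assms(2) bounded_linear_zero])
 qed (simp_all add: 1(1,2) assms(1) sc_tendsto eventually_pos)
 moreover have "bD H 0 (u p, 0) = 0" for p by (simp add: bD_def dx0)
 ultimately have "c1_bound V (%e p. (1 / sc e) *\<^sub>R (H (sc e *\<^sub>R u p) 0 - R0)) sc" by simp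
 from c1_bound_scale[OF this, of sc]
 have "c1_bound V (%e p. sc e *\<^sub>R ((1 / sc e) *\<^sub>R (H (sc e *\<^sub>R u p) 0 - R0))) (%e. \<bar>sc e\<bar> * sc e)" .
 moreover have "sc e *\<^sub>R ((1 / sc e) *\<^sub>R (H (sc e *\<^sub>R u p) 0 - R0)) = H (sc e *\<^sub>R u p) 0 - R0" for e p
 by (cases "sc e = 0") (auto simp: R0_def)
 moreover have "\<bar>sc e\<bar> * sc e = (sc e)\<^sup>2" for e by (simp add: sc_def power2_eq_square)
 ultimately show ?thesis by simp
qed

lemma eventually_region:
 assumes "0 < c"
 shows "\<forall>\<^sub>F e in at_right 0. good e & e <= 1 & 0 < sc e & sc e <= 1 & 4 * e < c * sc e & 2 * sc e / c < r1 & Lf e * sc e <= 1"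
proof -
 have "\<forall>\<^sub>F e in at_right 0. e / sc e < c / 4" using order_tendstoD(2)[OF hole_over_sc, of "c / 4"] assms by simp
 moreover have "\<forall>\<^sub>F e in at_right 0. sc e < min 1 (c * r1 / 2)"
 using order_tendstoD(2)[OF sc_tendsto, of "min 1 (c * r1 / 2)"] assms r1 by simp
 moreover have "\<forall>\<^sub>F e in at_right 0. Lf e * sc e < 1" using order_tendstoD(2)[OF Lf_limits(2), of 1] by simp
 moreover have "\<forall>\<^sub>F e::real in at_right 0. e < 1" by (rule order_tendstoD(2)[OF tendsto_ident_at]) simp
 ultimately show ?thesis using eventually_good eventually_pos
 proof eventually_elim
 case (elim e)
 have "4 * e < c * sc e" using elim(1,6) by (simp add: field_simps)
 moreover have "2 * sc e / c < r1" using elim(2) assms by (simp add: field_simps)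
 ultimately show ?case using elim by simp
 qed
qed

text \<open>\<open>kk\<close> is O(sc^3) on neighbourhoods of radius comparable to sc, and each of
  two gradient estimates costs one factor sc: \<open>dx (kk e)\<close> is O(sc^2) and its derivative
  O(sc). The division by sc, and for the derivative the chain rule factor sc as well, leave O(sc)
  for both.\<close>

lemma DK_bound:
 assumes "0 < c" "c <= 1" "bounded_linear u" "bounded_linear w"
 "!!p. p \<in> V ==> c < cmod (u p) & cmod (u p) < 1 / c & c < cmod (w p) & cmod (w p) < 1 / c"
 shows "c1_bound V (DK u w) sc"
proof -
 obtain N where N: "N > 0" "!!v. norm (u v, w v) <= norm v * N"
 using bounded_linear.pos_bounded[OF bounded_linear_Pair[OF assms(3,4)]] by blast
 define C' where "C' = (3 * C1 + 1 / r1) + 8 / c\<^sup>2"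
 have C': "0 <= C'" using C1 r1 by (simp add: C'_def)
 define Q where "Q = 16 * C' / c + 1024 * C' / c\<^sup>2 * N"
 have "\<forall>\<^sub>F e in at_right 0. 0 <= sc e & (\<forall>p\<in>V. \<exists>f'. (DK u w e has_derivative f') (at p) \<and>
 norm (DK u w e p) <= Q * sc e & (\<forall>v. norm (f' v) <= Q * sc e * norm v))"
 using eventually_region[OF assms(1)]
 proof eventually_elim
 case (elim e)
 define a where "a = sc e"
 have a: "0 < a" "a <= 1" "4 * e < c * a" "2 * a / c < r1" using elim by (simp_all add: a_def)
 have e: "good e" "0 < e" "e <= 1" using elim by (simp_all add: good_def)
 show ?case
 proof (intro conjI ballI)
 fix p assume "p \<in> V"
 note up = assms(5)[OF this]
 \<comment> \<open>Points within 2 rho of the rescaled point keep modulus between a c/2 and 2a/c, so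
   they avoid the hole and stay in the disc of radius r1.\<close>
 define rho where "rho = a * c / 4"
 have rho: "0 < rho" using a assms(1) by (simp add: rho_def)
 define x where "x = a *\<^sub>R u p"
 define y where "y = a *\<^sub>R w p"
 have rng: "a * c / 2 < cmod z' & cmod z' < 2 * a / c" if "cmod (z' - a *\<^sub>R z) < 2 * rho" "c < cmod z" "cmod z < 1 / c" for z z'
 proof -
 have "a * c < a * cmod z" "a * cmod z < a * (1 / c)"
 using mult_strict_left_mono[OF that(2) a(1)] mult_strict_left_mono[OF that(3) a(1)] by simp_all
 then have z: "a * c < cmod (a *\<^sub>R z)" "cmod (a *\<^sub>R z) < a / c" using a(1) by simp_all
 have "a * c <= a * (1 / c)" using assms(1,2) a(1) by (intro mult_left_mono) (auto simp: divide_simps mult_le_one)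
 then have "a * c / 2 + a / c <= 2 * a / c" using a(1) assms(1) by (simp add: field_simps)
 moreover have "\<bar>cmod z' - cmod (a *\<^sub>R z)\<bar> < a * c / 2"
 using le_less_trans[OF norm_triangle_ineq3 that(1)] by (simp add: rho_def)
 ultimately show ?thesis using z unfolding abs_less_iff by linarith
 qed
 have loc: "x' \<in> D - cball 0 e & y' \<in> D - cball 0 e & \<bar>kk e x' y'\<bar> <= C' * a ^ 3"
 if "cmod (x' - x) < 2 * rho" "cmod (y' - y) < 2 * rho" for x' y'
 proof -
 have rx: "a * c / 2 < cmod x'" "cmod x' < r1" using rng[OF that(1)[unfolded x_def]] up a(4) by auto
 have ry: "a * c / 2 < cmod y'" "cmod y' < r1" using rng[OF that(2)[unfolded y_def]] up a(4) by auto
 have big: "2 * e <= cmod x'" "e < cmod x'" "e < cmod y'" using rx ry a(3) e(2) by (auto simp: mult.commute)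
 have "\<bar>kk e x' y'\<bar> <= (3 * C1 + 1 / r1) * e + 2 * e\<^sup>2 / (cmod x' * cmod y')"
 by (rule kk_bound[OF e(1) big(3) ry(2) big(1) rx(2)])
 also have "... <= (3 * C1 + 1 / r1) * a ^ 3 + 8 / c\<^sup>2 * a ^ 3"
 proof (rule add_mono)
 show "(3 * C1 + 1 / r1) * e <= (3 * C1 + 1 / r1) * a ^ 3"
 using sc_cubed(1)[OF e(2,3)] C1 r1 unfolding a_def by (intro mult_left_mono) auto
 have "(a * c / 2) * (a * c / 2) <= cmod x' * cmod y'" using rx ry a assms(1) by (intro mult_mono) auto
 moreover have "0 < (a * c / 2) * (a * c / 2)" using a assms(1) by simp
 ultimately have "2 * e\<^sup>2 / (cmod x' * cmod y') <= 2 * a ^ 5 / ((a * c / 2) * (a * c / 2))"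
 using sc_cubed(2)[OF e(2,3)] a(1) unfolding a_def by (intro frac_le) auto
 also have "... = 8 / c\<^sup>2 * a ^ 3" using a(1) assms(1) by (simp add: power2_eq_square field_simps eval_nat_numeral)
 finally show "2 * e\<^sup>2 / (cmod x' * cmod y') <= 8 / c\<^sup>2 * a ^ 3" .
 qed
 also have "... = C' * a ^ 3" by (simp add: C'_def distrib_right)
 finally show ?thesis using in_E[OF e(1) big(2)] in_E[OF e(1) big(3)] rx ry r1 by auto
 qed
 note bd = biharm_derivative_bounds[OF kk_biharm[OF e(1)] rho, of x y "C' * a ^ 3"]
 have 1: "cmod (dx (kk e) x y) <= 4 * (C' * a ^ 3) / rho" by (rule bd(1)) (use loc in blast)
 obtain D where D: "((%p. dx (kk e) (fst p) (snd p)) has_derivative D) (at (x, y))"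
 "!!v. norm (D v) <= 64 * (C' * a ^ 3) / rho\<^sup>2 * norm v"
 using bd(2) loc by blast
 have c1: "4 * (C' * a ^ 3) / rho = 16 * C' / c * a\<^sup>2" "64 * (C' * a ^ 3) / rho\<^sup>2 = 1024 * C' / c\<^sup>2 * a"
 using a(1) assms(1) by (simp_all add: rho_def field_simps power2_eq_square power3_eq_cube)
 have "cmod (DK u w e p) = (1 / a) * cmod (dx (kk e) x y)" using a(1) by (simp add: DK_def x_def y_def a_def)
 also have "... <= (1 / a) * (16 * C' / c * a\<^sup>2)" using 1 a(1) unfolding c1 by (intro mult_left_mono) auto
 also have "... = 16 * C' / c * a" using a(1) by (simp add: power2_eq_square)
 also have "... <= Q * a" using a C' N assms(1) by (intro mult_right_mono) (auto simp: Q_def)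
 finally have n: "cmod (DK u w e p) <= Q * sc e" by (simp add: a_def)
 have "((%p. a *\<^sub>R (u p, w p)) has_derivative (%v. a *\<^sub>R (u v, w v))) (at p)"
 by (rule has_derivative_scaleR_right[OF bounded_linear_imp_has_derivative[OF bounded_linear_Pair[OF assms(3,4)]]])
 from has_derivative_compose[OF this, of "%p. dx (kk e) (fst p) (snd p)" D] D(1)
 have "((%p. dx (kk e) (a *\<^sub>R u p) (a *\<^sub>R w p)) has_derivative (%v. D (a *\<^sub>R (u v, w v)))) (at p)"
 by (simp add: x_def y_def)
 then have d: "(DK u w e has_derivative (%v. (1 / a) *\<^sub>R D (a *\<^sub>R (u v, w v)))) (at p)"
 unfolding DK_def[abs_def] a_def by (rule has_derivative_scaleR_right)
 have "norm ((1 / a) *\<^sub>R D (a *\<^sub>R (u v, w v))) <= Q * sc e * norm v" for v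
 proof -
 have "norm ((1 / a) *\<^sub>R D (a *\<^sub>R (u v, w v))) = (1 / a) * norm (D (a *\<^sub>R (u v, w v)))" using a(1) by simp
 also have "... <= (1 / a) * (1024 * C' / c\<^sup>2 * a * norm (a *\<^sub>R (u v, w v)))"
 using D(2)[of "a *\<^sub>R (u v, w v)"] a(1) unfolding c1 by (intro mult_left_mono) auto
 also have "... = 1024 * C' / c\<^sup>2 * a * norm (u v, w v)" using a(1) by (simp only: norm_scaleR) simp
 also have "... <= 1024 * C' / c\<^sup>2 * a * (norm v * N)" using N(2)[of v] a(1) C' by (intro mult_left_mono) auto
 also have "... = (1024 * C' / c\<^sup>2 * N) * a * norm v" by simp
 also have "... <= Q * a * norm v" using a C' assms(1) by (intro mult_right_mono) (auto simp: Q_def)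
 finally show ?thesis by (simp add: a_def)
 qed
 then show "\<exists>f'. (DK u w e has_derivative f') (at p) & norm (DK u w e p) <= Q * sc e & (\<forall>v. norm (f' v) <= Q * sc e * norm v)"
 using d n by blast
 qed (use a in \<open>simp add: a_def\<close>)
 qed
 moreover have "0 <= Q" using C' N assms(1) by (simp add: Q_def)
 ultimately show ?thesis unfolding c1_bound_def by blast
qed

end


section \<open>Splitting the rescaled equations into a limit system and a C^1-small
  perturbation\<close>

lemma c1_bound_linear_fixed:
 assumes "bounded V" "bounded_linear u"
 shows "c1_bound V (%_. u) (%_. 1)"
proof -
 obtain N where N: "N > 0" "!!x. norm (u x) <= norm x * N" using bounded_linear.pos_bounded[OF assms(2)] by blast
 obtain R where R: "R > 0" "!!p. p \<in> V ==> norm p <= R" using assms(1) unfolding bounded_pos by blast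
 show ?thesis
 proof (rule c1_bound_fixed[where f' = "%_. u" and C = "R * N + N"])
 show "(u has_derivative u) (at p)" for p by (rule bounded_linear_imp_has_derivative[OF assms(2)])
 show "norm (u p) <= R * N + N" if "p \<in> V" for p
 proof -
 have "norm p * N <= R * N" using R(2)[OF that] N(1) by (intro mult_right_mono) auto
 then show ?thesis using N(1) N(2)[of p] by linarith
 qed
 show "norm (u v) <= (R * N + N) * norm v" for v
 proof -
 have "norm v * N <= (R * N + N) * norm v" using R(1) N(1) by (simp add: algebra_simps)
 then show ?thesis using N(2)[of v] by linarith
 qed
 qed (use R N in auto)
qed

lemma c1_bound_const: "c1_bound V (%_ _. k) (%_. 1)"
 by (rule c1_bound_fixed[where f' = "%_ _. 0" and C = "norm k"]) auto

lemma c1_bound_mult1: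
 fixes f g :: "real => 'a::real_normed_vector => 'b::real_normed_algebra"
 assumes "c1_bound V f (%_. 1)" "c1_bound V g r"
 shows "c1_bound V (%eps p. f eps p * g eps p) r"
 using c1_bound_mult[OF assms] by simp

lemma c1_bound_cmult:
 fixes f :: "real => 'a::real_normed_vector => 'b::real_normed_algebra"
 assumes "c1_bound V f r"
 shows "c1_bound V (%eps p. k * f eps p) r"
 by (rule c1_bound_linear[OF assms bounded_linear_mult_right])

lemma c1_bound_le:
 assumes "c1_bound V f r" "\<forall>\<^sub>F eps in at_right 0. r eps <= s eps & 0 <= s eps"
 shows "c1_bound V f s"
 by (rule c1_bound_weaken[OF assms(1), of 1]) (use assms(2) in auto)

lemma c1_bound_ln:
 assumes "bounded_linear u" "0 < c" "c < 1" "!!p. p \<in> V ==> c < cmod (u p) & cmod (u p) < 1 / c"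
 shows "c1_bound V (%_ p. ln (cmod (u p))) (%_. 1)"
proof -
 obtain N where N: "N > 0" "!!x. norm (u x) <= norm x * N" using bounded_linear.pos_bounded[OF assms(1)] by blast
 show ?thesis
 proof (rule c1_bound_fixed[where f' = "%p v. Re (inverse (u p) * u v)" and C = "\<bar>ln c\<bar> + N / c"])
 fix p assume p: "p \<in> V"
 note b = assms(4)[OF p]
 have u0: "u p ~= 0" using b assms(2) by auto
 have d: "((%z. ln (cmod (z - 0))) has_derivative (%h. Re (inverse (u p - 0) * h))) (at (u p))"
 by (rule has_derivative_ln_cmod) (use u0 in simp)
 from has_derivative_compose[OF bounded_linear_imp_has_derivative[OF assms(1)] this]
 show "((%p. ln (cmod (u p))) has_derivative (%v. Re (inverse (u p) * u v))) (at p)" by simp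
 have "ln c <= ln (cmod (u p))" "ln (cmod (u p)) <= ln (1 / c)"
 using b assms(2) u0 by (auto simp del: ln_div)
 moreover have "ln (1 / c) = - ln c" using assms(2) by (simp add: ln_div)
 moreover have "0 <= N / c" using N(1) assms(2) by simp
 ultimately show "norm (ln (cmod (u p))) <= \<bar>ln c\<bar> + N / c" unfolding real_norm_def by linarith
 fix v
 have "\<bar>Re (inverse (u p) * u v)\<bar> <= cmod (inverse (u p) * u v)" by (rule abs_Re_le_cmod)
 also have "... = cmod (u v) / cmod (u p)" by (simp add: norm_mult norm_inverse divide_inverse)
 also have "... <= (norm v * N) / c" using N(2)[of v] b assms(2) N(1) by (intro frac_le) auto
 also have "... <= (\<bar>ln c\<bar> + N / c) * norm v" by (simp add: algebra_simps)
 finally show "norm (Re (inverse (u p) * u v)) <= (\<bar>ln c\<bar> + N / c) * norm v" by simp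
 next
 show "0 <= \<bar>ln c\<bar> + N / c" by (rule add_nonneg_nonneg) (use N(1) assms(2) in simp_all)
 qed
qed

context kr0
begin

definition T2 :: "real => complex \<times> complex => complex" where "T2 = Tg l2 l1 snd fst"
definition T12 :: "real => complex \<times> complex => complex" where
 "T12 e p = of_real l1 * Tg l1 l2 fst snd e p + of_real l2 * T2 e p"
definition W12 :: "real => complex \<times> complex => complex" where
 "W12 e p = of_real l1 * Wg fst e p + of_real l2 * Wg snd e p"
definition B0 :: "complex \<times> complex => complex" where
 "B0 p = of_real l1 * Bg l1 l2 fst snd p + of_real l2 * Bg l2 l1 snd fst p"
text \<open>The first component is the limit of the y-equation. The second packs the dilation
  equation (real part) and the rotation equation (imaginary part) into one complex number, so that
  domain and range have the same type.\<close>

definition Fz :: "complex \<times> complex => complex \<times> complex" where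
 "Fz p = (of_real l1 * (snd p / (snd p - fst p)) - of_real q0,
 Complex ((l1 + l2) * (l1 * ln (cmod (fst p)) + l2 * ln (cmod (snd p)) - c0)) (Im (B0 p)))"
text \<open>The deviation is an argument \<open>th\<close>, so that the same estimate serves for
  \<theta> in general and for - \<open>hh\<close> at the zeros of the limit system.\<close>

definition Dl :: "(real => complex \<times> complex => real) => real => complex \<times> complex => complex \<times> complex" where
 "Dl th e p = (of_real ((sc e)\<^sup>2) * (T2 e p - of_real (th e p / Lf e) * Wg snd e p) - of_real (th e p / Lf e),
 Complex ((l1 + l2) * hh e p + Lf e * (sc e)\<^sup>2 * Re (T12 e p - of_real (th e p / Lf e) * W12 e p))
 (Im (T12 e p - B0 p - of_real (th e p / Lf e) * W12 e p)))"
definition SS :: "real => complex \<times> complex => complex" where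
 "SS e p = of_real l1 * ee l1 l2 e (sc e *\<^sub>R fst p) (sc e *\<^sub>R snd p) + of_real l2 * ee l2 l1 e (sc e *\<^sub>R snd p) (sc e *\<^sub>R fst p)"
text \<open>The factors Lf and 1/sc^2 bring the two weak components to order 1; being nonzero, they
  do not change the zero set.\<close>

definition Psi :: "real => complex \<times> complex => complex \<times> complex" where
 "Psi e p = (ee l2 l1 e (sc e *\<^sub>R snd p) (sc e *\<^sub>R fst p), Complex (Lf e * Re (SS e p)) (Im (SS e p) / (sc e)\<^sup>2))"

lemma Psi_zero_iff:
 assumes "good e"
 shows "Psi e p = 0 \<longleftrightarrow> ee l1 l2 e (sc e *\<^sub>R fst p) (sc e *\<^sub>R snd p) = 0 & ee l2 l1 e (sc e *\<^sub>R snd p) (sc e *\<^sub>R fst p) = 0"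
proof -
 have "0 < e" "1 <= Lf e" using assms by (simp_all add: good_def)
 then have "sc e ~= 0" "Lf e ~= 0" using sc_pos[of e] by auto
 then have "Psi e p = 0 \<longleftrightarrow> ee l2 l1 e (sc e *\<^sub>R snd p) (sc e *\<^sub>R fst p) = 0 & SS e p = 0"
 by (auto simp: Psi_def zero_prod_def complex_eq_iff)
 then show ?thesis using l1 by (auto simp: SS_def)
qed

text \<open>An identity, not an estimate. In \<open>SS\<close> the singular fractions add to 1 and
  cancel against (l1 + l2) q0 = l1 l2. The remaining \<theta> term outside the factor sc^2 is real,
  so it drops out of the imaginary part, which may then be divided by sc^2.\<close>

lemma Psi_eq:
 assumes "good e" "sc e *\<^sub>R fst p \<in> D - cball 0 e" "sc e *\<^sub>R snd p \<in> D - cball 0 e" "fst p ~= snd p"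
 shows "Psi e p = Fz p + Dl \<theta> e p"
proof -
 have e0: "0 < e" "1 <= Lf e" using assms(1) by (simp_all add: good_def)
 have s0: "0 < sc e" using sc_pos[OF e0(1)] .
 have nz: "fst p ~= 0" "snd p ~= 0" using assms(2,3) e0(1) by auto
 note q = q_scaled[OF assms(1) nz]
 define t where "t = complex_of_real (\<theta> e p / Lf e)"
 have tt: "complex_of_real (q0 + \<theta> e p / Lf e) = of_real q0 + t" by (simp add: t_def)
 define a2 where "a2 = complex_of_real ((sc e)\<^sup>2)"
 note e1 = ee_scaled[of e fst p snd l1 l2, OF assms(1,2,3) q, unfolded tt, folded t_def a2_def]
 have q': "(l2 * g (sc e *\<^sub>R snd p) + l1 * g (sc e *\<^sub>R fst p)) / Lf e = q0 + \<theta> e p / Lf e" using q by (simp add: add.commute)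
 note e2 = ee_scaled[of e snd p fst l2 l1, OF assms(1,3,2) q', unfolded tt, folded t_def a2_def]
 have frac: "fst p / (fst p - snd p) + snd p / (snd p - fst p) = 1"
 proof -
 have "snd p / (snd p - fst p) = - (snd p / (fst p - snd p))" by (metis minus_diff_eq minus_divide_right)
 then show ?thesis using assms(4) by (simp add: diff_divide_distrib[symmetric])
 qed
 have "complex_of_real (l1 * l2) = of_real ((l1 + l2) * q0)" using l1 l2 by (simp add: q0_def)
 then have qc: "of_real l1 * of_real l2 = (of_real l1 + of_real l2) * complex_of_real q0" by simp
 have "SS e p = of_real l1 * of_real l2 * (fst p / (fst p - snd p) + snd p / (snd p - fst p)) - (of_real l1 + of_real l2) * (of_real q0 + t)
 + a2 * (T12 e p - t * W12 e p)"
 unfolding SS_def e1 e2 T12_def W12_def T2_def by (simp add: algebra_simps)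
 also have "... = - (of_real l1 + of_real l2) * t + a2 * (T12 e p - t * W12 e p)"
 unfolding frac by (simp add: qc algebra_simps)
 also have "... = of_real (- (l1 + l2) * (\<theta> e p / Lf e)) + of_real ((sc e)\<^sup>2) * (T12 e p - t * W12 e p)"
 by (simp add: t_def a2_def)
 finally have S: "SS e p = of_real (- (l1 + l2) * (\<theta> e p / Lf e)) + of_real ((sc e)\<^sup>2) * (T12 e p - t * W12 e p)" .
 have Rm: "Re (of_real r * z) = r * Re z" "Im (of_real r * z) = r * Im z" for r and z :: complex by simp_all
 have R: "Lf e * Re (SS e p) = - (l1 + l2) * \<theta> e p + Lf e * (sc e)\<^sup>2 * Re (T12 e p - t * W12 e p)"
 proof -
 have "Lf e * (- (l1 + l2) * u + v * w) = - (l1 + l2) * (Lf e * u) + Lf e * v * w" for u v w by (simp add: algebra_simps)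
 moreover have "Lf e * (\<theta> e p / Lf e) = \<theta> e p" using e0(2) by simp
 ultimately show ?thesis unfolding S plus_complex.sel Re_complex_of_real Rm(1) by (simp only:)
 qed
 have I: "Im (SS e p) / (sc e)\<^sup>2 = Im (T12 e p - t * W12 e p)"
 unfolding S plus_complex.sel Im_complex_of_real Rm(2) using s0 by simp
 have th: "- (l1 + l2) * \<theta> e p = (l1 + l2) * (l1 * ln (cmod (fst p)) + l2 * ln (cmod (snd p)) - c0) + (l1 + l2) * hh e p"
 by (simp add: \<theta>_def algebra_simps)
 show ?thesis unfolding Psi_def R I e2 th Fz_def Dl_def t_def[symmetric] a2_def[symmetric] T2_def[symmetric]
 by (simp add: prod_eq_iff complex_eq_iff algebra_simps)
qed

lemma eventually_small: "\<forall>\<^sub>F e in at_right 0. good e & 0 < sc e & sc e <= 1 & 1 <= Lf e & Lf e * sc e <= 1"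
 using eventually_region[OF zero_less_one] by eventually_elim (auto simp: good_def)

lemma annuli_c1:
 assumes "0 < c" "c < 1"
 defines "V \<equiv> annuli c"
 shows "c1_bound V (Tg l1 l2 fst snd) (%_. 1)" "c1_bound V T2 (%_. 1)"
 "c1_bound V (Wg fst) (%_. 1)" "c1_bound V (Wg snd) (%_. 1)"
 "c1_bound V (%e p. T12 e p - B0 p) sc" "c1_bound V hh (%e. (sc e)\<^sup>2)" "c1_bound V \<theta> (%_. 1)"
proof -
 have V: "bounded V" unfolding V_def by (rule annuli_bounded)
 have s1: "\<forall>\<^sub>F e in at_right 0. sc e <= 1 & (0::real) <= 1" using eventually_small by eventually_elim simp
 have s2: "\<forall>\<^sub>F e in at_right 0. (sc e)\<^sup>2 <= 1 & (0::real) <= 1"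
 using eventually_small by eventually_elim (simp add: power_le_one)
 note fl = bounded_linear_fst[where 'a=complex and 'b=complex] bounded_linear_snd[where 'a=complex and 'b=complex]
 have llb: "c1_bound V (%_ p. ll (u p, w p)) (%_. 1)" if "bounded_linear u" "bounded_linear w" for u w
 by (rule c1_bound_linear_fixed[OF V bounded_linear_compose[OF ll_linear bounded_linear_Pair[OF that]]])
 have TB: "c1_bound V (%e p. Tg l m u w e p - Bg l m u w p) sc"
 if "bounded_linear u" "bounded_linear w" "c1_bound V (DK u u) sc" "c1_bound V (DK u w) sc" for u w l m
 proof -
 have "c1_bound V (%e p. u p * (of_real l * (DN u u e p - ll (u p, u p)) + of_real m * (DN u w e p - ll (u p, w p))
 - of_real q0 * (DN u (%_. 0) e p - ll (u p, 0)) - (of_real l * DK u u e p + of_real m * DK u w e p))) sc"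
 by (intro c1_bound_mult1 c1_bound_linear_fixed[OF V] c1_bound_diff c1_bound_add c1_bound_cmult
 DN_remainder V that bounded_linear_zero)
 moreover have "(%e p. Tg l m u w e p - Bg l m u w p) = (%e p. u p * (of_real l * (DN u u e p - ll (u p, u p)) + of_real m * (DN u w e p - ll (u p, w p))
 - of_real q0 * (DN u (%_. 0) e p - ll (u p, 0)) - (of_real l * DK u u e p + of_real m * DK u w e p)))"
 by (simp add: Tg_def Bg_def fun_eq_iff algebra_simps)
 ultimately show ?thesis by simp
 qed
 have B: "c1_bound V (%_. Bg l m u w) (%_. 1)" if "bounded_linear u" "bounded_linear w" for u w l m
 unfolding Bg_def[abs_def]
 by (intro c1_bound_mult1 c1_bound_linear_fixed[OF V] c1_bound_diff c1_bound_add c1_bound_cmult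
 llb that bounded_linear_zero)
 have DK: "c1_bound V (DK u w) sc" if "u \<in> {fst, snd}" "w \<in> {fst, snd}" for u w
 by (rule DK_bound[OF assms(1) less_imp_le[OF assms(2)]])
 (use that fl in \<open>auto simp: V_def annuli_def\<close>)
 have TBs: "c1_bound V (%e p. Tg l1 l2 fst snd e p - Bg l1 l2 fst snd p) sc"
 "c1_bound V (%e p. Tg l2 l1 snd fst e p - Bg l2 l1 snd fst p) sc"
 by (intro TB fl DK; simp)+
 have "c1_bound V (%e p. (Tg l1 l2 fst snd e p - Bg l1 l2 fst snd p) + Bg l1 l2 fst snd p) (%_. 1)"
 by (intro c1_bound_add B fl c1_bound_le[OF TBs(1)] s1)
 then show "c1_bound V (Tg l1 l2 fst snd) (%_. 1)" by simp
 have "c1_bound V (%e p. (Tg l2 l1 snd fst e p - Bg l2 l1 snd fst p) + Bg l2 l1 snd fst p) (%_. 1)"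
 by (intro c1_bound_add B fl c1_bound_le[OF TBs(2)] s1)
 then show "c1_bound V T2 (%_. 1)" by (simp add: T2_def)
 have "c1_bound V (%e p. (DN u (%_. 0) e p - ll (u p, 0)) + ll (u p, 0)) (%_. 1)" if "bounded_linear u" for u
 by (intro c1_bound_add llb that bounded_linear_zero c1_bound_le[OF DN_remainder[OF V that bounded_linear_zero]] s1)
 then have W: "c1_bound V (Wg u) (%_. 1)" if "bounded_linear u" for u
 unfolding Wg_def[abs_def] using that by (intro c1_bound_mult1 c1_bound_linear_fixed[OF V]) simp_all
 show "c1_bound V (Wg fst) (%_. 1)" "c1_bound V (Wg snd) (%_. 1)" by (intro W fl)+
 have "c1_bound V (%e p. of_real l1 * (Tg l1 l2 fst snd e p - Bg l1 l2 fst snd p)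
 + of_real l2 * (Tg l2 l1 snd fst e p - Bg l2 l1 snd fst p)) sc"
 by (intro c1_bound_add c1_bound_cmult TBs)
 moreover have "(%e p. T12 e p - B0 p) = (%e p. of_real l1 * (Tg l1 l2 fst snd e p - Bg l1 l2 fst snd p)
 + of_real l2 * (Tg l2 l1 snd fst e p - Bg l2 l1 snd fst p))"
 by (simp add: T12_def B0_def T2_def fun_eq_iff algebra_simps)
 ultimately show "c1_bound V (%e p. T12 e p - B0 p) sc" by simp
 show h: "c1_bound V hh (%e. (sc e)\<^sup>2)"
 unfolding hh_def[abs_def] by (intro c1_bound_add c1_bound_cmult H_remainder V fl)
 have lnb: "c1_bound V (%_ p. ln (cmod (fst p))) (%_. 1)" "c1_bound V (%_ p. ln (cmod (snd p))) (%_. 1)"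
 by (rule c1_bound_ln[OF _ assms(1,2)], rule fl, simp add: V_def annuli_def)+
 show "c1_bound V \<theta> (%_. 1)" unfolding \<theta>_def[abs_def]
 by (intro c1_bound_diff c1_bound_const c1_bound_cmult lnb c1_bound_le[OF h s2])
qed

lemma Dl_bound:
 assumes c: "0 < c" "c < 1" and th: "c1_bound (annuli c) th rt"
 and r: "\<forall>\<^sub>F e in at_right 0. rt e <= 1 & 0 <= rt e & rt e / Lf e <= r e & sc e <= r e & Lf e * (sc e)\<^sup>2 <= r e"
 shows "c1_bound (annuli c) (Dl th) r"
proof -
 let ?V = "annuli c"
 note A = annuli_c1[OF c]
 have ev: "\<forall>\<^sub>F e in at_right 0. 0 <= rt e & rt e <= 1 & rt e / Lf e <= r e & sc e <= r e & Lf e * (sc e)\<^sup>2 <= r e \<and>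
 0 < sc e & sc e <= 1 & 1 <= Lf e & (sc e)\<^sup>2 <= sc e"
 using r eventually_small
 proof eventually_elim
 case (elim e)
 then have "(sc e)\<^sup>2 <= sc e" by (simp add: power2_eq_square mult_left_le_one_le)
 then show ?case using elim by simp
 qed
 have t0: "c1_bound ?V (%e p. (1 / Lf e) *\<^sub>R th e p) (%e. \<bar>1 / Lf e\<bar> * rt e)" by (rule c1_bound_scale[OF th])
 have t1: "c1_bound ?V (%e p. th e p / Lf e) r"
 proof -
 have "c1_bound ?V (%e p. (1 / Lf e) *\<^sub>R th e p) r"
 proof (rule c1_bound_le[OF t0])
 show "\<forall>\<^sub>F e in at_right 0. \<bar>1 / Lf e\<bar> * rt e <= r e & 0 <= r e"
 using ev by eventually_elim auto
 qed
 then show ?thesis by simp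
 qed
 have t2: "c1_bound ?V (%e p. th e p / Lf e) (%_. 1)"
 proof -
 have "c1_bound ?V (%e p. (1 / Lf e) *\<^sub>R th e p) (%_. 1)"
 proof (rule c1_bound_le[OF t0])
 show "\<forall>\<^sub>F e in at_right 0. \<bar>1 / Lf e\<bar> * rt e <= 1 & (0::real) <= 1"
 using ev by eventually_elim (auto simp: divide_le_eq)
 qed
 then show ?thesis by simp
 qed
 note ofr = bounded_linear_of_real[where 'a=complex]
 note tc1 = c1_bound_linear[OF t1 ofr] and tc2 = c1_bound_linear[OF t2 ofr]
 have Wc: "c1_bound ?V W12 (%_. 1)" unfolding W12_def[abs_def] by (intro c1_bound_add c1_bound_cmult A)
 have Tc: "c1_bound ?V T12 (%_. 1)" unfolding T12_def[abs_def] by (intro c1_bound_add c1_bound_cmult A)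
 have first: "c1_bound ?V (%e p. of_real ((sc e)\<^sup>2) * (T2 e p - of_real (th e p / Lf e) * Wg snd e p)) r"
 proof -
 have "c1_bound ?V (%e p. ((sc e)\<^sup>2) *\<^sub>R (T2 e p - of_real (th e p / Lf e) * Wg snd e p)) (%e. \<bar>(sc e)\<^sup>2\<bar> * 1)"
 by (intro c1_bound_scale c1_bound_diff A c1_bound_mult1 tc2)
 then have "c1_bound ?V (%e p. ((sc e)\<^sup>2) *\<^sub>R (T2 e p - of_real (th e p / Lf e) * Wg snd e p)) r"
 proof (rule c1_bound_le)
 show "\<forall>\<^sub>F e in at_right 0. \<bar>(sc e)\<^sup>2\<bar> * 1 <= r e & 0 <= r e" using ev by eventually_elim auto
 qed
 then show ?thesis by (simp add: scaleR_conv_of_real)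
 qed
 have hr: "c1_bound ?V hh r"
 proof (rule c1_bound_le[OF A(6)])
 show "\<forall>\<^sub>F e in at_right 0. (sc e)\<^sup>2 <= r e & 0 <= r e" using ev by eventually_elim auto
 qed
 have second: "c1_bound ?V (%e p. Lf e * (sc e)\<^sup>2 * Re (T12 e p - of_real (th e p / Lf e) * W12 e p)) r"
 proof -
 have "c1_bound ?V (%e p. (Lf e * (sc e)\<^sup>2) *\<^sub>R Re (T12 e p - of_real (th e p / Lf e) * W12 e p)) (%e. \<bar>Lf e * (sc e)\<^sup>2\<bar> * 1)"
 by (intro c1_bound_scale c1_bound_linear[OF _ bounded_linear_Re] c1_bound_diff Tc Wc c1_bound_mult1 tc2)
 then have "c1_bound ?V (%e p. (Lf e * (sc e)\<^sup>2) *\<^sub>R Re (T12 e p - of_real (th e p / Lf e) * W12 e p)) r"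
 proof (rule c1_bound_le)
 show "\<forall>\<^sub>F e in at_right 0. \<bar>Lf e * (sc e)\<^sup>2\<bar> * 1 <= r e & 0 <= r e" using ev by eventually_elim auto
 qed
 then show ?thesis by simp
 qed
 have tb: "c1_bound ?V (%e p. T12 e p - B0 p) r"
 proof (rule c1_bound_le[OF A(5)])
 show "\<forall>\<^sub>F e in at_right 0. sc e <= r e & 0 <= r e" using ev by eventually_elim auto
 qed
 have tw: "c1_bound ?V (%e p. of_real (th e p / Lf e) * W12 e p) r"
 using c1_bound_mult1[OF Wc tc1] by (simp add: mult.commute)
 have "c1_bound ?V (%e p. (of_real ((sc e)\<^sup>2) * (T2 e p - of_real (th e p / Lf e) * Wg snd e p) - of_real (th e p / Lf e),
 of_real ((l1 + l2) * hh e p + Lf e * (sc e)\<^sup>2 * Re (T12 e p - of_real (th e p / Lf e) * W12 e p))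
 + \<i> * of_real (Im (T12 e p - B0 p - of_real (th e p / Lf e) * W12 e p)))) r"
 by (intro c1_bound_Pair c1_bound_diff first tc1 c1_bound_add c1_bound_linear[OF _ ofr] c1_bound_cmult hr second
 c1_bound_linear[OF _ bounded_linear_Im] tb tw)
 then show ?thesis unfolding Dl_def[abs_def] Complex_eq .
qed

definition rate :: "real => real" where "rate e = 1 / Lf e + Lf e * sc e"

lemma Dl_theta_bound:
 assumes "0 < c" "c < 1"
 shows "c1_bound (annuli c) (Dl \<theta>) rate" "(rate \<longlongrightarrow> 0) (at_right 0)"
proof -
 show "c1_bound (annuli c) (Dl \<theta>) rate"
 proof (rule Dl_bound[OF assms annuli_c1(7)[OF assms]])
 show "\<forall>\<^sub>F e in at_right 0. (1::real) <= 1 & (0::real) <= 1 & 1 / Lf e <= rate e & sc e <= rate e & Lf e * (sc e)\<^sup>2 <= rate e"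
 using eventually_small
 proof eventually_elim
 case (elim e)
 have "sc e <= Lf e * sc e" "sc e * (Lf e * sc e) <= 1 * (Lf e * sc e)"
 using elim by (simp, intro mult_right_mono) auto
 moreover have "0 <= 1 / Lf e" "0 <= Lf e * sc e" using elim by auto
 moreover have "Lf e * (sc e)\<^sup>2 = sc e * (Lf e * sc e)" by (simp add: power2_eq_square)
 ultimately show ?case unfolding rate_def by linarith
 qed
 qed
 show "(rate \<longlongrightarrow> 0) (at_right 0)" unfolding rate_def[abs_def]
 using tendsto_add[OF Lf_limits] by simp
qed

text \<open>Under the logarithmic constraint \<theta> reduces to - \<open>hh\<close>, which is
  O(sc^2) instead of O(1), so no term of order 1/Lf is left. This is the source of the error
  O(e^(2\<beta>)) in the moduli.\<close>

lemma Dl_at_zero: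
 assumes "0 < c" "c < 1" "p \<in> annuli c" "l1 * ln (cmod (fst p)) + l2 * ln (cmod (snd p)) = c0"
 shows "\<exists>B\<ge>0. \<forall>\<^sub>F e in at_right 0. norm (Dl \<theta> e p) <= B * sc e"
proof -
 have h: "c1_bound (annuli c) (%e p. - hh e p) sc"
 proof (rule c1_bound_le[OF c1_bound_linear[OF annuli_c1(6)[OF assms(1,2)] bounded_linear_minus[OF bounded_linear_ident]]])
 show "\<forall>\<^sub>F e in at_right 0. (sc e)\<^sup>2 <= sc e & 0 <= sc e"
 using eventually_small by eventually_elim (simp add: power2_eq_square mult_left_le_one_le)
 qed
 have "c1_bound (annuli c) (Dl (%e p. - hh e p)) sc"
 proof (rule Dl_bound[OF assms(1,2) h])
 show "\<forall>\<^sub>F e in at_right 0. sc e <= 1 & 0 <= sc e & sc e / Lf e <= sc e & sc e <= sc e & Lf e * (sc e)\<^sup>2 <= sc e"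
 using eventually_small
 proof eventually_elim
 case (elim e)
 have "sc e / Lf e <= sc e" using elim by (simp add: divide_le_eq)
 moreover have "sc e * (Lf e * sc e) <= sc e * 1" using elim by (intro mult_left_mono) auto
 ultimately show ?case using elim by (simp add: power2_eq_square algebra_simps)
 qed
 qed
 then obtain B where B: "B >= 0" "\<forall>\<^sub>F e in at_right 0. 0 <= sc e & (\<forall>p\<in>annuli c. \<exists>f'. (Dl (%e p. - hh e p) e has_derivative f') (at p) \<and>
 norm (Dl (%e p. - hh e p) e p) <= B * sc e & (\<forall>v. norm (f' v) <= B * sc e * norm v))"
 unfolding c1_bound_def by blast
 have th: "\<theta> e p = - hh e p" for e using assms(4) by (simp add: \<theta>_def)
 have "Dl \<theta> e p = Dl (%e p. - hh e p) e p" for e unfolding Dl_def th ..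
 moreover have "\<forall>\<^sub>F e in at_right 0. norm (Dl (%e p. - hh e p) e p) <= B * sc e"
 using B(2) by eventually_elim (use assms(3) in blast)
 ultimately show ?thesis using B(1) by (intro exI[of _ B]) simp
qed

end


lemma linear_family_continuous:
 fixes D :: "'a::euclidean_space => 'a => 'b::real_normed_vector"
 assumes "!!z. linear (D z)" "!!v. isCont (%z. D z v) z0" "0 < eta"
 shows "\<exists>rho>0. \<forall>z\<in>ball z0 rho. \<forall>v. norm (D z v - D z0 v) <= eta * norm v"
proof -
 define S where "S z = (\<Sum>b\<in>Basis. norm (D z b - D z0 b))" for z
 have "isCont S z0" unfolding S_def by (intro continuous_intros assms(2))
 then have "(S \<longlongrightarrow> 0) (at z0)" by (simp add: isCont_def S_def)
 then have "\<forall>\<^sub>F z in at z0. dist (S z) 0 < eta" using assms(3) by (rule tendstoD)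
 then obtain rho where r: "rho > 0" "!!z. z ~= z0 ==> dist z z0 < rho ==> S z < eta"
 unfolding eventually_at by (auto simp: dist_real_def abs_less_iff)
 have "norm (D z v - D z0 v) <= eta * norm v" if "z \<in> ball z0 rho" for z v
 proof -
 have S: "S z <= eta" using r(2)[of z] that assms(3) by (cases "z = z0") (auto simp: S_def dist_commute less_imp_le)
 have l: "linear (%v. D z v - D z0 v)" by (intro linear_compose_sub assms(1))
 have "D z v - D z0 v = (\<Sum>b\<in>Basis. (v \<bullet> b) *\<^sub>R (D z b - D z0 b))"
 by (subst (1 2) euclidean_representation[symmetric, of v])
 (simp add: linear_sum[OF assms(1)] linear_cmul[OF assms(1)] sum_subtractf[symmetric] scaleR_right_diff_distrib)
 also have "norm ... <= (\<Sum>b\<in>Basis. norm v * norm (D z b - D z0 b))"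
 by (rule sum_norm_le) (simp add: mult_right_mono Basis_le_norm)
 also have "... = norm v * S z" by (simp add: S_def sum_distrib_left)
 also have "... <= norm v * eta" using S by (intro mult_left_mono) auto
 finally show ?thesis by (simp add: mult.commute)
 qed
 then show ?thesis using r(1) by blast
qed

section \<open>The limit system: its derivative and its four zeros\<close>

context kr0
begin

definition tr :: real where "tr = l2 / l1"
definition CC :: real where "CC = exp lnC"
text \<open>Complex form of a multiple of the Hessian combination in the theorem. The coefficients
  arise by inserting y = - tr x into the quadratic term: \<open>B0\<close> then becomes \<xi> times
  mm \<xi>.\<close>

definition mm :: "complex => complex" where
 "mm \<xi> = of_real ((l1 + l2 - q0) * (l1 + l2 * tr\<^sup>2)) * ll (\<xi>, 0) + of_real ((l1 - l2 * tr)\<^sup>2) * ll (0, \<xi>)"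
definition BL :: "real => real => (complex \<times> complex => complex) => (complex \<times> complex => complex) => complex \<times> complex => complex" where
 "BL l m u w p = of_real l * ll (u p, u p) + of_real m * ll (u p, w p) - of_real q0 * ll (u p, 0)"
text \<open>The bilinear form whose diagonal is \<open>B0\<close>; it is what the derivative of
  \<open>B0\<close> is written in.\<close>

definition Bl :: "complex \<times> complex => complex \<times> complex => complex" where
 "Bl p v = of_real l1 * (fst p * BL l1 l2 fst snd v) + of_real l2 * (snd p * BL l2 l1 snd fst v)"
definition D0 :: "complex \<times> complex => complex \<times> complex => complex \<times> complex" where
 "D0 p v = (of_real l1 * ((snd p * fst v - fst p * snd v) / (snd p - fst p)\<^sup>2),
 Complex ((l1 + l2) * (l1 * Re (inverse (fst p) * fst v) + l2 * Re (inverse (snd p) * snd v))) (Im (Bl p v + Bl v p)))"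

lemma tr_pos: "0 < tr" and CC_pos: "0 < CC" using l1 l2 by (auto simp: tr_def CC_def)

lemma BL_linear: "bounded_linear (BL l m u w)" if "bounded_linear u" "bounded_linear w"
 unfolding BL_def[abs_def]
 by (intro bounded_linear_sub bounded_linear_add bounded_linear_compose[OF bounded_linear_mult_right]
 bounded_linear_compose[OF ll_linear] bounded_linear_Pair that bounded_linear_zero)

lemma Bl_linear_right: "bounded_linear (Bl p)"
 unfolding Bl_def[abs_def]
 by (intro bounded_linear_add bounded_linear_compose[OF bounded_linear_mult_right] BL_linear bounded_linear_fst bounded_linear_snd)

lemma Bl_linear_left: "bounded_linear (%p. Bl p v)"
 unfolding Bl_def[abs_def]
 by (intro bounded_linear_add bounded_linear_compose[OF bounded_linear_mult_right]
 bounded_linear_compose[OF bounded_linear_mult_left] bounded_linear_fst bounded_linear_snd)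

lemma B0_Bl: "B0 p = Bl p p"
 by (simp add: B0_def Bl_def Bg_def BL_def)

lemma ll_add: "ll (a + a', b + b') = ll (a, b) + ll (a', b')"
 using linear_add[OF bounded_linear.linear[OF ll_linear], of "(a, b)" "(a', b')"] by simp

lemma ll_scale: "ll (of_real r * a, of_real r * b) = of_real r * ll (a, b)"
 using linear_cmul[OF bounded_linear.linear[OF ll_linear], of r "(a, b)"] by (simp add: scaleR_conv_of_real)

lemma Bl_mm: "Bl (\<xi>, - (of_real tr * \<xi>)) (h, - (of_real tr * h)) = \<xi> * mm h"
proof -
 define a where "a = ll (h, 0)"
 define b where "b = ll (0, h)"
 have s: "ll (of_real r * h, of_real s * h) = of_real r * a + of_real s * b" for r s
 proof -
 have "ll (of_real r * h, of_real s * h) = ll (of_real r * h, of_real r * 0) + ll (of_real s * 0, of_real s * h)"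
 using ll_add[of "of_real r * h" 0 0 "of_real s * h"] by simp
 then show ?thesis unfolding ll_scale by (simp add: a_def b_def)
 qed
 have e: "ll (h, h) = a + b" "ll (h, - (of_real tr * h)) = a - of_real tr * b" "ll (h, 0) = a"
 "ll (- (of_real tr * h), - (of_real tr * h)) = - of_real tr * a - of_real tr * b"
 "ll (- (of_real tr * h), h) = - of_real tr * a + b" "ll (- (of_real tr * h), 0) = - of_real tr * a"
 using s[of 1 1] s[of 1 "- tr"] s[of 1 0] s[of "- tr" "- tr"] s[of "- tr" 1] s[of "- tr" 0] by simp_all
 show ?thesis unfolding Bl_def BL_def fst_conv snd_conv e mm_def a_def[symmetric] b_def[symmetric]
 by (simp add: power2_eq_square algebra_simps)
qed

lemma Fz_derivative:
 assumes "fst p ~= 0" "snd p ~= 0" "fst p ~= snd p"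
 shows "(Fz has_derivative D0 p) (at p)"
proof -
 note df = bounded_linear_imp_has_derivative[OF bounded_linear_fst[where 'a=complex and 'b=complex]]
 note ds = bounded_linear_imp_has_derivative[OF bounded_linear_snd[where 'a=complex and 'b=complex]]
 have ne: "snd p - fst p ~= 0" using assms by simp
 have q: "((%p. snd p / (snd p - fst p)) has_derivative (%v. (snd p * fst v - fst p * snd v) / (snd p - fst p)\<^sup>2)) (at p)"
 proof (rule has_derivative_eq_rhs[OF has_derivative_divide'[OF ds has_derivative_diff[OF ds df] ne]])
 show "(%v. (snd v * (snd p - fst p) - snd p * (snd v - fst v)) / ((snd p - fst p) * (snd p - fst p)))
 = (%v. (snd p * fst v - fst p * snd v) / (snd p - fst p)\<^sup>2)"
 by (simp add: fun_eq_iff power2_eq_square algebra_simps)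
 qed
 have l: "((%p. ln (cmod (u p))) has_derivative (%v. Re (inverse (u p) * u v))) (at p)"
 if "bounded_linear u" "u p ~= 0" for u
 proof -
 have "((%z. ln (cmod (z - 0))) has_derivative (%h. Re (inverse (u p - 0) * h))) (at (u p))"
 by (rule has_derivative_ln_cmod) (use that in simp)
 from has_derivative_compose[OF bounded_linear_imp_has_derivative[OF that(1)] this] show ?thesis by simp
 qed
 have b: "(B0 has_derivative (%v. Bl p v + Bl v p)) (at p)"
 proof -
 have BLd: "(BL l m u w has_derivative BL l m u w) (at p)" if "bounded_linear u" "bounded_linear w" for l m u w
 by (rule bounded_linear_imp_has_derivative[OF BL_linear[OF that]])
 have "((%p. of_real l1 * (fst p * BL l1 l2 fst snd p) + of_real l2 * (snd p * BL l2 l1 snd fst p)) has_derivative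
 (%v. of_real l1 * (fst p * BL l1 l2 fst snd v + fst v * BL l1 l2 fst snd p)
 + of_real l2 * (snd p * BL l2 l1 snd fst v + snd v * BL l2 l1 snd fst p))) (at p)"
 by (intro has_derivative_add has_derivative_mult_right has_derivative_mult df ds BLd
 bounded_linear_fst bounded_linear_snd)
 moreover have "B0 = (%p. of_real l1 * (fst p * BL l1 l2 fst snd p) + of_real l2 * (snd p * BL l2 l1 snd fst p))"
 by (simp add: fun_eq_iff B0_Bl Bl_def)
 ultimately show ?thesis by (simp add: Bl_def algebra_simps)
 qed
 have "((%p. (of_real l1 * (snd p / (snd p - fst p)) - of_real q0,
 of_real ((l1 + l2) * (l1 * ln (cmod (fst p)) + l2 * ln (cmod (snd p)) - c0)) + \<i> * of_real (Im (B0 p)))) has_derivative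
 (%v. (of_real l1 * ((snd p * fst v - fst p * snd v) / (snd p - fst p)\<^sup>2) - 0,
 of_real ((l1 + l2) * (l1 * Re (inverse (fst p) * fst v) + l2 * Re (inverse (snd p) * snd v) - 0)) + \<i> * of_real (Im (Bl p v + Bl v p))))) (at p)"
 by (intro has_derivative_Pair has_derivative_diff has_derivative_add has_derivative_mult_right has_derivative_of_real
 has_derivative_Im has_derivative_const q b l bounded_linear_fst bounded_linear_snd assms)
 then show ?thesis unfolding Fz_def[abs_def] D0_def[abs_def] Complex_eq by simp
qed

lemma D0_continuous:
 assumes "fst p ~= 0" "snd p ~= 0" "fst p ~= snd p" "0 < eta"
 shows "\<exists>rho>0. \<forall>z\<in>ball p rho. \<forall>v. norm (D0 z v - D0 p v) <= eta * norm v"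
proof (rule linear_family_continuous[OF _ _ assms(4)])
 show "linear (D0 z)" for z
 proof -
 have "bounded_linear (D0 z)" unfolding D0_def[abs_def] Complex_eq
 by (intro bounded_linear_Pair bounded_linear_add bounded_linear_compose[OF bounded_linear_mult_right]
 bounded_linear_compose[OF bounded_linear_divide] bounded_linear_sub bounded_linear_compose[OF bounded_linear_of_real]
 bounded_linear_compose[OF bounded_linear_Im] bounded_linear_compose[OF bounded_linear_Re]
 Bl_linear_left Bl_linear_right bounded_linear_fst bounded_linear_snd)
 then show ?thesis by (rule bounded_linear.linear)
 qed
 show "isCont (%z. D0 z v) p" for v
 proof -
 have B: "isCont (%z. Bl z v + Bl v z) p"
 by (intro continuous_intros linear_continuous_at Bl_linear_left Bl_linear_right)
 have f: "isCont fst p" "isCont snd p" by (rule linear_continuous_at bounded_linear_fst bounded_linear_snd)+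
 have 1: "isCont (%z. of_real l1 * ((snd z * fst v - fst z * snd v) / (snd z - fst z)\<^sup>2)) p"
 by (intro isCont_mult isCont_divide isCont_diff isCont_power f continuous_const) (use assms in auto)
 have 2: "isCont (%z. (l1 + l2) * (l1 * Re (inverse (fst z) * fst v) + l2 * Re (inverse (snd z) * snd v))) p"
 by (intro isCont_mult isCont_add isCont_Re continuous_const continuous_at_within_inverse f) (use assms in auto)
 show ?thesis unfolding D0_def Complex_eq
 by (intro isCont_Pair 1 isCont_add isCont_mult continuous_const continuous_of_real 2 isCont_Im B)
 qed
qed

end

text \<open>Eigenvectors in complex notation. The conjugate appears because \<open>cgrad\<close> is
  the conjugate of the gradient vector; orthogonality of the unit eigenvectors becomes a factor i or
  -i.\<close>

locale kr1 = kr0 +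
 fixes nu :: "2 => complex" and mu :: "2 => real"
 assumes nu_norm: "!!m. cmod (nu m) = 1" and nu2: "nu 2 = \<i> * nu 1 \<or> nu 2 = - (\<i> * nu 1)"
 and mm_nu: "!!m. mm (nu m) = of_real (mu m) * cnj (nu m)" and mu_ne: "mu 1 ~= mu 2"
begin

definition zz :: "2 => bool => complex \<times> complex" where
 "zz m s = (of_real (sgnb s * CC) * nu m, - (of_real tr * (of_real (sgnb s * CC) * nu m)))"
text \<open>A compact neighbourhood of the four expected zeros that avoids the singular sets, and
  wide enough to capture every rescaled critical point once the hole is small.\<close>

definition KB :: "(complex \<times> complex) set" where
 "KB = {p. CC / 2 <= cmod (fst p) & cmod (fst p) <= 2 * CC & cmod (snd p + of_real tr * fst p) <= tr * CC / 4}"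

lemma sgnb_abs: "\<bar>sgnb s\<bar> = 1" by (simp add: sgnb_def)

lemma zz_norm: "cmod (fst (zz m s)) = CC" "cmod (snd (zz m s)) = tr * CC"
 using CC_pos tr_pos by (simp_all add: zz_def norm_mult nu_norm sgnb_abs)

lemma KB_compact: "compact KB"
proof -
 have cl: "closed KB" unfolding KB_def by (intro closed_Collect_conj closed_Collect_le continuous_intros)
 have "norm p <= 2 * CC + (tr * CC / 4 + tr * (2 * CC))" if "p \<in> KB" for p
 proof -
 have a: "cmod (fst p) <= 2 * CC" "cmod (snd p + of_real tr * fst p) <= tr * CC / 4" using that by (auto simp: KB_def)
 have "cmod (snd p) <= cmod (snd p + of_real tr * fst p) + cmod (of_real tr * fst p)"
 using norm_triangle_ineq4[of "snd p + of_real tr * fst p" "of_real tr * fst p"] by simp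
 also have "cmod (of_real tr * fst p) = tr * cmod (fst p)" using tr_pos by (simp add: norm_mult)
 also have "... <= tr * (2 * CC)" using a(1) tr_pos by (intro mult_left_mono) auto
 finally have "cmod (snd p) <= tr * CC / 4 + tr * (2 * CC)" using a(2) by linarith
 then show ?thesis using norm_Pair_le[of "fst p" "snd p"] a(1) by simp
 qed
 then have "bounded KB" by (rule boundedI)
 with cl show ?thesis by (simp only: compact_eq_bounded_closed)
qed

lemma KB_annuli: "\<exists>c. 0 < c & c < 1 & KB \<subseteq> annuli c"
proof -
 define c where "c = min (min (1 / 2) (CC / 4)) (min (tr * CC / 8) (min (1 / (4 * CC)) (1 / (4 * (tr * CC)))))"
 have tC: "0 < tr * CC" using tr_pos CC_pos by simp
 have c0: "0 < c" using tr_pos CC_pos by (simp add: c_def)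
 have c1: "c <= 1 / 2" "c <= CC / 4" "c <= tr * CC / 8" "c <= 1 / (4 * CC)" "c <= 1 / (4 * (tr * CC))" by (simp_all add: c_def)
 have i: "4 * CC <= 1 / c" "4 * (tr * CC) <= 1 / c" using c1(4,5) c0 CC_pos tC by (simp_all add: field_simps)
 have "p \<in> annuli c" if "p \<in> KB" for p
 proof -
 have a: "CC / 2 <= cmod (fst p)" "cmod (fst p) <= 2 * CC" "cmod (snd p + of_real tr * fst p) <= tr * CC / 4"
 using that by (auto simp: KB_def)
 have n: "cmod (of_real tr * fst p) = tr * cmod (fst p)" using tr_pos by (simp add: norm_mult)
 have b: "tr * (CC / 2) <= tr * cmod (fst p)" "tr * cmod (fst p) <= tr * (2 * CC)"
 using a tr_pos by (auto intro: mult_left_mono)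
 have "cmod (snd p) <= cmod (snd p + of_real tr * fst p) + cmod (of_real tr * fst p)"
 using norm_triangle_ineq4[of "snd p + of_real tr * fst p" "of_real tr * fst p"] by simp
 then have u: "cmod (snd p) <= 9 / 4 * (tr * CC)" unfolding n using a b by simp
 have "cmod (of_real tr * fst p) <= cmod (snd p + of_real tr * fst p) + cmod (snd p)"
 using norm_triangle_ineq4[of "snd p + of_real tr * fst p" "snd p"] by simp
 then have l: "tr * CC / 4 <= cmod (snd p)" unfolding n using a b by simp
 have "(1 + of_real tr) * fst p = (fst p - snd p) + (snd p + of_real tr * fst p)" by (simp add: algebra_simps)
 then have "cmod ((1 + of_real tr) * fst p) <= cmod (fst p - snd p) + cmod (snd p + of_real tr * fst p)"
 by (simp only: norm_triangle_ineq)
 moreover have "cmod ((1 + of_real tr) * fst p) = (1 + tr) * cmod (fst p)"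
 using tr_pos norm_of_real[of "1 + tr", where 'a=complex] by (simp add: norm_mult)
 ultimately have "CC / 2 <= cmod (fst p - snd p)" using a b tC by (simp add: algebra_simps)
 then show ?thesis using a u l c1 i CC_pos tC by (simp add: annuli_def)
 qed
 then have "KB \<subseteq> annuli c" by (rule subsetI)
 moreover have "c < 1" using c1(1) by linarith
 ultimately show ?thesis using c0 by (intro exI[of _ c] conjI)
qed

lemma ln_zz: "l1 * ln (cmod (fst (zz m s))) + l2 * ln (cmod (snd (zz m s))) = c0"
proof -
 have "(l1 + l2) * lnC = c0 + l2 * ln (l1 / l2)" using l1 l2 by (simp add: lnC_def c0_def)
 moreover have "ln (tr * CC) = lnC - ln (l1 / l2)" "ln CC = lnC"
 using l1 l2 by (simp_all add: tr_def CC_def ln_mult ln_div)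
 ultimately show ?thesis unfolding zz_norm by (simp only:) (simp add: algebra_simps)
qed

lemma mm_comb: "mm (of_real a * x + of_real b * y) = of_real a * mm x + of_real b * mm y"
proof -
 have "ll (of_real a * x + of_real b * y, 0) = of_real a * ll (x, 0) + of_real b * ll (y, 0)"
 "ll (0, of_real a * x + of_real b * y) = of_real a * ll (0, x) + of_real b * ll (0, y)"
 using ll_add[of "of_real a * x" "of_real b * y" 0 0] ll_add[of 0 0 "of_real a * x" "of_real b * y"]
 ll_scale[of a x 0] ll_scale[of b y 0] ll_scale[of a 0 x] ll_scale[of b 0 y] by simp_all
 then show ?thesis by (simp add: mm_def algebra_simps)
qed

text \<open>i times an eigenvector is, up to sign, the other eigenvector; hence the other
  eigenvalue.\<close>

lemma mm_i: "mm (\<i> * nu m) = - \<i> * of_real (mu (if m = 1 then 2 else 1)) * cnj (nu m)"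
proof -
 define m' :: 2 where "m' = (if m = 1 then 2 else 1)"
 have "m = 1 \<or> m = 2" using exhaust_2 by blast
 then have "\<i> * nu m = nu m' \<or> \<i> * nu m = - nu m'"
 using nu2 by (auto simp: m'_def simp flip: mult.assoc)
 then obtain s :: real where s: "\<i> * nu m = of_real s * nu m'" "s = 1 \<or> s = - 1"
 by (metis mult_1 mult_minus_left of_real_1 of_real_minus)
 have "mm (\<i> * nu m) = of_real s * mm (nu m')" using mm_comb[of s "nu m'" 0 0] by (simp add: s(1))
 also have "... = of_real (mu m') * cnj (of_real s * nu m')" by (simp add: mm_nu)
 also have "... = - \<i> * of_real (mu m') * cnj (nu m)" unfolding s(1)[symmetric] by simp
 finally show ?thesis by (simp add: m'_def)
qed

text \<open>The first component forces a kernel vector to respect y = - tr x, and the dilation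
  component to preserve |x| to first order. So it is an infinitesimal rotation h = i omega \<xi>,
  and the rotation component changes at the rate omega |\<xi>|^2 times the difference of the
  eigenvalues.\<close>

lemma D0_injective:
 assumes "D0 (zz m s) v = 0"
 shows "v = 0"
proof -
 define a where "a = sgnb s * CC"
 have a0: "a ~= 0" using CC_pos sgnb_abs[of s] by (auto simp: a_def)
 define \<xi> where "\<xi> = of_real a * nu m"
 have nu0: "nu m ~= 0" using nu_norm[of m] by auto
 have xi0: "\<xi> ~= 0" using a0 nu0 by (simp add: \<xi>_def)
 have z: "zz m s = (\<xi>, - (of_real tr * \<xi>))" by (simp add: zz_def \<xi>_def a_def)
 obtain h k where v: "v = (h, k)" by (cases v)
 note D = assms[unfolded D0_def z v fst_conv snd_conv zero_prod_def prod.inject]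
 have e1: "- (of_real tr * \<xi>) * h - \<xi> * k = 0"
 proof -
 have "- (of_real tr * \<xi>) - \<xi> = - (of_real (1 + tr) * \<xi>)" by (simp add: algebra_simps)
 then have "(- (of_real tr * \<xi>) - \<xi>)\<^sup>2 ~= 0"
 using xi0 tr_pos by (simp del: of_real_add)
 then show ?thesis using D l1 by auto
 qed
 moreover have "\<xi> * (k + of_real tr * h) = - (- (of_real tr * \<xi>) * h - \<xi> * k)" by (simp add: algebra_simps)
 ultimately have "\<xi> * (k + of_real tr * h) = 0" by simp
 then have k: "k = - (of_real tr * h)" using xi0 by (simp add: eq_neg_iff_add_eq_0)
 have e2: "(l1 + l2) * (l1 * Re (inverse \<xi> * h) + l2 * Re (inverse (- (of_real tr * \<xi>)) * k)) = 0"
 "Im (Bl (\<xi>, - (of_real tr * \<xi>)) (h, k) + Bl (h, k) (\<xi>, - (of_real tr * \<xi>))) = 0"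
 using D by (simp_all add: complex_eq_iff)
 define \<omega> where "\<omega> = Im (inverse \<xi> * h)"
 have "inverse (- (of_real tr * \<xi>)) * k = inverse \<xi> * h" using tr_pos xi0 by (simp add: k field_simps)
 then have "Re (inverse \<xi> * h) = 0" using e2(1) l1 l2 by (simp add: distrib_right[symmetric])
 then have "inverse \<xi> * h = \<i> * of_real \<omega>" by (simp add: \<omega>_def complex_eq_iff)
 then have h: "h = of_real (\<omega> * a) * (\<i> * nu m)" using xi0 by (simp add: field_simps \<xi>_def)
 have mh: "mm h = of_real (\<omega> * a) * (- \<i> * of_real (mu (if m = 1 then 2 else 1)) * cnj (nu m))"
 using mm_comb[of "\<omega> * a" "\<i> * nu m" 0 0] unfolding h mm_i by simp
 have mx: "mm \<xi> = of_real a * (of_real (mu m) * cnj (nu m))"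
 using mm_comb[of a "nu m" 0 0] unfolding \<xi>_def mm_nu by simp
 have nn: "nu m * cnj (nu m) = 1" using nu_norm[of m] by (simp add: complex_norm_square[symmetric])
 have "\<xi> * mm h + h * mm \<xi> = \<i> * of_real (\<omega> * a\<^sup>2 * (mu m - mu (if m = 1 then 2 else 1))) * (nu m * cnj (nu m))"
 unfolding mh mx unfolding h \<xi>_def by (simp add: power2_eq_square algebra_simps)
 then have "Im (\<xi> * mm h + h * mm \<xi>) = \<omega> * a\<^sup>2 * (mu m - mu (if m = 1 then 2 else 1))" unfolding nn by simp
 moreover have "Im (\<xi> * mm h + h * mm \<xi>) = 0" using e2(2) unfolding k Bl_mm .
 moreover have "mu m ~= mu (if m = 1 then 2 else 1)" using exhaust_2[of m] mu_ne by auto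
 ultimately have "\<omega> = 0" using a0 by simp
 then show ?thesis by (simp add: v k h zero_prod_def)
qed

text \<open>The first component gives y = - tr x, the logarithms then fix |x| = CC, and with \<xi> =
  w nu 1 the last equation reads Re w Im w (mu 1 - mu 2) = 0. So w is real or purely imaginary of
  modulus CC, which leaves four points.\<close>

lemma Fz_zero_iff:
 assumes "p \<in> KB"
 shows "Fz p = 0 \<longleftrightarrow> p \<in> {zz m s | m s. True}"
proof -
 obtain c where c: "0 < c" "c < 1" "KB \<subseteq> annuli c" using KB_annuli by blast
 obtain \<xi> eta where p: "p = (\<xi>, eta)" by (cases p)
 have ne: "\<xi> ~= 0" "eta ~= 0" "\<xi> ~= eta" using assms c p by (auto simp: annuli_def)
 have s0: "l1 + l2 ~= 0" using l1 l2 by simp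
 \<comment> \<open>With k = l1^2/(l1 + l2), both l1 - q0 = k and q0 = k tr, so the cleared equation
   is k (eta + tr \<xi>) = 0.\<close>
 have F1: "of_real l1 * (eta / (eta - \<xi>)) - of_real q0 = 0 \<longleftrightarrow> eta = - (of_real tr * \<xi>)"
 proof -
 have "of_real l1 * (eta / (eta - \<xi>)) - of_real q0 = 0 \<longleftrightarrow> of_real (l1 - q0) * eta + of_real q0 * \<xi> = 0"
 using ne by (auto simp: field_simps)
 also have "l1 - q0 = l1 / (l1 + l2) * l1" using s0 by (simp add: q0_def field_simps)
 also have "of_real (l1 / (l1 + l2) * l1) * eta + of_real q0 * \<xi> = of_real (l1 / (l1 + l2) * l1) * (eta + of_real tr * \<xi>)"
 proof -
 have "q0 = l1 / (l1 + l2) * l1 * tr" using l1 by (simp add: q0_def tr_def)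
 then have "complex_of_real q0 = of_real (l1 / (l1 + l2) * l1) * of_real tr" by (simp only: of_real_mult)
 then show ?thesis by (simp only: distrib_left mult.assoc)
 qed
 also have "... = 0 \<longleftrightarrow> eta + of_real tr * \<xi> = 0" using l1 s0 by (simp del: of_real_add of_real_divide of_real_mult)
 finally show ?thesis by (simp add: eq_neg_iff_add_eq_0)
 qed
 have nu1: "nu 1 ~= 0" using nu_norm[of 1] by auto
 have nn: "nu 1 * cnj (nu 1) = 1" using nu_norm[of 1] by (simp add: complex_norm_square[symmetric])
 have imxi: "Im (w * nu 1 * mm (w * nu 1)) = Re w * Im w * (mu 1 - mu 2)" for w
 proof -
 have "w * nu 1 = of_real (Re w) * nu 1 + of_real (Im w) * (\<i> * nu 1)"
 using complex_eq[of w] by (metis distrib_right mult.assoc mult.commute)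
 then have "mm (w * nu 1) = of_real (Re w) * (of_real (mu 1) * cnj (nu 1)) + of_real (Im w) * (- \<i> * of_real (mu 2) * cnj (nu 1))"
 by (simp only: mm_comb mm_nu mm_i if_True refl)
 moreover have "w * nu 1 * (of_real (Re w) * (of_real (mu 1) * cnj (nu 1)) + of_real (Im w) * (- \<i> * of_real (mu 2) * cnj (nu 1))) = w * (of_real (Re w * mu 1) - \<i> * of_real (Im w * mu 2)) * (nu 1 * cnj (nu 1))"
 by (simp add: algebra_simps)
 ultimately have "w * nu 1 * mm (w * nu 1) = w * (of_real (Re w * mu 1) - \<i> * of_real (Im w * mu 2))"
 by (simp only: nn mult_1_right)
 then show ?thesis by (simp only:) (simp add: algebra_simps)
 qed
 have lnf: "l1 * ln (cmod \<xi>) + l2 * ln (cmod (- (of_real tr * \<xi>))) = (l1 + l2) * (ln (cmod \<xi>) - lnC) + c0"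
 proof -
 have "cmod (- (of_real tr * \<xi>)) = tr * cmod \<xi>" using tr_pos by (simp add: norm_mult)
 then have "ln (cmod (- (of_real tr * \<xi>))) = ln (cmod \<xi>) - ln (l1 / l2)"
 using tr_pos ne l1 l2 by (simp add: ln_mult tr_def ln_div)
 moreover have "(l1 + l2) * lnC = c0 + l2 * ln (l1 / l2)" using l1 l2 by (simp add: lnC_def c0_def)
 ultimately show ?thesis by (simp only:) (simp add: algebra_simps)
 qed
 have Z: "Fz p = 0 \<longleftrightarrow> eta = - (of_real tr * \<xi>) & cmod \<xi> = CC & Im (\<xi> * mm \<xi>) = 0"
 proof -
 have "Fz p = 0 \<longleftrightarrow> eta = - (of_real tr * \<xi>) & l1 * ln (cmod \<xi>) + l2 * ln (cmod eta) - c0 = 0 & Im (B0 p) = 0"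
 unfolding Fz_def zero_prod_def prod.inject using F1 s0 by (auto simp: p complex_eq_iff)
 also have "... \<longleftrightarrow> eta = - (of_real tr * \<xi>) & ln (cmod \<xi>) - lnC = 0 & Im (\<xi> * mm \<xi>) = 0"
 using lnf s0 Bl_mm[of \<xi> \<xi>] by (auto simp: B0_Bl p)
 also have "ln (cmod \<xi>) - lnC = 0 \<longleftrightarrow> cmod \<xi> = CC"
 using ne CC_pos by (metis CC_def eq_iff_diff_eq_0 exp_ln ln_exp zero_less_norm_iff)
 finally show ?thesis .
 qed
 show ?thesis
 proof
 assume "Fz p = 0"
 then have f: "eta = - (of_real tr * \<xi>)" "cmod \<xi> = CC" "Im (\<xi> * mm \<xi>) = 0" using Z by auto
 define w where "w = \<xi> / nu 1"
 have xw: "\<xi> = w * nu 1" using nu1 by (simp add: w_def)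
 have "Re w * Im w = 0" using f(3) imxi[of w] mu_ne by (simp add: xw)
 moreover have wn: "cmod w = CC" using f(2) nu_norm by (simp add: w_def norm_divide)
 ultimately obtain m s where "w * nu 1 = of_real (sgnb s * CC) * nu m"
 proof (cases "Im w = 0")
 case True
 then have "w = of_real (Re w)" by (simp add: complex_eq_iff)
 moreover have "\<bar>Re w\<bar> = CC" using wn True by (simp add: cmod_def)
 then have "Re w = sgnb (0 <= Re w) * CC" by (auto simp: sgnb_def abs_if split: if_splits)
 ultimately have "w = of_real (sgnb (0 <= Re w) * CC)" by metis
 then have "w * nu 1 = of_real (sgnb (0 <= Re w) * CC) * nu 1" by (rule arg_cong[where f = "%w. w * nu 1"])
 then show ?thesis by (rule that)
 next
 case False
 assume "Re w * Im w = 0"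
 then have r: "Re w = 0" using False by simp
 then have w: "w = of_real (Im w) * \<i>" by (simp add: complex_eq_iff)
 have "\<bar>Im w\<bar> = CC" using wn r by (simp add: cmod_def)
 then have "Im w = sgnb (0 <= Im w) * CC" by (auto simp: sgnb_def abs_if split: if_splits)
 then have w': "w * nu 1 = of_real (sgnb (0 <= Im w) * CC) * (\<i> * nu 1)" using w by (metis mult.assoc)
 show ?thesis
 proof (cases "nu 2 = \<i> * nu 1")
 case True
 with w' show ?thesis by (intro that[of "0 <= Im w" 2]) (simp only:)
 next
 case False
 then have "nu 2 = - (\<i> * nu 1)" using nu2 by blast
 moreover have "sgnb (\<not> b) = - sgnb b" for b by (simp add: sgnb_def)
 ultimately have "w * nu 1 = of_real (sgnb (\<not> (0 <= Im w)) * CC) * nu 2" using w' by simp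
 then show ?thesis by (rule that)
 qed
 qed
 then show "p \<in> {zz m s | m s. True}" using xw f(1) p by (auto simp: zz_def)
 next
 assume "p \<in> {zz m s | m s. True}"
 then obtain m s where m: "p = zz m s" by blast
 define a where "a = sgnb s * CC"
 have xi: "\<xi> = of_real a * nu m" "eta = - (of_real tr * \<xi>)" using m p by (auto simp: zz_def a_def)
 have "cmod \<xi> = CC" using zz_norm(1)[of m s] unfolding m[symmetric] p by (simp only: fst_conv)
 moreover have "mm \<xi> = of_real a * (of_real (mu m) * cnj (nu m))"
 using mm_comb[of a "nu m" 0 0] unfolding xi mm_nu by simp
 then have "\<xi> * mm \<xi> = of_real (a * a * mu m) * (nu m * cnj (nu m))" by (simp add: xi(1) algebra_simps)
 then have "Im (\<xi> * mm \<xi>) = 0" by (simp add: complex_mult_cnj flip: of_real_mult of_real_add of_real_power)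
 ultimately show "Fz p = 0" using Z xi(2) by simp
 qed
qed

lemma zz_inj: "inj (%(m, s). zz m s)"
proof (rule injI, clarify)
 fix m m' s s' assume "zz m s = zz m' s'"
 then have e: "of_real (sgnb s) * nu m = of_real (sgnb s') * nu m'" using CC_pos by (simp add: zz_def)
 have n1: "nu 1 ~= 0" using nu_norm[of 1] by auto
 have "m = m'"
 proof (rule ccontr)
 assume "m ~= m'"
 then have "(m = 1 & m' = 2) \<or> (m = 2 & m' = 1)" using exhaust_2[of m] exhaust_2[of m'] by auto
 then show False using e nu2 n1 by (auto simp: sgnb_def complex_eq_iff split: if_splits)
 qed
 moreover have "nu m ~= 0" using nu_norm[of m] by auto
 ultimately show "m = m' & s = s'" using e by (auto simp: sgnb_def split: if_splits)
qed

lemma zz_interior: "{zz m s | m s. True} \<subseteq> interior KB"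
proof -
 define U where "U = {p::complex\<times>complex. CC / 2 < cmod (fst p) & cmod (fst p) < 2 * CC & cmod (snd p + of_real tr * fst p) < tr * CC / 4}"
 have "open U" unfolding U_def by (intro open_Collect_conj open_Collect_less continuous_intros)
 moreover have "U \<subseteq> KB" by (auto simp: U_def KB_def)
 moreover have "zz m s \<in> U" for m s
 using zz_norm(1)[of m s] CC_pos tr_pos by (simp add: U_def) (simp add: zz_def)
 ultimately show ?thesis using interior_maximal by blast
qed

text \<open>The stability theorem measures the displacement by the defect at the limit zero, and
  \<open>Dl_at_zero\<close> makes it O(sc); summing the constants over the four zeros gives one
  bound for all.\<close>

lemma rescaled_zeros:
 "\<exists>sol M. \<forall>\<^sub>F e in at_right 0. {z \<in> KB. Fz z + Dl \<theta> e z = 0} = {sol m s e | m s. True} \<and>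
 inj (%(m, s). sol m s e) & (\<forall>m s. norm (sol m s e - zz m s) <= M * sc e \<and>
 (\<forall>D v. ((%z. Fz z + Dl \<theta> e z) has_derivative D) (at (sol m s e)) --> D v = 0 --> v = 0))"
proof -
 let ?Z = "{zz m s | m s. True}"
 obtain c where c: "0 < c" "c < 1" "KB \<subseteq> annuli c" using KB_annuli by blast
 have Zr: "?Z = (%q. zz (fst q) (snd q)) ` UNIV" by (force simp: image_def)
 have fin: "finite ?Z" unfolding Zr by (rule finite_imageI) simp
 have ann: "fst p ~= 0" "snd p ~= 0" "fst p ~= snd p" if "p \<in> annuli c" for p
 using that c(1) by (auto simp: annuli_def)
 have zA: "zz m s \<in> annuli c" for m s using zz_interior interior_subset c(3) by blast
 have "\<exists>sol M. \<forall>\<^sub>F e in at_right 0. {z \<in> KB. Fz z + Dl \<theta> e z = 0} = (%z0. sol z0 e) ` ?Z \<and>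
 inj_on (%z0. sol z0 e) ?Z & (\<forall>z0\<in>?Z. norm (sol z0 e - z0) <= M * norm (Dl \<theta> e z0) \<and>
 (\<forall>D v. ((%z. Fz z + Dl \<theta> e z) has_derivative D) (at (sol z0 e)) --> D v = 0 --> v = 0))"
 proof (rule zero_stability[OF annuli_open KB_compact c(3) fin zz_interior Fz_zero_iff])
 show "(Fz has_derivative D0 z) (at z)" if "z \<in> annuli c" for z by (rule Fz_derivative[OF ann[OF that]])
 show "\<exists>rho>0. \<forall>z\<in>ball z0 rho. \<forall>v. norm (D0 z v - D0 z0 v) <= eta * norm v" if "z0 \<in> ?Z" "0 < eta" for z0 eta
 using that(1) D0_continuous[OF ann[OF zA] that(2)] by blast
 show "v = 0" if "z0 \<in> ?Z" "D0 z0 v = 0" for z0 v using that D0_injective by blast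
 show "c1_bound (annuli c) (Dl \<theta>) rate" "(rate \<longlongrightarrow> 0) (at_right 0)" by (rule Dl_theta_bound[OF c(1,2)])+
 qed
 then obtain sol M where sol: "\<forall>\<^sub>F e in at_right 0. {z \<in> KB. Fz z + Dl \<theta> e z = 0} = (%z0. sol z0 e) ` ?Z \<and>
 inj_on (%z0. sol z0 e) ?Z & (\<forall>z0\<in>?Z. norm (sol z0 e - z0) <= M * norm (Dl \<theta> e z0) \<and>
 (\<forall>D v. ((%z. Fz z + Dl \<theta> e z) has_derivative D) (at (sol z0 e)) --> D v = 0 --> v = 0))" by blast
 have "\<forall>z0. \<exists>B\<ge>0. z0 \<in> ?Z --> (\<forall>\<^sub>F e in at_right 0. norm (Dl \<theta> e z0) <= B * sc e)"
 
 proof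
 fix z0
 show "\<exists>B\<ge>0. z0 \<in> ?Z --> (\<forall>\<^sub>F e in at_right 0. norm (Dl \<theta> e z0) <= B * sc e)"
 proof (cases "z0 \<in> ?Z")
 case True
 then obtain m s where "z0 = zz m s" by blast
 then show ?thesis using Dl_at_zero[OF c(1,2) zA ln_zz, of m s] by blast
 next
 case False
 then show ?thesis by (intro exI[of _ 0]) simp
 qed
 qed
 from choice[OF this] obtain B where
 B': "\<forall>z0. B z0 >= 0 & (z0 \<in> ?Z --> (\<forall>\<^sub>F e in at_right 0. norm (Dl \<theta> e z0) <= B z0 * sc e))" ..
 have B: "!!z0. B z0 >= 0" "!!z0. z0 \<in> ?Z ==> \<forall>\<^sub>F e in at_right 0. norm (Dl \<theta> e z0) <= B z0 * sc e"
 by (rule conjunct1[OF spec[OF B']]) (rule mp[OF conjunct2[OF spec[OF B']]])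
 have "\<forall>\<^sub>F e in at_right 0. \<forall>z0\<in>?Z. norm (Dl \<theta> e z0) <= B z0 * sc e"
 by (rule eventually_ball_finite[OF fin]) (intro ballI B(2))
 then have "\<forall>\<^sub>F e in at_right 0. {z \<in> KB. Fz z + Dl \<theta> e z = 0} = {sol (zz m s) e | m s. True} \<and>
 inj (%(m, s). sol (zz m s) e) & (\<forall>m s. norm (sol (zz m s) e - zz m s) <= \<bar>M\<bar> * sum B ?Z * sc e \<and>
 (\<forall>D v. ((%z. Fz z + Dl \<theta> e z) has_derivative D) (at (sol (zz m s) e)) --> D v = 0 --> v = 0))"
 using sol eventually_small
 proof eventually_elim
 case (elim e)
 have i: "inj (%(m, s). sol (zz m s) e)"
 proof (rule injI, clarify)
 fix m s m' s' assume "sol (zz m s) e = sol (zz m' s') e"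
 moreover have "zz m s \<in> ?Z" "zz m' s' \<in> ?Z" by blast+
 ultimately have "zz m s = zz m' s'" using elim(2) by (meson inj_onD)
 then show "m = m' & s = s'" using injD[OF zz_inj, of "(m, s)" "(m', s')"] by simp
 qed
 have n: "norm (sol (zz m s) e - zz m s) <= \<bar>M\<bar> * sum B ?Z * sc e" for m s
 proof -
 have z: "zz m s \<in> ?Z" by blast
 have "norm (sol (zz m s) e - zz m s) <= M * norm (Dl \<theta> e (zz m s))" using elim(2) z by blast
 also have "... <= \<bar>M\<bar> * norm (Dl \<theta> e (zz m s))" by (intro mult_right_mono) auto
 also have "... <= \<bar>M\<bar> * (B (zz m s) * sc e)" using bspec[OF elim(1) z] by (rule mult_left_mono) simp
 also have "... <= \<bar>M\<bar> * (sum B ?Z * sc e)"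
 using member_le_sum[OF z B(1) fin] elim(3) by (intro mult_left_mono mult_right_mono) simp_all
 finally show ?thesis by (simp add: mult.assoc)
 qed
 have im: "(%z0. sol z0 e) ` ?Z = {sol (zz m s) e | m s. True}" by blast
 have inj: "\<forall>m s. \<forall>D v. ((%z. Fz z + Dl \<theta> e z) has_derivative D) (at (sol (zz m s) e)) --> D v = 0 --> v = 0"
 using elim(2) by blast
 show ?case using elim(2) i n im inj by simp
 qed
 then show ?thesis by (intro exI[of _ "%m s. sol (zz m s)"] exI[of _ "\<bar>M\<bar> * sum B ?Z"])
qed

end


section \<open>Every type III critical point arises from a zero of the rescaled system\<close>

lemma not_eventually_at_right_sequence:
 fixes Q :: "real => bool"
 assumes "\<not> (\<forall>\<^sub>F e in at_right 0. Q e)" "\<forall>\<^sub>F e in at_right 0. G e"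
 shows "\<exists>f. f \<longlonglongrightarrow> 0 & (\<forall>n. 0 < f n & G (f n) & \<not> Q (f n))"
proof -
 obtain b where b: "b > 0" "!!e. 0 < e ==> e < b ==> G e"
 using assms(2) unfolding eventually_at_right_field by blast
 have "\<exists>e. 0 < e & e < min b (1 / Suc n) & \<not> Q e" for n
 proof (rule ccontr)
 assume "\<nexists>e. 0 < e & e < min b (1 / Suc n) & \<not> Q e"
 then have "\<forall>e>0. e < min b (1 / Suc n) --> Q e" by blast
 moreover have "0 < min b (1 / Suc n)" using b(1) by simp
 ultimately show False using assms(1) unfolding eventually_at_right_field by blast
 qed
 then have "\<forall>n. \<exists>e. 0 < e & e < min b (1 / Suc n) & \<not> Q e" by blast
 from choice[OF this] obtain f where f: "\<forall>n. 0 < f n & f n < min b (1 / Suc n) & \<not> Q (f n)" ..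
 have "f \<longlonglongrightarrow> 0"
 proof (rule real_tendsto_sandwich[OF _ _ tendsto_const LIMSEQ_inverse_real_of_nat])
 show "\<forall>\<^sub>F n in sequentially. 0 <= f n" using f by (intro always_eventually allI) (simp add: less_imp_le)
 show "\<forall>\<^sub>F n in sequentially. f n <= inverse (real (Suc n))" using f
 by (intro always_eventually allI) (simp add: less_imp_le inverse_eq_divide)
 qed
 then show ?thesis using f b(2) by (intro exI[of _ f]) auto
qed

context kr1
begin

text \<open>By contradiction: a failure would produce a sequence of radii with critical points
  outside \<open>KB\<close>, contrary to the limits in \<open>crit_limit\<close>.\<close>

lemma crit_localised:
 "\<forall>\<^sub>F e in at_right 0. \<forall>x y. e < cmod x & cmod x < \<delta>0 & e < cmod y & cmod y < \<delta>0 & is_crit e x y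
 --> (x /\<^sub>R sc e, y /\<^sub>R sc e) \<in> KB"
proof (rule ccontr)
 assume "\<not> ?thesis"
 from not_eventually_at_right_sequence[OF this eventually_good] obtain f where f: "f \<longlonglongrightarrow> 0" and
 f': "\<forall>n. 0 < f n & good (f n) & \<not> (\<forall>x y. f n < cmod x & cmod x < \<delta>0 & f n < cmod y & cmod y < \<delta>0 & is_crit (f n) x y
 --> (x /\<^sub>R sc (f n), y /\<^sub>R sc (f n)) \<in> KB)" by (elim exE conjE)
 have fp: "0 < f n" "good (f n)" for n using f' by blast+
 have "\<forall>n. \<exists>q. f n < cmod (fst q) & cmod (fst q) < \<delta>0 & f n < cmod (snd q) & cmod (snd q) < \<delta>0 & is_crit (f n) (fst q) (snd q)
 & (fst q /\<^sub>R sc (f n), snd q /\<^sub>R sc (f n)) \<notin> KB"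
 proof
 fix n
 from f'[rule_format, of n] obtain x y where "f n < cmod x & cmod x < \<delta>0 & f n < cmod y & cmod y < \<delta>0 & is_crit (f n) x y
 & (x /\<^sub>R sc (f n), y /\<^sub>R sc (f n)) \<notin> KB" by blast
 then show "\<exists>q. f n < cmod (fst q) & cmod (fst q) < \<delta>0 & f n < cmod (snd q) & cmod (snd q) < \<delta>0 & is_crit (f n) (fst q) (snd q)
 & (fst q /\<^sub>R sc (f n), snd q /\<^sub>R sc (f n)) \<notin> KB" by (intro exI[of _ "(x, y)"]) simp
 qed
 from choice[OF this] obtain q where q0: "\<forall>n. f n < cmod (fst (q n)) & cmod (fst (q n)) < \<delta>0 & f n < cmod (snd (q n))
 & cmod (snd (q n)) < \<delta>0 & is_crit (f n) (fst (q n)) (snd (q n))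
 & (fst (q n) /\<^sub>R sc (f n), snd (q n) /\<^sub>R sc (f n)) \<notin> KB" ..
 define x where "x n = fst (q n)" for n
 define y where "y n = snd (q n)" for n
 have q: "f n < cmod (x n)" "cmod (x n) < \<delta>0" "f n < cmod (y n)" "cmod (y n) < \<delta>0" "is_crit (f n) (x n) (y n)"
 "(x n /\<^sub>R sc (f n), y n /\<^sub>R sc (f n)) \<notin> KB" for n
 using q0 by (simp_all add: x_def y_def)
 have l1': "(%n. y n / x n) \<longlonglongrightarrow> of_real (- l2 / l1)" by (rule crit_limit(1)[OF f fp(2) q(1-5)])
 have l2': "(%n. cmod (x n) / f n powr \<beta>) \<longlonglongrightarrow> exp lnC" by (rule crit_limit(2)[OF f fp(2) q(1-5)])
 have "(%n. y n / x n + of_real tr) \<longlonglongrightarrow> of_real (- l2 / l1) + of_real tr" by (intro tendsto_add l1' tendsto_const)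
 then have l0: "(%n. y n / x n + of_real tr) \<longlonglongrightarrow> 0" by (simp add: tr_def)
 have "\<forall>\<^sub>F n in sequentially. cmod (y n / x n + of_real tr) < tr / 8"
 using tendstoD[OF l0, of "tr / 8"] tr_pos by (simp add: dist_norm)
 moreover have "\<forall>\<^sub>F n in sequentially. CC / 2 < cmod (x n) / f n powr \<beta>" "\<forall>\<^sub>F n in sequentially. cmod (x n) / f n powr \<beta> < 2 * CC"
 using order_tendstoD[OF l2', of "CC / 2"] order_tendstoD[OF l2', of "2 * CC"] CC_pos by (simp_all add: CC_def)
 ultimately have "\<forall>\<^sub>F n in sequentially. False"
 proof eventually_elim
 case (elim n)
 define a where "a = sc (f n)"
 have a: "0 < a" using sc_pos fp(1) by (simp add: a_def)
 have x0: "x n ~= 0" using q(1)[of n] fp(1)[of n] by auto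
 define u where "u = x n /\<^sub>R a"
 have nu: "cmod u = cmod (x n) / f n powr \<beta>" using a by (simp add: u_def a_def sc_def divide_inverse mult.commute)
 have "y n /\<^sub>R a + of_real tr * u = u * (y n / x n + of_real tr)" using x0 by (simp add: u_def scaleR_conv_of_real algebra_simps)
 then have "cmod (y n /\<^sub>R a + of_real tr * u) = cmod u * cmod (y n / x n + of_real tr)" by (simp only: norm_mult)
 \<comment> \<open>The tolerance tr/8 for the quotient was chosen so that with |u| < 2 CC the
   product is tr CC/4, the width allowed in \<open>KB\<close>.\<close>
 also have "... <= (2 * CC) * (tr / 8)" using elim nu CC_pos by (intro mult_mono) auto
 finally have "(u, y n /\<^sub>R a) \<in> KB" using elim nu by (simp add: KB_def mult.commute)
 then show False using q(6)[of n] by (simp add: u_def a_def)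
 qed
 then show False by simp
qed

text \<open>Localisation puts every critical point into \<open>KB\<close> after rescaling, where
  being critical is the same as being a zero of \<open>Psi\<close>. Conversely the zeros have size
  e^\<beta> after scaling back, hence lie within any fixed \<delta> but outside the hole.\<close>

theorem crit_set:
 assumes "0 < \<delta>" "\<delta> <= \<delta>0"
 and sol: "\<forall>\<^sub>F e in at_right 0. {z \<in> KB. Fz z + Dl \<theta> e z = 0} = {sol m s e | m s. True}"
 shows "\<forall>\<^sub>F e in at_right 0. {(x, y). e < cmod x & cmod x < \<delta> & e < cmod y & cmod y < \<delta> & is_crit e x y}
 = {(sc e *\<^sub>R fst (sol m s e), sc e *\<^sub>R snd (sol m s e)) | m s. True}"
proof -
 obtain c where c: "0 < c" "c < 1" "KB \<subseteq> annuli c" using KB_annuli by blast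
 have "\<forall>\<^sub>F e in at_right 0. sc e < c * \<delta>" using order_tendstoD(2)[OF sc_tendsto, of "c * \<delta>"] c assms(1) by simp
 then show ?thesis using eventually_region[OF c(1)] sol crit_localised
 proof eventually_elim
 case (elim e)
 define a where "a = sc e"
 have a: "0 < a" "4 * e < c * a" "a < c * \<delta>" "a / c < \<delta>" using elim c by (simp_all add: a_def divide_less_eq mult.commute)
 have g: "good e" "0 < e" using elim by (auto simp: good_def)
 have rng: "e < cmod (a *\<^sub>R z) & cmod (a *\<^sub>R z) < \<delta>" if "c < cmod z" "cmod z < 1 / c" for z
 proof -
 have n: "cmod (a *\<^sub>R z) = a * cmod z" "a * (1 / c) = a / c" using a(1) by simp_all
 have "4 * e < a * c" using a(2) by (simp only: mult.commute[of a c])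
 then have "e < a * c" using g(2) by linarith
 then have "e < a * cmod z" using mult_strict_left_mono[OF that(1) a(1)] by (rule less_trans)
 moreover have "a * cmod z < \<delta>" using mult_strict_left_mono[OF that(2) a(1)] a(4) unfolding n(2) by (rule less_trans)
 ultimately show ?thesis unfolding n(1) by simp
 qed
 have E: "a *\<^sub>R z \<in> D - cball 0 e" if "c < cmod z" "cmod z < 1 / c" for z
 using in_E[OF g(1), of "a *\<^sub>R z"] rng[OF that] assms(2) delta0(2) r1(1) by auto
 have eqv: "is_crit e (a *\<^sub>R fst p) (a *\<^sub>R snd p) \<longleftrightarrow> Fz p + Dl \<theta> e p = 0" if "p \<in> KB" for p
 proof -
 have p: "c < cmod (fst p)" "cmod (fst p) < 1 / c" "c < cmod (snd p)" "cmod (snd p) < 1 / c" "fst p ~= snd p"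
 using that c by (auto simp: annuli_def)
 have "Psi e p = Fz p + Dl \<theta> e p"
 by (rule Psi_eq[OF g(1) E[OF p(1,2), unfolded a_def] E[OF p(3,4), unfolded a_def] p(5)])
 then show ?thesis using Psi_zero_iff[OF g(1), of p] p(5) a(1) by (simp add: is_crit_def a_def)
 qed
 show ?case
 proof (intro equalityI subsetI)
 fix q assume "q \<in> {(x, y). e < cmod x & cmod x < \<delta> & e < cmod y & cmod y < \<delta> & is_crit e x y}"
 then obtain x y where q: "q = (x, y)" "e < cmod x" "cmod x < \<delta>" "e < cmod y" "cmod y < \<delta>" "is_crit e x y" by blast
 define p where "p = (x /\<^sub>R a, y /\<^sub>R a)"
 have xy: "x = a *\<^sub>R fst p" "y = a *\<^sub>R snd p" using a(1) by (simp_all add: p_def)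
 have "cmod x < \<delta>0" "cmod y < \<delta>0" using q assms(2) by linarith+
 then have K: "p \<in> KB" using elim(4) q unfolding p_def a_def by blast
 then have "p \<in> {z \<in> KB. Fz z + Dl \<theta> e z = 0}" using eqv[OF K] q(6) xy by simp
 then obtain m s where "p = sol m s e" unfolding elim(3) by blast
 then show "q \<in> {(sc e *\<^sub>R fst (sol m s e), sc e *\<^sub>R snd (sol m s e)) | m s. True}"
 using q(1) xy by (auto simp: a_def)
 next
 fix q assume "q \<in> {(sc e *\<^sub>R fst (sol m s e), sc e *\<^sub>R snd (sol m s e)) | m s. True}"
 then obtain m s where q: "q = (sc e *\<^sub>R fst (sol m s e), sc e *\<^sub>R snd (sol m s e))" by blast
 have "sol m s e \<in> {sol m s e | m s. True}" by blast
 then have K: "sol m s e \<in> KB" "Fz (sol m s e) + Dl \<theta> e (sol m s e) = 0" unfolding elim(3)[symmetric] by auto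
 have p: "c < cmod (fst (sol m s e))" "cmod (fst (sol m s e)) < 1 / c" "c < cmod (snd (sol m s e))" "cmod (snd (sol m s e)) < 1 / c"
 using K c by (auto simp: annuli_def)
 then show "q \<in> {(x, y). e < cmod x & cmod x < \<delta> & e < cmod y & cmod y < \<delta> & is_crit e x y}"
 using rng[OF p(1,2)] rng[OF p(3,4)] eqv[OF K(1)] K(2) unfolding q a_def by simp
 qed
 qed
qed

end


section \<open>Gradient and Hessian of the Kirchhoff--Routh function\<close>

definition cbD :: "(complex => complex => real) => complex \<times> complex => complex \<times> complex => complex" where
 "cbD f z v = of_real (bD (%x y. Re (dx f x y)) z v) + \<i> * of_real (bD (%x y. Im (dx f x y)) z v)"

lemma dx_has_derivative:
 assumes "biharm S T f" "z \<in> S \<times> T"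
 shows "((%p. dx f (fst p) (snd p)) has_derivative cbD f z) (at z)"
proof -
 have "((%p. of_real (Re (dx f (fst p) (snd p))) + \<i> * of_real (Im (dx f (fst p) (snd p)))) has_derivative cbD f z) (at z)"
 unfolding cbD_def[abs_def] by (intro has_derivative_add has_derivative_mult_right has_derivative_of_real
 biharm_bD[OF biharm_dx(1)[OF assms(1)] assms(2)] biharm_bD[OF biharm_dx(2)[OF assms(1)] assms(2)])
 then show ?thesis by (simp flip: complex_eq)
qed

text \<open>2 l times this is the complex gradient of \<open>KC\<close> in its first variable, where
  \<open>KC\<close> is 2 pi times the Kirchhoff-Routh function.\<close>

definition KE :: "complex set => real => real => complex => complex => complex" where
 "KE E l m x y = of_real l * dx (hreg E) x x + of_real m * (dx (hreg E) x y + 1 / (x - y))"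

definition KC :: "complex set => real => real => complex \<times> complex => real" where
 "KC E l m p = l\<^sup>2 * hreg E (fst p) (fst p) + m\<^sup>2 * hreg E (snd p) (snd p)
 + 2 * l * m * (ln (cmod (fst p - snd p)) + hreg E (fst p) (snd p))"

context reg_domain
begin

lemma dy_hreg:
 assumes "x \<in> D" "y \<in> D"
 shows "dy (hreg D) x y = dx (hreg D) y x"
 unfolding dy_def dx_def
 by (rule cgrad_cong[OF D_open assms(2)]) (rule hreg_sym[OF assms(1)])

lemma hreg_diag_derivative:
 assumes "x \<in> D"
 shows "((%x. hreg D x x) has_derivative (%h. 2 * Re (dx (hreg D) x x * h))) (at x)"
proof -
 have "((%x. (x, x)) has_derivative (%h. (h, h))) (at x)" by (intro has_derivative_Pair has_derivative_ident)
 from has_derivative_compose[OF this biharm_has_derivative[OF hreg_biharm assms assms]]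
 have "((%x. hreg D x x) has_derivative (%h. Re (dx (hreg D) x x * h) + Re (dy (hreg D) x x * h))) (at x)"
 by (simp only: fst_conv snd_conv)
 then show ?thesis by (rule has_derivative_eq_rhs) (simp add: dy_hreg[OF assms assms] fun_eq_iff algebra_simps)
qed

lemma KC_derivative:
 assumes "fst p \<in> D" "snd p \<in> D" "fst p ~= snd p"
 shows "(KC D l m has_derivative (%v. 2 * l * Re (KE D l m (fst p) (snd p) * fst v)
 + 2 * m * Re (KE D m l (snd p) (fst p) * snd v))) (at p)"
proof -
 note df = bounded_linear_imp_has_derivative[OF bounded_linear_fst[where 'a=complex and 'b=complex]]
 note ds = bounded_linear_imp_has_derivative[OF bounded_linear_snd[where 'a=complex and 'b=complex]]
 have 1: "((%p. hreg D (fst p) (fst p)) has_derivative (%v. 2 * Re (dx (hreg D) (fst p) (fst p) * fst v))) (at p)"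
 by (rule has_derivative_compose[OF df hreg_diag_derivative[OF assms(1)]])
 have 2: "((%p. hreg D (snd p) (snd p)) has_derivative (%v. 2 * Re (dx (hreg D) (snd p) (snd p) * snd v))) (at p)"
 by (rule has_derivative_compose[OF ds hreg_diag_derivative[OF assms(2)]])
 have 3: "((%p. hreg D (fst p) (snd p)) has_derivative (%v. Re (dx (hreg D) (fst p) (snd p) * fst v)
 + Re (dx (hreg D) (snd p) (fst p) * snd v))) (at p)"
 using biharm_has_derivative[OF hreg_biharm assms(1,2)] by (simp add: dy_hreg[OF assms(1,2)])
 have "((%z. ln (cmod (z - 0))) has_derivative (%h. Re (inverse (fst p - snd p - 0) * h))) (at (fst p - snd p))"
 by (rule has_derivative_ln_cmod) (use assms(3) in simp)
 from has_derivative_compose[OF has_derivative_diff[OF df ds] this]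
 have 4: "((%p. ln (cmod (fst p - snd p))) has_derivative (%v. Re (inverse (fst p - snd p) * (fst v - snd v)))) (at p)" by simp
 define r where "r = inverse (fst p - snd p)"
 have r: "1 / (fst p - snd p) = r" "1 / (snd p - fst p) = - r"
 by (simp_all add: r_def divide_inverse) (metis inverse_minus_eq minus_diff_eq)
 have "((%p. l\<^sup>2 * hreg D (fst p) (fst p) + m\<^sup>2 * hreg D (snd p) (snd p)
 + 2 * l * m * (ln (cmod (fst p - snd p)) + hreg D (fst p) (snd p))) has_derivative
 (%v. l\<^sup>2 * (2 * Re (dx (hreg D) (fst p) (fst p) * fst v)) + m\<^sup>2 * (2 * Re (dx (hreg D) (snd p) (snd p) * snd v))
 + 2 * l * m * (Re (r * (fst v - snd v)) + (Re (dx (hreg D) (fst p) (snd p) * fst v)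
 + Re (dx (hreg D) (snd p) (fst p) * snd v))))) (at p)"
 unfolding r_def by (intro has_derivative_add has_derivative_mult_right 1 2 3 4)
 then show ?thesis unfolding KC_def[abs_def] KE_def r
 by (rule has_derivative_eq_rhs) (simp add: fun_eq_iff power2_eq_square algebra_simps)
qed

lemma KE_differentiable:
 assumes "fst p \<in> D" "snd p \<in> D" "fst p ~= snd p"
 shows "\<exists>F. ((%p. KE D l m (fst p) (snd p)) has_derivative F) (at p)"
 "\<exists>F. ((%p. KE D m l (snd p) (fst p)) has_derivative F) (at p)"
proof -
 note df = bounded_linear_imp_has_derivative[OF bounded_linear_fst[where 'a=complex and 'b=complex]]
 note ds = bounded_linear_imp_has_derivative[OF bounded_linear_snd[where 'a=complex and 'b=complex]]
 have *: "\<exists>F. ((%p. KE D l m (u p) (w p)) has_derivative F) (at p)"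
 if "(u has_derivative u) (at p)" "(w has_derivative w) (at p)" "u p \<in> D" "w p \<in> D" "u p ~= w p" for u w l m
 proof -
 have c: "((%p. dx (hreg D) (u p) (w p)) has_derivative (%v. cbD (hreg D) (u p, w p) (u v, w v))) (at p)"
 if "(u has_derivative u) (at p)" "(w has_derivative w) (at p)" "u p \<in> D" "w p \<in> D" for u w
 proof -
 have z: "(u p, w p) \<in> D \<times> D" using that by simp
 from has_derivative_compose[OF has_derivative_Pair[OF that(1,2)] dx_has_derivative[OF hreg_biharm z]] show ?thesis by simp
 qed
 show ?thesis unfolding KE_def
 by (rule exI, rule has_derivative_add, rule has_derivative_mult_right, rule c[OF that(1,1,3,3)],
 rule has_derivative_mult_right, rule has_derivative_add, rule c[OF that(1-4)],
 rule has_derivative_divide'[OF has_derivative_const has_derivative_diff[OF that(1,2)]]) (use that(5) in simp)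
 qed
 show "\<exists>F. ((%p. KE D l m (fst p) (snd p)) has_derivative F) (at p)" by (rule *[OF df ds assms])
 show "\<exists>F. ((%p. KE D m l (snd p) (fst p)) has_derivative F) (at p)"
 by (rule *[OF ds df assms(2,1) assms(3)[symmetric]])
qed

text \<open>A second mixed difference is used because it inherits the symmetry of the regular part,
  which then passes to the mixed derivative. The limit is found by the mean value theorem in the
  direction k and the differential of dx at the origin for the increment h.\<close>

lemma mixed_difference_limit:
 assumes "0 \<in> D"
 shows "((%s. (hreg D (of_real s * k) (of_real s * h) - hreg D (of_real s * k) 0 - hreg D 0 (of_real s * h) + hreg D 0 0) / s\<^sup>2)
 \<longlongrightarrow> Re (cbD (hreg D) (0, 0) (0, h) * k)) (at_right 0)"
proof (rule tendstoI)
 let ?H = "hreg D" let ?l = "cbD (hreg D) (0, 0)"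
 fix eta :: real assume eta: "0 < eta"
 define N where "N = 1 + cmod h + cmod k"
 have N: "1 <= N" "cmod h <= N" "cmod k <= N" by (simp_all add: N_def)
 \<comment> \<open>The error is at most 4 eta' (s N) N = s eta/2; division by s leaves
   eta/2.\<close>
 define eta' where "eta' = eta / (8 * N\<^sup>2)"
 have eta': "0 < eta'" using eta N(1) by (simp add: eta'_def)
 have z: "(0, 0) \<in> D \<times> D" using assms by simp
 note dl = dx_has_derivative[OF hreg_biharm z]
 have lin: "linear ?l" by (rule bounded_linear.linear[OF has_derivative_bounded_linear[OF dl]])
 obtain rho where rho: "rho > 0" "!!p. norm p < rho ==> norm (dx ?H (fst p) (snd p) - dx ?H 0 0 - ?l p) <= eta' * norm p"
 using dl[unfolded has_derivative_at_alt] eta' by (auto simp flip: zero_prod_def)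
 obtain rho' where rho': "rho' > 0" "ball 0 rho' \<subseteq> D" using D_open assms by (meson open_contains_ball)
 define b where "b = min rho rho' / (2 * N)"
 have b: "0 < b" using rho(1) rho'(1) N by (simp add: b_def)
 have "dist ((?H (of_real s * k) (of_real s * h) - ?H (of_real s * k) 0 - ?H 0 (of_real s * h) + ?H 0 0) / s\<^sup>2) (Re (?l (0, h) * k)) < eta"
 if s: "0 < s" "s < b" for s
 proof -
 have sN: "s * (2 * N) < rho" "s * (2 * N) < rho'" using s(2) N(1) unfolding b_def by (auto simp: less_divide_eq)
 have le: "cmod (of_real t * x) <= s * N" if "0 <= t" "t <= s" "cmod x <= N" for t x
 using mult_mono[OF that(2,3)] that s(1) by (simp add: norm_mult)
 have inD: "of_real t * x \<in> D" if "0 <= t" "t <= s" "cmod x <= N" for t x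
 proof -
 have "s * N < rho'" using sN(2) s(1) N(1) mult_pos_pos[of s N] by linarith
 then have "of_real t * x \<in> ball 0 rho'" using le[OF that] by simp
 then show ?thesis using rho'(2) by blast
 qed
 define phi where "phi t = ?H (of_real t * k) (of_real s * h) - ?H (of_real t * k) 0" for t
 define phi' where "phi' t = Re (dx ?H (of_real t * k) (of_real s * h) * k) - Re (dx ?H (of_real t * k) 0 * k)" for t
 have y: "of_real s * h \<in> D" using inD[of s h] s N by simp
 have d: "(phi has_real_derivative phi' t) (at t)" if "0 <= t" "t <= s" for t
 proof -
 have t: "0 + of_real t * k \<in> D" using inD[OF that N(3)] by simp
 have "((%t. ?H (0 + of_real t * k) y) has_real_derivative Re (dx ?H (0 + of_real t * k) y * k)) (at t)" if "y \<in> D" for y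
 unfolding dx_def by (rule has_dir_deriv_shift[OF has_dir_deriv_harm[OF hreg_props(2)[OF that] t]])
 from DERIV_diff[OF this[OF y] this[OF assms]] show ?thesis by (simp add: phi_def[abs_def] phi'_def)
 qed
 obtain t where t: "0 < t" "t < s" "phi s - phi 0 = (s - 0) * phi' t"
 using MVT2[OF s(1), of phi phi'] d by auto
 have R: "norm (dx ?H x y - dx ?H 0 0 - ?l (x, y)) <= eta' * (2 * (s * N))" if "cmod x <= s * N" "cmod y <= s * N" for x y
 proof -
 have n: "norm (x, y) <= 2 * (s * N)" using norm_Pair_le[of x y] that by simp
 then have "norm (x, y) < rho" using sN(1) by simp
 from rho(2)[OF this] have "norm (dx ?H x y - dx ?H 0 0 - ?l (x, y)) <= eta' * norm (x, y)" by simp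
 also have "... <= eta' * (2 * (s * N))" using n eta' by (intro mult_left_mono) auto
 finally show ?thesis .
 qed
 define u where "u = dx ?H (of_real t * k) (of_real s * h) - dx ?H (of_real t * k) 0 - of_real s * ?l (0, h)"
 have "?l (of_real t * k, of_real s * h) - ?l (of_real t * k, 0) = ?l (s *\<^sub>R (0, h))"
 by (simp add: linear_diff[OF lin, symmetric] scaleR_conv_of_real)
 also have "... = of_real s * ?l (0, h)" by (simp only: linear_cmul[OF lin] scaleR_conv_of_real)
 finally have "u = (dx ?H (of_real t * k) (of_real s * h) - dx ?H 0 0 - ?l (of_real t * k, of_real s * h))
 - (dx ?H (of_real t * k) 0 - dx ?H 0 0 - ?l (of_real t * k, 0))" by (simp add: u_def algebra_simps)
 moreover have "norm (dx ?H (of_real t * k) (of_real s * h) - dx ?H 0 0 - ?l (of_real t * k, of_real s * h)) <= eta' * (2 * (s * N))"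
 by (rule R; rule le) (use t s N in auto)
 moreover have "norm (dx ?H (of_real t * k) 0 - dx ?H 0 0 - ?l (of_real t * k, 0)) <= eta' * (2 * (s * N))"
 by (rule R, rule le) (use t s N in auto)
 ultimately have un: "cmod u <= 4 * eta' * (s * N)"
 using norm_triangle_ineq4[of "dx ?H (of_real t * k) (of_real s * h) - dx ?H 0 0 - ?l (of_real t * k, of_real s * h)"
 "dx ?H (of_real t * k) 0 - dx ?H 0 0 - ?l (of_real t * k, 0)"] by simp
 have "phi' t = s * Re (?l (0, h) * k) + Re (u * k)" by (simp add: phi'_def u_def algebra_simps)
 moreover have "?H (of_real s * k) (of_real s * h) - ?H (of_real s * k) 0 - ?H 0 (of_real s * h) + ?H 0 0 = phi s - phi 0"
 by (simp add: phi_def)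
 ultimately have e: "(?H (of_real s * k) (of_real s * h) - ?H (of_real s * k) 0 - ?H 0 (of_real s * h) + ?H 0 0) / s\<^sup>2
 = Re (?l (0, h) * k) + Re (u * k) / s" using t(3) s(1) by (simp add: power2_eq_square field_simps)
 have "\<bar>Re (u * k)\<bar> <= cmod u * cmod k" by (metis abs_Re_le_cmod norm_mult)
 also have "... <= (4 * eta' * (s * N)) * N" using un N eta' s(1) by (intro mult_mono) auto
 also have "... = s * (eta / 2)" using N(1) by (simp add: eta'_def power2_eq_square)
 finally have "\<bar>Re (u * k) / s\<bar> <= eta / 2" using s(1) by (simp add: divide_le_eq mult.commute)
 then have "\<bar>Re (u * k) / s\<bar> < eta" using eta by linarith
 moreover have "dist (r + q) r = \<bar>q\<bar>" for r q :: real by (simp add: dist_real_def)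
 ultimately show ?thesis unfolding e by (simp only:)
 qed
 then show "\<forall>\<^sub>F s in at_right 0. dist ((?H (of_real s * k) (of_real s * h) - ?H (of_real s * k) 0 - ?H 0 (of_real s * h) + ?H 0 0) / s\<^sup>2)
 (Re (?l (0, h) * k)) < eta"
 using b unfolding eventually_at_right_field by blast
qed

lemma mixed_symmetric:
 assumes "0 \<in> D"
 shows "Re (cbD (hreg D) (0, 0) (0, h) * k) = Re (cbD (hreg D) (0, 0) (0, k) * h)"
proof (rule tendsto_unique[OF _ mixed_difference_limit[OF assms]])
 obtain rho' where rho': "rho' > 0" "ball 0 rho' \<subseteq> D" using D_open assms by (meson open_contains_ball)
 have ev: "\<forall>\<^sub>F s::real in at_right 0. of_real s * x \<in> D" for x :: complex
 proof -
 have "((%s. of_real s * x) \<longlongrightarrow> of_real 0 * x) (at_right 0)" by (intro tendsto_intros)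
 then show ?thesis using D_open assms by (simp add: tendsto_def)
 qed
 show "((%s. (hreg D (of_real s * k) (of_real s * h) - hreg D (of_real s * k) 0 - hreg D 0 (of_real s * h) + hreg D 0 0) / s\<^sup>2)
 \<longlongrightarrow> Re (cbD (hreg D) (0, 0) (0, k) * h)) (at_right 0)"
 proof (rule Lim_transform_eventually[OF mixed_difference_limit[OF assms, of h k]])
 show "\<forall>\<^sub>F s in at_right 0. (hreg D (of_real s * h) (of_real s * k) - hreg D (of_real s * h) 0 - hreg D 0 (of_real s * k) + hreg D 0 0) / s\<^sup>2
 = (hreg D (of_real s * k) (of_real s * h) - hreg D (of_real s * k) 0 - hreg D 0 (of_real s * h) + hreg D 0 0) / s\<^sup>2"
 using ev[of h] ev[of k]
 proof eventually_elim
 case (elim s)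
 then show ?case using hreg_sym[OF elim] hreg_sym[OF elim(1) assms] hreg_sym[OF elim(2) assms] by simp
 qed
 qed
qed simp

text \<open>With the pole at 0 the gradient is holomorphic in x, so its differential is
  multiplication by a complex number, and multiplication commutes.\<close>

lemma pure_symmetric:
 assumes "0 \<in> D"
 shows "Re (cbD (hreg D) (0, 0) (h, 0) * k) = Re (cbD (hreg D) (0, 0) (k, 0) * h)"
proof -
 have z: "(0, 0) \<in> D \<times> D" using assms by simp
 have hol: "(%x. dx (hreg D) x 0) holomorphic_on D"
 unfolding dx_def by (rule harm_cgrad_holomorphic[OF hreg_props(2)[OF assms]])
 have 1: "((%x. dx (hreg D) x 0) has_derivative (%h. deriv (%x. dx (hreg D) x 0) 0 * h)) (at 0)"
 using holomorphic_derivI[OF hol D_open assms] by (simp add: has_field_derivative_def)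
 have "((%x. (x, 0::complex)) has_derivative (%h. (h, 0))) (at (0::complex))"
 by (intro has_derivative_Pair has_derivative_ident has_derivative_const)
 from has_derivative_compose[OF this, of "%p. dx (hreg D) (fst p) (snd p)"] dx_has_derivative[OF hreg_biharm z]
 have "((%x. dx (hreg D) x 0) has_derivative (%h. cbD (hreg D) (0, 0) (h, 0))) (at 0)" by simp
 then have "cbD (hreg D) (0, 0) (h, 0) = deriv (%x. dx (hreg D) x 0) 0 * h" for h
 using has_derivative_unique[OF 1] by metis
 then show ?thesis by (simp add: mult.assoc mult.commute[of h k])
qed

end

context kr1
begin

text \<open>At a critical point the derivative of x times \<open>KE\<close> is x times the
  derivative of \<open>KE\<close>. So a kernel vector of the latter, divided by the scale, is a
  kernel vector of the derivative of \<open>Psi\<close>, which locally equals \<open>Fz\<close> plus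
  \<open>Dl\<close> and is injective there.\<close>

lemma hessian_injective:
 assumes "good e" "sc e *\<^sub>R fst z \<in> D - cball 0 e" "sc e *\<^sub>R snd z \<in> D - cball 0 e" "fst z ~= snd z"
 and crit: "KE (D - cball 0 e) l1 l2 (sc e *\<^sub>R fst z) (sc e *\<^sub>R snd z) = 0" "KE (D - cball 0 e) l2 l1 (sc e *\<^sub>R snd z) (sc e *\<^sub>R fst z) = 0"
 and inj: "!!D v. ((%z. Fz z + Dl \<theta> e z) has_derivative D) (at z) ==> D v = 0 ==> v = 0"
 and F: "((%p. (KE (D - cball 0 e) l1 l2 (fst p) (snd p), KE (D - cball 0 e) l2 l1 (snd p) (fst p))) has_derivative F) (at (sc e *\<^sub>R z))"
 and v: "F v = 0"
 shows "v = 0"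
proof -
 define E where "E = D - cball 0 e"
 define a where "a = sc e"
 have e0: "0 < e" using assms(1) by (simp add: good_def)
 then have a: "0 < a" using sc_pos[of e] by (simp add: a_def)
 have E_open: "open E" unfolding E_def by (rule open_Diff[OF D_open closed_cball])
 define G1 where "G1 p = KE E l1 l2 (fst p) (snd p)" for p
 define G2 where "G2 p = KE E l2 l1 (snd p) (fst p)" for p
 have F12: "(G1 has_derivative (%v. fst (F v))) (at (a *\<^sub>R z))" "(G2 has_derivative (%v. snd (F v))) (at (a *\<^sub>R z))"
 using has_derivative_fst[OF F] has_derivative_snd[OF F] by (simp_all add: G1_def[abs_def] G2_def[abs_def] E_def a_def)
 have sc: "((%p. a *\<^sub>R p) has_derivative (%v. a *\<^sub>R v)) (at z)" by (intro has_derivative_scaleR_right has_derivative_ident)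
 have K1: "((%p. G1 (a *\<^sub>R p)) has_derivative (%v. fst (F (a *\<^sub>R v)))) (at z)"
 by (rule has_derivative_compose[OF sc F12(1)])
 have K2: "((%p. G2 (a *\<^sub>R p)) has_derivative (%v. snd (F (a *\<^sub>R v)))) (at z)"
 by (rule has_derivative_compose[OF sc F12(2)])
 have z0: "G1 (a *\<^sub>R z) = 0" "G2 (a *\<^sub>R z) = 0" using crit by (simp_all add: G1_def G2_def E_def a_def)
 note df = bounded_linear_imp_has_derivative[OF bounded_linear_fst[where 'a=complex and 'b=complex]]
 note ds = bounded_linear_imp_has_derivative[OF bounded_linear_snd[where 'a=complex and 'b=complex]]
 have e1: "((%p. a *\<^sub>R fst p * G1 (a *\<^sub>R p)) has_derivative (%v. a *\<^sub>R fst z * fst (F (a *\<^sub>R v)))) (at z)"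
 by (rule has_derivative_eq_rhs[OF has_derivative_mult[OF has_derivative_scaleR_right[OF df] K1]]) (simp add: z0)
 have e2: "((%p. a *\<^sub>R snd p * G2 (a *\<^sub>R p)) has_derivative (%v. a *\<^sub>R snd z * snd (F (a *\<^sub>R v)))) (at z)"
 by (rule has_derivative_eq_rhs[OF has_derivative_mult[OF has_derivative_scaleR_right[OF ds] K2]]) (simp add: z0)
 have ee1: "ee l1 l2 e (sc e *\<^sub>R fst p) (sc e *\<^sub>R snd p) = a *\<^sub>R fst p * G1 (a *\<^sub>R p)"
 and ee2: "ee l2 l1 e (sc e *\<^sub>R snd p) (sc e *\<^sub>R fst p) = a *\<^sub>R snd p * G2 (a *\<^sub>R p)" for p
 by (simp_all add: ee_def G1_def G2_def KE_def E_def a_def)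
 define S' where "S' v = of_real l1 * (a *\<^sub>R fst z * fst (F (a *\<^sub>R v))) + of_real l2 * (a *\<^sub>R snd z * snd (F (a *\<^sub>R v)))" for v
 have S: "(SS e has_derivative S') (at z)"
 unfolding SS_def[abs_def] ee1 ee2 S'_def[abs_def] by (intro has_derivative_add has_derivative_mult_right e1 e2)
 define P' where "P' v = (a *\<^sub>R snd z * snd (F (a *\<^sub>R v)), of_real (Lf e * Re (S' v)) + \<i> * of_real (inverse ((sc e)\<^sup>2) * Im (S' v)))" for v
 have Pd: "(Psi e has_derivative P') (at z)"
 unfolding Psi_def[abs_def] Complex_eq P'_def[abs_def] ee2 divide_inverse mult.commute[of _ "inverse ((sc e)\<^sup>2)"]
 by (intro has_derivative_Pair has_derivative_add has_derivative_mult_right has_derivative_of_real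
 has_derivative_Re has_derivative_Im e2 S)
 have "open {p. a *\<^sub>R fst p \<in> E & a *\<^sub>R snd p \<in> E & fst p ~= snd p}"
 proof -
 have "open ((%p::complex \<times> complex. a *\<^sub>R fst p) -` E)" "open ((%p::complex \<times> complex. a *\<^sub>R snd p) -` E)"
 by (intro open_vimage[OF E_open] continuous_intros)+
 moreover have "open {p::complex\<times>complex. fst p ~= snd p}" by (intro open_Collect_neq continuous_intros)
 ultimately have "open (((%p::complex \<times> complex. a *\<^sub>R fst p) -` E) \<inter> ((%p. a *\<^sub>R snd p) -` E) \<inter> {p. fst p ~= snd p})" by (intro open_Int)
 moreover have "((%p::complex \<times> complex. a *\<^sub>R fst p) -` E) \<inter> ((%p. a *\<^sub>R snd p) -` E) \<inter> {p. fst p ~= snd p}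
 = {p. a *\<^sub>R fst p \<in> E & a *\<^sub>R snd p \<in> E & fst p ~= snd p}" by blast
 ultimately show ?thesis by simp
 qed
 moreover have "z \<in> {p. a *\<^sub>R fst p \<in> E & a *\<^sub>R snd p \<in> E & fst p ~= snd p}" using assms(2-4) by (simp add: a_def E_def)
 moreover have "Psi e p = Fz p + Dl \<theta> e p" if "p \<in> {p. a *\<^sub>R fst p \<in> E & a *\<^sub>R snd p \<in> E & fst p ~= snd p}" for p
 using that by (intro Psi_eq[OF assms(1)]) (auto simp: a_def E_def)
 ultimately have FD: "((%z. Fz z + Dl \<theta> e z) has_derivative P') (at z)"
 by (rule has_derivative_transform_within_open[OF Pd])
 have "a *\<^sub>R (v /\<^sub>R a) = v" using a by simp
 then have "P' (v /\<^sub>R a) = 0" using v by (simp add: P'_def S'_def zero_prod_def)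
 from inj[OF FD this] show ?thesis using a by simp
qed

end


section \<open>Return to the real plane\<close>

definition cx :: "pt => complex" where "cx h = Complex (h $ 1) (h $ 2)"

lemma pm_cx: "pm P x = cx (x - P)" by (simp add: pm_def cx_def)
lemma em_rx: "em P z = P + em 0 z" by (simp add: em_def)
lemma cx_em [simp]: "cx (em 0 z) = z" using pm_em[of 0 z] by (simp add: pm_cx)
lemma em_cx [simp]: "em 0 (cx h) = h" using em_pm[of 0 h] by (simp add: pm_cx)
lemma norm_em [simp]: "norm (em 0 z) = cmod z" using dist_em[of 0 z 0] by simp

lemma cx_linear: "bounded_linear cx"
 unfolding linear_conv_bounded_linear[symmetric] by (rule linearI) (simp_all add: cx_def complex_eq_iff)

lemma em_linear: "bounded_linear (em 0)"
 unfolding linear_conv_bounded_linear[symmetric] by (rule linearI) (simp_all add: em_def algebra_simps)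

lemma em_inner: "em 0 c \<bullet> h = Re (cnj c * cx h)"
 by (simp add: inner_vec_def sum_2 em_nth cx_def)

lemma pm_derivative: "(pm P has_derivative cx) (at x)"
 unfolding pm_cx[abs_def]
 by (rule has_derivative_eq_rhs[OF has_derivative_compose[OF _ bounded_linear_imp_has_derivative[OF cx_linear]]])
 (auto intro!: derivative_eq_intros)

lemma em_derivative: "(em P has_derivative em 0) (at z)"
proof -
 have "((%z. P + em 0 z) has_derivative (%h. 0 + em 0 h)) (at z)"
 by (intro has_derivative_add has_derivative_const bounded_linear_imp_has_derivative em_linear)
 then show ?thesis by (simp flip: em_rx)
qed

lemma partial_em_derivative:
 assumes "((f \<circ> em P) has_derivative F) (at z)"
 shows "partial i f (em P z) = F (cdir i)"
proof -
 have "((%t. z + of_real t * cdir i) has_derivative (%t. 0 + of_real t * cdir i)) (at (0::real))"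
 by (intro has_derivative_add has_derivative_const has_derivative_mult_left has_derivative_of_real has_derivative_ident)
 then have "((%t. (f \<circ> em P) (z + of_real t * cdir i)) has_derivative (%t. F (of_real t * cdir i))) (at (0::real))"
 using assms has_derivative_compose[of "%t. z + of_real t * cdir i" _ 0 UNIV "f \<circ> em P" F] by simp
 moreover have "F (of_real t * cdir i) = F (cdir i) * t" for t
 using linear_cmul[OF bounded_linear.linear[OF has_derivative_bounded_linear[OF assms]], of t "cdir i"]
 by (simp add: scaleR_conv_of_real)
 ultimately have "((%t. (f \<circ> em P) (z + of_real t * cdir i)) has_real_derivative F (cdir i)) (at 0)"
 by (simp add: has_field_derivative_def)
 then show ?thesis unfolding partial_def partial_em_cdir by (rule DERIV_imp_deriv)
qed

lemma partial_Hreg: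
 assumes "open S" "regular_domain (em P -` S)" "y \<in> em P -` S" "z \<in> em P -` S"
 shows "partial j (%x. Hreg S x (em P y)) (em P z) = Re (dx (hreg (em P -` S)) z y * cdir j) / (2 * pi)"
proof (rule partial_em_derivative)
 interpret reg_domain "em P -` S" by unfold_locales (rule assms(2))
 have "((%x. hreg (em P -` S) x y / (2 * pi)) has_derivative (%h. Re (dx (hreg (em P -` S)) z y * h) / (2 * pi))) (at z)"
 unfolding dx_def by (rule bounded_linear.has_derivative[OF bounded_linear_divide harm_has_derivative[OF hreg_props(2)[OF assms(3)] assms(4)]])
 then show "((%x. Hreg S x (em P y)) \<circ> em P has_derivative (%h. Re (dx (hreg (em P -` S)) z y * h) / (2 * pi))) (at z)"
 proof (rule has_derivative_transform_within_open[OF _ D_open assms(4)])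
 fix x assume "x \<in> em P -` S"
 then have "x \<in> closure (em P -` S)" using D_sub_closure by blast
 from Hreg_eq_hreg[OF assms(1-3) this]
 show "hreg (em P -` S) x y / (2 * pi) = ((%x. Hreg S x (em P y)) \<circ> em P) x" by simp
 qed
qed

lemma Hessian_entries:
 assumes "open S" "regular_domain (em P -` S)" "P \<in> S"
 shows "Hxx S P i j = Re (cbD (hreg (em P -` S)) (0, 0) (cdir i, 0) * cdir j) / (2 * pi)"
 "Hyx S P i j = Re (cbD (hreg (em P -` S)) (0, 0) (0, cdir i) * cdir j) / (2 * pi)"
proof -
 let ?D = "em P -` S"
 interpret reg_domain ?D by unfold_locales (rule assms(2))
 have z: "0 \<in> ?D" "(0, 0) \<in> ?D \<times> ?D" using assms(3) by simp_all
 note d = dx_has_derivative[OF hreg_biharm z(2)]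
 have c: "((%z. Re (dx (hreg ?D) (u z) (w z) * cdir j) / (2 * pi)) has_derivative
 (%h. Re (cbD (hreg ?D) (0, 0) (u h, w h) * cdir j) / (2 * pi))) (at 0)"
 if "(u has_derivative u) (at 0)" "(w has_derivative w) (at 0)" "u 0 = 0" "w 0 = 0" for u w
 proof -
 have "((%z. dx (hreg ?D) (u z) (w z)) has_derivative (%h. cbD (hreg ?D) (0, 0) (u h, w h))) (at 0)"
 using has_derivative_compose[OF has_derivative_Pair[OF that(1,2)], of "%p. dx (hreg ?D) (fst p) (snd p)"] d that(3,4) by simp
 then show ?thesis
 by (intro bounded_linear.has_derivative[OF bounded_linear_divide] has_derivative_Re has_derivative_mult_left)
 qed
 have i: "((%z. z) has_derivative (%z. z)) (at (0::complex))" "((%z. 0::complex) has_derivative (%z. 0)) (at (0::complex))"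
 by (rule has_derivative_ident has_derivative_const)+
 have "partial i (partial j (%x. Hreg S x (em P 0))) (em P 0) = Re (cbD (hreg ?D) (0, 0) (cdir i, 0) * cdir j) / (2 * pi)"
 proof (rule partial_em_derivative)
 show "(partial j (%x. Hreg S x (em P 0)) \<circ> em P has_derivative (%h. Re (cbD (hreg ?D) (0, 0) (h, 0) * cdir j) / (2 * pi))) (at 0)"
 proof (rule has_derivative_transform_within_open[OF c[OF i refl refl] D_open z(1)])
 show "Re (dx (hreg ?D) x 0 * cdir j) / (2 * pi) = (partial j (%x. Hreg S x (em P 0)) \<circ> em P) x" if "x \<in> ?D" for x
 using partial_Hreg[OF assms(1,2) z(1) that, of j] by simp
 qed
 qed
 then show "Hxx S P i j = Re (cbD (hreg ?D) (0, 0) (cdir i, 0) * cdir j) / (2 * pi)" by (simp add: Hxx_def)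
 have "partial i (%y. partial j (%x. Hreg S x y) (em P 0)) (em P 0) = Re (cbD (hreg ?D) (0, 0) (0, cdir i) * cdir j) / (2 * pi)"
 proof (rule partial_em_derivative)
 show "((%y. partial j (%x. Hreg S x y) (em P 0)) \<circ> em P has_derivative (%h. Re (cbD (hreg ?D) (0, 0) (0, h) * cdir j) / (2 * pi))) (at 0)"
 proof (rule has_derivative_transform_within_open[OF c[OF i(2,1) refl refl] D_open z(1)])
 show "Re (dx (hreg ?D) 0 x * cdir j) / (2 * pi) = ((%y. partial j (%x. Hreg S x y) (em P 0)) \<circ> em P) x" if "x \<in> ?D" for x
 using partial_Hreg[OF assms(1,2) that z(1), of j] by simp
 qed
 qed
 then show "Hyx S P i j = Re (cbD (hreg ?D) (0, 0) (0, cdir i) * cdir j) / (2 * pi)" by (simp add: Hyx_def)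
qed

lemma Robin_eq:
 assumes "open S" "regular_domain (em P -` S)" "x \<in> em P -` S"
 shows "Robin S (em P x) = hreg (em P -` S) x x / (2 * pi)"
proof -
 have "x \<in> closure (em P -` S)" by (rule subsetD[OF closure_subset assms(3)])
 from Hreg_eq_hreg[OF assms(1-3) this] show ?thesis by (simp add: Robin_def)
qed

lemma Robin_critical:
 assumes "open S" "regular_domain (em P -` S)" "P \<in> S" "(Robin S has_derivative (%h. 0)) (at P)"
 shows "dx (hreg (em P -` S)) 0 0 = 0"
proof -
 let ?D = "em P -` S"
 interpret reg_domain ?D by unfold_locales (rule assms(2))
 have z: "0 \<in> ?D" using assms(3) by simp
 have "((%z. Robin S (em P z)) has_derivative (%h. 0)) (at 0)"
 using has_derivative_compose[OF em_derivative[of P 0], of "Robin S" "%h. 0"] assms(4) by simp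
 then have "((%z. hreg ?D z z / (2 * pi)) has_derivative (%h. 0)) (at 0)"
 by (rule has_derivative_transform_within_open[OF _ D_open z]) (rule Robin_eq[OF assms(1,2)])
 moreover have "((%z. hreg ?D z z / (2 * pi)) has_derivative (%h. 2 * Re (dx (hreg ?D) 0 0 * h) / (2 * pi))) (at 0)"
 by (rule bounded_linear.has_derivative[OF bounded_linear_divide hreg_diag_derivative[OF z]])
 ultimately have "(%h. 0) = (%h. 2 * Re (dx (hreg ?D) 0 0 * h) / (2 * pi))" by (rule has_derivative_unique)
 then have "Re (dx (hreg ?D) 0 0 * h) = 0" for h by (simp add: fun_eq_iff)
 from this[of 1] this[of \<i>] show ?thesis by (simp add: complex_eq_iff)
qed

lemma KR_eq:
 assumes "open S" "regular_domain (em P -` S)" "w \<in> S \<times> S"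
 shows "KR S l m w = KC (em P -` S) l m (pm P (fst w), pm P (snd w)) / (2 * pi)"
proof -
 define x where "x = pm P (fst w)"
 define y where "y = pm P (snd w)"
 have w: "fst w = em P x" "snd w = em P y" by (simp_all add: x_def y_def)
 have xy: "x \<in> em P -` S" "y \<in> em P -` S" using assms(3) w by (auto simp: mem_Times_iff)
 have "x \<in> closure (em P -` S)" by (rule subsetD[OF closure_subset xy(1)])
 note h = Hreg_eq_hreg[OF assms(1,2) xy(2) this]
 show ?thesis unfolding KR_def w Green_def fund_def dist_em h Robin_eq[OF assms(1,2) xy(1)] Robin_eq[OF assms(1,2) xy(2)] KC_def pm_em fst_conv snd_conv
 by (simp add: field_simps)
qed

text \<open>The gradient vector of \<open>KR\<close>. The conjugation converts complex gradients
  into vectors, and l/pi is the factor 2l of \<open>KC\<close> divided by 2 pi.\<close>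

definition KG :: "pt set => pt => real => real => pt \<times> pt => pt \<times> pt" where
 "KG S P l m w = ((l / pi) *\<^sub>R em 0 (cnj (KE (em P -` S) l m (pm P (fst w)) (pm P (snd w)))),
 (m / pi) *\<^sub>R em 0 (cnj (KE (em P -` S) m l (pm P (snd w)) (pm P (fst w)))))"

lemma pm2_derivative: "((%w. (pm P (fst w), pm P (snd w))) has_derivative (%h. (cx (fst h), cx (snd h)))) (at w)"
 by (intro has_derivative_Pair has_derivative_compose[OF _ pm_derivative]
 bounded_linear_imp_has_derivative bounded_linear_fst bounded_linear_snd)

lemma KR_derivative:
 assumes "open S" "regular_domain (em P -` S)" "w \<in> S \<times> S" "fst w ~= snd w"
 shows "(KR S l m has_derivative (%h. KG S P l m w \<bullet> h)) (at w)"
proof -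
 let ?D = "em P -` S"
 interpret reg_domain ?D by unfold_locales (rule assms(2))
 let ?p = "(pm P (fst w), pm P (snd w))"
 have p: "fst ?p \<in> ?D" "snd ?p \<in> ?D" using assms(3) by (auto simp: mem_Times_iff)
 have "pm P (fst w) ~= pm P (snd w)" using assms(4) em_pm by metis
 then have ne: "fst ?p ~= snd ?p" by simp
 have "((%w. KC ?D l m (pm P (fst w), pm P (snd w)) / (2 * pi)) has_derivative
 (%h. (2 * l * Re (KE ?D l m (fst ?p) (snd ?p) * fst (cx (fst h), cx (snd h)))
 + 2 * m * Re (KE ?D m l (snd ?p) (fst ?p) * snd (cx (fst h), cx (snd h)))) / (2 * pi))) (at w)"
 by (rule bounded_linear.has_derivative[OF bounded_linear_divide has_derivative_compose[OF pm2_derivative KC_derivative[OF p ne]]])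
 then have "((%w. KC ?D l m (pm P (fst w), pm P (snd w)) / (2 * pi)) has_derivative (%h. KG S P l m w \<bullet> h)) (at w)"
 by (rule has_derivative_eq_rhs) (simp add: fun_eq_iff KG_def inner_prod_def em_inner field_simps)
 then show ?thesis
 by (rule has_derivative_transform_within_open[OF _ open_Times[OF assms(1,1)] assms(3)])
 (rule KR_eq[OF assms(1,2), symmetric])
qed

lemma KR_crit_iff:
 assumes "open S" "regular_domain (em P -` S)" "0 < l" "0 < m"
 shows "KR_crit S l m w \<longleftrightarrow> fst w \<in> S & snd w \<in> S & fst w ~= snd w \<and>
 KE (em P -` S) l m (pm P (fst w)) (pm P (snd w)) = 0 & KE (em P -` S) m l (pm P (snd w)) (pm P (fst w)) = 0"
proof -
 have "(KR S l m has_derivative (%h. 0)) (at w) \<longleftrightarrow> KG S P l m w = 0" if "w \<in> S \<times> S" "fst w ~= snd w"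
 proof
 assume "(KR S l m has_derivative (%h. 0)) (at w)"
 from has_derivative_unique[OF this KR_derivative[OF assms(1,2) that]]
 have "KG S P l m w \<bullet> KG S P l m w = 0" by metis
 then show "KG S P l m w = 0" by simp
 next
 assume "KG S P l m w = 0"
 then show "(KR S l m has_derivative (%h. 0)) (at w)" using KR_derivative[OF assms(1,2) that, of l m] by simp
 qed
 moreover have "em 0 c = 0 \<longleftrightarrow> c = 0" for c using norm_em[of c] by (metis norm_eq_zero)
 then have "KG S P l m w = 0 \<longleftrightarrow> KE (em P -` S) l m (pm P (fst w)) (pm P (snd w)) = 0 & KE (em P -` S) m l (pm P (snd w)) (pm P (fst w)) = 0"
 using assms(3,4) by (simp add: KG_def zero_prod_def)
 ultimately show ?thesis unfolding KR_crit_def by (auto simp: mem_Times_iff)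
qed

text \<open>The Hessian is conjugate to \<open>F\<close> up to positive factors in the two
  components, and an injective linear endomorphism in finite dimension is bijective.\<close>

lemma KR_nondegenerate:
 assumes "open S" "regular_domain (em P -` S)" "0 < l" "0 < m" "KR_crit S l m w"
 and F: "((%p. (KE (em P -` S) l m (fst p) (snd p), KE (em P -` S) m l (snd p) (fst p))) has_derivative F)
 (at (pm P (fst w), pm P (snd w)))"
 and inj: "!!v. F v = 0 ==> v = 0"
 shows "nondeg_crit (KR S l m) w"
proof -
 have w: "w \<in> S \<times> S" "fst w ~= snd w" "(KR S l m has_derivative (%h. 0)) (at w)"
 using assms(5) by (auto simp: KR_crit_def mem_Times_iff)
 define U where "U = S \<times> S \<inter> {w. fst w ~= snd w}"
 have "open U" unfolding U_def
 by (intro open_Int open_Times assms(1) open_Collect_neq continuous_intros)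
 moreover have "w \<in> U" using w by (simp add: U_def)
 ultimately obtain e where e: "e > 0" "ball w e \<subseteq> U" by (meson open_contains_ball)
 have g: "(KR S l m has_derivative (%h. KG S P l m v \<bullet> h)) (at v)" if "v \<in> ball w e" for v
 proof -
 have "v \<in> S \<times> S" "fst v ~= snd v" using that e(2) by (auto simp: U_def)
 then show ?thesis by (rule KR_derivative[OF assms(1,2)])
 qed
 define Hs where "Hs v = ((l / pi) *\<^sub>R em 0 (cnj (fst (F (cx (fst v), cx (snd v))))),
 (m / pi) *\<^sub>R em 0 (cnj (snd (F (cx (fst v), cx (snd v))))))" for v
 have ec: "bounded_linear (%z. em 0 (cnj z))" by (rule bounded_linear_compose[OF em_linear bounded_linear_cnj])
 note c = has_derivative_compose[OF pm2_derivative F]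
 have d: "(KG S P l m has_derivative Hs) (at w)"
 unfolding KG_def[abs_def] Hs_def[abs_def]
 by (intro has_derivative_Pair has_derivative_scaleR_right bounded_linear.has_derivative[OF ec])
 (use has_derivative_fst[OF c] has_derivative_snd[OF c] in simp_all)
 have lin: "linear Hs" by (rule bounded_linear.linear[OF has_derivative_bounded_linear[OF d]])
 have "v = 0" if "Hs v = 0" for v
 proof -
 have "em 0 c = 0 \<longleftrightarrow> c = 0" for c using norm_em[of c] by (metis norm_eq_zero)
 then have "F (cx (fst v), cx (snd v)) = 0" using that assms(3,4) by (simp add: Hs_def zero_prod_def prod_eq_iff)
 then have "(cx (fst v), cx (snd v)) = 0" by (rule inj)
 then have "em 0 (cx (fst v)) = em 0 0" "em 0 (cx (snd v)) = em 0 0" by (simp_all add: zero_prod_def)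
 then have "fst v = 0" "snd v = 0" by simp_all
 then show ?thesis by (simp add: prod_eq_iff)
 qed
 then have "inj Hs" using linear_injective_0[OF lin] by blast
 then have "bij Hs" using linear_injective_imp_surjective[OF lin] by (simp add: bij_def)
 then show ?thesis unfolding nondeg_crit_def using w(3) e(1) g d
 by (intro conjI exI[of _ "KG S P l m"] exI[of _ Hs] exI[of _ e]) auto
qed

text \<open>The deviation O(e^b) of the rescaled point is multiplied by the scale e^b in the
  modulus; the direction does not see the scale and converges because the limit is nonzero.\<close>

lemma scaled_asymptotics:
 assumes "\<forall>\<^sub>F e in at_right 0. cmod (u e - z) <= B * e powr b" "0 < b" "z ~= 0"
 shows "(%e. norm (em P (e powr b *\<^sub>R u e) - P) - cmod z * e powr b) \<in> O[at_right 0](%e. e powr (2 * b))"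
 "((%e. (em P (e powr b *\<^sub>R u e) - P) /\<^sub>R norm (em P (e powr b *\<^sub>R u e) - P) - em 0 (z /\<^sub>R cmod z)) \<longlongrightarrow> 0) (at_right 0)"
proof -
 have n: "em P z - P = em 0 z" for z by (simp add: em_rx[of P])
 have pos: "\<forall>\<^sub>F e in at_right (0::real). 0 < e" by (rule eventually_at_right_less)
 show "(%e. norm (em P (e powr b *\<^sub>R u e) - P) - cmod z * e powr b) \<in> O[at_right 0](%e. e powr (2 * b))"
 proof (rule bigoI[of _ B])
 show "\<forall>\<^sub>F e in at_right 0. norm (norm (em P (e powr b *\<^sub>R u e) - P) - cmod z * e powr b) <= B * norm (e powr (2 * b))"
 using assms(1) pos
 proof eventually_elim
 case (elim e)
 have "norm (em P (e powr b *\<^sub>R u e) - P) - cmod z * e powr b = e powr b * (cmod (u e) - cmod z)"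
 by (simp add: n algebra_simps)
 then have "norm (norm (em P (e powr b *\<^sub>R u e) - P) - cmod z * e powr b) = e powr b * \<bar>cmod (u e) - cmod z\<bar>"
 by (simp add: abs_mult)
 also have "... <= e powr b * (B * e powr b)"
 using order_trans[OF norm_triangle_ineq3 elim(1)] by (intro mult_left_mono) auto
 also have "... = B * (e powr b * e powr b)" by simp
 also have "e powr b * e powr b = e powr (2 * b)" by (simp flip: powr_add)
 finally show ?case by simp
 qed
 qed
 have "((%e. e powr b) \<longlongrightarrow> 0) (at_right 0)" using assms(2) by real_asymp
 then have "((%e. B * e powr b) \<longlongrightarrow> 0) (at_right 0)" by (rule tendsto_mult_right_zero)
 then have "((%e. u e - z) \<longlongrightarrow> 0) (at_right 0)" by (rule Lim_null_comparison[OF assms(1)])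
 then have ul: "(u \<longlongrightarrow> z) (at_right 0)" by (rule Lim_null[THEN iffD2])
 have "((%e. em 0 (u e /\<^sub>R cmod (u e)) - em 0 (z /\<^sub>R cmod z)) \<longlongrightarrow> em 0 (z /\<^sub>R cmod z) - em 0 (z /\<^sub>R cmod z)) (at_right 0)"
 by (intro tendsto_diff tendsto_const bounded_linear.tendsto[OF em_linear] tendsto_scaleR tendsto_inverse tendsto_norm ul)
 (use assms(3) in simp)
 then have "((%e. em 0 (u e /\<^sub>R cmod (u e)) - em 0 (z /\<^sub>R cmod z)) \<longlongrightarrow> 0) (at_right 0)" by simp
 then show "((%e. (em P (e powr b *\<^sub>R u e) - P) /\<^sub>R norm (em P (e powr b *\<^sub>R u e) - P) - em 0 (z /\<^sub>R cmod z)) \<longlongrightarrow> 0) (at_right 0)"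
 proof (rule Lim_transform_eventually)
 show "\<forall>\<^sub>F e in at_right 0. em 0 (u e /\<^sub>R cmod (u e)) - em 0 (z /\<^sub>R cmod z)
 = (em P (e powr b *\<^sub>R u e) - P) /\<^sub>R norm (em P (e powr b *\<^sub>R u e) - P) - em 0 (z /\<^sub>R cmod z)"
 using pos
 proof eventually_elim
 case (elim e)
 have "em 0 (a *\<^sub>R x) = a *\<^sub>R em 0 x" for a x by (rule linear_cmul[OF bounded_linear.linear[OF em_linear]])
 then show ?case using elim unfolding n norm_em by simp
 qed
 qed
qed

text \<open>The orbits of the swap partition \<open>A\<close>, and each has two elements since
  \<open>A\<close> avoids the diagonal.\<close>

lemma card_unordered_pairs:
 assumes "finite A" "!!x y. (x, y) \<in> A ==> (y, x) \<in> A" "!!x. (x, x) \<notin> A"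
 shows "2 * card ((%(x, y). {(x, y), (y, x)}) ` A) = card A"
proof -
 let ?C = "(%(x, y). {(x, y), (y, x)}) ` A"
 have im: "?C = (%q. {q, (snd q, fst q)}) ` A" by (rule image_cong) auto
 have U: "\<Union> ?C = A" using assms(2) by auto
 have "2 * card ?C = card (\<Union> ?C)"
 proof (rule card_partition)
 show "finite ?C" by (rule finite_imageI[OF assms(1)])
 show "finite (\<Union> ?C)" unfolding U by (rule assms(1))
 show "card c = 2" if c: "c \<in> ?C" for c
 proof -
 obtain q where q: "q \<in> A" "c = {q, (snd q, fst q)}" using c unfolding im by blast
 have "fst q ~= snd q" using q(1) assms(3)[of "fst q"] by (cases q) auto
 then have "q ~= (snd q, fst q)" by (cases q) auto
 then show ?thesis unfolding q(2) by simp
 qed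
 show "c1 \<inter> c2 = {}" if c: "c1 \<in> ?C" "c2 \<in> ?C" "c1 ~= c2" for c1 c2
 proof -
 obtain q where 1: "c1 = {q, (snd q, fst q)}" using c(1) unfolding im by blast
 obtain r where 2: "c2 = {r, (snd r, fst r)}" using c(2) unfolding im by blast
 show ?thesis using c(3) unfolding 1 2 by (cases q; cases r) auto
 qed
 qed
 then show ?thesis unfolding U .
qed


text \<open>The rows of \<open>Mx\<close> are indexed by the outer derivative. Symmetry of the pure
  and the mixed block allows reading columns instead, so that testing N (cx v) against 1 and i
  recovers Mx v; pairing by Re (a b) rather than by the inner product puts the conjugate on the
  right.\<close>

lemma (in reg_domain) hessian_eigenvector:
 fixes Mx :: "real^2^2" and A B :: real
 defines "N \<equiv> %h. of_real A * cbD (hreg D) (0, 0) (h, 0) + of_real B * cbD (hreg D) (0, 0) (0, h)"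
 assumes "0 \<in> D" "!!i j. Mx $ i $ j = Re (N (cdir i) * cdir j) / (2 * pi)" "Mx *v v = c *\<^sub>R v"
 shows "N (cx v) = of_real (2 * pi * c) * cnj (cx v)"
 "Re (N h * k) = Re (N k * h)"
proof -
 show sym: "Re (N h * k) = Re (N k * h)" for h k
 proof -
 have "Re (N h * k) = A * Re (cbD (hreg D) (0, 0) (h, 0) * k) + B * Re (cbD (hreg D) (0, 0) (0, h) * k)" for h k
 by (simp add: N_def algebra_simps)
 then show ?thesis using pure_symmetric[OF assms(2), of h k] mixed_symmetric[OF assms(2), of h k] by (simp only:)
 qed
 have row: "Re (N (cx v) * cdir i) = 2 * pi * c * v $ i" for i
 proof -
 have "Re (N (cx v) * cdir i) = Re (N (cdir i) * cx v)" by (rule sym)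
 also have "... = Re (N (cdir i) * cdir 1) * v $ 1 + Re (N (cdir i) * cdir 2) * v $ 2"
 by (simp add: cx_def cdir_def algebra_simps)
 also have "... = 2 * pi * (Mx *v v) $ i" by (simp add: matrix_vector_mult_def sum_2 assms(3) field_simps)
 also have "... = 2 * pi * c * v $ i" by (simp add: assms(4))
 finally show ?thesis .
 qed
 show "N (cx v) = of_real (2 * pi * c) * cnj (cx v)"
 using row[of 1] row[of 2] by (simp add: complex_eq_iff cx_def cdir_def)
qed

lemma orthogonal_unit_complex:
 assumes "cmod a = 1" "cmod b = 1" "Re (cnj a * b) = 0"
 shows "b = \<i> * a \<or> b = - (\<i> * a)"
proof -
 define t where "t = Im (cnj a * b)"
 have t: "cnj a * b = \<i> * of_real t" using assms(3) by (simp add: t_def complex_eq_iff)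
 have "a * cnj a = 1" using assms(1) by (simp add: complex_norm_square[symmetric])
 then have "b = a * (cnj a * b)" by (simp flip: mult.assoc)
 then have b: "b = \<i> * a * of_real t" unfolding t by simp
 then have "\<bar>t\<bar> = 1" using arg_cong[OF b, of cmod] assms(1,2) by (simp add: norm_mult)
 then have "t = 1 \<or> t = - 1" by linarith
 then show ?thesis using b by auto
qed

context kr1
begin

lemma is_crit_iff:
 assumes "x ~= 0" "y ~= 0"
 shows "is_crit e x y \<longleftrightarrow> x ~= y & KE (D - cball 0 e) l1 l2 x y = 0 & KE (D - cball 0 e) l2 l1 y x = 0"
 using assms by (simp add: is_crit_def ee_def KE_def)

theorem crit_summary:
 "\<exists>sol B. (\<forall>\<^sub>F e in at_right 0. \<forall>m s. norm (sol m s e - zz m s) <= B * sc e) \<and>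
 (\<forall>\<delta>. 0 < \<delta> & \<delta> < \<delta>0 --> (\<forall>\<^sub>F e in at_right 0. good e & inj (%(m, s). sol m s e) \<and>
 {(x, y). e < cmod x & cmod x < \<delta> & e < cmod y & cmod y < \<delta> & is_crit e x y}
 = {(sc e *\<^sub>R fst (sol m s e), sc e *\<^sub>R snd (sol m s e)) | m s. True} \<and>
 (\<forall>m s F v. ((%p. (KE (D - cball 0 e) l1 l2 (fst p) (snd p), KE (D - cball 0 e) l2 l1 (snd p) (fst p)))
 has_derivative F) (at (sc e *\<^sub>R sol m s e)) --> F v = 0 --> v = 0)))"
proof -
 obtain sol B where S: "\<forall>\<^sub>F e in at_right 0. {z \<in> KB. Fz z + Dl \<theta> e z = 0} = {sol m s e | m s. True} \<and>
 inj (%(m, s). sol m s e) & (\<forall>m s. norm (sol m s e - zz m s) <= B * sc e \<and>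
 (\<forall>D v. ((%z. Fz z + Dl \<theta> e z) has_derivative D) (at (sol m s e)) --> D v = 0 --> v = 0))"
 using rescaled_zeros by (elim exE)
 have S1: "\<forall>\<^sub>F e in at_right 0. {z \<in> KB. Fz z + Dl \<theta> e z = 0} = {sol m s e | m s. True}"
 using S by (rule eventually_mono) simp
 have "\<forall>\<^sub>F e in at_right 0. \<forall>m s. norm (sol m s e - zz m s) <= B * sc e" using S by (rule eventually_mono) simp
 moreover have "\<forall>\<^sub>F e in at_right 0. good e & inj (%(m, s). sol m s e) \<and>
 {(x, y). e < cmod x & cmod x < \<delta> & e < cmod y & cmod y < \<delta> & is_crit e x y}
 = {(sc e *\<^sub>R fst (sol m s e), sc e *\<^sub>R snd (sol m s e)) | m s. True} \<and>
 (\<forall>m s F v. ((%p. (KE (D - cball 0 e) l1 l2 (fst p) (snd p), KE (D - cball 0 e) l2 l1 (snd p) (fst p)))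
 has_derivative F) (at (sc e *\<^sub>R sol m s e)) --> F v = 0 --> v = 0)" if d: "0 < \<delta>" "\<delta> < \<delta>0" for \<delta>
 using crit_set[OF d(1) less_imp_le[OF d(2)] S1] S eventually_small
 proof eventually_elim
 case (elim e)
 have g: "good e" "0 < sc e" "0 < e" using elim(3) by (auto simp: good_def)
 have H: "v = 0" if F: "((%p. (KE (D - cball 0 e) l1 l2 (fst p) (snd p), KE (D - cball 0 e) l2 l1 (snd p) (fst p)))
 has_derivative F) (at (sc e *\<^sub>R sol m s e))" "F v = 0" for m s F v
 proof (rule hessian_injective[OF g(1) _ _ _ _ _ _ F])
 let ?x = "sc e *\<^sub>R fst (sol m s e)" and ?y = "sc e *\<^sub>R snd (sol m s e)"
 have "(?x, ?y) \<in> {(sc e *\<^sub>R fst (sol m s e), sc e *\<^sub>R snd (sol m s e)) | m s. True}" by blast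
 then have c: "e < cmod ?x" "cmod ?x < \<delta>" "e < cmod ?y" "cmod ?y < \<delta>" "is_crit e ?x ?y"
 unfolding elim(1)[symmetric] by simp_all
 show "?x \<in> D - cball 0 e" "?y \<in> D - cball 0 e"
 using in_E[OF g(1) c(1)] in_E[OF g(1) c(3)] c(2,4) d(2) delta0(2) r1(1) by auto
 have nz: "?x ~= 0" "?y ~= 0" using c(1,3) g(3) by auto
 show "KE (D - cball 0 e) l1 l2 ?x ?y = 0" "KE (D - cball 0 e) l2 l1 ?y ?x = 0"
 using c(5) unfolding is_crit_iff[OF nz] by simp_all
 show "fst (sol m s e) ~= snd (sol m s e)" using c(5) unfolding is_crit_iff[OF nz] by auto
 show "v = 0" if "((%z. Fz z + Dl \<theta> e z) has_derivative D) (at (sol m s e))" "D v = 0" for D v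
 using elim(2) that by blast
 qed
 have "inj (%(m, s). sol m s e)" using elim(2) by simp
 then show ?case using elim(1) g(1) H by simp
 qed
 ultimately show ?thesis by (intro exI[of _ sol] exI[of _ B] conjI allI impI) simp_all
qed

end

section \<open>Assembly in the original coordinates\<close>

theorem theorem1p19:
  fixes \<Omega> :: "pt set" and P :: pt and L1 L2 :: real
    and \<mu> :: "2 \<Rightarrow> real" and \<nu> :: "2 \<Rightarrow> pt"
  defines "\<tau> \<equiv> L1 / L2"
  defines "\<beta> \<equiv> \<tau> / (1 + \<tau>)\<^sup>2"
  defines "C\<tau> \<equiv> \<tau> powr (1 / (1 + \<tau>)) *
                  exp (- (2 * pi * Robin \<Omega> P * (\<tau>\<^sup>2 + \<tau> + 1)) / (1 + \<tau>)\<^sup>2)"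
  defines "M \<equiv> (\<chi> i j. (\<tau>^4 + \<tau>\<^sup>2 + 1) * Hxx \<Omega> P i j + (\<tau>\<^sup>2 - 1)\<^sup>2 * Hyx \<Omega> P i j) :: real^2^2"
  assumes dom: "smooth_bounded_domain \<Omega>"
    and PinO: "P \<in> \<Omega>"
    and L1pos: "L1 > 0" and L2pos: "L2 > 0"
    and gradR: "(Robin \<Omega> has_derivative (\<lambda>h. 0)) (at P)"
    and mu_ne: "\<mu> 1 \<noteq> \<mu> 2"
    and nu_unit: "\<And>m. norm (\<nu> m) = 1"
    and eig: "\<And>m. M *v \<nu> m = \<mu> m *\<^sub>R \<nu> m"
  shows "\<exists>\<delta>0>0. \<forall>\<delta>. 0 < \<delta> \<and> \<delta> < \<delta>0 \<longrightarrow>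
     (\<exists>\<epsilon>0>0. \<exists>(xf :: 2 \<Rightarrow> bool \<Rightarrow> real \<Rightarrow> pt) (yf :: 2 \<Rightarrow> bool \<Rightarrow> real \<Rightarrow> pt).
        (\<forall>\<epsilon>. 0 < \<epsilon> \<and> \<epsilon> < \<epsilon>0 \<longrightarrow>
           (let D = \<Omega> - cball P \<epsilon>;
                CS = {z. KR_crit D L1 L2 z \<and> fst z \<in> ball P \<delta> \<and> snd z \<in> ball P \<delta>}
            in CS = {(xf m s \<epsilon>, yf m s \<epsilon>) | m s. True}
               \<and> card CS = 4
               \<and> (\<forall>z\<in>CS. nondeg_crit (KR D L1 L2) z)
               \<and> (L1 = L2 \<longrightarrow> card ((\<lambda>(x, y). {(x, y), (y, x)}) ` CS) = 2)))
      \<and> (\<forall>m s.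
           (\<lambda>\<epsilon>. norm (xf m s \<epsilon> - P) - C\<tau> * \<epsilon> powr \<beta>) \<in> O[at_right 0](\<lambda>\<epsilon>. \<epsilon> powr (2 * \<beta>))
         \<and> ((\<lambda>\<epsilon>. (xf m s \<epsilon> - P) /\<^sub>R norm (xf m s \<epsilon> - P) - sgnb s *\<^sub>R \<nu> m) \<longlongrightarrow> 0) (at_right 0)
         \<and> (\<lambda>\<epsilon>. norm (yf m s \<epsilon> - P) - (C\<tau> / \<tau>) * \<epsilon> powr \<beta>) \<in> O[at_right 0](\<lambda>\<epsilon>. \<epsilon> powr (2 * \<beta>))
         \<and> ((\<lambda>\<epsilon>. (yf m s \<epsilon> - P) /\<^sub>R norm (yf m s \<epsilon> - P) + sgnb s *\<^sub>R \<nu> m) \<longlongrightarrow> 0) (at_right 0)))"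
proof -
 define D where "D = em P -` \<Omega>"
 have Oo: "open \<Omega>" using dom by (simp add: smooth_bounded_domain_def)
 have reg: "regular_domain (em P -` \<Omega>)" by (rule smooth_imp_regular[OF dom])
 have D0: "0 \<in> D" using PinO by (simp add: D_def)
 interpret RD: reg_domain D by unfold_locales (simp add: D_def reg)
 obtain r1 C1 M0 where hole: "hole D r1 C1 M0" using RD.hole_exists[OF D0] by blast
 have dx0: "dx (hreg D) 0 0 = 0" unfolding D_def by (rule Robin_critical[OF Oo reg PinO gradR])
 have kr0: "kr0 D r1 C1 M0 L1 L2"
 using hole L1pos L2pos dx0 by (simp add: kr0_def kr_def kr_axioms_def kr0_axioms_def)
 interpret Z: kr0 D r1 C1 M0 L1 L2 by (rule kr0)
 have s0: "L1 + L2 ~= 0" "L1 ~= 0" "L2 ~= 0" using L1pos L2pos by auto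
 have tp0: "0 < \<tau>" unfolding \<tau>_def by (rule divide_pos_pos[OF L1pos L2pos])
 then have "1 + \<tau> ~= 0" by linarith
 note tp = tp0 this
 have t1: "1 + \<tau> = (L1 + L2) / L2" using s0 by (simp add: \<tau>_def field_simps)
 define a where "a = \<tau>^4 + \<tau>\<^sup>2 + 1"
 define b where "b = (\<tau>\<^sup>2 - 1)\<^sup>2"
 \<comment> \<open>The common factor between the coefficients of \<open>mm\<close> and those of the
   matrix \<open>M\<close>; being nonzero, it keeps the eigenvectors and the distinctness of the
   eigenvalues.\<close>
 define c where "c = L2^4 / L1\<^sup>2"
 define N where "N h = of_real a * cbD (hreg D) (0, 0) (h, 0) + of_real b * cbD (hreg D) (0, 0) (0, h)" for h
 have Me: "M $ i $ j = Re (N (cdir i) * cdir j) / (2 * pi)" for i j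
 proof -
 have "M $ i $ j = a * Hxx \<Omega> P i j + b * Hyx \<Omega> P i j" by (simp add: M_def a_def b_def)
 also have "... = (a * Re (cbD (hreg D) (0, 0) (cdir i, 0) * cdir j) + b * Re (cbD (hreg D) (0, 0) (0, cdir i) * cdir j)) / (2 * pi)"
 unfolding Hessian_entries[OF Oo reg PinO] D_def[symmetric] by (simp only: add_divide_distrib times_divide_eq_right)
 also have "a * Re (cbD (hreg D) (0, 0) (cdir i, 0) * cdir j) + b * Re (cbD (hreg D) (0, 0) (0, cdir i) * cdir j)
 = Re (N (cdir i) * cdir j)" by (simp add: N_def algebra_simps)
 finally show ?thesis .
 qed
 note HE = RD.hessian_eigenvector[of M a b, folded N_def, OF D0 Me]
 define nu where "nu m = cx (\<nu> m)" for m
 define mu where "mu m = c * (2 * pi * \<mu> m)" for m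
 have N_nu: "N (nu m) = of_real (2 * pi * \<mu> m) * cnj (nu m)" for m unfolding nu_def by (rule HE(1)[OF eig])
 have nn: "cmod (nu m) = 1" for m using norm_em[of "cx (\<nu> m)"] nu_unit[of m] by (simp add: nu_def)
 \<comment> \<open>Symmetry of the bilinear form evaluates the pairing of the two eigenvectors with
   either eigenvalue; as these differ, the eigenvectors are orthogonal.\<close>
 have "(2 * pi * \<mu> 1) * Re (cnj (nu 1) * nu 2) = (2 * pi * \<mu> 2) * Re (cnj (nu 1) * nu 2)"
 proof -
 have "Re (N (nu 1) * nu 2) = Re (N (nu 2) * nu 1)" by (rule HE(2)[OF eig[of 1]])
 moreover have r: "Re (of_real p * cnj x * y) = p * Re (cnj x * y)" for p x y by (simp add: algebra_simps)
 moreover have "Re (cnj (nu 2) * nu 1) = Re (cnj (nu 1) * nu 2)" by (simp add: mult.commute)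
 ultimately show ?thesis unfolding N_nu r by (simp only:)
 qed
 then have "Re (cnj (nu 1) * nu 2) = 0" using mu_ne by (simp only: mult_cancel_right) simp
 note nu2 = orthogonal_unit_complex[OF nn nn this]
 have coef: "(L1 + L2 - Z.q0) * (L1 + L2 * Z.tr\<^sup>2) = c * a" "(L1 - L2 * Z.tr)\<^sup>2 = c * b"
 using s0 by (simp_all add: Z.q0_def Z.tr_def a_def b_def c_def \<tau>_def divide_simps) (simp_all add: algebra_simps power2_eq_square eval_nat_numeral)
 have llc: "Z.ll v = cbD (hreg D) (0, 0) v" for v by (simp add: Z.ll_def cbD_def)
 have mmN: "Z.mm h = of_real c * N h" for h
 unfolding Z.mm_def coef llc N_def by (simp add: algebra_simps)
 have mm_nu: "Z.mm (nu m) = of_real (mu m) * cnj (nu m)" for m unfolding mmN N_nu mu_def by simp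
 have "c ~= 0" using s0 by (simp add: c_def)
 then have mne: "mu 1 ~= mu 2" using mu_ne by (simp add: mu_def)
 interpret K: kr1 D r1 C1 M0 L1 L2 nu mu
 by unfold_locales (use nn nu2 mm_nu mne in auto)
 have beta: "Z.\<beta> = \<beta>" using s0 unfolding \<beta>_def t1 unfolding Z.\<beta>_def Z.q0_def \<tau>_def by (simp add: power2_eq_square field_simps)
 \<comment> \<open>\<open>R0\<close> is 2 pi times the Robin function at P, and its coefficient
   \<beta> - 1 in \<open>lnC\<close> equals -(\<tau>^2 + \<tau> + 1)/(1 + \<tau>)^2; the factor
   \<tau>^(1/(1 + \<tau>)) comes from the term l2 ln (l1/l2).\<close>
 have CC: "Z.CC = C\<tau>"
 proof -
 have R0: "Z.R0 = 2 * pi * Robin \<Omega> P"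
 proof -
 have "Z.R0 = hreg D 0 0" by (rule Z.R0_def)
 also have "... = 2 * pi * Robin \<Omega> P" using Robin_eq[OF Oo reg, of 0] PinO by (simp add: D_def)
 finally show ?thesis .
 qed
 have e1: "L2 / (L1 + L2) = 1 / (1 + \<tau>)" unfolding t1 by simp
 have e2: "Z.q0 / (L1 + L2) - 1 = - (\<tau>\<^sup>2 + \<tau> + 1) / (1 + \<tau>)\<^sup>2"
 proof -
 have "Z.q0 / (L1 + L2) = \<tau> / (1 + \<tau>)\<^sup>2" using beta unfolding Z.\<beta>_def \<beta>_def .
 moreover have "\<tau> / (1 + \<tau>)\<^sup>2 - 1 = (\<tau> - (1 + \<tau>)\<^sup>2) / (1 + \<tau>)\<^sup>2" using tp(2) by (simp add: diff_divide_distrib)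
 moreover have "\<tau> - (1 + \<tau>)\<^sup>2 = - (\<tau>\<^sup>2 + \<tau> + 1)" by (simp add: power2_eq_square algebra_simps)
 ultimately show ?thesis by simp
 qed
 have "Z.lnC = (Z.q0 / (L1 + L2) - 1) * Z.R0 + L2 / (L1 + L2) * ln \<tau>"
 using s0(1) by (simp add: Z.lnC_def \<tau>_def add_divide_distrib diff_divide_distrib left_diff_distrib)
 also have "... = 1 / (1 + \<tau>) * ln \<tau> + (- (2 * pi * Robin \<Omega> P * (\<tau>\<^sup>2 + \<tau> + 1)) / (1 + \<tau>)\<^sup>2)"
 proof -
 have "- q / d * (2 * pi * R) = - (2 * pi * R * q) / d" for q d R :: real by simp
 then show ?thesis unfolding e1 e2 R0 by (simp only: add.commute)
 qed
 finally have "exp Z.lnC = exp (1 / (1 + \<tau>) * ln \<tau>) * exp (- (2 * pi * Robin \<Omega> P * (\<tau>\<^sup>2 + \<tau> + 1)) / (1 + \<tau>)\<^sup>2)"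
 by (simp only: exp_add)
 then show ?thesis using tp(1) by (simp add: Z.CC_def C\<tau>_def powr_def)
 qed
 have trt: "Z.tr = 1 / \<tau>" by (simp add: Z.tr_def \<tau>_def)
 obtain sol B where sol: "\<forall>\<^sub>F e in at_right 0. \<forall>m s. norm (sol m s e - K.zz m s) <= B * Z.sc e"
 and crit: "\<forall>\<delta>. 0 < \<delta> & \<delta> < Z.\<delta>0 --> (\<forall>\<^sub>F e in at_right 0. Z.good e & inj (%(m, s). sol m s e) \<and>
 {(x, y). e < cmod x & cmod x < \<delta> & e < cmod y & cmod y < \<delta> & Z.is_crit e x y}
 = {(Z.sc e *\<^sub>R fst (sol m s e), Z.sc e *\<^sub>R snd (sol m s e)) | m s. True} \<and>
 (\<forall>m s F v. ((%p. (KE (D - cball 0 e) L1 L2 (fst p) (snd p), KE (D - cball 0 e) L2 L1 (snd p) (fst p)))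
 has_derivative F) (at (Z.sc e *\<^sub>R sol m s e)) --> F v = 0 --> v = 0))"
 using K.crit_summary by (elim exE conjE)
 define xf where "xf m s e = em P (Z.sc e *\<^sub>R fst (sol m s e))" for m s e
 define yf where "yf m s e = em P (Z.sc e *\<^sub>R snd (sol m s e))" for m s e
 have em_scale: "em 0 (r *\<^sub>R x) = r *\<^sub>R em 0 x" for r x by (rule linear_cmul[OF bounded_linear.linear[OF em_linear]])
 have asym: "(%\<epsilon>. norm (xf m s \<epsilon> - P) - C\<tau> * \<epsilon> powr \<beta>) \<in> O[at_right 0](%\<epsilon>. \<epsilon> powr (2 * \<beta>))
 & ((%\<epsilon>. (xf m s \<epsilon> - P) /\<^sub>R norm (xf m s \<epsilon> - P) - sgnb s *\<^sub>R \<nu> m) \<longlongrightarrow> 0) (at_right 0)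
 & (%\<epsilon>. norm (yf m s \<epsilon> - P) - (C\<tau> / \<tau>) * \<epsilon> powr \<beta>) \<in> O[at_right 0](%\<epsilon>. \<epsilon> powr (2 * \<beta>))
 & ((%\<epsilon>. (yf m s \<epsilon> - P) /\<^sub>R norm (yf m s \<epsilon> - P) + sgnb s *\<^sub>R \<nu> m) \<longlongrightarrow> 0) (at_right 0)" for m s
 proof -
 have Cp: "0 < C\<tau>" using Z.CC_pos CC by simp
 have scd: "Z.sc e = e powr \<beta>" for e by (simp add: Z.sc_def beta)
 have bp: "0 < \<beta>" using Z.beta_pos beta by simp
 have n: "cmod (fst (K.zz m s)) = C\<tau>" "cmod (snd (K.zz m s)) = C\<tau> / \<tau>"
 using K.zz_norm[of m s] by (simp_all add: CC trt)
 have z1: "fst (K.zz m s) = C\<tau> *\<^sub>R sgnb s *\<^sub>R nu m" "snd (K.zz m s) = - ((C\<tau> / \<tau>) *\<^sub>R sgnb s *\<^sub>R nu m)"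
 by (simp_all add: K.zz_def CC trt scaleR_conv_of_real)
 have nz: "fst (K.zz m s) ~= 0" "snd (K.zz m s) ~= 0"
 proof -
 have "C\<tau> ~= 0" "C\<tau> / \<tau> ~= 0" using Cp tp(1) by simp_all
 then show "fst (K.zz m s) ~= 0" "snd (K.zz m s) ~= 0" using n by (metis norm_zero)+
 qed
 have gen: "x ~= 0 ==> (x *\<^sub>R w) /\<^sub>R x = w" "x ~= 0 ==> (- (x *\<^sub>R w)) /\<^sub>R x = - w" for x :: real and w :: complex
 by simp_all
 have le: "cmod (fst v) <= norm v" "cmod (snd v) <= norm v" for v :: "complex \<times> complex"
 using norm_fst_le[of "fst v" "snd v"] norm_snd_le[of "snd v" "fst v"] by (simp_all only: prod.collapse)
 have dirs: "em 0 (fst (K.zz m s) /\<^sub>R cmod (fst (K.zz m s))) = sgnb s *\<^sub>R \<nu> m"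
 "em 0 (snd (K.zz m s) /\<^sub>R cmod (snd (K.zz m s))) = - (sgnb s *\<^sub>R \<nu> m)"
 proof -
 have "fst (K.zz m s) /\<^sub>R cmod (fst (K.zz m s)) = sgnb s *\<^sub>R nu m"
 unfolding n(1) unfolding z1(1) by (rule gen(1)) (use Cp in simp)
 then show "em 0 (fst (K.zz m s) /\<^sub>R cmod (fst (K.zz m s))) = sgnb s *\<^sub>R \<nu> m" by (simp add: em_scale nu_def)
 have "snd (K.zz m s) /\<^sub>R cmod (snd (K.zz m s)) = (- sgnb s) *\<^sub>R nu m"
 unfolding n(2) unfolding z1(2) scaleR_minus_left by (rule gen(2)) (use Cp tp(1) in simp)
 then have "em 0 (snd (K.zz m s) /\<^sub>R cmod (snd (K.zz m s))) = (- sgnb s) *\<^sub>R em 0 (nu m)" by (simp only: em_scale)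
 then show "em 0 (snd (K.zz m s) /\<^sub>R cmod (snd (K.zz m s))) = - (sgnb s *\<^sub>R \<nu> m)" by (simp add: nu_def)
 qed
 have f: "\<forall>\<^sub>F e in at_right 0. cmod (fst (sol m s e) - fst (K.zz m s)) <= B * e powr \<beta>"
 using sol
 proof eventually_elim
 case (elim e)
 then have h: "norm (sol m s e - K.zz m s) <= B * Z.sc e" by blast
 show ?case using order_trans[OF le(1) h] by (simp only: fst_diff scd)
 qed
 have g: "\<forall>\<^sub>F e in at_right 0. cmod (snd (sol m s e) - snd (K.zz m s)) <= B * e powr \<beta>"
 using sol
 proof eventually_elim
 case (elim e)
 then have h: "norm (sol m s e - K.zz m s) <= B * Z.sc e" by blast
 show ?case using order_trans[OF le(2) h] by (simp only: snd_diff scd)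
 qed
 show ?thesis
 unfolding xf_def yf_def scd
 using scaled_asymptotics[where P = P, OF f bp nz(1), unfolded dirs, unfolded n]
 scaled_asymptotics[where P = P, OF g bp nz(2), unfolded dirs, unfolded n diff_minus_eq_add]
 by (intro conjI)
 qed
 \<comment> \<open>Collects everything required at a single radius, so that the threshold for the
   radius can be chosen after \<delta> while \<open>xf\<close> and \<open>yf\<close> do not depend
   on \<delta>.\<close>
 define Q where "Q \<delta> \<epsilon> \<longleftrightarrow> (let D = \<Omega> - cball P \<epsilon>;
 CS = {z. KR_crit D L1 L2 z & fst z \<in> ball P \<delta> & snd z \<in> ball P \<delta>}
 in CS = {(xf m s \<epsilon>, yf m s \<epsilon>) | m s. True}
 & card CS = 4
 & (\<forall>z\<in>CS. nondeg_crit (KR D L1 L2) z)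
 & (L1 = L2 --> card ((%(x, y). {(x, y), (y, x)}) ` CS) = 2))" for \<delta> \<epsilon>
 have main: "\<exists>\<epsilon>0>0. \<forall>\<epsilon>. 0 < \<epsilon> & \<epsilon> < \<epsilon>0 -->
 Q \<delta> \<epsilon>"
 if d: "0 < \<delta>" "\<delta> < Z.\<delta>0" for \<delta>
 proof -
 obtain \<epsilon>0 where e0: "\<epsilon>0 > 0" "\<And>e. 0 < e ==> e < \<epsilon>0 ==> Z.good e & inj (%(m, s). sol m s e) \<and>
 {(x, y). e < cmod x & cmod x < \<delta> & e < cmod y & cmod y < \<delta> & Z.is_crit e x y}
 = {(Z.sc e *\<^sub>R fst (sol m s e), Z.sc e *\<^sub>R snd (sol m s e)) | m s. True} \<and>
 (\<forall>m s F v. ((%p. (KE (D - cball 0 e) L1 L2 (fst p) (snd p), KE (D - cball 0 e) L2 L1 (snd p) (fst p)))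
 has_derivative F) (at (Z.sc e *\<^sub>R sol m s e)) --> F v = 0 --> v = 0)"
 using crit[rule_format, OF conjI[OF d]] unfolding eventually_at_right_field by blast
 have "Q \<delta> \<epsilon>"
 if e: "0 < \<epsilon>" "\<epsilon> < \<epsilon>0" for \<epsilon>
 proof -
 define S where "S = \<Omega> - cball P \<epsilon>"
 define CS where "CS = {z. KR_crit S L1 L2 z & fst z \<in> ball P \<delta> & snd z \<in> ball P \<delta>}"
 note E = e0(2)[OF e]
 have g: "Z.good \<epsilon>" and inj: "inj (%(m, s). sol m s \<epsilon>)" using E by simp_all
 have cr: "{(x, y). \<epsilon> < cmod x & cmod x < \<delta> & \<epsilon> < cmod y & cmod y < \<delta> & Z.is_crit \<epsilon> x y}
 = {(Z.sc \<epsilon> *\<^sub>R fst (sol m s \<epsilon>), Z.sc \<epsilon> *\<^sub>R snd (sol m s \<epsilon>)) | m s. True}" using E by (elim conjE)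
 have nd: "\<And>m s F v. ((%p. (KE (D - cball 0 \<epsilon>) L1 L2 (fst p) (snd p), KE (D - cball 0 \<epsilon>) L2 L1 (snd p) (fst p)))
 has_derivative F) (at (Z.sc \<epsilon> *\<^sub>R sol m s \<epsilon>)) ==> F v = 0 ==> v = 0" using E by blast
 have So: "open S" unfolding S_def by (rule open_Diff[OF Oo closed_cball])
 have SE: "em P -` S = D - cball 0 \<epsilon>" unfolding S_def vimage_Diff em_vimage_cball D_def ..
 have Sreg: "regular_domain (em P -` S)" unfolding SE using regular_domain_minus_disc[OF RD.reg e(1)] .
 interpret SD: reg_domain "D - cball 0 \<epsilon>" by unfold_locales (use Sreg SE in simp)
 have sp: "0 < Z.sc \<epsilon>" by (rule Z.sc_pos[OF e(1)])
 have zCS: "z \<in> CS \<longleftrightarrow> (pm P (fst z), pm P (snd z)) \<in> {(x, y). \<epsilon> < cmod x & cmod x < \<delta> & \<epsilon> < cmod y & cmod y < \<delta> & Z.is_crit \<epsilon> x y}" for z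
 proof -
 define x where "x = pm P (fst z)"
 define y where "y = pm P (snd z)"
 have z: "fst z = em P x" "snd z = em P y" by (simp_all add: x_def y_def)
 have bl: "em P w \<in> ball P \<delta> \<longleftrightarrow> cmod w < \<delta>" for w using dist_em[of P 0 w] by (simp del: dist_em)
 \<comment> \<open>Within radius \<delta> around P only the hole is missing, since the disc of
   radius 4 r1 lies in the domain.\<close>
 have iS: "em P w \<in> S & cmod w < \<delta> \<longleftrightarrow> \<epsilon> < cmod w & cmod w < \<delta>" for w
 proof -
 have "em P w \<in> S \<longleftrightarrow> w \<in> D - cball 0 \<epsilon>" using SE by blast
 moreover have "w \<in> D - cball 0 \<epsilon>" if "\<epsilon> < cmod w" "cmod w < \<delta>"
 using Z.in_E[OF g that(1)] that(2) d(2) Z.delta0(2) Z.r1(1) by auto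
 ultimately show ?thesis by auto
 qed
 have "z \<in> CS \<longleftrightarrow> (em P x \<in> S & cmod x < \<delta>) & (em P y \<in> S & cmod y < \<delta>) & x ~= y \<and>
 KE (D - cball 0 \<epsilon>) L1 L2 x y = 0 & KE (D - cball 0 \<epsilon>) L2 L1 y x = 0"
 unfolding CS_def mem_Collect_eq KR_crit_iff[OF So Sreg L1pos L2pos] z bl SE by auto
 also have "... \<longleftrightarrow> \<epsilon> < cmod x & cmod x < \<delta> & \<epsilon> < cmod y & cmod y < \<delta> & Z.is_crit \<epsilon> x y"
 proof (cases "\<epsilon> < cmod x & \<epsilon> < cmod y")
 case True
 then have "x ~= 0" "y ~= 0" using e(1) by auto
 then show ?thesis unfolding iS using K.is_crit_iff by auto
 qed (auto simp: iS)
 finally show ?thesis by (simp add: x_def y_def)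
 qed
 have CSeq: "CS = {(xf m s \<epsilon>, yf m s \<epsilon>) | m s. True}"
 proof -
 have "z \<in> CS \<longleftrightarrow> z \<in> {(xf m s \<epsilon>, yf m s \<epsilon>) | m s. True}" for z
 proof -
 have "z \<in> CS \<longleftrightarrow> (\<exists>m s. pm P (fst z) = Z.sc \<epsilon> *\<^sub>R fst (sol m s \<epsilon>) & pm P (snd z) = Z.sc \<epsilon> *\<^sub>R snd (sol m s \<epsilon>))"
 unfolding zCS cr by simp
 also have "... \<longleftrightarrow> (\<exists>m s. fst z = xf m s \<epsilon> & snd z = yf m s \<epsilon>)"
 unfolding xf_def yf_def by (metis em_pm pm_em)
 also have "... \<longleftrightarrow> z \<in> {(xf m s \<epsilon>, yf m s \<epsilon>) | m s. True}" by (auto simp: prod_eq_iff)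
 finally show ?thesis .
 qed
 then show ?thesis by (rule set_eqI)
 qed
 have CSr: "CS = (%q. (xf (fst q) (snd q) \<epsilon>, yf (fst q) (snd q) \<epsilon>)) ` UNIV" unfolding CSeq by (force simp: image_def)
 have fin: "finite CS" unfolding CSr by (rule finite_imageI) simp
 have c4: "card CS = 4"
 proof -
 have "inj (%q. (xf (fst q) (snd q) \<epsilon>, yf (fst q) (snd q) \<epsilon>))"
 proof (rule injI)
 fix q q' assume "(xf (fst q) (snd q) \<epsilon>, yf (fst q) (snd q) \<epsilon>) = (xf (fst q') (snd q') \<epsilon>, yf (fst q') (snd q') \<epsilon>)"
 then have "sol (fst q) (snd q) \<epsilon> = sol (fst q') (snd q') \<epsilon>" using sp by (simp add: xf_def yf_def prod_eq_iff)
 then show "q = q'" using injD[OF inj, of q q'] by (simp add: split_beta)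
 qed
 then have "card CS = card (UNIV :: (2 \<times> bool) set)" unfolding CSr by (rule card_image)
 also have "... = 4" by simp
 finally show ?thesis .
 qed
 have ndg: "nondeg_crit (KR S L1 L2) z" if "z \<in> CS" for z
 proof -
 obtain m s where z: "z = (xf m s \<epsilon>, yf m s \<epsilon>)" using \<open>z \<in> CS\<close> unfolding CSeq by blast
 have crz: "KR_crit S L1 L2 z" using \<open>z \<in> CS\<close> by (simp add: CS_def)
 define p where "p = (pm P (fst z), pm P (snd z))"
 have p: "p = Z.sc \<epsilon> *\<^sub>R sol m s \<epsilon>" by (simp add: p_def z xf_def yf_def prod_eq_iff)
 have inE: "fst p \<in> D - cball 0 \<epsilon>" "snd p \<in> D - cball 0 \<epsilon>"
 using crz by (auto simp: p_def KR_crit_def simp flip: SE)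
 have "fst z ~= snd z" using crz by (simp add: KR_crit_def)
 then have ne: "fst p ~= snd p" unfolding p_def fst_conv snd_conv by (metis em_pm)
 obtain F1 F2 where F: "((%p. KE (D - cball 0 \<epsilon>) L1 L2 (fst p) (snd p)) has_derivative F1) (at p)"
 "((%p. KE (D - cball 0 \<epsilon>) L2 L1 (snd p) (fst p)) has_derivative F2) (at p)"
 using SD.KE_differentiable[OF inE ne] by blast
 note F12 = has_derivative_Pair[OF F]
 show ?thesis
 proof (rule KR_nondegenerate[OF So Sreg L1pos L2pos crz])
 show "((%p. (KE (em P -` S) L1 L2 (fst p) (snd p), KE (em P -` S) L2 L1 (snd p) (fst p))) has_derivative
 (%v. (F1 v, F2 v))) (at (pm P (fst z), pm P (snd z)))" using F12 unfolding SE p_def .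
 show "v = 0" if "(F1 v, F2 v) = 0" for v using nd[OF F12[unfolded p] that] .
 qed
 qed
 \<comment> \<open>For equal weights the two equations are exchanged by swapping x and y, so the
   four points split into two swap orbits.\<close>
 have c2: "card ((%(x, y). {(x, y), (y, x)}) ` CS) = 2" if "L1 = L2"
 proof -
 have "2 * card ((%(x, y). {(x, y), (y, x)}) ` CS) = card CS"
 proof (rule card_unordered_pairs[OF fin])
 show "(y, x) \<in> CS" if "(x, y) \<in> CS" for x y
 using that unfolding zCS Z.is_crit_def using \<open>L1 = L2\<close> by auto
 show "(x, x) \<notin> CS" for x by (simp add: CS_def KR_crit_def)
 qed
 then show ?thesis using c4 by simp
 qed
 show ?thesis unfolding Q_def Let_def S_def[symmetric] CS_def[symmetric] using CSeq c4 ndg c2 by blast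
 qed
 then show ?thesis using e0(1) by blast
 qed
 show ?thesis
 proof (rule exI[of _ Z.\<delta>0], rule conjI[OF Z.delta0(1)], intro allI impI, goal_cases)
 case (1 \<delta>)
 then have "0 < \<delta>" "\<delta> < Z.\<delta>0" by simp_all
 from main[OF this] obtain \<epsilon>0 where e: "0 < \<epsilon>0" "\<forall>\<epsilon>. 0 < \<epsilon> & \<epsilon> < \<epsilon>0 --> Q \<delta> \<epsilon>" by blast
 show ?case
 by (rule exI[of _ \<epsilon>0], rule conjI[OF e(1)], rule exI[of _ xf], rule exI[of _ yf],
 rule conjI[OF e(2)[unfolded Q_def]], intro allI, rule asym)
 qed
qed

end
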